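(* Let $\Omega=\mathrm{Q}_N=(0,1)^N$, $N\ge1$. Let $s:\mathrm{Q}_N\to\mathbb{R}$ be measurable with $s(x)\in[0,1]$ for almost all $x$ and $|\{x\in\mathrm{Q}_N:s(x)=0\}|=0$, and let $\mathrm{G}_s:\mathrm{Q}_N\to\mathbb{R}$ be a weight with $\mathrm{G}_s^{-1}\in L^1_{\mathrm{loc}}(\mathrm{Q}_N)$ such that, if $s(\cdot)=s\in(0,1)$ is constant, then $\mathrm{G}_s(x)=2^{2s-1}\Gamma(s)/\Gamma(1-s)$ for all $x$. Assume that for every $i=1,\dots,N$, for almost every $x_j\in(0,1)$, $j\neq i$, and almost every $z\in(0,1)$, $$\int_0^1\left(\mathrm{G}_s(x)|x_i-z|^{1-2s(x)}\right)^{-1}dx_i<\infty,\qquad x=(x_1,\dots,x_N).$$ Let $w(x,y)=\mathrm{G}_s(x)y^{1-2s(x)}$ and assume that functions in $\mathscr{H}_{0,L}^{1,2}(\mathcal{C},w)$ satisfy a Poincaré inequality, i.e. there is $C>0$ with $\|u\|_{L^2(\mathcal{C},w)}\le C\|\nabla u\|_{L^2(\mathcal{C},w)}$ for all $u\in\mathscr{H}_{0,L}^{1,2}(\mathcal{C},w)$. Then for every $$h\in\mathbb{W}^{s(\cdot),2}(\mathrm{Q}_N,\tilde w,w_1,\dots,w_N)'$$ the equation $(-\Delta)^{s(\cdot)}v=h$ admits a unique solution $$v\in\mathscr{Y}(\Omega,w)\subset\mathbb{W}^{s(\cdot),2}(\mathrm{Q}_N,\tilde w,w_1,\dots,w_N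).$$
   Context: A weight is a measurable function that is positive and finite a.e. With $\Omega=\mathrm{Q}_N$: $\mathcal{C}=\Omega\times(0,\infty)$, $\partial_L\mathcal{C}=\partial\Omega\times[0,\infty)$, $\mathcal{C}_\Omega=\mathcal{C}\cup(\Omega\times\{0\})$; points are written $X=(x,y)$. For an open set $U$ and a weight $\rho$ on $U$, $L^2(U,\rho)$ is the space of measurable $u$ with $\|u\|_{L^2(U,\rho)}=(\int_U|u|^2\rho)^{1/2}<\infty$; if $\rho^{-1}\in L^1_{\mathrm{loc}}(U)$, $W^{1,2}(U,\rho)$ is the space of $u\in L^2(U,\rho)$ with weak gradient satisfying $|\nabla u|\in L^2(U,\rho)$, normed by $(\int_U|u|^2\rho+\int_U|\nabla u|^2\rho)^{1/2}$. $C_c^\infty(\mathcal{C}_\Omega)$ is the set of $u\in C^\infty(\overline{\mathcal{C}})$ with compact support in $\mathcal{C}_\Omega$ (so the support does not meet $\partial_L\mathcal{C}$, while $u$ need not vanish on $\Omega\times\{0\}$). $\mathscr{H}_{0,L}^{1,2}(\mathcal{C},w)$ is the closure of $C_c^\infty(\mathcal{C}_\Omega)\cap W^{1,2}(\mathcal{C},w)$ in $W^{1,2}(\mathcal{C},w)$; under the Poincaré inequality it is endowed with the norm $\|\nabla u\|_{L^2(\mathcal{C},w)}$. Weights on the cube. $\tilde w(x)=\mathrm{G}_s(x)(2s(x))^2$. For $a\in(0,1)$, $x_a^i=(x_1,\dots,x_{i-1},a,x_{i+1},\dots,x_N)$. For $i=1,\dots,N$, $(x,\tau)\in\mathrm{Q}_N\times(0,1)$: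 $\Phi_i(x,\tau)=\mathrm{G}_s(x)|x_i-\tau|^{1-2s(x)}$, $$\varphi_i(x,\tau)=\Phi_i(x,\tau)^{-1}\left(\int_{\min\{x_i,\tau\}}^{\max\{x_i,\tau\}}\Phi_i(x_{t'}^i,\tau)^{-1}dt'\right)^{-2},\quad \psi_i(x,\tau)=\Phi_i(x,\tau)^{-1}\left(\int_{\min\{x_i,\tau\}}^{\max\{x_i,\tau\}}\Phi_i(x,\tau')^{-1}d\tau'\right)^{-2},$$ and $w_i=\min\{\varphi_i,\psi_i\}$. The space $\mathbb{W}^{s(\cdot),2}(\mathrm{Q}_N,\tilde w,w_1,\dots,w_N)$ is the set of $v\in L^2(\mathrm{Q}_N,\tilde w)$ with $A_i(v)<\infty$ for $i=1,\dots,N$, with norm $(\|v\|^2_{L^2(\mathrm{Q}_N,\tilde w)}+\sum_iA_i(v))^{1/2}$, where $$A_i(v)=\int_0^1\!\!\cdots\!\int_0^1\left(\int_0^1\!\int_0^1w_i(x_t^i,\tau)|v(x_t^i)-v(x_\tau^i)|^2\,d\tau\,dt\right)dx_1\cdots dx_{i-1}\,dx_{i+1}\cdots dx_N$$ (outer integral $(N-1)$-fold, absent if $N=1$). A prime denotes the dual space. Under the stated assumptions there is a unique bounded linear operator $\mathrm{tr}_\Omega:\mathscr{H}_{0,L}^{1,2}(\mathcal{C},w)\to\mathbb{W}^{s(\cdot),2}(\mathrm{Q}_N,\tilde w,w_1,\dots,w_N)\subset L^2(\mathrm{Q}_N,\tilde w)$ with $\mathrm{tr}_\Omega u=u(\cdot,0)$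 for all $u\in\mathscr{H}_{0,L}^{1,2}(\mathcal{C},w)\cap C_c^\infty(\mathcal{C}_\Omega)$. Set $\mathscr{W}_0^{1,2}(\mathcal{C},w)=\{u\in\mathscr{H}_{0,L}^{1,2}(\mathcal{C},w):\mathrm{tr}_\Omega u=0\}$, $\mathscr{Y}(\Omega,w)=\mathscr{H}_{0,L}^{1,2}(\mathcal{C},w)/\mathscr{W}_0^{1,2}(\mathcal{C},w)$ with the quotient norm, and $\mathrm{TR}_\Omega u=[u]\in\mathscr{Y}(\Omega,w)$. The inclusion $\mathscr{Y}(\Omega,w)\subset\mathbb{W}^{s(\cdot),2}(\mathrm{Q}_N,\tilde w,w_1,\dots,w_N)$ is via the bounded linear injection $I([u])=\mathrm{tr}_\Omega u$. For $v\in\mathscr{Y}(\Omega,w)$, $S(v)$ is the unique minimizer of $\frac12\int_{\mathcal{C}}w|\nabla u|^2dX$ over $u\in\mathscr{H}_{0,L}^{1,2}(\mathcal{C},w)$ with $\mathrm{TR}_\Omega u=v$. The operator $(-\Delta)^{s(\cdot)}:\mathscr{Y}(\Omega,w)\to\mathscr{Y}(\Omega,w)'$ is defined by $$\langle(-\Delta)^{s(\cdot)}v,\mathrm{TR}_\Omega\psi\rangle_{\mathscr{Y}',\mathscr{Y}}=\int_{\mathcal{C}}w\,\nabla S(v)\cdot\nabla\psi\,dX\qquad\text{for all }\psi\in\mathscr{H}_{0,L}^{1,2}(\mathcal{C},w).$$ An element $h$ of the dual of $\mathbb{W}^{s(\cdot),2}(\mathrm{Q}_N,\tilde w,w_1,\dots,w_N)$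 is regarded as an element of $\mathscr{Y}(\Omega,w)'$ via the adjoint of $I$, i.e. $\langle h,\mathrm{TR}_\Omega\psi\rangle_{\mathscr{Y}',\mathscr{Y}}=\langle h,\mathrm{tr}_\Omega\psi\rangle$; the equation is understood in $\mathscr{Y}(\Omega,w)'$. *)

theory Defs
  imports "HOL-Analysis.Analysis"
begin

text \<open>
  Elements of the Lebesgue and Sobolev spaces below are total functions of which only the values
  almost everywhere on the underlying open set matter; the spaces are closed under changes on null
  sets, and the norms are seminorms on functions.
\<close>

subsection \<open>Smooth functions\<close>

primrec Ck_on :: "nat \<Rightarrow> 'a::euclidean_space set \<Rightarrow> ('a \<Rightarrow> real) \<Rightarrow> bool" where
  "Ck_on 0 U f \<longleftrightarrow> continuous_on U f"
| "Ck_on (Suc k) U f \<longleftrightarrow> (\<forall>x\<in>U. f differentiable (at x)) \<and>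
     (\<forall>b\<in>Basis. Ck_on k U (\<lambda>x. frechet_derivative f (at x) b))"

text \<open>Meaningful for open \<open>U\<close>; only used with \<open>U = UNIV\<close>.\<close>

definition smooth_on :: "'a::euclidean_space set \<Rightarrow> ('a \<Rightarrow> real) \<Rightarrow> bool" where
  "smooth_on U f \<longleftrightarrow> (\<forall>k. Ck_on k U f)"

definition test_functions :: "'a::euclidean_space set \<Rightarrow> ('a \<Rightarrow> real) set" where
  "test_functions U =
     {\<phi>. smooth_on UNIV \<phi> \<and> (\<exists>K. compact K \<and> K \<subseteq> U \<and> (\<forall>x. x \<notin> K \<longrightarrow> \<phi> x = 0))}"


subsection \<open>Weighted Lebesgue and Sobolev spaces\<close>

definition is_weight :: "'a::euclidean_space set \<Rightarrow> ('a \<Rightarrow> real) \<Rightarrow> bool" where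
  "is_weight U \<rho> \<longleftrightarrow>
     \<rho> \<in> borel_measurable (lebesgue_on U) \<and> (AE x in lebesgue_on U. 0 < \<rho> x)"

definition locally_integrable ::
    "'a::euclidean_space set \<Rightarrow> ('a \<Rightarrow> 'b::euclidean_space) \<Rightarrow> bool" where
  "locally_integrable U f \<longleftrightarrow> (\<forall>K. compact K \<and> K \<subseteq> U \<longrightarrow> f absolutely_integrable_on K)"

definition L2 :: "'a::euclidean_space set \<Rightarrow> ('a \<Rightarrow> real) \<Rightarrow> ('a \<Rightarrow> real) set" where
  "L2 U \<rho> = {u. u \<in> borel_measurable (lebesgue_on U) \<and>
                integrable (lebesgue_on U) (\<lambda>x. \<bar>u x\<bar>\<^sup>2 * \<rho> x)}"

definition L2_norm :: "'a::euclidean_space set \<Rightarrow> ('a \<Rightarrow> real) \<Rightarrow> ('a \<Rightarrow> real) \<Rightarrow> real" where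
  "L2_norm U \<rho> u = sqrt (LINT x|lebesgue_on U. \<bar>u x\<bar>\<^sup>2 * \<rho> x)"

definition is_weak_gradient ::
    "'a::euclidean_space set \<Rightarrow> ('a \<Rightarrow> real) \<Rightarrow> ('a \<Rightarrow> 'a) \<Rightarrow> bool" where
  "is_weak_gradient U u g \<longleftrightarrow> locally_integrable U u \<and> locally_integrable U g \<and>
     (\<forall>\<phi>\<in>test_functions U. \<forall>b\<in>Basis.
        (LINT x|lebesgue_on U. u x * frechet_derivative \<phi> (at x) b)
          = - (LINT x|lebesgue_on U. (g x \<bullet> b) * \<phi> x))"

text \<open>A representative; weak gradients are unique up to null sets.\<close>

definition weak_gradient :: "'a::euclidean_space set \<Rightarrow> ('a \<Rightarrow> real) \<Rightarrow> 'a \<Rightarrow> 'a" where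
  "weak_gradient U u = (SOME g. is_weak_gradient U u g)"

definition W12 :: "'a::euclidean_space set \<Rightarrow> ('a \<Rightarrow> real) \<Rightarrow> ('a \<Rightarrow> real) set" where
  "W12 U \<rho> = {u \<in> L2 U \<rho>. \<exists>g. is_weak_gradient U u g \<and> (\<lambda>x. norm (g x)) \<in> L2 U \<rho>}"

definition grad_norm :: "'a::euclidean_space set \<Rightarrow> ('a \<Rightarrow> real) \<Rightarrow> ('a \<Rightarrow> real) \<Rightarrow> real" where
  "grad_norm U \<rho> u = L2_norm U \<rho> (\<lambda>x. norm (weak_gradient U u x))"

definition W12_norm :: "'a::euclidean_space set \<Rightarrow> ('a \<Rightarrow> real) \<Rightarrow> ('a \<Rightarrow> real) \<Rightarrow> real" where
  "W12_norm U \<rho> u = sqrt ((L2_norm U \<rho> u)\<^sup>2 + (grad_norm U \<rho> u)\<^sup>2)"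


subsection \<open>The extended cylinder\<close>

definition cube :: "(real^'n) set" where
  "cube = {x. \<forall>i. 0 < x $ i \<and> x $ i < 1}"

definition cylinder :: "((real^'n) \<times> real) set" where
  "cylinder = cube \<times> {0<..}"

definition cylinder_base :: "((real^'n) \<times> real) set" where
  "cylinder_base = cylinder \<union> cube \<times> {0}"

text \<open>
  The smooth functions on the closed cylinder are the restrictions of smooth functions on the whole
  space. The support condition leaves the values on the base \<open>cube \<times> {0}\<close> free.
\<close>

definition Cc_cylinder :: "((real^'n) \<times> real \<Rightarrow> real) set" where
  "Cc_cylinder =
     {u. (\<exists>f. smooth_on UNIV f \<and> (\<forall>p\<in>closure cylinder. u p = f p)) \<and>
         (\<exists>K. compact K \<and> K \<subseteq> cylinder_base \<and> (\<forall>p\<in>closure cylinder - K. u p = 0))}"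

definition H0L ::
    "((real^'n) \<times> real \<Rightarrow> real) \<Rightarrow> ((real^'n) \<times> real \<Rightarrow> real) set" where
  "H0L w = {u \<in> W12 cylinder w. \<forall>\<epsilon>>0. \<exists>\<phi>\<in>Cc_cylinder \<inter> W12 cylinder w.
              W12_norm cylinder w (\<lambda>p. u p - \<phi> p) < \<epsilon>}"

definition poincare_inequality :: "((real^'n) \<times> real \<Rightarrow> real) \<Rightarrow> bool" where
  "poincare_inequality w \<longleftrightarrow>
     (\<exists>C>0. \<forall>u\<in>H0L w. L2_norm cylinder w u \<le> C * grad_norm cylinder w u)"


subsection \<open>Weights and the trace space on the cube\<close>

text \<open>
  Throughout, \<open>s\<close> is the variable order and \<open>G\<close> the weight with index \<open>s\<close>.
\<close>

definition cyl_weight ::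
    "(real^'n \<Rightarrow> real) \<Rightarrow> (real^'n \<Rightarrow> real) \<Rightarrow> (real^'n) \<times> real \<Rightarrow> real" where
  "cyl_weight s G = (\<lambda>(x, y). G x * y powr (1 - 2 * s x))"

definition w_tilde :: "(real^'n \<Rightarrow> real) \<Rightarrow> (real^'n \<Rightarrow> real) \<Rightarrow> real^'n \<Rightarrow> real" where
  "w_tilde s G x = G x * (2 * s x)\<^sup>2"

text \<open>
  The point with \<open>i\<close>-th coordinate \<open>a\<close> and \<open>j\<close>-th coordinate \<open>z j\<close> for \<open>j \<noteq> i\<close>.
\<close>

definition set_coord :: "'n \<Rightarrow> ('n \<Rightarrow> real) \<Rightarrow> real \<Rightarrow> real^'n" where
  "set_coord i z a = (\<chi> j. if j = i then a else z j)"

text \<open>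
  Lebesgue measure on the unit cube of the coordinates other than \<open>i\<close>. In dimension one this is the
  unit mass at the only point of the empty product, so that integration against it disappears.
\<close>

definition other_coords :: "'n::finite \<Rightarrow> ('n \<Rightarrow> real) measure" where
  "other_coords i = Pi\<^sub>M (UNIV - {i}) (\<lambda>_. restrict_space lborel {0<..<1})"

definition Phi ::
    "(real^'n \<Rightarrow> real) \<Rightarrow> (real^'n \<Rightarrow> real) \<Rightarrow> 'n \<Rightarrow> real^'n \<Rightarrow> real \<Rightarrow> real" where
  "Phi s G i x \<tau> = G x * \<bar>x $ i - \<tau>\<bar> powr (1 - 2 * s x)"

text \<open>
  Reciprocals and integrals are taken in \<open>[0,\<infinity>]\<close>; a divergent inner integral gives the factor
  \<open>\<infinity>\<^sup>-\<^sup>2 = 0\<close>.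
\<close>

definition phi_weight ::
    "(real^'n \<Rightarrow> real) \<Rightarrow> (real^'n \<Rightarrow> real) \<Rightarrow> 'n \<Rightarrow> real^'n \<Rightarrow> real \<Rightarrow> ennreal" where
  "phi_weight s G i x \<tau> = inverse (ennreal (Phi s G i x \<tau>)) *
     (inverse (\<integral>\<^sup>+t\<in>{min (x $ i) \<tau>..max (x $ i) \<tau>}.
        inverse (ennreal (Phi s G i (set_coord i (($) x) t) \<tau>)) \<partial>lborel))\<^sup>2"

definition psi_weight ::
    "(real^'n \<Rightarrow> real) \<Rightarrow> (real^'n \<Rightarrow> real) \<Rightarrow> 'n \<Rightarrow> real^'n \<Rightarrow> real \<Rightarrow> ennreal" where
  "psi_weight s G i x \<tau> = inverse (ennreal (Phi s G i x \<tau>)) *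
     (inverse (\<integral>\<^sup>+t\<in>{min (x $ i) \<tau>..max (x $ i) \<tau>}.
        inverse (ennreal (Phi s G i x t)) \<partial>lborel))\<^sup>2"

definition w_coord ::
    "(real^'n \<Rightarrow> real) \<Rightarrow> (real^'n \<Rightarrow> real) \<Rightarrow> 'n \<Rightarrow> real^'n \<Rightarrow> real \<Rightarrow> ennreal" where
  "w_coord s G i x \<tau> = min (phi_weight s G i x \<tau>) (psi_weight s G i x \<tau>)"

definition A_form ::
    "(real^'n \<Rightarrow> real) \<Rightarrow> (real^'n \<Rightarrow> real) \<Rightarrow> 'n::finite \<Rightarrow> (real^'n \<Rightarrow> real) \<Rightarrow> ennreal" where
  "A_form s G i v = (\<integral>\<^sup>+z. (\<integral>\<^sup>+t\<in>{0<..<1}. (\<integral>\<^sup>+\<tau>\<in>{0<..<1}.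
      w_coord s G i (set_coord i z t) \<tau> *
      ennreal (\<bar>v (set_coord i z t) - v (set_coord i z \<tau>)\<bar>\<^sup>2)
      \<partial>lborel) \<partial>lborel) \<partial>other_coords i)"

definition Ws2 ::
    "(real^'n \<Rightarrow> real) \<Rightarrow> (real^'n \<Rightarrow> real) \<Rightarrow> (real^'n::finite \<Rightarrow> real) set" where
  "Ws2 s G = {v \<in> L2 cube (w_tilde s G). \<forall>i. A_form s G i v < \<infinity>}"

definition Ws2_norm ::
    "(real^'n \<Rightarrow> real) \<Rightarrow> (real^'n \<Rightarrow> real) \<Rightarrow> (real^'n::finite \<Rightarrow> real) \<Rightarrow> real" where
  "Ws2_norm s G v =
     sqrt ((L2_norm cube (w_tilde s G) v)\<^sup>2 + (\<Sum>i\<in>UNIV. enn2real (A_form s G i v)))"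

text \<open>
  A linear functional that is bounded for the seminorm automatically does not distinguish functions
  that agree almost everywhere on the cube.
\<close>

definition Ws2_dual ::
    "(real^'n \<Rightarrow> real) \<Rightarrow> (real^'n \<Rightarrow> real) \<Rightarrow> ((real^'n::finite \<Rightarrow> real) \<Rightarrow> real) set" where
  "Ws2_dual s G = {h.
     (\<forall>v\<in>Ws2 s G. \<forall>v'\<in>Ws2 s G. h (\<lambda>x. v x + v' x) = h v + h v') \<and>
     (\<forall>c. \<forall>v\<in>Ws2 s G. h (\<lambda>x. c * v x) = c * h v) \<and>
     (\<exists>C. \<forall>v\<in>Ws2 s G. \<bar>h v\<bar> \<le> C * Ws2_norm s G v)}"


subsection \<open>The trace operator and the quotient space\<close>

definition is_trace_operator ::
    "(real^'n \<Rightarrow> real) \<Rightarrow> (real^'n \<Rightarrow> real) \<Rightarrow>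
     (((real^'n::finite) \<times> real \<Rightarrow> real) \<Rightarrow> real^'n \<Rightarrow> real) \<Rightarrow> bool" where
  "is_trace_operator s G T \<longleftrightarrow> (let H = H0L (cyl_weight s G) in
     (\<forall>u\<in>H. T u \<in> Ws2 s G) \<and>
     (\<forall>u\<in>H. \<forall>u'\<in>H. AE x in lebesgue_on cube. T (\<lambda>p. u p + u' p) x = T u x + T u' x) \<and>
     (\<forall>c. \<forall>u\<in>H. AE x in lebesgue_on cube. T (\<lambda>p. c * u p) x = c * T u x) \<and>
     (\<exists>C. \<forall>u\<in>H. Ws2_norm s G (T u) \<le> C * grad_norm cylinder (cyl_weight s G) u) \<and>
     (\<forall>u\<in>H \<inter> Cc_cylinder. AE x in lebesgue_on cube. T u x = u (x, 0)))"

text \<open>A representative; the trace operator is unique up to null sets of the cube.\<close>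

definition trace_op ::
    "(real^'n \<Rightarrow> real) \<Rightarrow> (real^'n \<Rightarrow> real) \<Rightarrow>
     ((real^'n::finite) \<times> real \<Rightarrow> real) \<Rightarrow> real^'n \<Rightarrow> real" where
  "trace_op s G = (SOME T. is_trace_operator s G T)"

definition W0_kernel ::
    "(real^'n \<Rightarrow> real) \<Rightarrow> (real^'n \<Rightarrow> real) \<Rightarrow> ((real^'n::finite) \<times> real \<Rightarrow> real) set" where
  "W0_kernel s G = {u \<in> H0L (cyl_weight s G). AE x in lebesgue_on cube. trace_op s G u x = 0}"

definition W0_rel ::
    "(real^'n \<Rightarrow> real) \<Rightarrow> (real^'n \<Rightarrow> real) \<Rightarrow>
     (((real^'n::finite) \<times> real \<Rightarrow> real) \<times> ((real^'n) \<times> real \<Rightarrow> real)) set" where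
  "W0_rel s G = {(u, u'). u \<in> H0L (cyl_weight s G) \<and> u' \<in> H0L (cyl_weight s G) \<and>
                   (\<lambda>p. u p - u' p) \<in> W0_kernel s G}"

definition Y_space ::
    "(real^'n \<Rightarrow> real) \<Rightarrow> (real^'n \<Rightarrow> real) \<Rightarrow> ((real^'n::finite) \<times> real \<Rightarrow> real) set set" where
  "Y_space s G = H0L (cyl_weight s G) // W0_rel s G"

definition TR ::
    "(real^'n \<Rightarrow> real) \<Rightarrow> (real^'n \<Rightarrow> real) \<Rightarrow>
     ((real^'n::finite) \<times> real \<Rightarrow> real) \<Rightarrow> ((real^'n) \<times> real \<Rightarrow> real) set" where
  "TR s G u = W0_rel s G `` {u}"

definition Y_norm ::
    "(real^'n \<Rightarrow> real) \<Rightarrow> (real^'n \<Rightarrow> real) \<Rightarrow> ((real^'n::finite) \<times> real \<Rightarrow> real) set \<Rightarrow> real" where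
  "Y_norm s G v = (INF u\<in>v. grad_norm cylinder (cyl_weight s G) u)"

text \<open>Functionals are extensional on the space, so that equality of functionals is equality.\<close>

definition Y_dual ::
    "(real^'n \<Rightarrow> real) \<Rightarrow> (real^'n \<Rightarrow> real) \<Rightarrow>
     (((real^'n::finite) \<times> real \<Rightarrow> real) set \<Rightarrow> real) set" where
  "Y_dual s G = {L \<in> extensional (Y_space s G). let H = H0L (cyl_weight s G) in
     (\<forall>u\<in>H. \<forall>u'\<in>H. L (TR s G (\<lambda>p. u p + u' p)) = L (TR s G u) + L (TR s G u')) \<and>
     (\<forall>c. \<forall>u\<in>H. L (TR s G (\<lambda>p. c * u p)) = c * L (TR s G u)) \<and>
     (\<exists>C. \<forall>v\<in>Y_space s G. \<bar>L v\<bar> \<le> C * Y_norm s G v)}"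

text \<open>The choice of the representative affects the value only on a null set of the cube.\<close>

definition Y_incl ::
    "(real^'n \<Rightarrow> real) \<Rightarrow> (real^'n \<Rightarrow> real) \<Rightarrow>
     ((real^'n::finite) \<times> real \<Rightarrow> real) set \<Rightarrow> real^'n \<Rightarrow> real" where
  "Y_incl s G v = trace_op s G (SOME u. u \<in> v)"

definition Y_incl_adjoint ::
    "(real^'n \<Rightarrow> real) \<Rightarrow> (real^'n \<Rightarrow> real) \<Rightarrow> ((real^'n::finite \<Rightarrow> real) \<Rightarrow> real) \<Rightarrow>
     ((real^'n) \<times> real \<Rightarrow> real) set \<Rightarrow> real" where
  "Y_incl_adjoint s G h = restrict (\<lambda>v. h (Y_incl s G v)) (Y_space s G)"


subsection \<open>The fractional Laplacian of variable order\<close>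

definition energy ::
    "(real^'n \<Rightarrow> real) \<Rightarrow> (real^'n \<Rightarrow> real) \<Rightarrow> ((real^'n) \<times> real \<Rightarrow> real) \<Rightarrow> real" where
  "energy s G u = 1 / 2 *
     (LINT p|lebesgue_on cylinder. cyl_weight s G p * (norm (weak_gradient cylinder u p))\<^sup>2)"

text \<open>\<open>arg_min\<close> selects a minimizer; it is unique up to null sets of the cylinder.\<close>

definition S_min ::
    "(real^'n \<Rightarrow> real) \<Rightarrow> (real^'n \<Rightarrow> real) \<Rightarrow>
     ((real^'n::finite) \<times> real \<Rightarrow> real) set \<Rightarrow> (real^'n) \<times> real \<Rightarrow> real" where
  "S_min s G v = arg_min (energy s G) (\<lambda>u. u \<in> H0L (cyl_weight s G) \<and> TR s G u = v)"

definition frac_laplacian ::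
    "(real^'n \<Rightarrow> real) \<Rightarrow> (real^'n \<Rightarrow> real) \<Rightarrow> ((real^'n::finite) \<times> real \<Rightarrow> real) set \<Rightarrow>
     ((real^'n) \<times> real \<Rightarrow> real) set \<Rightarrow> real" where
  "frac_laplacian s G v = (THE L. L \<in> Y_dual s G \<and>
     (\<forall>\<psi>\<in>H0L (cyl_weight s G). L (TR s G \<psi>) =
        (LINT p|lebesgue_on cylinder. cyl_weight s G p *
           (weak_gradient cylinder (S_min s G v) p \<bullet> weak_gradient cylinder \<psi> p))))"

end

theory Submission
  imports Defs
begin

text \<open>
  The equation is a variational one. On the energy space \<open>H\<close>, the closure of the smooth functions that
  vanish near the lateral boundary of the cylinder, the Poincare inequality makes the Dirichlet form
  \<open>B u v\<close>, the integral of \<open>w * (\<nabla>u \<bullet> \<nabla>v)\<close>, an inner product for which \<open>H\<close> is complete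
  (\<open>H_complete\<close>; completeness of the weighted Sobolev space, \<open>W12_complete\<close>, holds because \<open>1 / w\<close> is
  locally integrable). If \<open>T\<close> is the trace operator, \<open>\<psi> \<mapsto> h (T \<psi>)\<close> is a bounded functional on \<open>H\<close>, so
  by \<open>riesz\<close> there is \<open>u\<close> with \<open>B u \<psi> = h (T \<psi>)\<close> for all \<open>\<psi>\<close>. This \<open>u\<close> is orthogonal to the kernel \<open>W0\<close>
  of the trace, hence it has minimal energy in its class \<open>TR u\<close>, and the fractional Laplacian of that
  class is the functional \<open>TR \<psi> \<mapsto> B u \<psi>\<close> (\<open>frac_laplacian_perp\<close>). So \<open>TR u\<close> is a solution. Two solutions
  have minimal extensions with the same inner products against all of \<open>H\<close>, therefore a difference of
  energy zero, therefore the same trace.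

  The substance lies in the existence of the trace operator, that is, in two inequalities for smooth
  functions \<open>f\<close> on the closed cylinder, followed by an extension by density.

  The weighted square norm of \<open>f (x, 0)\<close> is controlled by comparing the values at the heights \<open>0\<close> and
  \<open>y < 1\<close> with the Cauchy-Schwarz inequality on the vertical segment; the integral of \<open>1 / w\<close> over it
  is \<open>y powr (2 * s x) / (2 * s x * G x)\<close>, and this is where the weight \<open>G x * (2 * s x)\<^sup>2\<close> comes from
  (\<open>trace_L2_bound\<close>).

  For the form \<open>A_form\<close>, the base points with \<open>i\<close>-th coordinates \<open>t\<close> and \<open>\<tau>\<close> are joined by a path that
  goes up vertically from the first one to height \<open>\<bar>t - \<tau>\<bar>\<close> and then diagonally down to the second one.
  On either part \<open>Phi\<close> is the weight of the cylinder along the path. Both \<open>psi_weight\<close> and \<open>phi_weight\<close>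
  have the form \<open>1 / \<Phi>\<close> divided by the square of the integral of \<open>1 / \<Phi>\<close>, which is the weight in
  Hardy's inequality with respect to the measure with density \<open>1 / \<Phi>\<close> (\<open>hardy_cum\<close>). Applied on both
  parts and integrated over the remaining variables it bounds \<open>A_form\<close> by a multiple of the energy
  (\<open>trace_A_form_bound\<close>).

  For the extension, \<open>u\<close> in \<open>H\<close> is approximated by smooth functions. Their base values form a Cauchy
  sequence in a weighted square norm and converge almost everywhere along a subsequence
  (\<open>L2_Cauchy_limit\<close>), and Fatou's lemma carries the bound for \<open>A_form\<close> over to the limit
  (\<open>trace_operator_exists\<close>).

  Gradients in the definitions are selected representatives of weak gradients. They can be computed
  with because weak gradients are unique up to null sets (\<open>weak_gradient_unique\<close>) and because classical
  gradients of smooth functions are weak gradients (\<open>classical_gradient_is_weak_gradient\<close>).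
\<close>

section \<open>Smooth functions and bumps\<close>

lemma Ck_on_cong: "Ck_on k U f \<Longrightarrow> (\<And>x. x \<in> U \<Longrightarrow> f x = g x) \<Longrightarrow> open U \<Longrightarrow> Ck_on k U g"
proof (induction k arbitrary: f g)
  case 0
  then show ?case by (simp cong: continuous_on_cong)
next
  case (Suc k)
  have d: "(g has_derivative frechet_derivative f (at x)) (at x)" if "x \<in> U" for x
  proof -
    have "(f has_derivative frechet_derivative f (at x)) (at x)"
      using Suc.prems that by (auto simp: frechet_derivative_works)
    then show ?thesis
      by (rule has_derivative_transform_within_open[OF _ Suc.prems(3) that]) (use Suc.prems in auto)
  qed
  then have "frechet_derivative g (at x) = frechet_derivative f (at x)" if "x \<in> U" for x
    using that frechet_derivative_at by fastforce
  then have e: "frechet_derivative f (at x) b = frechet_derivative g (at x) b" if "x \<in> U" for x b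
    using that by simp
  have "Ck_on k U (\<lambda>x. frechet_derivative g (at x) b)" if "b \<in> Basis" for b
    by (rule Suc.IH[of "\<lambda>x. frechet_derivative f (at x) b"]) (use Suc.prems that e in simp_all)
  then show ?case using d by (simp add: differentiable_def) blast
qed

lemma Ck_on_SucI:
  assumes "\<And>x. x \<in> U \<Longrightarrow> (f has_derivative D x) (at x)"
    and "\<And>b. b \<in> Basis \<Longrightarrow> Ck_on k U (\<lambda>x. D x b)" and "open U"
  shows "Ck_on (Suc k) U f"
proof -
  have "frechet_derivative f (at x) = D x" if "x \<in> U" for x
    using assms(1)[OF that] frechet_derivative_at by fastforce
  then have "Ck_on k U (\<lambda>x. frechet_derivative f (at x) b)" if "b \<in> Basis" for b
    by (intro Ck_on_cong[OF assms(2)[OF that]]) (use assms in auto)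
  then show ?thesis using assms(1) by (auto simp: differentiable_def)
qed

lemma Ck_on_SucD:
  assumes "Ck_on (Suc k) U f" "x \<in> U"
  shows "(f has_derivative frechet_derivative f (at x)) (at x)"
  using assms by (auto simp: frechet_derivative_works)

lemma Ck_on_lower: "Ck_on (Suc k) U f \<Longrightarrow> Ck_on k U f"
proof (induction k arbitrary: f)
  case 0
  then have "f differentiable_on U" 
    by (simp add: differentiable_on_def differentiable_at_withinI)
  then show ?case by (simp add: differentiable_imp_continuous_on)
next
  case (Suc k)
  then show ?case by (metis Ck_on.simps(2))
qed

lemma Ck_on_const: "open U \<Longrightarrow> Ck_on k U (\<lambda>x. c)"
proof (induction k arbitrary: c)
  case (Suc k)
  show ?case by (rule Ck_on_SucI[where D="\<lambda>_ _. 0"]) (use Suc in auto)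
qed auto

lemma Ck_on_add: "Ck_on k U f \<Longrightarrow> Ck_on k U g \<Longrightarrow> open U \<Longrightarrow> Ck_on k U (\<lambda>x. f x + g x)"
proof (induction k arbitrary: f g)
  case 0
  then show ?case by (auto intro: continuous_on_add)
next
  case (Suc k)
  note d = Ck_on_SucD[OF Suc.prems(1)] Ck_on_SucD[OF Suc.prems(2)]
  show ?case
    by (rule Ck_on_SucI, rule has_derivative_add[OF d])
      (use Suc in \<open>auto intro!: Suc.IH\<close>)
qed

lemma Ck_on_mult: "Ck_on k U f \<Longrightarrow> Ck_on k U g \<Longrightarrow> open U \<Longrightarrow> Ck_on k U (\<lambda>x. f x * g x)"
proof (induction k arbitrary: f g)
  case 0
  then show ?case by (auto intro: continuous_on_mult)
next
  case (Suc k)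
  note d = Ck_on_SucD[OF Suc.prems(1)] Ck_on_SucD[OF Suc.prems(2)]
  note l = Ck_on_lower[OF Suc.prems(1)] Ck_on_lower[OF Suc.prems(2)]
  show ?case
    by (rule Ck_on_SucI, rule has_derivative_mult[OF d])
      (use Suc l in \<open>auto intro!: Suc.IH Ck_on_add\<close>)
qed

lemma Ck_on_prod:
  "finite J \<Longrightarrow> (\<And>j. j \<in> J \<Longrightarrow> Ck_on k U (f j)) \<Longrightarrow> open U \<Longrightarrow> Ck_on k U (\<lambda>x. \<Prod>j\<in>J. f j x)"
  by (induction J rule: finite_induct) (auto intro: Ck_on_const Ck_on_mult)

lemma smooth_on_add: "smooth_on UNIV f \<Longrightarrow> smooth_on UNIV g \<Longrightarrow> smooth_on UNIV (\<lambda>x. f x + g x)"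
  by (auto simp: smooth_on_def intro: Ck_on_add)

lemma smooth_on_cmult: "smooth_on UNIV f \<Longrightarrow> smooth_on UNIV (\<lambda>x. c * f x)"
  by (auto simp: smooth_on_def intro!: Ck_on_mult Ck_on_const)

lemma smooth_on_has_derivative:
  assumes "smooth_on UNIV f"
  shows "(f has_derivative frechet_derivative f (at x)) (at x)"
proof -
  have "Ck_on (Suc 0) UNIV f" using assms by (simp only: smooth_on_def)
  then show ?thesis by (rule Ck_on_SucD) simp
qed

lemma smooth_on_continuous_partial:
  assumes "smooth_on UNIV f" "b \<in> Basis"
  shows "continuous_on A (\<lambda>x. frechet_derivative f (at x) b)"
proof -
  have "Ck_on (Suc 0) UNIV f" using assms by (simp only: smooth_on_def)
  then show ?thesis using assms(2) by (auto intro: continuous_on_subset)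
qed

lemma smooth_on_continuous:
  assumes "smooth_on UNIV f"
  shows "continuous_on A f"
proof -
  have "Ck_on 0 UNIV f" using assms by (simp only: smooth_on_def)
  then show ?thesis by (auto intro: continuous_on_subset)
qed

text \<open>Derivatives of \<open>exp (- 1 / t)\<close>, extended by \<open>0\<close>. The polynomial is evaluated at \<open>1 / t\<close>.\<close>

definition flat_poly :: "real poly \<Rightarrow> real \<Rightarrow> real" where
  "flat_poly p t = (if t \<le> 0 then 0 else poly p (1 / t) * exp (- (1 / t)))"

lemma poly_over_exp_tendsto_0: "((\<lambda>u::real. poly p u * exp (- u)) \<longlongrightarrow> 0) at_top"
proof -
  have "((\<lambda>u::real. \<Sum>i\<le>degree p. coeff p i * (u ^ i / exp u)) \<longlongrightarrow> (\<Sum>i\<le>degree p. coeff p i * 0)) at_top"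
    by (intro tendsto_intros tendsto_power_div_exp_0)
  then show ?thesis
    by (simp add: poly_altdef sum_distrib_right exp_minus divide_inverse mult.assoc)
qed

text \<open>
  Every function in this family vanishes at \<open>0\<close> together with its difference quotient, because the
  exponential beats the polynomial in \<open>1 / t\<close>. So the family is closed under differentiation.
\<close>

lemma flat_poly_at_0: "((flat_poly p) \<longlongrightarrow> 0) (at 0)"
proof -
  have "((\<lambda>t. poly p (inverse t) * exp (- inverse t)) \<longlongrightarrow> 0) (at_right 0)"
    by (rule filterlim_compose[OF poly_over_exp_tendsto_0 filterlim_inverse_at_top_right])
  then have r: "(flat_poly p \<longlongrightarrow> 0) (at_right 0)"
    by (rule Lim_transform_eventually)
      (auto simp: flat_poly_def inverse_eq_divide eventually_at_right_less
        intro!: eventually_at_rightI[of 0 1])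
  have l: "(flat_poly p \<longlongrightarrow> 0) (at_left 0)"
    by (rule Lim_transform_eventually[OF tendsto_const])
      (auto simp: flat_poly_def intro!: eventually_at_leftI[of "-1"])
  show ?thesis using l r by (simp add: filterlim_split_at)
qed

lemma flat_poly_has_derivative:
  "(flat_poly p has_real_derivative flat_poly ([:0, 0, 1:] * (p - pderiv p)) t) (at t)"
proof (cases t "0::real" rule: linorder_cases)
  case less
  have "((\<lambda>_. 0::real) has_real_derivative 0) (at t)" by simp
  then have "(flat_poly p has_real_derivative 0) (at t)"
    by (rule has_field_derivative_transform_within_open[of _ _ _ "{..<0}"])
      (use less in \<open>auto simp: flat_poly_def\<close>)
  then show ?thesis using less by (simp add: flat_poly_def)
next
  case greater
  have "((\<lambda>t. poly p (1 / t) * exp (- (1 / t))) has_real_derivative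
      (poly p (1 / t) * (exp (- (1 / t)) * (1 / t\<^sup>2)) + poly (pderiv p) (1 / t) * (- 1 / t\<^sup>2) * exp (- (1 / t)))) (at t)"
    using greater
    by (auto intro!: derivative_eq_intros DERIV_chain2[OF poly_DERIV] simp: power2_eq_square)
  then have "(flat_poly p has_real_derivative
      (poly p (1 / t) * (exp (- (1 / t)) * (1 / t\<^sup>2)) + poly (pderiv p) (1 / t) * (- 1 / t\<^sup>2) * exp (- (1 / t)))) (at t)"
    by (rule has_field_derivative_transform_within_open[of _ _ _ "{0<..}"])
      (use greater in \<open>auto simp: flat_poly_def\<close>)
  moreover have "(poly p (1 / t) * (exp (- (1 / t)) * (1 / t\<^sup>2)) + poly (pderiv p) (1 / t) * (- 1 / t\<^sup>2) * exp (- (1 / t)))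
     = flat_poly ([:0, 0, 1:] * (p - pderiv p)) t"
    using greater by (simp add: flat_poly_def algebra_simps power2_eq_square)
  ultimately show ?thesis by simp
next
  case equal
  have "(\<lambda>h. (flat_poly p (0 + h) - flat_poly p 0) / h) = flat_poly ([:0, 1:] * p)"
    by (auto simp: flat_poly_def fun_eq_iff)
  then have "(flat_poly p has_real_derivative 0) (at 0)"
    using flat_poly_at_0[of "[:0, 1:] * p"] by (simp add: DERIV_def)
  then show ?thesis using equal by (simp add: flat_poly_def)
qed

abbreviation flat :: "real \<Rightarrow> real" where "flat \<equiv> flat_poly 1"

lemma flat_bounds: "0 \<le> flat t" "flat t \<le> 1"
  by (auto simp: flat_poly_def)

lemma Ck_on_flat_poly: "Ck_on k UNIV (\<lambda>x. flat_poly p (c * (x \<bullet> e) + d))"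
proof (induction k arbitrary: p)
  case 0
  have "continuous_on UNIV (flat_poly p)"
    by (meson DERIV_continuous_on flat_poly_has_derivative has_field_derivative_at_within)
  then show ?case
    by (auto intro!: continuous_on_compose2[of UNIV "flat_poly p"] continuous_intros)
next
  case (Suc k)
  let ?p = "[:0, 0, 1:] * (p - pderiv p)"
  show ?case
  proof (rule Ck_on_SucI)
    fix x :: 'a
    show "((\<lambda>x. flat_poly p (c * (x \<bullet> e) + d)) has_derivative
      (\<lambda>v. c * (v \<bullet> e) * flat_poly ?p (c * (x \<bullet> e) + d))) (at x)"
    proof -
      have "((\<lambda>x. c * (x \<bullet> e) + d) has_derivative (\<lambda>v. c * (v \<bullet> e))) (at x)"
        by (auto intro!: derivative_eq_intros)
      from has_derivative_compose[OF this] flat_poly_has_derivative[of p "c * (x \<bullet> e) + d"]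
      have "((\<lambda>x. flat_poly p (c * (x \<bullet> e) + d)) has_derivative
          (\<lambda>v. flat_poly ?p (c * (x \<bullet> e) + d) * (c * (v \<bullet> e)))) (at x)"
        unfolding has_field_derivative_def by blast
      then show ?thesis by (simp only: mult.commute)
    qed
  qed (auto intro!: Ck_on_mult Ck_on_const Suc)
qed

text \<open>
  One factor for either face of the box in every direction. Multiplying the distances to the faces by
  \<open>n\<close> pushes the values inside the box towards \<open>1\<close>.
\<close>

definition bump :: "'a::euclidean_space \<Rightarrow> 'a \<Rightarrow> nat \<Rightarrow> 'a \<Rightarrow> real" where
  "bump a b n x = (\<Prod>i\<in>Basis. flat (n * (x \<bullet> i - a \<bullet> i)) * flat (n * (b \<bullet> i - x \<bullet> i)))"

lemma bump_outside: "x \<notin> box a b \<Longrightarrow> bump a b n x = 0"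
proof -
  assume "x \<notin> box a b"
  then obtain i where i: "i \<in> Basis" "x \<bullet> i \<le> a \<bullet> i \<or> b \<bullet> i \<le> x \<bullet> i" by (auto simp: mem_box not_less)
  then have "flat (n * (x \<bullet> i - a \<bullet> i)) * flat (n * (b \<bullet> i - x \<bullet> i)) = 0"
    by (auto simp: flat_poly_def mult_le_0_iff)
  then show ?thesis unfolding bump_def using i(1) by (auto simp: prod_zero_iff simp del: mult_eq_0_iff)
qed

lemma bump_bounds: "0 \<le> bump a b n x" "bump a b n x \<le> 1"
  unfolding bump_def by (auto intro!: prod_nonneg prod_le_1 mult_nonneg_nonneg mult_le_one flat_bounds)

lemma bump_smooth: "smooth_on UNIV (bump a b n)"
proof -
  have "Ck_on k UNIV (\<lambda>x. \<Prod>i\<in>Basis. flat (n * (x \<bullet> i) + (- n * (a \<bullet> i))) * flat ((- n) * (x \<bullet> i) + n * (b \<bullet> i)))" for k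
    by (rule Ck_on_prod Ck_on_mult Ck_on_flat_poly finite_Basis open_UNIV)+
  then show ?thesis
    unfolding smooth_on_def bump_def[abs_def] by (simp add: algebra_simps)
qed

lemma bump_test_function: "cbox a b \<subseteq> U \<Longrightarrow> bump a b n \<in> test_functions U"
  unfolding test_functions_def
  using bump_smooth[of a b n] bump_outside[of _ a b n] box_subset_cbox[of a b]
  by (intro CollectI conjI exI[of _ "cbox a b"] allI impI) auto

lemma flat_tendsto_1: "0 < c \<Longrightarrow> (\<lambda>n. flat (real n * c)) \<longlonglongrightarrow> 1"
proof -
  assume c: "0 < c"
  have "(\<lambda>n. exp (- (inverse (real n) * inverse c))) \<longlonglongrightarrow> exp (- (0 * inverse c))"
    by (intro tendsto_intros lim_inverse_n)
  then have "(\<lambda>n. exp (- (inverse (real n) * inverse c))) \<longlonglongrightarrow> 1" by simp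
  then show ?thesis
    by (rule Lim_transform_eventually)
      (use c in \<open>auto simp: flat_poly_def field_simps zero_less_mult_iff mult_le_0_iff
         intro!: eventually_sequentiallyI[of 1]\<close>)
qed

lemma bump_tendsto_indicator:
  fixes x :: "'a::euclidean_space"
  shows "(\<lambda>n. bump a b n x) \<longlonglongrightarrow> indicator (box a b) x"
proof (cases "x \<in> box a b")
  case True
  have "(\<lambda>n. \<Prod>i\<in>Basis. flat (n * (x \<bullet> i - a \<bullet> i)) * flat (n * (b \<bullet> i - x \<bullet> i))) \<longlonglongrightarrow> (\<Prod>i\<in>(Basis::'a set). 1 * 1)"
    using True by (intro tendsto_intros flat_tendsto_1) (auto simp: mem_box)
  then show ?thesis using True by (simp add: bump_def)
next
  case False
  then show ?thesis by (simp add: bump_outside)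
qed

section \<open>Uniqueness of weak gradients\<close>

text \<open>
  The positive and the negative part of \<open>f\<close> are densities of two measures that agree on boxes, which
  generate the Borel sets.
\<close>

lemma AE_zero_if_box_integrals_zero:
  fixes f :: "'a::euclidean_space \<Rightarrow> real"
  assumes f: "integrable lborel f"
    and z: "\<And>u v. (LINT x|lborel. indicator (box u v) x * f x) = 0"
  shows "AE x in lborel. f x = 0"
proof -
  have [measurable]: "f \<in> borel_measurable borel" using f by auto
  let ?M = "density lborel (\<lambda>x. ennreal (f x))" and ?N = "density lborel (\<lambda>x. ennreal (- f x))"
  have eq: "emeasure ?M (box u v) = emeasure ?N (box u v)" 
    and fin: "emeasure ?M (box u v) \<noteq> \<infinity>" for u v
  proof -
    let ?g = "\<lambda>x. indicator (box u v) x * f x"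
    have g: "integrable lborel ?g"
      using integrable_mult_indicator[of "box u v" lborel f] f by simp
    have p: "(\<integral>\<^sup>+x. ennreal (?g x) \<partial>lborel) \<noteq> \<infinity>" "(\<integral>\<^sup>+x. ennreal (- ?g x) \<partial>lborel) \<noteq> \<infinity>"
      using real_integrable_def[of lborel ?g] g by auto
    have "enn2real (\<integral>\<^sup>+x. ennreal (?g x) \<partial>lborel) = enn2real (\<integral>\<^sup>+x. ennreal (- ?g x) \<partial>lborel)"
      using real_lebesgue_integral_def[OF g] z[of u v] by simp
    then have e: "(\<integral>\<^sup>+x. ennreal (?g x) \<partial>lborel) = (\<integral>\<^sup>+x. ennreal (- ?g x) \<partial>lborel)"
      using p by (subst (1 2) ennreal_enn2real[symmetric]) (auto simp: less_top)
    have m: "emeasure ?M (box u v) = (\<integral>\<^sup>+x. ennreal (?g x) \<partial>lborel)" 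
       "emeasure ?N (box u v) = (\<integral>\<^sup>+x. ennreal (- ?g x) \<partial>lborel)"
      by (auto simp: emeasure_density indicator_def intro!: nn_integral_cong)
    show "emeasure ?M (box u v) = emeasure ?N (box u v)" "emeasure ?M (box u v) \<noteq> \<infinity>"
      using e m p by auto
  qed
  let ?E = "range (\<lambda>(a, b::'a). box a b)"
  have "?M = ?N"
  proof (rule measure_eqI_generator_eq[where E="?E" and \<Omega>=UNIV and A="\<lambda>n. box (- (real n *\<^sub>R One)) (real n *\<^sub>R One)"])
    show "Int_stable ?E"
      by (auto simp: Int_stable_def box_Int_box)
    show "sets ?M = sigma_sets UNIV ?E" "sets ?N = sigma_sets UNIV ?E"
      by (simp_all add: borel_eq_box)
    show "(\<Union>n. box (- (real n *\<^sub>R One)) (real n *\<^sub>R One)) = (UNIV :: 'a set)"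
      by (rule UN_box_eq_UNIV)
  qed (use eq fin in auto)
  then have "AE x in lborel. ennreal (f x) = ennreal (- f x)"
    by (subst (asm) sigma_finite_measure.density_unique_iff[OF sigma_finite_lborel]) auto
  then show ?thesis
    by eventually_elim (metis ennreal_eq_0_iff ennreal_neg linear neg_le_0_iff_le order_antisym)
qed

text \<open>
  The bump functions of a box increase boundedly to its indicator function, so a locally integrable
  function that is orthogonal to all test functions has vanishing integral over all small boxes.
\<close>

lemma fundamental_lemma:
  fixes g :: "'a::euclidean_space \<Rightarrow> real"
  assumes U: "open U" and g: "locally_integrable U g"
    and z: "\<And>\<phi>. \<phi> \<in> test_functions U \<Longrightarrow> (LINT x|lebesgue_on U. g x * \<phi> x) = 0"
  shows "AE x in lebesgue_on U. g x = 0"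
proof -
  have Us: "U \<in> sets lebesgue" using U by (simp add: borel_open)
  have box0: "AE x in lebesgue. x \<in> box a b \<longrightarrow> g x = 0" if ab: "cbox a b \<subseteq> U" for a b
  proof -
    have gi: "set_integrable lebesgue (cbox a b) g"
      using g ab by (auto simp: locally_integrable_def)
    then have gi': "integrable lebesgue (\<lambda>x. indicator (cbox a b) x * g x)"
      by (simp add: set_integrable_def)
    have zero: "(LINT x|lebesgue. indicator (box u v) x * g x) = 0" if uv: "cbox u v \<subseteq> cbox a b" for u v
    proof -
      have sub: "cbox u v \<subseteq> U" using uv ab by auto
      have n0: "(LINT x|lebesgue. g x * bump u v n x) = 0" for n
      proof -
        have b0: "bump u v n x = 0" if "x \<notin> U" for x
          using that sub box_subset_cbox[of u v] by (intro bump_outside) auto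
        have "(LINT x|lebesgue. g x * bump u v n x) = (LINT x|lebesgue_on U. g x * bump u v n x)"
          using Us b0
          by (subst integral_restrict_space) 
            (auto intro!: Bochner_Integration.integral_cong simp: set_lebesgue_integral_def indicator_def)
        then show ?thesis using z[OF bump_test_function[OF sub]] by simp
      qed
      have gm: "(\<lambda>x. indicator (cbox a b) x * g x) \<in> borel_measurable lebesgue" using gi' by auto
      have bm: "bump u v n \<in> borel_measurable lebesgue" for n
        by (auto intro!: borel_measurable_continuous_onI measurable_completion
            smooth_on_continuous bump_smooth)
      have ib: "indicator (box u v) x * g x = indicator (box u v) x * (indicator (cbox a b) x * g x)" for x
        using uv box_subset_cbox[of u v] by (auto simp: indicator_def)
      have bb: "g x * bump u v n x = indicator (cbox a b) x * g x * bump u v n x" for x n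
        using uv box_subset_cbox[of u v] bump_outside[of x u v n] by (auto simp: indicator_def)
      have "(\<lambda>n. LINT x|lebesgue. g x * bump u v n x) \<longlonglongrightarrow> (LINT x|lebesgue. indicator (box u v) x * g x)"
      proof (rule integral_dominated_convergence[where w="\<lambda>x. \<bar>indicator (cbox a b) x * g x\<bar>"])
        show "(\<lambda>x. indicator (box u v) x * g x) \<in> borel_measurable lebesgue"
          unfolding ib by (intro borel_measurable_times gm borel_measurable_indicator) auto
        show "(\<lambda>x. g x * bump u v i x) \<in> borel_measurable lebesgue" for i
          unfolding bb by (intro borel_measurable_times gm bm)
        show "integrable lebesgue (\<lambda>x. \<bar>indicator (cbox a b) x * g x\<bar>)" using gi' by simp
        show "AE x in lebesgue. (\<lambda>i. g x * bump u v i x) \<longlonglongrightarrow> indicator (box u v) x * g x"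
          unfolding mult.commute[of "indicator (box u v) _"]
          by (intro AE_I2 tendsto_mult tendsto_const bump_tendsto_indicator)
        show "AE x in lebesgue. norm (g x * bump u v i x) \<le> \<bar>indicator (cbox a b) x * g x\<bar>" for i
          unfolding bb using bump_bounds[of u v i] 
          by (auto simp: abs_mult mult_left_le)
      qed
      then show ?thesis using n0 LIMSEQ_const_iff by (simp add: LIMSEQ_const_iff)
    qed
    define g1 where "g1 x = indicator (box a b) x * g x" for x
    have g1: "integrable lebesgue g1"
    proof -
      have "integrable lebesgue (\<lambda>x. indicator (box a b) x *\<^sub>R (indicator (cbox a b) x * g x))"
        using gi' by (intro integrable_mult_indicator) auto
      moreover have "g1 = (\<lambda>x. indicator (box a b) x *\<^sub>R (indicator (cbox a b) x * g x))"
        using box_subset_cbox[of a b] by (auto simp: g1_def indicator_def fun_eq_iff)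
      ultimately show ?thesis by simp
    qed
    then obtain g2 where g2: "g2 \<in> borel_measurable lborel" "AE x in lborel. g1 x = g2 x"
      using completion_ex_borel_measurable_real[of g1 lborel] by auto
    have g12: "AE x in lebesgue. g1 x = g2 x" using g2(2) by (rule AE_completion)
    have g1m: "g1 \<in> borel_measurable lebesgue" and g2m: "g2 \<in> borel_measurable lebesgue"
      using g1 g2 by (auto intro: measurable_completion)
    have g2i: "integrable lborel g2"
    proof -
      have "integrable lebesgue g2"
        by (rule integrable_cong_AE_imp[OF g1])
          (use g2 g12 in \<open>auto simp: eq_commute intro: measurable_completion\<close>)
      then show ?thesis using g2 by (simp add: integrable_completion)
    qed
    have "(LINT x|lborel. indicator (box u v) x * g2 x) = 0" for u v
    proof -
      obtain c d where cd: "box a b \<inter> box u v = box c d" unfolding box_Int_box by blast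
      have "(LINT x|lborel. indicator (box u v) x * g2 x) = (LINT x|lebesgue. indicator (box u v) x * g2 x)"
        by (rule integral_completion[symmetric]) (use g2 in measurable)
      also have "\<dots> = (LINT x|lebesgue. indicator (box u v) x * g1 x)"
        by (rule integral_cong_AE) (use g12 g1m g2m in \<open>auto intro!: borel_measurable_times borel_measurable_indicator\<close>)
      also have "\<dots> = (LINT x|lebesgue. indicator (box c d) x * g x)"
        by (rule Bochner_Integration.integral_cong) (auto simp: g1_def indicator_def cd[symmetric])
      also have "\<dots> = 0"
      proof (cases "box c d = {}")
        case False
        then have "cbox c d \<subseteq> cbox a b"
          using closure_minimal[of "box c d" "cbox a b"] cd box_subset_cbox[of a b]
          by (auto simp: closure_box)
        then show ?thesis by (rule zero)
      qed simp
      finally show ?thesis .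
    qed
    from AE_zero_if_box_integrals_zero[OF g2i this]
    have "AE x in lebesgue. g2 x = 0" by (rule AE_completion)
    with g12 show ?thesis by eventually_elim (auto simp: g1_def indicator_def)
  qed
  obtain \<D> where D: "countable \<D>" "\<D> \<subseteq> Pow U"
    "\<And>X. X \<in> \<D> \<Longrightarrow> \<exists>a b. X = cbox a b" "\<Union>\<D> = U"
    by (rule open_countable_Union_open_cbox[OF U]) blast
  have "AE x in lebesgue. \<forall>X\<in>\<D>. x \<in> X \<longrightarrow> g x = 0"
    unfolding AE_ball_countable[OF D(1)]
  proof
    fix X assume "X \<in> \<D>"
    then obtain a b where X: "X = cbox a b" "cbox a b \<subseteq> U" using D by blast
    have "AE x in lebesgue. x \<notin> cbox a b - box a b"
      using negligible_frontier_interval[of a b] unfolding negligible_iff_null_sets by (rule AE_not_in)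
    with box0[OF X(2)] show "AE x in lebesgue. x \<in> X \<longrightarrow> g x = 0"
      by eventually_elim (auto simp: X)
  qed
  then have "AE x in lebesgue. x \<in> U \<longrightarrow> g x = 0" using D(4) by auto
  then show ?thesis by (simp add: AE_restrict_space_iff Us)
qed

lemma lebesgue_measurable_open: "open U \<Longrightarrow> U \<in> sets lebesgue"
  by (simp add: borel_open)

lemma locally_integrable_test_function:
  fixes f :: "'a::euclidean_space \<Rightarrow> real"
  assumes f: "locally_integrable U f" and \<phi>: "continuous_on UNIV \<phi>" 
    and K: "compact K" "K \<subseteq> U" "\<And>x. x \<notin> K \<Longrightarrow> \<phi> x = 0" and U: "open U"
  shows "integrable (lebesgue_on U) (\<lambda>x. f x * \<phi> x)"
proof -
  have fi: "set_integrable lebesgue K f" using f K by (auto simp: locally_integrable_def)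
  obtain B where B: "\<And>x. x \<in> K \<Longrightarrow> \<bar>\<phi> x\<bar> \<le> B"
    using compact_imp_bounded[OF compact_continuous_image[OF continuous_on_subset[OF \<phi>] K(1)]]
    by (auto simp: bounded_iff)
  have [measurable]: "\<phi> \<in> borel_measurable lebesgue"
    using \<phi> by (intro measurable_completion) (auto intro: borel_measurable_continuous_onI)
  have "integrable lebesgue (\<lambda>x. (indicator K x *\<^sub>R f x) * \<phi> x)"
  proof (rule Bochner_Integration.integrable_bound)
    show "integrable lebesgue (\<lambda>x. B *\<^sub>R (indicator K x *\<^sub>R f x))"
      using fi unfolding set_integrable_def by (rule integrable_scaleR_right)
    show "(\<lambda>x. (indicator K x *\<^sub>R f x) * \<phi> x) \<in> borel_measurable lebesgue"
      using fi by (intro borel_measurable_times) (auto simp: set_integrable_def)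
    show "AE x in lebesgue. norm ((indicator K x *\<^sub>R f x) * \<phi> x) \<le> norm (B *\<^sub>R (indicator K x *\<^sub>R f x))"
    proof (intro AE_I2)
      fix x
      show "norm ((indicator K x *\<^sub>R f x) * \<phi> x) \<le> norm (B *\<^sub>R (indicator K x *\<^sub>R f x))"
      proof (cases "x \<in> K")
        case True
        then have "\<bar>\<phi> x\<bar> \<le> \<bar>B\<bar>" using B[of x] by linarith
        then show ?thesis using True by (simp add: abs_mult mult.commute mult_right_mono)
      qed auto
    qed
  qed
  moreover have "(\<lambda>x. (indicator K x *\<^sub>R f x) * \<phi> x) = (\<lambda>x. indicator U x *\<^sub>R (f x * \<phi> x))"
    using K by (fastforce simp: indicator_def)
  ultimately have "set_integrable lebesgue U (\<lambda>x. f x * \<phi> x)"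
    by (simp only: set_integrable_def)
  then show ?thesis
    using U by (simp add: integrable_restrict_space set_integrable_def borel_open)
qed

text \<open>
  The support also contains the support of the derivatives, so one compact set serves both sides of
  the identity that defines weak gradients.
\<close>

lemma test_functionE:
  assumes "\<phi> \<in> test_functions U"
  obtains K where "compact K" "K \<subseteq> U" "\<And>x. x \<notin> K \<Longrightarrow> \<phi> x = 0"
    "\<And>x b. x \<notin> K \<Longrightarrow> frechet_derivative \<phi> (at x) b = 0"
proof -
  from assms obtain K where K: "compact K" "K \<subseteq> U" "\<And>x. x \<notin> K \<Longrightarrow> \<phi> x = 0"
    unfolding test_functions_def by blast
  have "frechet_derivative \<phi> (at x) b = 0" if "x \<notin> K" for x b
  proof -
    have "((\<lambda>_. 0) has_derivative (\<lambda>_. 0)) (at x)" by simp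
    then have "(\<phi> has_derivative (\<lambda>_. 0)) (at x)"
      by (rule has_derivative_transform_within_open[of _ _ _ _ "- K"])
        (use K that in \<open>auto intro: compact_imp_closed\<close>)
    from frechet_derivative_at[OF this] show ?thesis by metis
  qed
  then show thesis using that K by blast
qed

lemma locally_integrable_inner:
  assumes "locally_integrable U g"
  shows "locally_integrable U (\<lambda>x. g x \<bullet> b)"
  using assms unfolding locally_integrable_def set_integrable_def
  by (auto simp flip: inner_scaleR_left)

lemma weak_gradient_unique:
  assumes U: "open U" and g: "is_weak_gradient U u g" and h: "is_weak_gradient U u h"
  shows "AE x in lebesgue_on U. g x = h x"
proof -
  have "AE x in lebesgue_on U. \<forall>b\<in>Basis. (g x - h x) \<bullet> b = 0"
  proof (subst AE_ball_countable[OF countable_finite[OF finite_Basis]], intro ballI)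
    fix b :: 'a assume b: "b \<in> Basis"
    note lg = locally_integrable_inner[of U g b] and lh = locally_integrable_inner[of U h b]
    show "AE x in lebesgue_on U. (g x - h x) \<bullet> b = 0"
    proof (rule fundamental_lemma[OF U])
      show "locally_integrable U (\<lambda>x. (g x - h x) \<bullet> b)"
        using lg lh g h 
        by (auto simp: locally_integrable_def inner_diff_left is_weak_gradient_def intro: set_integral_diff)
      fix \<phi> assume \<phi>: "\<phi> \<in> test_functions U"
      then have c: "continuous_on UNIV \<phi>"
        by (auto simp: test_functions_def intro: smooth_on_continuous)
      obtain K where K: "compact K" "K \<subseteq> U" "\<And>x. x \<notin> K \<Longrightarrow> \<phi> x = 0"
        by (rule test_functionE[OF \<phi>]) blast
      have "integrable (lebesgue_on U) (\<lambda>x. (g x \<bullet> b) * \<phi> x)"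
        "integrable (lebesgue_on U) (\<lambda>x. (h x \<bullet> b) * \<phi> x)"
        using lg lh g h by (auto intro!: locally_integrable_test_function[OF _ c K U] simp: is_weak_gradient_def)
      then have "(LINT x|lebesgue_on U. (g x - h x) \<bullet> b * \<phi> x) =
          (LINT x|lebesgue_on U. (g x \<bullet> b) * \<phi> x) - (LINT x|lebesgue_on U. (h x \<bullet> b) * \<phi> x)"
        by (simp add: inner_diff_left left_diff_distrib)
      then show "(LINT x|lebesgue_on U. (g x - h x) \<bullet> b * \<phi> x) = 0"
        using g h \<phi> b by (simp add: is_weak_gradient_def)
    qed
  qed
  then show ?thesis
    by eventually_elim (metis euclidean_all_zero_iff right_minus_eq)
qed

section \<open>Classical gradients are weak gradients\<close>

definition classical_gradient :: "('a::euclidean_space \<Rightarrow> real) \<Rightarrow> 'a \<Rightarrow> 'a" where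
  "classical_gradient f x = (\<Sum>b\<in>Basis. frechet_derivative f (at x) b *\<^sub>R b)"

lemma classical_gradient_inner: "b \<in> Basis \<Longrightarrow> classical_gradient f x \<bullet> b = frechet_derivative f (at x) b"
  by (simp add: classical_gradient_def inner_sum_left inner_Basis if_distrib cong: if_cong)

lemma classical_gradient_has_derivative:
  assumes "smooth_on UNIV f"
  shows "(f has_derivative (\<lambda>v. classical_gradient f x \<bullet> v)) (at x)"
proof -
  have d: "(f has_derivative frechet_derivative f (at x)) (at x)"
    by (rule smooth_on_has_derivative[OF assms])
  have "frechet_derivative f (at x) = (\<lambda>v. classical_gradient f x \<bullet> v)"
  proof
    fix v
    interpret bounded_linear "frechet_derivative f (at x)" using d by (rule has_derivative_bounded_linear)
    have "frechet_derivative f (at x) v = frechet_derivative f (at x) (\<Sum>b\<in>Basis. (v \<bullet> b) *\<^sub>R b)"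
      by (simp add: euclidean_representation)
    also have "\<dots> = classical_gradient f x \<bullet> v"
      by (simp add: sum scaleR classical_gradient_def inner_sum_left mult.commute inner_commute[of v])
    finally show "frechet_derivative f (at x) v = classical_gradient f x \<bullet> v" .
  qed
  then show ?thesis using d by simp
qed

lemma continuous_on_classical_gradient: "smooth_on UNIV f \<Longrightarrow> continuous_on A (classical_gradient f)"
  unfolding classical_gradient_def[abs_def]
  by (intro continuous_on_sum continuous_on_scaleR continuous_on_const smooth_on_continuous_partial)

text \<open>
  Translation invariance makes the integral of every difference quotient vanish, and the difference
  quotients converge boundedly to the derivative.
\<close>

lemma integral_derivative_compact_support:
  fixes F :: "'a::euclidean_space \<Rightarrow> real"
  assumes d: "\<And>x. (F has_derivative D x) (at x)"
    and c: "continuous_on UNIV (\<lambda>x. D x b)"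
    and K: "compact K" "\<And>x. x \<notin> K \<Longrightarrow> F x = 0"
  shows "(LINT x|lborel. D x b) = 0"
proof -
  have Fc: "continuous_on UNIV F" using d by (meson continuous_at_imp_continuous_on has_derivative_continuous)
  have D0: "D x b = 0" if "x \<notin> K" for x
  proof -
    have "((\<lambda>_. 0) has_derivative (\<lambda>_. 0)) (at x)" by simp
    then have "(F has_derivative (\<lambda>_. 0)) (at x)"
      by (rule has_derivative_transform_within_open[of _ _ _ _ "- K"])
        (use K that in \<open>auto intro: compact_imp_closed\<close>)
    with d[of x] have "D x = (\<lambda>_. 0)" by (rule has_derivative_unique)
    then show ?thesis by simp
  qed
  obtain B where B: "\<And>x. \<bar>D x b\<bar> \<le> B"
  proof -
    obtain B where "\<And>x. x \<in> K \<Longrightarrow> \<bar>D x b\<bar> \<le> B"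
      using compact_imp_bounded[OF compact_continuous_image[OF continuous_on_subset[OF c] K(1)]]
      by (auto simp: bounded_iff)
    then have "\<bar>D x b\<bar> \<le> \<bar>B\<bar>" for x by (cases "x \<in> K") (fastforce simp: D0)+
    then show thesis by (rule that)
  qed
  define K' where "K' = {x + y | x y. x \<in> K \<and> y \<in> cball 0 (norm b)}"
  have K': "compact K'" unfolding K'_def by (intro compact_sums K compact_cball)
  have line: "((\<lambda>t. F (x + t *\<^sub>R b)) has_real_derivative D (x + t *\<^sub>R b) b) (at t)" for x t
  proof -
    have "((\<lambda>t. x + t *\<^sub>R b) has_derivative (\<lambda>t. t *\<^sub>R b)) (at t)"
      by (auto intro!: derivative_eq_intros)
    from has_derivative_compose[OF this d]
    have "((\<lambda>t. F (x + t *\<^sub>R b)) has_derivative (\<lambda>s. D (x + t *\<^sub>R b) (s *\<^sub>R b))) (at t)" .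
    moreover have "D (x + t *\<^sub>R b) (s *\<^sub>R b) = D (x + t *\<^sub>R b) b * s" for s
      using has_derivative_linear[OF d] by (simp add: linear_scale)
    ultimately show ?thesis by (simp add: has_field_derivative_def)
  qed
  define q where "q n x = (F (x + (1 / real (Suc n)) *\<^sub>R b) - F x) * real (Suc n)" for n x
  have Fint: "integrable lborel (\<lambda>x. F (x + a))" for a
  proof -
    have "compact {x - y | x y. x \<in> K \<and> y \<in> {a}}" by (intro compact_differences K compact_sing)
    moreover have "{x - y | x y. x \<in> K \<and> y \<in> {a}} = {x. x + a \<in> K}" 
      by (auto simp: diff_eq_eq) (metis add_diff_cancel_right')
    ultimately have cK: "compact {x. x + a \<in> K}" by simp
    have "integrable lborel (\<lambda>x. indicator {x. x + a \<in> K} x *\<^sub>R F (x + a))"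
      by (rule borel_integrable_compact[OF cK])
        (auto intro!: continuous_on_compose2[OF Fc] continuous_intros)
    moreover have "(\<lambda>x. indicator {x. x + a \<in> K} x *\<^sub>R F (x + a)) = (\<lambda>x. F (x + a))"
      using K(2) by (auto simp: indicator_def fun_eq_iff)
    ultimately show ?thesis by simp
  qed
  have q0: "(LINT x|lborel. q n x) = 0" for n
  proof -
    have "(LINT x|lborel. F (x + a)) = (LINT x|lborel. F x)" for a
      by (subst (2) lborel_distr_plus[of a, symmetric], subst integral_distr)
        (auto intro!: borel_measurable_continuous_onI Fc simp: add.commute)
    then show ?thesis
      unfolding q_def using Fint[of "(1 / real (Suc n)) *\<^sub>R b"] Fint[of 0]
      by simp
  qed
  have qb: "\<bar>q n x\<bar> \<le> B * indicator K' x" for n x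
  proof -
    define h where "h = 1 / real (Suc n)"
    have h: "0 < h" "h \<le> 1" by (auto simp: h_def)
    obtain z where z: "0 < z" "z < h" "F (x + h *\<^sub>R b) - F (x + 0 *\<^sub>R b) = (h - 0) * D (x + z *\<^sub>R b) b"
      using MVT2[OF h(1), of "\<lambda>t. F (x + t *\<^sub>R b)" "\<lambda>t. D (x + t *\<^sub>R b) b"] line by auto
    have "q n x = D (x + z *\<^sub>R b) b" using z(3) h by (simp add: q_def h_def field_simps)
    moreover have "D (x + z *\<^sub>R b) b = 0" if "x \<notin> K'"
    proof (rule D0, rule notI)
      assume "x + z *\<^sub>R b \<in> K"
      moreover have "norm (- (z *\<^sub>R b)) \<le> norm b" using z h by (simp add: mult_left_le_one_le)
      ultimately have "(x + z *\<^sub>R b) + (- (z *\<^sub>R b)) \<in> K'"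
        unfolding K'_def by (intro CollectI exI[of _ "x + z *\<^sub>R b"] exI[of _ "- (z *\<^sub>R b)"] conjI refl) auto
      then show False using that by simp
    qed
    ultimately show ?thesis using B by (cases "x \<in> K'") auto
  qed
  have "(\<lambda>n. LINT x|lborel. q n x) \<longlonglongrightarrow> (LINT x|lborel. D x b)"
  proof (rule integral_dominated_convergence[where w="\<lambda>x. B * indicator K' x"])
    show "integrable lborel (\<lambda>x. B * indicator K' x)"
      using K' emeasure_bounded_finite[OF compact_imp_bounded[OF K']]
      by (intro integrable_mult_right integrable_real_indicator)
        (auto intro: compact_imp_closed borel_closed)
    show "AE x in lborel. (\<lambda>n. q n x) \<longlonglongrightarrow> D x b"
    proof (intro AE_I2)
      fix x
      have "((\<lambda>h. (F (x + (0 + h) *\<^sub>R b) - F (x + 0 *\<^sub>R b)) / h) \<longlongrightarrow> D (x + 0 *\<^sub>R b) b) (at 0)"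
        using line[of x 0] unfolding DERIV_def .
      moreover have "filterlim (\<lambda>n. 1 / real (Suc n)) (at 0) sequentially"
        unfolding filterlim_at using LIMSEQ_inverse_real_of_nat by (auto simp: inverse_eq_divide)
      ultimately have "(\<lambda>n. (F (x + (0 + 1 / real (Suc n)) *\<^sub>R b) - F (x + 0 *\<^sub>R b)) / (1 / real (Suc n))) \<longlonglongrightarrow> D (x + 0 *\<^sub>R b) b"
        by (rule filterlim_compose)
      then show "(\<lambda>n. q n x) \<longlonglongrightarrow> D x b" by (simp add: q_def)
    qed
    show "(\<lambda>x. q n x) \<in> borel_measurable lborel" for n
      unfolding q_def by (auto intro!: borel_measurable_continuous_onI continuous_intros continuous_on_compose2[OF Fc])
    show "(\<lambda>x. D x b) \<in> borel_measurable lborel" using c by (simp add: borel_measurable_continuous_onI)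
    show "AE x in lborel. norm (q n x) \<le> B * indicator K' x" for n using qb by simp
  qed
  then show ?thesis using q0 by (simp add: LIMSEQ_const_iff)
qed

lemma continuous_locally_integrable:
  assumes "continuous_on UNIV f"
  shows "locally_integrable U f"
  unfolding locally_integrable_def
proof (intro allI impI)
  fix K assume "compact K \<and> K \<subseteq> U"
  then have "integrable lborel (\<lambda>x. indicator K x *\<^sub>R f x)"
    using assms by (intro borel_integrable_compact) (auto intro: continuous_on_subset)
  then show "f absolutely_integrable_on K"
    unfolding set_integrable_def by (subst integrable_completion) auto
qed

text \<open>
  Integration by parts is the product rule together with the vanishing of the integral of a derivative
  with compact support.
\<close>

lemma classical_gradient_is_weak_gradient:
  assumes U: "open U" and f: "smooth_on UNIV f"
  shows "is_weak_gradient U f (classical_gradient f)"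
  unfolding is_weak_gradient_def
proof (intro conjI ballI)
  show l: "locally_integrable U f" "locally_integrable U (classical_gradient f)"
    using f by (auto intro!: continuous_locally_integrable smooth_on_continuous continuous_on_classical_gradient)
  fix \<phi> and b :: 'a assume \<phi>: "\<phi> \<in> test_functions U" and b: "b \<in> Basis"
  then have \<phi>s: "smooth_on UNIV \<phi>" by (simp add: test_functions_def)
  obtain K where K: "compact K" "K \<subseteq> U" "\<And>x. x \<notin> K \<Longrightarrow> \<phi> x = 0" 
    "\<And>x b. x \<notin> K \<Longrightarrow> frechet_derivative \<phi> (at x) b = 0"
    by (rule test_functionE[OF \<phi>]) blast
  let ?D = "\<lambda>x v. f x * frechet_derivative \<phi> (at x) v + frechet_derivative f (at x) v * \<phi> x"
  have Dc: "continuous_on UNIV (\<lambda>x. ?D x b)"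
    using f \<phi>s b by (intro continuous_intros smooth_on_continuous smooth_on_continuous_partial)
  have z: "(LINT x|lborel. ?D x b) = 0"
  proof (rule integral_derivative_compact_support[where F="\<lambda>x. f x * \<phi> x"])
    show "((\<lambda>x. f x * \<phi> x) has_derivative ?D x) (at x)" for x
      by (rule has_derivative_mult[OF smooth_on_has_derivative[OF f] smooth_on_has_derivative[OF \<phi>s]])
  qed (use Dc K in auto)
  have i1: "integrable (lebesgue_on U) (\<lambda>x. f x * frechet_derivative \<phi> (at x) b)"
    by (rule locally_integrable_test_function[OF l(1) _ K(1,2) K(4) U])
       (rule smooth_on_continuous_partial[OF \<phi>s b])
  have i2: "integrable (lebesgue_on U) (\<lambda>x. (classical_gradient f x \<bullet> b) * \<phi> x)"
    by (rule locally_integrable_test_function[OF locally_integrable_inner[OF l(2)] smooth_on_continuous[OF \<phi>s] K(1-3) U])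
  have "(LINT x|lebesgue_on U. f x * frechet_derivative \<phi> (at x) b) + (LINT x|lebesgue_on U. (classical_gradient f x \<bullet> b) * \<phi> x)
      = (LINT x|lebesgue_on U. ?D x b)"
    using i1 i2 b by (simp add: classical_gradient_inner)
  also have "\<dots> = (LINT x|lebesgue. ?D x b)"
  proof -
    have e: "(\<lambda>x. indicator U x *\<^sub>R ?D x b) = (\<lambda>x. ?D x b)"
      using K by (fastforce simp: indicator_def)
    have "(LINT x|lebesgue_on U. ?D x b) = (LINT x|lebesgue. indicator U x *\<^sub>R ?D x b)"
      using U by (subst integral_restrict_space) (auto simp: set_lebesgue_integral_def borel_open)
    then show ?thesis unfolding e .
  qed
  also have "\<dots> = (LINT x|lborel. ?D x b)"
    by (rule integral_completion) (use Dc in \<open>simp add: borel_measurable_continuous_onI\<close>)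
  finally show "(LINT x|lebesgue_on U. f x * frechet_derivative \<phi> (at x) b)
      = - (LINT x|lebesgue_on U. (classical_gradient f x \<bullet> b) * \<phi> x)"
    using z by simp
qed

section \<open>Completeness of square integrable functions\<close>

text \<open>
  Along a subsequence with increments \<open>d k\<close> of squared norm at most \<open>(1 / 4) ^ k\<close> the series of
  \<open>2 ^ k * (norm (d k))\<^sup>2\<close> is integrable, hence finite almost everywhere, and it dominates the series of
  \<open>norm (d k)\<close> up to a geometric series. Fatou's lemma turns convergence almost everywhere into
  convergence in square mean.
\<close>

lemma L2_Cauchy_limit:
  fixes u :: "nat \<Rightarrow> 'x \<Rightarrow> 'b::euclidean_space"
  assumes [measurable]: "\<And>n. u n \<in> borel_measurable M"
    and Cauchy: "\<And>e. e > 0 \<Longrightarrow> \<exists>N. \<forall>m\<ge>N. \<forall>n\<ge>N. (\<integral>\<^sup>+x. ennreal ((norm (u m x - u n x))\<^sup>2) \<partial>M) \<le> ennreal e"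
  obtains v r where "v \<in> borel_measurable M" "strict_mono (r :: nat \<Rightarrow> nat)"
    "AE x in M. (\<lambda>k. u (r k) x) \<longlonglongrightarrow> v x"
    "\<And>e. e > 0 \<Longrightarrow> \<exists>N. \<forall>n\<ge>N. (\<integral>\<^sup>+x. ennreal ((norm (u n x - v x))\<^sup>2) \<partial>M) \<le> ennreal e"
proof -
  have "\<forall>k. \<exists>N. \<forall>m\<ge>N. \<forall>n\<ge>N. (\<integral>\<^sup>+x. ennreal ((norm (u m x - u n x))\<^sup>2) \<partial>M) \<le> ennreal ((1/4)^k)"
    using Cauchy by auto
  then obtain N where N: "\<And>k m n. m \<ge> N k \<Longrightarrow> n \<ge> N k \<Longrightarrow>
      (\<integral>\<^sup>+x. ennreal ((norm (u m x - u n x))\<^sup>2) \<partial>M) \<le> ennreal ((1/4)^k)"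
    by metis
  \<comment> \<open>strictly increasing and beyond the Cauchy bound for \<open>(1 / 4) ^ k\<close> at every step\<close>
  define r where "r = rec_nat (N 0) (\<lambda>k rk. max (N (Suc k)) (Suc rk))"
  have rS: "r (Suc k) = max (N (Suc k)) (Suc (r k))" for k by (simp add: r_def)
  have rN: "r k \<ge> N k" for k by (cases k) (auto simp: r_def)
  have r: "strict_mono r" by (rule strict_monoI_Suc) (simp add: rS)
  define d where "d k x = u (r (Suc k)) x - u (r k) x" for k x
  have [measurable]: "d k \<in> borel_measurable M" for k unfolding d_def by measurable
  have dk: "(\<integral>\<^sup>+x. ennreal ((norm (d k x))\<^sup>2) \<partial>M) \<le> ennreal ((1/4)^k)" for k
    unfolding d_def using rN[of k] strict_mono_leD[OF r, of k "Suc k"] by (intro N) auto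
  have "(\<integral>\<^sup>+x. (\<Sum>k. ennreal (2 ^ k * (norm (d k x))\<^sup>2)) \<partial>M) = (\<Sum>k. \<integral>\<^sup>+x. ennreal (2 ^ k * (norm (d k x))\<^sup>2) \<partial>M)"
    by (intro nn_integral_suminf) measurable
  also have "\<dots> \<le> (\<Sum>k. ennreal ((1/2)^k))"
  proof (intro suminf_le summableI)
    fix k
    have "(\<integral>\<^sup>+x. ennreal (2 ^ k * (norm (d k x))\<^sup>2) \<partial>M) = ennreal (2 ^ k) * (\<integral>\<^sup>+x. ennreal ((norm (d k x))\<^sup>2) \<partial>M)"
      by (subst nn_integral_cmult[symmetric]) (auto simp: ennreal_mult)
    also have "\<dots> \<le> ennreal (2 ^ k) * ennreal ((1/4)^k)" by (intro mult_left_mono dk) auto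
    also have "\<dots> = ennreal ((1/2)^k)"
      by (simp add: ennreal_mult[symmetric] power_mult_distrib[symmetric])
    finally show "(\<integral>\<^sup>+x. ennreal (2 ^ k * (norm (d k x))\<^sup>2) \<partial>M) \<le> ennreal ((1/2)^k)" .
  qed
  also have "\<dots> = ennreal (\<Sum>k. (1/2)^k)"
    by (rule suminf_ennreal2) (auto intro: summable_geometric)
  also have "\<dots> < \<infinity>" by simp
  finally have "AE x in M. (\<Sum>k. ennreal (2 ^ k * (norm (d k x))\<^sup>2)) \<noteq> \<infinity>"
    by (intro nn_integral_noteq_infinite) auto
  then have conv: "AE x in M. convergent (\<lambda>k. u (r k) x)"
  proof eventually_elim
    fix x assume "(\<Sum>k. ennreal (2 ^ k * (norm (d k x))\<^sup>2)) \<noteq> \<infinity>"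
    then have s: "summable (\<lambda>k. 2 ^ k * (norm (d k x))\<^sup>2)"
      by (intro summable_suminf_not_top) auto
    have "summable (\<lambda>k. norm (d k x))"
    proof (rule summable_comparison_test')
      show "summable (\<lambda>k. (1/2)^k + 2 ^ k * (norm (d k x))\<^sup>2)"
        by (intro summable_add s summable_geometric) simp
      fix k :: nat
      define a :: real where "a = 2 ^ k"
      have a: "a > 0" by (simp add: a_def)
      have "0 \<le> (a * norm (d k x) - 1)\<^sup>2 + (a * norm (d k x))\<^sup>2 + 1" by simp
      then have "2 * (a * norm (d k x)) \<le> 2 * (1 + a * a * (norm (d k x))\<^sup>2)"
        by (simp add: power2_eq_square algebra_simps)
      then have "norm (d k x) \<le> 1 / a + a * (norm (d k x))\<^sup>2"
        using a by (simp add: field_simps power2_eq_square)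
      then show "norm (norm (d k x)) \<le> (1/2)^k + 2 ^ k * (norm (d k x))\<^sup>2"
        by (simp add: a_def power_one_over)
    qed
    then have "summable (\<lambda>k. d k x)" by (rule summable_norm_cancel)
    then have "convergent (\<lambda>n. \<Sum>k<n. d k x)" by (simp add: summable_iff_convergent)
    moreover have "(\<Sum>k<n. d k x) = u (r n) x - u (r 0) x" for n
      unfolding d_def by (rule sum_lessThan_telescope)
    ultimately have "convergent (\<lambda>n. (u (r n) x - u (r 0) x) + u (r 0) x)"
      by (intro convergent_add convergent_const) simp
    then show "convergent (\<lambda>k. u (r k) x)" by simp
  qed
  define v where "v x = lim (\<lambda>k. u (r k) x)" for x
  have [measurable]: "v \<in> borel_measurable M"
    unfolding v_def by (rule borel_measurable_lim_metric) measurable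
  have lim: "AE x in M. (\<lambda>k. u (r k) x) \<longlonglongrightarrow> v x"
    using conv by eventually_elim (simp add: v_def convergent_LIMSEQ_iff)
  have "\<exists>N. \<forall>n\<ge>N. (\<integral>\<^sup>+x. ennreal ((norm (u n x - v x))\<^sup>2) \<partial>M) \<le> ennreal e" if "0 < e" for e
  proof -
    obtain N0 where N0: "\<And>m n. m \<ge> N0 \<Longrightarrow> n \<ge> N0 \<Longrightarrow> (\<integral>\<^sup>+x. ennreal ((norm (u m x - u n x))\<^sup>2) \<partial>M) \<le> ennreal e"
      using Cauchy[OF \<open>0 < e\<close>] by blast
    have "(\<integral>\<^sup>+x. ennreal ((norm (u n x - v x))\<^sup>2) \<partial>M) \<le> ennreal e" if n: "n \<ge> N0" for n
    proof -
      have "AE x in M. ennreal ((norm (u n x - v x))\<^sup>2) \<le> liminf (\<lambda>k. ennreal ((norm (u n x - u (r k) x))\<^sup>2))"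
        using lim
      proof eventually_elim
        fix x assume "(\<lambda>k. u (r k) x) \<longlonglongrightarrow> v x"
        then have "(\<lambda>k. ennreal ((norm (u n x - u (r k) x))\<^sup>2)) \<longlonglongrightarrow> ennreal ((norm (u n x - v x))\<^sup>2)"
          by (intro tendsto_ennrealI tendsto_intros)
        then show "ennreal ((norm (u n x - v x))\<^sup>2) \<le> liminf (\<lambda>k. ennreal ((norm (u n x - u (r k) x))\<^sup>2))"
          by (intro eq_refl lim_imp_Liminf[OF trivial_limit_sequentially, symmetric])
      qed
      then have "(\<integral>\<^sup>+x. ennreal ((norm (u n x - v x))\<^sup>2) \<partial>M)
          \<le> (\<integral>\<^sup>+x. liminf (\<lambda>k. ennreal ((norm (u n x - u (r k) x))\<^sup>2)) \<partial>M)"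
        by (rule nn_integral_mono_AE)
      also have "\<dots> \<le> liminf (\<lambda>k. \<integral>\<^sup>+x. ennreal ((norm (u n x - u (r k) x))\<^sup>2) \<partial>M)"
        by (rule nn_integral_liminf) measurable
      also have "\<dots> \<le> ennreal e"
      proof (rule Liminf_le)
        have "r k \<ge> N0" if "k \<ge> N0" for k using seq_suble[OF r, of k] that by simp
        then show "\<forall>\<^sub>F k in sequentially. (\<integral>\<^sup>+x. ennreal ((norm (u n x - u (r k) x))\<^sup>2) \<partial>M) \<le> ennreal e"
          using n N0 by (auto intro!: eventually_sequentiallyI[of N0])
      qed simp
      finally show ?thesis .
    qed
    then show ?thesis by blast
  qed
  with \<open>v \<in> borel_measurable M\<close> r lim show thesis by (rule that)
qed

section \<open>Riesz representation for a semi-inner product\<close>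

lemma quadratic_nonneg_imp_discriminant:
  fixes a b c :: real
  assumes "\<And>t. 0 \<le> a + 2 * b * t + c * t\<^sup>2"
  shows "b\<^sup>2 \<le> a * c"
proof (cases "c = 0")
  case True
  have "b = 0"
  proof (rule ccontr)
    assume "b \<noteq> 0"
    then show False using assms[of "- (a + 1) / (2 * b)"] True by simp
  qed
  then show ?thesis using True by simp
next
  case False
  have "c > 0"
  proof (rule ccontr)
    assume "\<not> c > 0"
    then have c: "c < 0" using False by simp
    \<comment> \<open>large enough for the negative quadratic term to outweigh the other two\<close>
    define t where "t = (\<bar>a\<bar> + 2 * \<bar>b\<bar>) / (- c) + 1"
    have "0 \<le> (\<bar>a\<bar> + 2 * \<bar>b\<bar>) / (- c)" using c by (intro divide_nonneg_pos) auto
    then have t: "t \<ge> 1" by (simp add: t_def)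
    have "c * t = - (\<bar>a\<bar> + 2 * \<bar>b\<bar>) + c" using c by (simp add: t_def field_simps)
    then have "c * t * t = (- (\<bar>a\<bar> + 2 * \<bar>b\<bar>) + c) * t" by (rule arg_cong)
    then have "c * t\<^sup>2 = - (\<bar>a\<bar> * t) - 2 * \<bar>b\<bar> * t + c * t" by (simp add: power2_eq_square algebra_simps)
    moreover have "\<bar>a\<bar> * t \<ge> a" using t mult_left_mono[OF t, of "\<bar>a\<bar>"] by simp
    moreover have "2 * \<bar>b\<bar> * t \<ge> 2 * b * t" using t by (simp add: mult_right_mono)
    moreover have "c * t < 0" using c t by (simp add: mult_neg_pos)
    ultimately have "a + 2 * b * t + c * t\<^sup>2 < 0" by linarith
    then show False using assms[of t] by simp
  qed
  have "0 \<le> a + 2 * b * (- b / c) + c * (- b / c)\<^sup>2" by (rule assms)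
  also have "\<dots> = a - b\<^sup>2 / c" using \<open>c > 0\<close> by (simp add: power2_eq_square field_simps)
  finally show ?thesis using \<open>c > 0\<close> by (simp add: field_simps)
qed

text \<open>
  The spaces below consist of functions that are only relevant up to null sets, so the form is merely
  semidefinite and the linear structure enters through two operations that are compatible with it.
\<close>

locale semi_inner_space =
  fixes K :: "'b set" and add :: "'b \<Rightarrow> 'b \<Rightarrow> 'b" and scl :: "real \<Rightarrow> 'b \<Rightarrow> 'b"
    and B :: "'b \<Rightarrow> 'b \<Rightarrow> real"
  assumes nonempty: "K \<noteq> {}"
    and add_closed: "u \<in> K \<Longrightarrow> v \<in> K \<Longrightarrow> add u v \<in> K"
    and scl_closed: "u \<in> K \<Longrightarrow> scl c u \<in> K"
    and B_add: "u \<in> K \<Longrightarrow> v \<in> K \<Longrightarrow> k \<in> K \<Longrightarrow> B (add u v) k = B u k + B v k"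
    and B_scl: "u \<in> K \<Longrightarrow> k \<in> K \<Longrightarrow> B (scl c u) k = c * B u k"
    and B_sym: "u \<in> K \<Longrightarrow> v \<in> K \<Longrightarrow> B u v = B v u"
    and B_nonneg: "u \<in> K \<Longrightarrow> 0 \<le> B u u"
begin

definition dst :: "'b \<Rightarrow> 'b \<Rightarrow> real" where "dst u v = B (add u (scl (-1) v)) (add u (scl (-1) v))"

lemma B_add': "u \<in> K \<Longrightarrow> v \<in> K \<Longrightarrow> k \<in> K \<Longrightarrow> B k (add u v) = B k u + B k v"
  by (metis B_add B_sym add_closed)

lemma B_scl': "u \<in> K \<Longrightarrow> k \<in> K \<Longrightarrow> B k (scl c u) = c * B k u"
  by (metis B_scl B_sym scl_closed)

lemmas B_simps = B_add B_add' B_scl B_scl' add_closed scl_closed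

lemma B_expand: "u \<in> K \<Longrightarrow> v \<in> K \<Longrightarrow> B (add u (scl t v)) (add u (scl t v)) = B u u + 2 * B u v * t + B v v * t\<^sup>2"
  by (simp add: B_simps B_sym[of v u] power2_eq_square algebra_simps)

lemma Cauchy_Schwarz: "u \<in> K \<Longrightarrow> v \<in> K \<Longrightarrow> (B u v)\<^sup>2 \<le> B u u * B v v"
  by (rule quadratic_nonneg_imp_discriminant) (metis B_expand B_nonneg add_closed scl_closed)

lemma dst_eq: "u \<in> K \<Longrightarrow> v \<in> K \<Longrightarrow> dst u v = B u u - 2 * B u v + B v v"
  by (simp add: dst_def B_expand)

text \<open>Nearly minimal points of \<open>B u u - 2 * F u\<close> are close by the parallelogram law.\<close>

lemma riesz:
  assumes complete: "\<And>u. (\<And>n. u n \<in> K) \<Longrightarrow> (\<And>e. e > 0 \<Longrightarrow> \<exists>N. \<forall>m\<ge>N. \<forall>n\<ge>N. dst (u m) (u n) < e)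
      \<Longrightarrow> \<exists>v\<in>K. (\<lambda>n. dst (u n) v) \<longlonglongrightarrow> (0::real)"
    and F_add: "\<And>u v. u \<in> K \<Longrightarrow> v \<in> K \<Longrightarrow> F (add u v) = F u + F v"
    and F_scl: "\<And>u c. u \<in> K \<Longrightarrow> F (scl c u) = c * F u"
    and F_bound: "\<And>u. u \<in> K \<Longrightarrow> \<bar>F u\<bar> \<le> C * sqrt (B u u)"
  shows "\<exists>u\<in>K. \<forall>k\<in>K. B u k = F k"
proof -
  define J where "J u = B u u - 2 * F u" for u
  have lower: "- C\<^sup>2 \<le> J u" if "u \<in> K" for u
  proof -
    have "0 \<le> (sqrt (B u u) - C)\<^sup>2" by simp
    then have "2 * (C * sqrt (B u u)) \<le> B u u + C\<^sup>2"
      using B_nonneg[OF that] by (simp add: power2_diff algebra_simps)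
    then show ?thesis using F_bound[OF that] by (simp add: J_def)
  qed
  define m where "m = (INF u\<in>K. J u)"
  have bdd: "bdd_below (J ` K)" using lower by (auto intro!: bdd_belowI2)
  have m: "m \<le> J u" if "u \<in> K" for u unfolding m_def using bdd that by (rule cINF_lower)
  have "\<exists>u\<in>K. J u < m + 1 / real (Suc n)" for n
    using cINF_less_iff[OF nonempty bdd, of "m + 1 / real (Suc n)"] by (simp add: m_def)
  then obtain u where u: "\<And>n. u n \<in> K" "\<And>n. J (u n) < m + 1 / real (Suc n)" by metis
  have d: "dst (u i) (u j) \<le> 2 / real (Suc i) + 2 / real (Suc j)" for i j
  proof -
    have "m \<le> J (scl (1/2) (add (u i) (u j)))" using u by (intro m scl_closed add_closed)
    moreover have "4 * J (scl (1/2) (add (u i) (u j)))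
        = B (u i) (u i) + 2 * B (u i) (u j) + B (u j) (u j) - 4 * F (u i) - 4 * F (u j)"
      using u by (simp add: J_def B_simps F_add F_scl B_sym[of "u j" "u i"] algebra_simps)
    ultimately have "dst (u i) (u j) \<le> 2 * J (u i) + 2 * J (u j) - 4 * m"
      using dst_eq[OF u(1) u(1), of i j] unfolding J_def by argo
    also have "\<dots> \<le> 2 * (m + 1 / real (Suc i)) + 2 * (m + 1 / real (Suc j)) - 4 * m"
      using u(2)[of i] u(2)[of j] by argo
    finally show ?thesis by simp
  qed
  have "\<exists>N. \<forall>i\<ge>N. \<forall>j\<ge>N. dst (u i) (u j) < e" if "e > 0" for e
  proof -
    have "0 < e / 4" using that by simp
    then obtain N where N: "inverse (real (Suc N)) < e / 4" by (rule reals_Archimedean[THEN exE])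
    have "dst (u i) (u j) < e" if ij: "i \<ge> N" "j \<ge> N" for i j
    proof -
      have "2 / real (Suc i) \<le> 2 * inverse (real (Suc N))" "2 / real (Suc j) \<le> 2 * inverse (real (Suc N))"
        using ij by (auto simp: divide_inverse intro!: le_imp_inverse_le)
      then show ?thesis using d[of i j] N by linarith
    qed
    then show ?thesis by blast
  qed
  from complete[OF u(1) this] obtain v where v: "v \<in> K" "(\<lambda>n. dst (u n) v) \<longlonglongrightarrow> 0" by auto
  have "B v k = F k" if k: "k \<in> K" for k
  proof -
    have "(\<lambda>n. B (u n) k - B v k) \<longlonglongrightarrow> 0"
    proof (rule Lim_null_comparison)
      show "(\<lambda>n. sqrt (dst (u n) v * B k k)) \<longlonglongrightarrow> 0"
        using tendsto_real_sqrt[OF tendsto_mult_right[OF v(2), of "B k k"]] by simp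
      show "\<forall>\<^sub>F n in sequentially. norm (B (u n) k - B v k) \<le> sqrt (dst (u n) v * B k k)"
      proof (intro always_eventually allI)
        fix n
        let ?d = "add (u n) (scl (-1) v)"
        have dK: "?d \<in> K" using u v by (intro add_closed scl_closed)
        have "B (u n) k - B v k = B ?d k" using u v k by (simp add: B_simps)
        moreover have "\<bar>B ?d k\<bar> \<le> sqrt (B ?d ?d * B k k)"
          using Cauchy_Schwarz[OF dK k] by (intro real_le_rsqrt) simp
        ultimately show "norm (B (u n) k - B v k) \<le> sqrt (dst (u n) v * B k k)" by (simp add: dst_def)
      qed
    qed
    then have lim: "(\<lambda>n. B (u n) k) \<longlonglongrightarrow> B v k" by (simp add: LIM_zero_iff)
    have "0 \<le> 0 + 2 * (B v k - F k) * t + B k k * t\<^sup>2" for t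
    proof (rule LIMSEQ_le_const)
      show "(\<lambda>n. 1 / real (Suc n) + 2 * (B (u n) k - F k) * t + B k k * t\<^sup>2) \<longlonglongrightarrow> 0 + 2 * (B v k - F k) * t + B k k * t\<^sup>2"
        using lim LIMSEQ_inverse_real_of_nat by (intro tendsto_intros) (auto simp: inverse_eq_divide)
      have "0 \<le> 1 / real (Suc n) + 2 * (B (u n) k - F k) * t + B k k * t\<^sup>2" for n
      proof -
        have "m \<le> J (add (u n) (scl t k))" using u k by (intro m scl_closed add_closed)
        also have "\<dots> = J (u n) + 2 * (B (u n) k - F k) * t + B k k * t\<^sup>2"
          using u k by (simp add: J_def B_expand F_add F_scl scl_closed algebra_simps)
        finally show ?thesis using u(2)[of n] by linarith
      qed
      then show "\<exists>N. \<forall>n\<ge>N. 0 \<le> 1 / real (Suc n) + 2 * (B (u n) k - F k) * t + B k k * t\<^sup>2" by blast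
    qed
    from quadratic_nonneg_imp_discriminant[OF this] show ?thesis by simp
  qed
  then show ?thesis using v by blast
qed

end

section \<open>Weighted Sobolev spaces\<close>

text \<open>
  An open set is a countable union of closed boxes, on each of which the function is integrable.
\<close>

lemma locally_integrable_measurable:
  fixes f :: "'a::euclidean_space \<Rightarrow> 'b::euclidean_space"
  assumes U: "open U" and f: "locally_integrable U f"
  shows "f \<in> borel_measurable (lebesgue_on U)"
proof -
  obtain \<D> where D: "countable \<D>" "\<D> \<subseteq> Pow U"
    "\<And>X. X \<in> \<D> \<Longrightarrow> \<exists>a b. X = cbox a b" "\<Union>\<D> = U"
    by (rule open_countable_Union_open_cbox[OF U]) blast
  show ?thesis
  proof (rule measurable_piecewise_restrict[OF D(1)])
    show "space (lebesgue_on U) \<subseteq> \<Union>\<D>" using D(4) by simp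
    fix X assume X: "X \<in> \<D>"
    then obtain a b where ab: "X = cbox a b" "cbox a b \<subseteq> U" using D by blast
    show "X \<inter> space (lebesgue_on U) \<in> sets (lebesgue_on U)"
      using ab U by (auto simp: sets_restrict_space borel_open)
    have "(\<lambda>x. indicator X x *\<^sub>R f x) \<in> borel_measurable lebesgue"
      using f ab borel_measurable_integrable unfolding locally_integrable_def set_integrable_def
      by (metis compact_cbox)
    then have "f \<in> borel_measurable (lebesgue_on X)"
      using ab by (subst borel_measurable_restrict_space_iff) auto
    moreover have "restrict_space (lebesgue_on U) X = lebesgue_on X"
      using ab U by (subst restrict_restrict_space) (auto simp: borel_open Int_absorb1)
    ultimately show "f \<in> borel_measurable (restrict_space (lebesgue_on U) X)" by simp
  qed
qed

lemma is_weak_gradient_add: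
  assumes "is_weak_gradient U u g" "is_weak_gradient U v h" and U: "open U"
  shows "is_weak_gradient U (\<lambda>x. u x + v x) (\<lambda>x. g x + h x)"
proof -
  have l: "locally_integrable U u" "locally_integrable U v" "locally_integrable U g" "locally_integrable U h"
    using assms by (auto simp: is_weak_gradient_def)
  have "(LINT x|lebesgue_on U. (u x + v x) * frechet_derivative \<phi> (at x) b)
          = - (LINT x|lebesgue_on U. ((g x + h x) \<bullet> b) * \<phi> x)" if \<phi>: "\<phi> \<in> test_functions U" and b: "b \<in> Basis" for \<phi> b
  proof -
    have s: "smooth_on UNIV \<phi>" using \<phi> by (simp add: test_functions_def)
    obtain K where K: "compact K" "K \<subseteq> U" "\<And>x. x \<notin> K \<Longrightarrow> \<phi> x = 0"
      "\<And>x b. x \<notin> K \<Longrightarrow> frechet_derivative \<phi> (at x) b = 0"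
      by (rule test_functionE[OF \<phi>]) blast
    have "integrable (lebesgue_on U) (\<lambda>x. u x * frechet_derivative \<phi> (at x) b)"
      "integrable (lebesgue_on U) (\<lambda>x. v x * frechet_derivative \<phi> (at x) b)"
      using l K by (auto intro!: locally_integrable_test_function[OF _ _ K(1,2) _ U] smooth_on_continuous_partial[OF s b])
    moreover have "integrable (lebesgue_on U) (\<lambda>x. (g x \<bullet> b) * \<phi> x)" "integrable (lebesgue_on U) (\<lambda>x. (h x \<bullet> b) * \<phi> x)"
      using l K by (auto intro!: locally_integrable_test_function[OF _ _ K(1,2) _ U] smooth_on_continuous[OF s] locally_integrable_inner)
    ultimately show ?thesis
      using assms \<phi> b by (simp add: distrib_right inner_add_left is_weak_gradient_def)
  qed
  then show ?thesis
    using l by (auto simp: is_weak_gradient_def locally_integrable_def intro: set_integral_add)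
qed

lemma is_weak_gradient_cmult:
  assumes "is_weak_gradient U u g"
  shows "is_weak_gradient U (\<lambda>x. c * u x) (\<lambda>x. c *\<^sub>R g x)"
  using assms unfolding is_weak_gradient_def locally_integrable_def
  by (auto simp: mult.assoc)

lemma is_weak_gradient_cong:
  assumes "is_weak_gradient U u g" "\<And>x. x \<in> U \<Longrightarrow> u x = v x"
  shows "is_weak_gradient U v g"
proof -
  have "u absolutely_integrable_on K \<longleftrightarrow> v absolutely_integrable_on K" if "K \<subseteq> U" for K
    using that assms(2) by (intro set_integrable_cong) auto
  then have "locally_integrable U u \<longleftrightarrow> locally_integrable U v"
    unfolding locally_integrable_def by blast
  moreover have "(LINT x|lebesgue_on U. u x * k x) = (LINT x|lebesgue_on U. v x * k x)" for k
    using assms(2) by (intro Bochner_Integration.integral_cong) auto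
  ultimately show ?thesis
    using assms(1) unfolding is_weak_gradient_def by simp
qed

text \<open>
  The assumptions under which the weighted Sobolev space is a complete space of distributions.
\<close>

locale weighted_domain =
  fixes U :: "'a::euclidean_space set" and w :: "'a \<Rightarrow> real"
  assumes U: "open U" and w: "is_weight U w"
    and w_inv: "locally_integrable U (\<lambda>x. inverse (w x))"
begin

abbreviation M where "M \<equiv> lebesgue_on U"

lemma w_measurable[measurable]: "w \<in> borel_measurable M" and w_pos: "AE x in M. 0 < w x"
  using w by (auto simp: is_weight_def)

text \<open>
  The square of the weighted norm as an extended number, so that it makes sense for all measurable
  functions.
\<close>

definition sq :: "('a \<Rightarrow> 'b::euclidean_space) \<Rightarrow> ennreal" where
  "sq f = (\<integral>\<^sup>+x. ennreal (w x * (norm (f x))\<^sup>2) \<partial>M)"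

definition ip :: "('a \<Rightarrow> 'b::euclidean_space) \<Rightarrow> ('a \<Rightarrow> 'b) \<Rightarrow> real" where
  "ip f g = (LINT x|M. w x * (f x \<bullet> g x))"

definition L2v :: "('a \<Rightarrow> 'b::euclidean_space) set" where
  "L2v = {f \<in> borel_measurable M. sq f < \<infinity>}"

lemma L2v_measurable: "f \<in> L2v \<Longrightarrow> f \<in> borel_measurable M" by (simp add: L2v_def)

text \<open>In this form completeness reduces to the unweighted case.\<close>

lemma sq_density: 
  assumes [measurable]: "f \<in> borel_measurable M"
  shows "sq f = (\<integral>\<^sup>+x. ennreal ((norm (f x))\<^sup>2) \<partial>density M (\<lambda>x. ennreal (w x)))"
  unfolding sq_def
  by (subst nn_integral_density) (auto intro!: nn_integral_cong_AE simp: ennreal_mult'')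

lemma sq_cong: "AE x in M. f x = g x \<Longrightarrow> sq f = sq g"
  unfolding sq_def by (intro nn_integral_cong_AE) auto

lemma ip_cong:
  assumes "AE x in M. f x = f' x" "AE x in M. g x = g' x"
    and [measurable]: "f \<in> borel_measurable M" "g \<in> borel_measurable M" "f' \<in> borel_measurable M" "g' \<in> borel_measurable M"
  shows "ip f g = ip f' g'"
  unfolding ip_def using assms(1,2) by (intro integral_cong_AE) auto

lemma sq_add_le:
  assumes [measurable]: "f \<in> borel_measurable M" "g \<in> borel_measurable M"
  shows "sq (\<lambda>x. f x + g x) \<le> 2 * sq f + 2 * sq g"
proof -
  have "sq (\<lambda>x. f x + g x) \<le> (\<integral>\<^sup>+x. 2 * ennreal (w x * (norm (f x))\<^sup>2) + 2 * ennreal (w x * (norm (g x))\<^sup>2) \<partial>M)"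
    unfolding sq_def
  proof (rule nn_integral_mono_AE)
    show "AE x in M. ennreal (w x * (norm (f x + g x))\<^sup>2) \<le> 2 * ennreal (w x * (norm (f x))\<^sup>2) + 2 * ennreal (w x * (norm (g x))\<^sup>2)"
      using w_pos
    proof eventually_elim
      fix x assume w: "0 < w x"
      have "(norm (f x + g x))\<^sup>2 \<le> (norm (f x) + norm (g x))\<^sup>2" by (intro power_mono norm_triangle_ineq) simp
      also have "\<dots> \<le> 2 * (norm (f x))\<^sup>2 + 2 * (norm (g x))\<^sup>2"
        using sum_squares_bound[of "norm (f x)" "norm (g x)"] by (simp add: power2_sum)
      finally have "w x * (norm (f x + g x))\<^sup>2 \<le> w x * (2 * (norm (f x))\<^sup>2 + 2 * (norm (g x))\<^sup>2)"
        using w by (intro mult_left_mono) auto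
      then have "ennreal (w x * (norm (f x + g x))\<^sup>2) \<le> ennreal (2 * (w x * (norm (f x))\<^sup>2) + 2 * (w x * (norm (g x))\<^sup>2))"
        by (intro ennreal_leI) (simp add: algebra_simps)
      also have "\<dots> = 2 * ennreal (w x * (norm (f x))\<^sup>2) + 2 * ennreal (w x * (norm (g x))\<^sup>2)"
        using w by (simp add: ennreal_plus ennreal_mult)
      finally show "ennreal (w x * (norm (f x + g x))\<^sup>2) \<le> 2 * ennreal (w x * (norm (f x))\<^sup>2) + 2 * ennreal (w x * (norm (g x))\<^sup>2)" .
    qed
  qed
  also have "\<dots> = 2 * sq f + 2 * sq g"
    unfolding sq_def by (subst nn_integral_add) (auto simp: nn_integral_cmult)
  finally show ?thesis .
qed

lemma sq_scale:
  assumes [measurable]: "f \<in> borel_measurable M"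
  shows "sq (\<lambda>x. c *\<^sub>R f x) = ennreal (c\<^sup>2) * sq f"
  unfolding sq_def
  by (subst nn_integral_cmult[symmetric])
    (auto intro!: nn_integral_cong simp: ennreal_mult'[symmetric] power_mult_distrib ac_simps)

lemma L2v_add: "f \<in> L2v \<Longrightarrow> g \<in> L2v \<Longrightarrow> (\<lambda>x. f x + g x) \<in> L2v"
proof -
  assume a: "f \<in> L2v" "g \<in> L2v"
  have "sq (\<lambda>x. f x + g x) \<le> 2 * sq f + 2 * sq g" using a by (intro sq_add_le) (auto simp: L2v_def)
  also have "\<dots> < \<infinity>" using a by (auto simp: L2v_def ennreal_mult_less_top)
  finally show ?thesis using a by (auto simp: L2v_def)
qed

lemma L2v_scale: "f \<in> L2v \<Longrightarrow> (\<lambda>x. c *\<^sub>R f x) \<in> L2v"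
  by (auto simp: L2v_def sq_scale ennreal_mult_less_top)

lemma L2v_diff: "f \<in> L2v \<Longrightarrow> g \<in> L2v \<Longrightarrow> (\<lambda>x. f x - g x) \<in> L2v"
  using L2v_add[of f "\<lambda>x. (-1) *\<^sub>R g x"] L2v_scale[of g "-1"] by simp

lemma L2v_integrable_sq: "f \<in> L2v \<Longrightarrow> integrable M (\<lambda>x. w x * (norm (f x))\<^sup>2)"
proof -
  assume f: "f \<in> L2v"
  then have [measurable]: "f \<in> borel_measurable M" by (rule L2v_measurable)
  show ?thesis
    using w_pos f by (intro integrableI_nonneg) (auto simp: L2v_def sq_def)
qed

lemma L2v_integrable: 
  assumes "f \<in> L2v" "g \<in> L2v"
  shows "integrable M (\<lambda>x. w x * (f x \<bullet> g x))"
proof (rule Bochner_Integration.integrable_bound)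
  have [measurable]: "f \<in> borel_measurable M" "g \<in> borel_measurable M" using assms by (auto simp: L2v_def)
  show "integrable M (\<lambda>x. w x * (norm (f x))\<^sup>2 + w x * (norm (g x))\<^sup>2)"
    using assms by (intro Bochner_Integration.integrable_add L2v_integrable_sq)
  show "(\<lambda>x. w x * (f x \<bullet> g x)) \<in> borel_measurable M" by measurable
  show "AE x in M. norm (w x * (f x \<bullet> g x)) \<le> norm (w x * (norm (f x))\<^sup>2 + w x * (norm (g x))\<^sup>2)"
    using w_pos
  proof eventually_elim
    fix x assume w: "0 < w x"
    have "\<bar>f x \<bullet> g x\<bar> \<le> norm (f x) * norm (g x)" by (rule Cauchy_Schwarz_ineq2)
    also have "\<dots> \<le> (norm (f x))\<^sup>2 + (norm (g x))\<^sup>2"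
      using sum_squares_bound[of "norm (f x)" "norm (g x)"] mult_nonneg_nonneg[OF norm_ge_zero[of "f x"] norm_ge_zero[of "g x"]] by linarith
    finally have "w x * \<bar>f x \<bullet> g x\<bar> \<le> w x * ((norm (f x))\<^sup>2 + (norm (g x))\<^sup>2)"
      using w by (intro mult_left_mono) auto
    then show "norm (w x * (f x \<bullet> g x)) \<le> norm (w x * (norm (f x))\<^sup>2 + w x * (norm (g x))\<^sup>2)"
      using w by (simp add: abs_mult algebra_simps)
  qed
qed

lemma sq_eq_ip: "f \<in> L2v \<Longrightarrow> sq f = ennreal (ip f f)"
  unfolding sq_def ip_def dot_square_norm
  using w_pos by (intro nn_integral_eq_integral L2v_integrable_sq) auto

lemma ip_nonneg: "0 \<le> ip f f"
  unfolding ip_def using w_pos by (intro integral_nonneg_AE) auto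

lemma ip_sym: "ip f g = ip g f"
  by (simp add: ip_def inner_commute)

lemma L2v_zero: "(\<lambda>x. 0) \<in> L2v" by (simp add: L2v_def sq_def)

lemma semi_inner_space_L2v: "semi_inner_space L2v (\<lambda>f g x. f x + g x) (\<lambda>c f x. c *\<^sub>R f x) ip"
proof
  show "L2v \<noteq> {}" using L2v_zero by blast
  fix u v k :: "'a \<Rightarrow> 'b" and c :: real
  assume u: "u \<in> L2v"
  show "(\<lambda>x. c *\<^sub>R u x) \<in> L2v" using u by (rule L2v_scale)
  show "0 \<le> ip u u" by (rule ip_nonneg)
  { assume v: "v \<in> L2v"
    show "(\<lambda>x. u x + v x) \<in> L2v" using u v by (rule L2v_add)
    show "ip u v = ip v u" by (rule ip_sym)
    assume k: "k \<in> L2v"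
    show "ip (\<lambda>x. u x + v x) k = ip u k + ip v k"
      unfolding ip_def inner_add_left distrib_left
      by (rule Bochner_Integration.integral_add[OF L2v_integrable[OF u k] L2v_integrable[OF v k]]) }
  have "(\<lambda>x. w x * (c *\<^sub>R u x \<bullet> k x)) = (\<lambda>x. c * (w x * (u x \<bullet> k x)))" by (simp add: mult.left_commute)
  then show "ip (\<lambda>x. c *\<^sub>R u x) k = c * ip u k" unfolding ip_def by (simp only: integral_mult_right_zero)
qed

lemmas ip_Cauchy_Schwarz = semi_inner_space.Cauchy_Schwarz[OF semi_inner_space_L2v]

lemma ip_add_left: "f \<in> L2v \<Longrightarrow> g \<in> L2v \<Longrightarrow> k \<in> L2v \<Longrightarrow> ip (\<lambda>x. f x + g x) k = ip f k + ip g k"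
  by (rule semi_inner_space.B_add[OF semi_inner_space_L2v])

lemma ip_scale_left: "f \<in> L2v \<Longrightarrow> k \<in> L2v \<Longrightarrow> ip (\<lambda>x. c *\<^sub>R f x) k = c * ip f k"
  by (rule semi_inner_space.B_scl[OF semi_inner_space_L2v])

lemma ip_diff_left: "f \<in> L2v \<Longrightarrow> g \<in> L2v \<Longrightarrow> k \<in> L2v \<Longrightarrow> ip (\<lambda>x. f x - g x) k = ip f k - ip g k"
  using ip_add_left[of f "\<lambda>x. (-1) *\<^sub>R g x" k] ip_scale_left[of g k "-1"] L2v_scale[of g "-1"] by simp

lemma ip_add_square_le:
  assumes "f \<in> L2v" "g \<in> L2v"
  shows "ip (\<lambda>x. f x + g x) (\<lambda>x. f x + g x) \<le> 2 * ip f f + 2 * ip g g"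
proof -
  have "ennreal (ip (\<lambda>x. f x + g x) (\<lambda>x. f x + g x)) \<le> 2 * ennreal (ip f f) + 2 * ennreal (ip g g)"
    using sq_add_le[of f g] assms by (simp add: sq_eq_ip L2v_add L2v_measurable)
  also have "\<dots> = ennreal (2 * ip f f + 2 * ip g g)"
    by (simp add: ennreal_plus ennreal_mult ip_nonneg)
  finally show ?thesis by (subst (asm) ennreal_le_iff) (simp_all add: ip_nonneg)
qed

lemma ip_tendsto:
  assumes f: "\<And>n. f n \<in> L2v" "g \<in> L2v" "k \<in> L2v"
    and lim: "(\<lambda>n. ip (\<lambda>x. f n x - g x) (\<lambda>x. f n x - g x)) \<longlonglongrightarrow> 0"
  shows "(\<lambda>n. ip (f n) k) \<longlonglongrightarrow> ip g k"
proof -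
  have "(\<lambda>n. ip (f n) k - ip g k) \<longlonglongrightarrow> 0"
  proof (rule Lim_null_comparison)
    show "(\<lambda>n. sqrt (ip (\<lambda>x. f n x - g x) (\<lambda>x. f n x - g x) * ip k k)) \<longlonglongrightarrow> 0"
      using tendsto_real_sqrt[OF tendsto_mult_right[OF lim, of "ip k k"]] by simp
    show "\<forall>\<^sub>F n in sequentially. norm (ip (f n) k - ip g k) \<le> sqrt (ip (\<lambda>x. f n x - g x) (\<lambda>x. f n x - g x) * ip k k)"
    proof (intro always_eventually allI)
      fix n
      have "ip (f n) k - ip g k = ip (\<lambda>x. f n x - g x) k" using f by (simp add: ip_diff_left)
      moreover have "(ip (\<lambda>x. f n x - g x) k)\<^sup>2 \<le> ip (\<lambda>x. f n x - g x) (\<lambda>x. f n x - g x) * ip k k"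
        using f by (intro ip_Cauchy_Schwarz L2v_diff)
      ultimately show "norm (ip (f n) k - ip g k) \<le> sqrt (ip (\<lambda>x. f n x - g x) (\<lambda>x. f n x - g x) * ip k k)"
        by (intro real_le_rsqrt) simp
    qed
  qed
  then show ?thesis by (simp add: LIM_zero_iff)
qed

lemma L2v_complete:
  fixes f :: "nat \<Rightarrow> 'a \<Rightarrow> 'b::euclidean_space"
  assumes f: "\<And>n. f n \<in> L2v"
    and Cauchy: "\<And>e. e > 0 \<Longrightarrow> \<exists>N. \<forall>m\<ge>N. \<forall>n\<ge>N. ip (\<lambda>x. f m x - f n x) (\<lambda>x. f m x - f n x) < e"
  shows "\<exists>g\<in>L2v. (\<lambda>n. ip (\<lambda>x. f n x - g x) (\<lambda>x. f n x - g x)) \<longlonglongrightarrow> 0"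
proof -
  have [measurable]: "f n \<in> borel_measurable M" for n using f by (rule L2v_measurable)
  let ?D = "density M (\<lambda>x. ennreal (w x))"
  have dens: "(\<integral>\<^sup>+x. ennreal ((norm (h x - k x))\<^sup>2) \<partial>?D) = sq (\<lambda>x. h x - k x)"
    if [measurable]: "h \<in> borel_measurable M" "k \<in> borel_measurable M" for h k :: "'a \<Rightarrow> 'b"
    by (subst sq_density) auto
  have C: "\<exists>N. \<forall>m\<ge>N. \<forall>n\<ge>N. (\<integral>\<^sup>+x. ennreal ((norm (f m x - f n x))\<^sup>2) \<partial>?D) \<le> ennreal e" if "e > 0" for e
  proof -
    obtain N where N: "\<And>m n. m \<ge> N \<Longrightarrow> n \<ge> N \<Longrightarrow> ip (\<lambda>x. f m x - f n x) (\<lambda>x. f m x - f n x) < e"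
      using Cauchy[OF \<open>e > 0\<close>] by metis
    have "(\<integral>\<^sup>+x. ennreal ((norm (f m x - f n x))\<^sup>2) \<partial>?D) \<le> ennreal e" if "m \<ge> N" "n \<ge> N" for m n
      using N[OF that] f by (simp add: dens sq_eq_ip L2v_diff ennreal_leI less_imp_le)
    then show ?thesis by blast
  qed
  have m: "f n \<in> borel_measurable ?D" for n by simp
  obtain g r where g: "g \<in> borel_measurable ?D" "strict_mono (r :: nat \<Rightarrow> nat)"
    "AE x in ?D. (\<lambda>k. f (r k) x) \<longlonglongrightarrow> g x"
    "\<And>e. e > 0 \<Longrightarrow> \<exists>N. \<forall>n\<ge>N. (\<integral>\<^sup>+x. ennreal ((norm (f n x - g x))\<^sup>2) \<partial>?D) \<le> ennreal e"
    by (rule L2_Cauchy_limit[OF m C]) blast+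
  from g(1) have [measurable]: "g \<in> borel_measurable M" by simp
  have g4: "\<exists>N. \<forall>n\<ge>N. sq (\<lambda>x. f n x - g x) \<le> ennreal e" if "e > 0" for e
    using g(4)[OF that] by (simp add: dens)
  have gL: "g \<in> L2v"
  proof -
    obtain N where "sq (\<lambda>x. f N x - g x) \<le> ennreal 1" using g4[of 1] by auto
    then have "(\<lambda>x. f N x - g x) \<in> L2v" by (auto simp: L2v_def intro: le_less_trans)
    from L2v_diff[OF f[of N] this] show ?thesis by simp
  qed
  have "(\<lambda>n. ip (\<lambda>x. f n x - g x) (\<lambda>x. f n x - g x)) \<longlonglongrightarrow> 0"
  proof (rule LIMSEQ_I)
    fix e :: real assume "e > 0"
    then obtain N where N: "\<And>n. n \<ge> N \<Longrightarrow> sq (\<lambda>x. f n x - g x) \<le> ennreal (e/2)" using g4[of "e/2"] by auto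
    have "norm (ip (\<lambda>x. f n x - g x) (\<lambda>x. f n x - g x) - 0) < e" if "n \<ge> N" for n
    proof -
      have "ennreal (ip (\<lambda>x. f n x - g x) (\<lambda>x. f n x - g x)) \<le> ennreal (e/2)"
        using N[OF that] f gL by (simp add: sq_eq_ip L2v_diff)
      then have "ip (\<lambda>x. f n x - g x) (\<lambda>x. f n x - g x) \<le> e / 2" using \<open>e > 0\<close> by simp
      then show ?thesis using \<open>e > 0\<close> ip_nonneg[of "\<lambda>x. f n x - g x"] by simp
    qed
    then show "\<exists>N. \<forall>n\<ge>N. norm (ip (\<lambda>x. f n x - g x) (\<lambda>x. f n x - g x) - 0) < e" by blast
  qed
  with gL show ?thesis by blast
qed

text \<open>
  Integration against a bounded function \<open>\<psi>\<close> with compact support is the inner product with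
  \<open>\<psi> / w\<close>, which is square integrable because \<open>1 / w\<close> is locally integrable. Local integrability and
  the passage to the limit in weak gradients both come from this observation.
\<close>

lemma over_weight_L2v:
  fixes \<psi> :: "'a \<Rightarrow> real"
  assumes K: "compact K" "K \<subseteq> U" and \<psi>: "\<psi> \<in> borel_measurable M"
    and B: "\<And>x. \<bar>\<psi> x\<bar> \<le> B * indicator K x"
  shows "(\<lambda>x. inverse (w x) * \<psi> x) \<in> L2v"
proof -
  note [measurable] = \<psi>
  have "set_integrable lebesgue K (\<lambda>x. inverse (w x))"
    using w_inv K by (auto simp: locally_integrable_def)
  moreover have "indicator K x *\<^sub>R inverse (w x) = indicator U x *\<^sub>R (indicator K x * inverse (w x))" for x
    using K by (auto simp: indicator_def)
  ultimately have "set_integrable lebesgue U (\<lambda>x. indicator K x * inverse (w x))"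
    by (simp only: set_integrable_def)
  then have i: "integrable M (\<lambda>x. indicator K x * inverse (w x))"
    using U by (simp add: integrable_restrict_space set_integrable_def borel_open)
  have "sq (\<lambda>x. inverse (w x) * \<psi> x) \<le> (\<integral>\<^sup>+x. ennreal (norm (B\<^sup>2 * (indicator K x * inverse (w x)))) \<partial>M)"
    unfolding sq_def
  proof (rule nn_integral_mono_AE)
    show "AE x in M. ennreal (w x * (norm (inverse (w x) * \<psi> x))\<^sup>2) \<le> ennreal (norm (B\<^sup>2 * (indicator K x * inverse (w x))))"
      using w_pos
    proof eventually_elim
      fix x assume w: "0 < w x"
      have "(\<psi> x)\<^sup>2 \<le> (B * indicator K x)\<^sup>2" using B[of x] by (metis abs_ge_zero power2_abs power_mono)
      also have "\<dots> = B\<^sup>2 * indicator K x" by (simp add: indicator_def)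
      finally have "inverse (w x) * (\<psi> x)\<^sup>2 \<le> inverse (w x) * (B\<^sup>2 * indicator K x)"
        using w by (intro mult_left_mono) auto
      moreover have "w x * (norm (inverse (w x) * \<psi> x))\<^sup>2 = inverse (w x) * (\<psi> x)\<^sup>2"
        using w by (simp add: power2_eq_square field_simps abs_mult)
      moreover have "norm (B\<^sup>2 * (indicator K x * inverse (w x))) = inverse (w x) * (B\<^sup>2 * indicator K x)"
        using w by (simp add: abs_mult)
      ultimately show "ennreal (w x * (norm (inverse (w x) * \<psi> x))\<^sup>2) \<le> ennreal (norm (B\<^sup>2 * (indicator K x * inverse (w x))))"
        by (intro ennreal_leI) simp
    qed
  qed
  also have "\<dots> < \<infinity>"
    using integrable_mult_right[OF i, of "B\<^sup>2"] by (simp only: integrable_iff_bounded) 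
  finally show ?thesis by (simp add: L2v_def)
qed

lemma L2v_locally_integrable:
  fixes f :: "'a \<Rightarrow> 'b::euclidean_space"
  assumes f: "f \<in> L2v"
  shows "locally_integrable U f"
  unfolding locally_integrable_def
proof (intro allI impI)
  fix K assume K: "compact K \<and> K \<subseteq> U"
  have fm[measurable]: "f \<in> borel_measurable M" using f by (rule L2v_measurable)
  have Ks: "K \<in> sets lebesgue" using K by (simp add: compact_imp_closed borel_closed)
  have [measurable]: "(\<lambda>x. indicator K x :: real) \<in> borel_measurable M"
    using Ks by (intro measurable_restrict_space1 borel_measurable_indicator)
  have k: "(\<lambda>x. inverse (w x) * indicator K x :: real) \<in> L2v"
    by (rule over_weight_L2v[where K=K and B=1]) (use K in auto)
  have n: "(\<lambda>x. norm (f x)) \<in> L2v" using f by (auto simp: L2v_def sq_def)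
  have "integrable M (\<lambda>x. indicator K x *\<^sub>R f x)"
  proof (rule Bochner_Integration.integrable_bound[OF L2v_integrable[OF n k]])
    show "(\<lambda>x. indicator K x *\<^sub>R f x) \<in> borel_measurable M" by measurable
    show "AE x in M. norm (indicator K x *\<^sub>R f x) \<le> norm (w x * (norm (f x) \<bullet> (inverse (w x) * indicator K x)))"
      using w_pos by eventually_elim (auto simp: indicator_def field_simps)
  qed
  then have "integrable lebesgue (\<lambda>x. indicator U x *\<^sub>R (indicator K x *\<^sub>R f x))"
    using U by (subst (asm) integrable_restrict_space) (auto simp: borel_open)
  moreover have "(\<lambda>x. indicator U x *\<^sub>R (indicator K x *\<^sub>R f x)) = (\<lambda>x. indicator K x *\<^sub>R f x)"
    using K by (fastforce simp: indicator_def)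
  ultimately show "f absolutely_integrable_on K"
    by (simp only: set_integrable_def)
qed

lemma integral_test_eq_ip:
  fixes f \<psi> :: "'a \<Rightarrow> real"
  assumes [measurable]: "f \<in> borel_measurable M" "\<psi> \<in> borel_measurable M"
  shows "(LINT x|M. f x * \<psi> x) = ip f (\<lambda>x. inverse (w x) * \<psi> x)"
  unfolding ip_def using w_pos by (intro integral_cong_AE) (auto elim!: eventually_mono)

abbreviation wg :: "('a \<Rightarrow> real) \<Rightarrow> 'a \<Rightarrow> 'a" where "wg \<equiv> weak_gradient U"

text \<open>The Dirichlet form; \<open>Q\<close> is the square of the Sobolev norm.\<close>

definition B :: "('a \<Rightarrow> real) \<Rightarrow> ('a \<Rightarrow> real) \<Rightarrow> real" where "B u v = ip (wg u) (wg v)"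

definition Q :: "('a \<Rightarrow> real) \<Rightarrow> real" where "Q u = ip u u + B u u"

lemma L2_norm_eq: "L2_norm U w u = sqrt (ip u u)"
  by (simp add: L2_norm_def ip_def power2_eq_square mult.commute)

lemma L2_iff: "u \<in> L2 U w \<longleftrightarrow> u \<in> L2v"
proof -
  have e: "\<bar>u x\<bar>\<^sup>2 * w x = w x * (norm (u x))\<^sup>2" for x by simp
  have nn: "AE x in M. 0 \<le> w x * (norm (u x))\<^sup>2" using w_pos by eventually_elim simp
  have "u \<in> L2v" if "u \<in> borel_measurable M" "integrable M (\<lambda>x. w x * (norm (u x))\<^sup>2)"
    using that nn_integral_eq_integral[OF that(2) nn] unfolding L2v_def sq_def by simp
  then show ?thesis
    unfolding L2_def mem_Collect_eq e using L2v_integrable_sq L2v_measurable by blast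
qed

lemma norm_L2v: "g \<in> borel_measurable M \<Longrightarrow> (\<lambda>x. norm (g x)) \<in> L2v \<longleftrightarrow> g \<in> L2v"
  by (auto simp: L2v_def sq_def)

lemma grad_norm_eq: "grad_norm U w u = sqrt (B u u)"
  by (simp add: grad_norm_def L2_norm_eq B_def ip_def dot_square_norm power2_eq_square)

lemma B_nonneg: "0 \<le> B u u" by (simp add: B_def ip_nonneg)

lemma W12_norm_eq: "W12_norm U w u = sqrt (Q u)"
  by (simp add: W12_norm_def L2_norm_eq grad_norm_eq Q_def B_nonneg ip_nonneg)

lemma weak_gradient_measurable: "is_weak_gradient U u g \<Longrightarrow> g \<in> borel_measurable M"
  using locally_integrable_measurable[OF U] by (auto simp: is_weak_gradient_def)

lemma weak_gradient_AE_eq: "is_weak_gradient U u g \<Longrightarrow> is_weak_gradient U u (wg u) \<and> (AE x in M. wg u x = g x)"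
  using weak_gradient_unique[OF U] by (metis someI_ex weak_gradient_def)

lemma L2v_cong: "f \<in> L2v \<Longrightarrow> AE x in M. f x = g x \<Longrightarrow> g \<in> borel_measurable M \<Longrightarrow> g \<in> L2v"
  using sq_cong[of f g] by (auto simp: L2v_def)

lemma W12I:
  assumes "u \<in> L2v" "is_weak_gradient U u g" "g \<in> L2v"
  shows "u \<in> W12 U w" "AE x in M. wg u x = g x"
proof -
  have "(\<lambda>x. norm (g x)) \<in> L2v" using norm_L2v[of g] assms by (simp add: L2v_measurable)
  then show "u \<in> W12 U w" using assms by (auto simp: W12_def L2_iff)
  show "AE x in M. wg u x = g x" using weak_gradient_AE_eq assms by blast
qed

lemma W12D:
  assumes u: "u \<in> W12 U w"
  shows "u \<in> L2v" "is_weak_gradient U u (wg u)" "wg u \<in> L2v"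
proof -
  obtain g where g: "u \<in> L2v" "is_weak_gradient U u g" "(\<lambda>x. norm (g x)) \<in> L2v"
    using u by (auto simp: W12_def L2_iff)
  show "u \<in> L2v" by fact
  show wg: "is_weak_gradient U u (wg u)" using weak_gradient_AE_eq g by blast
  have gL: "g \<in> L2v" using g norm_L2v weak_gradient_measurable by blast
  show "wg u \<in> L2v"
  proof (rule L2v_cong[OF gL])
    show "AE x in M. g x = wg u x" using weak_gradient_AE_eq[OF g(2)] by auto
  qed (rule weak_gradient_measurable[OF wg])
qed

lemma W12_add:
  assumes "u \<in> W12 U w" "v \<in> W12 U w"
  shows "(\<lambda>x. u x + v x) \<in> W12 U w" "AE x in M. wg (\<lambda>x. u x + v x) x = wg u x + wg v x"
  using W12I[of "\<lambda>x. u x + v x" "\<lambda>x. wg u x + wg v x"] W12D[OF assms(1)] W12D[OF assms(2)]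
  by (auto intro: L2v_add is_weak_gradient_add U)

lemma W12_scale:
  assumes "u \<in> W12 U w"
  shows "(\<lambda>x. c * u x) \<in> W12 U w" "AE x in M. wg (\<lambda>x. c * u x) x = c *\<^sub>R wg u x"
  using W12I[of "\<lambda>x. c * u x" "\<lambda>x. c *\<^sub>R wg u x"] W12D[OF assms] L2v_scale[of u c]
  by (auto intro: L2v_scale is_weak_gradient_cmult)

lemma W12_diff:
  assumes "u \<in> W12 U w" "v \<in> W12 U w"
  shows "(\<lambda>x. u x - v x) \<in> W12 U w" "AE x in M. wg (\<lambda>x. u x - v x) x = wg u x - wg v x"
proof -
  have "(\<lambda>x. u x - v x) = (\<lambda>x. u x + (-1) * v x)" by simp
  then show "(\<lambda>x. u x - v x) \<in> W12 U w" "AE x in M. wg (\<lambda>x. u x - v x) x = wg u x - wg v x"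
    using W12_add[OF assms(1) W12_scale(1)[OF assms(2), of "-1"]] W12_scale(2)[OF assms(2), of "-1"]
    by auto
qed

lemma W12_zero: "(\<lambda>x. 0) \<in> W12 U w"
proof -
  have "is_weak_gradient U (\<lambda>x. 0) (\<lambda>x. 0)"
    by (auto simp: is_weak_gradient_def locally_integrable_def set_integrable_def)
  then show ?thesis by (rule W12I(1)[OF L2v_zero _ L2v_zero])
qed

lemma wg_measurable: "u \<in> W12 U w \<Longrightarrow> wg u \<in> borel_measurable M"
  by (rule L2v_measurable[OF W12D(3)])

lemma B_cong:
  assumes "u \<in> W12 U w" "v \<in> W12 U w" "AE x in M. wg u x = g x" "AE x in M. wg v x = h x"
    and "g \<in> borel_measurable M" "h \<in> borel_measurable M"
  shows "B u v = ip g h"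
  unfolding B_def by (intro ip_cong assms wg_measurable)

lemma B_sym: "B u v = B v u" unfolding B_def by (rule ip_sym)

lemma semi_inner_space_W12:
  "semi_inner_space (W12 U w) (\<lambda>f g x. f x + g x) (\<lambda>c f x. c * f x) B"
proof
  show "W12 U w \<noteq> {}" using W12_zero by blast
  fix u v k :: "'a \<Rightarrow> real" and c :: real
  assume u: "u \<in> W12 U w"
  show "(\<lambda>x. c * u x) \<in> W12 U w" using u by (rule W12_scale)
  show "0 \<le> B u u" by (rule B_nonneg)
  { assume v: "v \<in> W12 U w"
    show "(\<lambda>x. u x + v x) \<in> W12 U w" using u v by (rule W12_add)
    show "B u v = B v u" by (rule B_sym)
    assume k: "k \<in> W12 U w"
    have "B (\<lambda>x. u x + v x) k = ip (\<lambda>x. wg u x + wg v x) (wg k)"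
      using u v k by (intro B_cong W12_add) (auto intro!: wg_measurable borel_measurable_add)
    then show "B (\<lambda>x. u x + v x) k = B u k + B v k"
      using u v k by (simp add: ip_add_left W12D B_def) }
  assume k: "k \<in> W12 U w"
  have "B (\<lambda>x. c * u x) k = ip (\<lambda>x. c *\<^sub>R wg u x) (wg k)"
    using u k by (intro B_cong W12_scale) (auto intro!: wg_measurable borel_measurable_scaleR)
  then show "B (\<lambda>x. c * u x) k = c * B u k"
    using u k by (simp add: ip_scale_left W12D B_def)
qed

lemma B_diff_eq:
  assumes "u \<in> W12 U w" "v \<in> W12 U w"
  shows "B (\<lambda>x. u x - v x) (\<lambda>x. u x - v x) = ip (\<lambda>x. wg u x - wg v x) (\<lambda>x. wg u x - wg v x)"
  using assms by (intro B_cong W12_diff) (auto intro!: wg_measurable borel_measurable_diff)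

lemma Q_nonneg: "0 \<le> Q u" by (simp add: Q_def B_nonneg ip_nonneg)

lemma Q_add_le:
  assumes "u \<in> W12 U w" "v \<in> W12 U w"
  shows "Q (\<lambda>x. u x + v x) \<le> 2 * Q u + 2 * Q v"
proof -
  have "B (\<lambda>x. u x + v x) (\<lambda>x. u x + v x) = ip (\<lambda>x. wg u x + wg v x) (\<lambda>x. wg u x + wg v x)"
    using assms by (intro B_cong W12_add) (auto intro!: wg_measurable borel_measurable_add)
  then show ?thesis
    using ip_add_square_le[of u v] ip_add_square_le[of "wg u" "wg v"] assms
    by (simp add: Q_def W12D B_def)
qed

lemma Q_scale:
  assumes "u \<in> W12 U w"
  shows "Q (\<lambda>x. c * u x) = c\<^sup>2 * Q u"
proof -
  note b = semi_inner_space.B_simps[OF semi_inner_space_W12]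
  have u: "u \<in> L2v" "(\<lambda>x. c *\<^sub>R u x) \<in> L2v" using W12D[OF assms] L2v_scale by blast+
  have "ip (\<lambda>x. c * u x) (\<lambda>x. c * u x) = c * (c * ip u u)"
    using ip_scale_left[OF u(1) u(2), of c] ip_scale_left[OF u(1) u(1), of c] ip_sym[of u "\<lambda>x. c *\<^sub>R u x"] by simp
  then show ?thesis using assms by (simp add: Q_def b power2_eq_square algebra_simps)
qed

text \<open>
  A Cauchy sequence and its weak gradients converge in the weighted square norm. Both sides of the
  identity for weak gradients are inner products with fixed square integrable functions and pass to
  the limit.
\<close>

lemma W12_complete:
  assumes u: "\<And>n. u n \<in> W12 U w"
    and Cauchy: "\<And>e. e > 0 \<Longrightarrow> \<exists>N. \<forall>m\<ge>N. \<forall>n\<ge>N. Q (\<lambda>x. u m x - u n x) < e"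
  shows "\<exists>v\<in>W12 U w. (\<lambda>n. Q (\<lambda>x. u n x - v x)) \<longlonglongrightarrow> 0"
proof -
  have Qd: "Q (\<lambda>x. u m x - v x) = ip (\<lambda>x. u m x - v x) (\<lambda>x. u m x - v x)
      + ip (\<lambda>x. wg (u m) x - wg v x) (\<lambda>x. wg (u m) x - wg v x)" if "v \<in> W12 U w" for m v
    using u that by (simp add: Q_def B_diff_eq)
  have "\<exists>N. \<forall>m\<ge>N. \<forall>n\<ge>N. ip (\<lambda>x. u m x - u n x) (\<lambda>x. u m x - u n x) < e" if "e > 0" for e
  proof -
    have "ip (\<lambda>x. u m x - u n x) (\<lambda>x. u m x - u n x) \<le> Q (\<lambda>x. u m x - u n x)" for m n
      by (simp add: Q_def B_nonneg)
    then show ?thesis using Cauchy[OF that] by (meson le_less_trans)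
  qed
  then obtain v where v: "v \<in> L2v" "(\<lambda>n. ip (\<lambda>x. u n x - v x) (\<lambda>x. u n x - v x)) \<longlonglongrightarrow> 0"
    using L2v_complete[of u] W12D(1)[OF u] by blast
  have "\<exists>N. \<forall>m\<ge>N. \<forall>n\<ge>N. ip (\<lambda>x. wg (u m) x - wg (u n) x) (\<lambda>x. wg (u m) x - wg (u n) x) < e" if "e > 0" for e
  proof -
    have "ip (\<lambda>x. wg (u m) x - wg (u n) x) (\<lambda>x. wg (u m) x - wg (u n) x) \<le> Q (\<lambda>x. u m x - u n x)" for m n
      using u by (simp add: Qd ip_nonneg)
    then show ?thesis using Cauchy[OF that] by (meson le_less_trans)
  qed
  then obtain g where g: "g \<in> L2v" "(\<lambda>n. ip (\<lambda>x. wg (u n) x - g x) (\<lambda>x. wg (u n) x - g x)) \<longlonglongrightarrow> 0"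
    using L2v_complete[of "\<lambda>n. wg (u n)"] W12D(3)[OF u] by blast
  have "is_weak_gradient U v g"
    unfolding is_weak_gradient_def
  proof (intro conjI ballI)
    show "locally_integrable U v" "locally_integrable U g"
      using v g by (auto intro: L2v_locally_integrable)
    fix \<phi> and b :: 'a assume \<phi>: "\<phi> \<in> test_functions U" and b: "b \<in> Basis"
    have s: "smooth_on UNIV \<phi>" using \<phi> by (simp add: test_functions_def)
    obtain K where K: "compact K" "K \<subseteq> U" "\<And>x. x \<notin> K \<Longrightarrow> \<phi> x = 0"
      "\<And>x b. x \<notin> K \<Longrightarrow> frechet_derivative \<phi> (at x) b = 0"
      by (rule test_functionE[OF \<phi>]) blast
    have L: "(\<lambda>x. inverse (w x) * \<psi> x) \<in> L2v" "\<psi> \<in> borel_measurable M"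
      if c: "continuous_on UNIV \<psi>" and z: "\<And>x. x \<notin> K \<Longrightarrow> \<psi> x = 0" for \<psi> :: "'a \<Rightarrow> real"
    proof -
      show m: "\<psi> \<in> borel_measurable M"
        using c by (intro measurable_restrict_space1 measurable_completion) (auto intro: borel_measurable_continuous_onI)
      obtain C where C: "\<And>x. x \<in> K \<Longrightarrow> \<bar>\<psi> x\<bar> \<le> C"
        using compact_imp_bounded[OF compact_continuous_image[OF continuous_on_subset[OF c] K(1)]]
        by (auto simp: bounded_iff)
      show "(\<lambda>x. inverse (w x) * \<psi> x) \<in> L2v"
        by (rule over_weight_L2v[OF K(1,2) m, of C]) (use C z in \<open>auto simp: indicator_def\<close>)
    qed
    let ?d = "\<lambda>x. frechet_derivative \<phi> (at x) b"
    note L1 = L[OF smooth_on_continuous_partial[OF s b] K(4)] and L2 = L[OF smooth_on_continuous[OF s] K(3)]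
    have L2': "(\<lambda>x. (inverse (w x) * \<phi> x) *\<^sub>R b) \<in> L2v"
    proof -
      have "sq (\<lambda>x. (inverse (w x) * \<phi> x) *\<^sub>R b) = sq (\<lambda>x. inverse (w x) * \<phi> x)"
        using b by (simp add: sq_def)
      moreover have "(\<lambda>x. (inverse (w x) * \<phi> x) *\<^sub>R b) \<in> borel_measurable M"
        using L2v_measurable[OF L2(1)] by measurable
      ultimately show ?thesis using L2(1) by (simp add: L2v_def)
    qed
    have e1: "(LINT x|M. h x * ?d x) = ip h (\<lambda>x. inverse (w x) * ?d x)" if "h \<in> L2v" for h
      by (rule integral_test_eq_ip[OF L2v_measurable[OF that] L1(2)]) auto
    have e2: "(LINT x|M. (h x \<bullet> b) * \<phi> x) = ip h (\<lambda>x. (inverse (w x) * \<phi> x) *\<^sub>R b)" if h: "h \<in> L2v" for h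
    proof -
      have [measurable]: "h \<in> borel_measurable M" "\<phi> \<in> borel_measurable M" using h L2 by (auto simp: L2v_def)
      show ?thesis
        unfolding ip_def using w_pos by (intro integral_cong_AE) (auto elim!: eventually_mono)
    qed
    have "(\<lambda>n. ip (u n) (\<lambda>x. inverse (w x) * ?d x)) \<longlonglongrightarrow> ip v (\<lambda>x. inverse (w x) * ?d x)"
      by (rule ip_tendsto[OF W12D(1)[OF u] v(1) L1(1) v(2)])
    moreover have "(\<lambda>n. ip (wg (u n)) (\<lambda>x. (inverse (w x) * \<phi> x) *\<^sub>R b)) \<longlonglongrightarrow> ip g (\<lambda>x. (inverse (w x) * \<phi> x) *\<^sub>R b)"
      by (rule ip_tendsto[OF W12D(3)[OF u] g(1) L2' g(2)])
    moreover have "ip (u n) (\<lambda>x. inverse (w x) * ?d x) = - ip (wg (u n)) (\<lambda>x. (inverse (w x) * \<phi> x) *\<^sub>R b)" for n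
      using W12D(2)[OF u, of n] \<phi> b
      unfolding e1[OF W12D(1)[OF u], symmetric] e2[OF W12D(3)[OF u], symmetric] is_weak_gradient_def by blast
    ultimately have "ip v (\<lambda>x. inverse (w x) * ?d x) = - ip g (\<lambda>x. (inverse (w x) * \<phi> x) *\<^sub>R b)"
      by (intro LIMSEQ_unique[of "\<lambda>n. ip (u n) (\<lambda>x. inverse (w x) * ?d x)"]) (simp_all add: tendsto_minus)
    then show "(LINT x|M. v x * ?d x) = - (LINT x|M. (g x \<bullet> b) * \<phi> x)"
      unfolding e1[OF v(1)] e2[OF g(1)] .
  qed
  from W12I[OF v(1) this g(1)] have vW: "v \<in> W12 U w" "AE x in M. wg v x = g x" .
  have "ip (\<lambda>x. wg (u n) x - wg v x) (\<lambda>x. wg (u n) x - wg v x) = ip (\<lambda>x. wg (u n) x - g x) (\<lambda>x. wg (u n) x - g x)" for n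
    using vW(2) g(1) vW(1) u by (intro ip_cong)
       (auto intro!: borel_measurable_diff wg_measurable intro: L2v_measurable)
  then have "(\<lambda>n. Q (\<lambda>x. u n x - v x)) \<longlonglongrightarrow> 0"
    using tendsto_add[OF v(2) g(2)] by (simp add: Qd[OF vW(1)])
  then show ?thesis using vW by blast
qed

end

section \<open>Hardy's inequality with one weight\<close>

lemma nn_integral_powr_to_inf:
  fixes v p :: real
  assumes "0 < v" "0 < p"
  shows "(\<integral>\<^sup>+l. ennreal (p * l powr (- p - 1)) * indicator {v<..} l \<partial>lborel) = ennreal (v powr - p)"
proof -
  have "((\<lambda>x. x powr (- p - 1)) has_integral - (v powr (- p - 1 + 1)) / (- p - 1 + 1)) {v..}"
    using assms by (intro has_integral_powr_to_inf) auto
  then have "((\<lambda>x. x powr (- p - 1)) has_integral v powr (- p) / p) {v..}" by simp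
  then have "((\<lambda>x. p * x powr (- p - 1)) has_integral p * (v powr (- p) / p)) {v..}"
    by (rule has_integral_mult_right)
  then have "((\<lambda>x. if x \<in> {v..} then p * x powr (- p - 1) else 0) has_integral v powr (- p)) UNIV"
    using assms by (subst has_integral_restrict_UNIV) simp
  then have "(\<integral>\<^sup>+x. ennreal (if x \<in> {v..} then p * x powr (- p - 1) else 0) \<partial>lborel) = ennreal (v powr - p)"
    using assms by (intro nn_integral_has_integral_lborel) auto
  moreover have "(\<integral>\<^sup>+x. ennreal (if x \<in> {v..} then p * x powr (- p - 1) else 0) \<partial>lborel)
      = (\<integral>\<^sup>+l. ennreal (p * l powr (- p - 1)) * indicator {v<..} l \<partial>lborel)"
    by (intro nn_integral_cong_AE) (use AE_lborel_singleton[of v] in \<open>auto elim!: eventually_mono simp: indicator_def\<close>)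
  ultimately show ?thesis by simp
qed

lemma nn_integral_inverse_sqrt_from_0:
  fixes v :: real
  assumes "0 < v"
  shows "(\<integral>\<^sup>+l. ennreal ((1/2) * l powr (- 1/2)) * indicator {0..v} l \<partial>lborel) = ennreal (v powr (1/2))"
proof -
  have "((\<lambda>x. x powr (- 1/2)) has_integral (v powr (- 1/2 + 1)) / (- 1/2 + 1)) {0..v}"
    using assms by (intro has_integral_powr_from_0) auto
  then have "((\<lambda>x. (1/2) * x powr (- 1/2)) has_integral (1/2) * ((v powr (- 1/2 + 1)) / (- 1/2 + 1))) {0..v}"
    by (rule has_integral_mult_right)
  then have "((\<lambda>x. if x \<in> {0..v} then (1/2) * x powr (- 1/2) else 0) has_integral v powr (1/2)) UNIV"
    by (subst has_integral_restrict_UNIV) simp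
  then have "(\<integral>\<^sup>+x. ennreal (if x \<in> {0..v} then (1/2) * x powr (- 1/2) else 0) \<partial>lborel) = ennreal (v powr (1/2))"
    by (intro nn_integral_has_integral_lborel) auto
  then show ?thesis
    by (subst (asm) nn_integral_cong[of _ _ "\<lambda>l. ennreal ((1/2) * l powr (- 1/2)) * indicator {0..v} l"])
      (auto simp: indicator_def)
qed

text \<open>
  The distribution function of the measure with density \<open>q\<close>, and its real powers. The powers are set
  to \<open>0\<close> where the distribution function is \<open>0\<close> or infinite; these points do not contribute below.
\<close>

definition cum :: "(real \<Rightarrow> ennreal) \<Rightarrow> real \<Rightarrow> ennreal" where
  "cum q r = (\<integral>\<^sup>+x. q x * indicator {..r} x \<partial>lborel)"

definition cum_powr :: "(real \<Rightarrow> ennreal) \<Rightarrow> real \<Rightarrow> real \<Rightarrow> ennreal" where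
  "cum_powr q p r = (if 0 < cum q r \<and> cum q r < \<infinity> then ennreal (enn2real (cum q r) powr p) else 0)"

context
  fixes q :: "real \<Rightarrow> ennreal"
  assumes q[measurable]: "q \<in> borel_measurable borel"
begin

lemma cum_mono: "r \<le> r' \<Longrightarrow> cum q r \<le> cum q r'"
  unfolding cum_def by (intro nn_integral_mono mult_left_mono) (auto simp: indicator_def)

lemma cum_measurable[measurable]: "cum q \<in> borel_measurable borel"
proof -
  have "(\<lambda>r. \<integral>\<^sup>+x. q x * indicator {x. x \<le> r} x \<partial>lborel) \<in> borel_measurable borel" by measurable
  moreover have "{x. x \<le> r} = {..r}" for r :: real by auto
  ultimately show ?thesis by (simp add: cum_def[abs_def])
qed

lemma cum_powr_measurable[measurable]: "cum_powr q p \<in> borel_measurable borel"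
  unfolding cum_powr_def[abs_def] by measurable

lemma cum_powr_mult: "cum_powr q a r * cum_powr q b r = cum_powr q (a + b) r"
  by (simp add: cum_powr_def ennreal_mult[symmetric] powr_add)

text \<open>
  The distribution of \<open>cum\<close> under the measure with density \<open>q\<close> is dominated by Lebesgue measure. The
  sublevel sets of \<open>cum\<close> are initial segments, and the measure of such a segment is a value of \<open>cum\<close> or
  a limit of values.
\<close>

lemma sublevel_cum_le: "(\<integral>\<^sup>+x. q x * indicator {x. cum q x < l} x \<partial>lborel) \<le> l"
proof -
  let ?A = "{x. cum q x < l}"
  have down: "y \<in> ?A" if "x \<in> ?A" "y \<le> x" for x y using that cum_mono[of y x] by auto
  consider "?A = {}" | s where "s \<in> ?A" "\<And>x. x \<in> ?A \<Longrightarrow> x \<le> s" | 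
    f :: "nat \<Rightarrow> real" where "incseq f" "\<And>n. f n \<in> ?A" "?A = (\<Union>n. {..f n})"
  proof (cases "?A \<noteq> {} \<and> (\<forall>s\<in>?A. \<exists>x\<in>?A. s < x)")
    case False
    then show thesis using that(1,2) by (meson not_le)
  next
    case True
    show thesis
    proof (cases "bdd_above ?A")
      case bdd: True
      define s where "s = Sup ?A"
      have lt: "x < s" if x: "x \<in> ?A" for x
      proof -
        obtain y where "y \<in> ?A" "x < y" using True x by blast
        then show ?thesis using cSup_upper[OF _ bdd, of y] by (simp add: s_def)
      qed
      have inA: "x \<in> ?A" if xs: "x < s" for x
      proof -
        obtain y where "y \<in> ?A" "x < y" by (rule less_cSupE[of x ?A]) (use True xs s_def in auto)
        then show ?thesis using down less_imp_le by blast
      qed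
      show thesis
      proof (rule that(3))
        show "incseq (\<lambda>n. s - 1 / real (Suc n))"
          by (auto simp: incseq_def frac_le)
        show "s - 1 / real (Suc n) \<in> ?A" for n by (rule inA) simp
        show "?A = (\<Union>n. {..s - 1 / real (Suc n)})"
        proof (intro equalityI subsetI)
          fix x assume "x \<in> ?A"
          then have "0 < s - x" using lt by simp
          then obtain n where "inverse (real (Suc n)) < s - x" by (rule reals_Archimedean[THEN exE])
          then show "x \<in> (\<Union>n. {..s - 1 / real (Suc n)})" by (auto simp: inverse_eq_divide intro!: exI[of _ n])
        next
          fix x assume "x \<in> (\<Union>n. {..s - 1 / real (Suc n)})"
          then obtain n where "x \<le> s - 1 / real (Suc n)" by auto
          moreover have "0 < 1 / real (Suc n)" by simp
          ultimately show "x \<in> ?A" by (intro inA) linarith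
        qed
      qed
    next
      case unb: False
      have all: "x \<in> ?A" for x
      proof -
        obtain y where "y \<in> ?A" "x < y" using unb by (auto simp: bdd_above_def not_le)
        then show ?thesis using down less_imp_le by blast
      qed
      show thesis
      proof (rule that(3))
        show "incseq (\<lambda>n. real n)" by (auto simp: incseq_def)
        show "real n \<in> ?A" for n by (rule all)
        show "?A = (\<Union>n. {..real n})" using all real_arch_simple by auto
      qed
    qed
  qed
  then show ?thesis
  proof cases
    case 1
    then show ?thesis unfolding 1 by simp
  next
    case 2
    then have e: "?A = {..s}" using down[of s] by blast
    have "(\<integral>\<^sup>+x. q x * indicator ?A x \<partial>lborel) = cum q s" by (subst e) (simp add: cum_def)
    also have "\<dots> \<le> l" using 2(1) by simp
    finally show ?thesis .
  next
    case 3
    have "(\<integral>\<^sup>+x. q x * indicator ?A x \<partial>lborel) = emeasure (density lborel q) (\<Union>n. {..f n})"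
      unfolding 3(3) by (simp add: emeasure_density)
    also have "\<dots> = (SUP n. emeasure (density lborel q) {..f n})"
      by (rule SUP_emeasure_incseq[symmetric]) (use 3(1) in \<open>auto simp: incseq_def\<close>)
    also have "\<dots> \<le> l"
    proof (rule SUP_least)
      fix n
      have "emeasure (density lborel q) {..f n} = cum q (f n)" by (simp add: emeasure_density cum_def)
      also have "\<dots> \<le> l" using 3(2)[of n] by simp
      finally show "emeasure (density lborel q) {..f n} \<le> l" .
    qed
    finally show ?thesis .
  qed
qed

text \<open>
  A negative power \<open>v powr - p\<close> is the integral of \<open>p * l powr (- p - 1)\<close> over \<open>l > v\<close>. After exchanging
  the integrals only the measures of sublevel sets of \<open>cum\<close> occur.
\<close>

lemma cum_powr_layer_cake:
  assumes p: "0 < p" and D[measurable]: "D \<in> sets borel"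
  shows "(\<integral>\<^sup>+x. q x * (cum_powr q (- p) x * indicator D x) \<partial>lborel)
    = (\<integral>\<^sup>+l. ennreal (p * l powr (- p - 1)) * indicator {0<..} l *
        (\<integral>\<^sup>+x. q x * indicator {x \<in> D. 0 < cum q x \<and> cum q x < ennreal l} x \<partial>lborel) \<partial>lborel)"
proof -
  have pe: "cum_powr q (- p) x = (\<integral>\<^sup>+l. ennreal (p * l powr (- p - 1)) * indicator {0<..} l *
      indicator {x. 0 < cum q x \<and> cum q x < ennreal l} x \<partial>lborel)" for x
  proof (cases "0 < cum q x \<and> cum q x < \<infinity>")
    case True
    then obtain v where v: "cum q x = ennreal v" "0 < v"
      by (cases "cum q x") (auto simp: ennreal_less_zero_iff)
    have "(\<integral>\<^sup>+l. ennreal (p * l powr (- p - 1)) * indicator {0<..} l *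
      indicator {x. 0 < cum q x \<and> cum q x < ennreal l} x \<partial>lborel) =
      (\<integral>\<^sup>+l. ennreal (p * l powr (- p - 1)) * indicator {v<..} l \<partial>lborel)"
      using v by (intro nn_integral_cong) (auto simp: indicator_def ennreal_less_iff)
    also have "\<dots> = ennreal (v powr - p)" by (rule nn_integral_powr_to_inf[OF v(2) p])
    finally show ?thesis using True v by (simp add: cum_powr_def)
  next
    case False
    then have "\<not> (0 < cum q x \<and> cum q x < ennreal l)" for l by (auto intro: less_trans)
    then show ?thesis using False by (auto simp: cum_powr_def)
  qed
  have "(\<integral>\<^sup>+x. q x * (cum_powr q (- p) x * indicator D x) \<partial>lborel) =
    (\<integral>\<^sup>+x. \<integral>\<^sup>+l. q x * (ennreal (p * l powr (- p - 1)) * indicator {0<..} l *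
      indicator {x. 0 < cum q x \<and> cum q x < ennreal l} x * indicator D x) \<partial>lborel \<partial>lborel)"
    unfolding pe by (simp add: nn_integral_cmult nn_integral_multc)
  also have "\<dots> = (\<integral>\<^sup>+l. \<integral>\<^sup>+x. q x * (ennreal (p * l powr (- p - 1)) * indicator {0<..} l *
      indicator {x. 0 < cum q x \<and> cum q x < ennreal l} x * indicator D x) \<partial>lborel \<partial>lborel)"
    by (rule lborel_pair.Fubini') measurable
  also have "\<dots> = (\<integral>\<^sup>+l. \<integral>\<^sup>+x. (ennreal (p * l powr (- p - 1)) * indicator {0<..} l) *
      (q x * indicator {x \<in> D. 0 < cum q x \<and> cum q x < ennreal l} x) \<partial>lborel \<partial>lborel)"
    by (intro nn_integral_cong) (auto simp: indicator_def ac_simps)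
  also have "\<dots> = (\<integral>\<^sup>+l. ennreal (p * l powr (- p - 1)) * indicator {0<..} l *
        (\<integral>\<^sup>+x. q x * indicator {x \<in> D. 0 < cum q x \<and> cum q x < ennreal l} x \<partial>lborel) \<partial>lborel)"
    by (intro nn_integral_cong nn_integral_cmult) measurable
  finally show ?thesis .
qed

text \<open>
  The sublevel set for the level \<open>l\<close> has measure at most \<open>l\<close>, and at most \<open>cum r\<close> within \<open>{..r}\<close>; the two
  bounds are used for \<open>l\<close> below and above \<open>cum r\<close>.
\<close>

lemma integral_cum_powr_below:
  assumes r: "0 < cum q r" "cum q r < \<infinity>"
  shows "(\<integral>\<^sup>+x. q x * (cum_powr q (- (1/2)) x * indicator {..r} x) \<partial>lborel) \<le> 2 * cum_powr q (1/2) r"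
proof -
  obtain v where v: "cum q r = ennreal v" "0 < v" using r by (cases "cum q r") auto
  let ?I = "\<lambda>l. \<integral>\<^sup>+x. q x * indicator {x \<in> {..r}. 0 < cum q x \<and> cum q x < ennreal l} x \<partial>lborel"
  have I1: "?I l \<le> ennreal l" for l
    by (rule order_trans[OF nn_integral_mono sublevel_cum_le[of "ennreal l"]]) (auto simp: indicator_def)
  have I2: "?I l \<le> ennreal v" for l
    unfolding v(1)[symmetric] cum_def
    by (intro nn_integral_mono mult_left_mono) (auto simp: indicator_def)
  have "(\<integral>\<^sup>+x. q x * (cum_powr q (- (1/2)) x * indicator {..r} x) \<partial>lborel)
    = (\<integral>\<^sup>+l. ennreal ((1/2) * l powr (- (1/2) - 1)) * indicator {0<..} l * ?I l \<partial>lborel)"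
    by (rule cum_powr_layer_cake) auto
  also have "\<dots> \<le> (\<integral>\<^sup>+l. ennreal ((1/2) * l powr (- 1/2)) * indicator {0..v} l +
      ennreal v * (ennreal ((1/2) * l powr (- (1/2) - 1)) * indicator {v<..} l) \<partial>lborel)"
  proof (rule nn_integral_mono)
    fix l :: real
    consider "l \<le> 0" | "0 < l" "l \<le> v" | "v < l" by linarith
    then show "ennreal ((1/2) * l powr (- (1/2) - 1)) * indicator {0<..} l * ?I l \<le>
      ennreal ((1/2) * l powr (- 1/2)) * indicator {0..v} l +
      ennreal v * (ennreal ((1/2) * l powr (- (1/2) - 1)) * indicator {v<..} l)"
    proof cases
      case 2
      have "ennreal ((1/2) * l powr (- (1/2) - 1)) * ?I l \<le> ennreal ((1/2) * l powr (- (1/2) - 1)) * ennreal l"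
        by (intro mult_left_mono I1) simp
      also have "\<dots> = ennreal ((1/2) * l powr (- 1/2))"
        using 2 powr_mult_base[of l "- (1/2) - 1"] by (simp add: ennreal_mult[symmetric] mult.commute)
      finally show ?thesis using 2 by simp
    next
      case 3
      have "ennreal ((1/2) * l powr (- (1/2) - 1)) * ?I l \<le> ennreal ((1/2) * l powr (- (1/2) - 1)) * ennreal v"
        by (intro mult_left_mono I2) simp
      then show ?thesis using 3 v(2) by (simp add: mult.commute)
    qed simp
  qed
  also have "\<dots> = ennreal (v powr (1/2)) + ennreal v * ennreal (v powr (- (1/2)))"
    using nn_integral_inverse_sqrt_from_0[OF v(2)] nn_integral_powr_to_inf[OF v(2), of "1/2"]
    by (subst nn_integral_add) (simp_all add: nn_integral_cmult)
  also have "ennreal v * ennreal (v powr (- (1/2))) = ennreal (v powr (1/2))"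
    using v(2) powr_mult_base[of v "- (1/2)"] by (simp add: ennreal_mult[symmetric])
  also have "ennreal (v powr (1/2)) + ennreal (v powr (1/2)) = 2 * cum_powr q (1/2) r"
    using v r by (simp add: cum_powr_def mult_2)
  finally show ?thesis .
qed

text \<open>
  On \<open>{x..}\<close> sublevel sets are empty for the levels up to \<open>cum x\<close>.
\<close>

lemma integral_cum_powr_above:
  assumes x: "0 < cum q x" "cum q x < \<infinity>"
  shows "(\<integral>\<^sup>+r. q r * (cum_powr q (- (3/2)) r * indicator {x..} r) \<partial>lborel) \<le> 3 * cum_powr q (- (1/2)) x"
proof -
  obtain v where v: "cum q x = ennreal v" "0 < v" using x by (cases "cum q x") auto
  let ?I = "\<lambda>l. \<integral>\<^sup>+r. q r * indicator {r \<in> {x..}. 0 < cum q r \<and> cum q r < ennreal l} r \<partial>lborel"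
  have I1: "?I l \<le> ennreal l" for l
    by (rule order_trans[OF nn_integral_mono sublevel_cum_le[of "ennreal l"]]) (auto simp: indicator_def)
  have I2: "?I l = 0" if "l \<le> v" for l
  proof -
    have "\<not> cum q r < ennreal l" if "x \<le> r" for r
      using cum_mono[OF that] v \<open>l \<le> v\<close> by (simp add: not_less) (meson ennreal_leI order_trans)
    then have e: "{r \<in> {x..}. 0 < cum q r \<and> cum q r < ennreal l} = {}" by auto
    show ?thesis unfolding e by simp
  qed
  have "(\<integral>\<^sup>+r. q r * (cum_powr q (- (3/2)) r * indicator {x..} r) \<partial>lborel)
    = (\<integral>\<^sup>+l. ennreal ((3/2) * l powr (- (3/2) - 1)) * indicator {0<..} l * ?I l \<partial>lborel)"
    by (rule cum_powr_layer_cake) auto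
  also have "\<dots> \<le> (\<integral>\<^sup>+l. 3 * (ennreal ((1/2) * l powr (- (1/2) - 1)) * indicator {v<..} l) \<partial>lborel)"
  proof (rule nn_integral_mono)
    fix l :: real
    show "ennreal ((3/2) * l powr (- (3/2) - 1)) * indicator {0<..} l * ?I l \<le>
      3 * (ennreal ((1/2) * l powr (- (1/2) - 1)) * indicator {v<..} l)"
    proof (cases "l \<le> v")
      case True
      then show ?thesis using I2[OF True] by simp
    next
      case False
      then have l: "0 < l" using v by simp
      have "ennreal ((3/2) * l powr (- (3/2) - 1)) * ?I l \<le> ennreal ((3/2) * l powr (- (3/2) - 1)) * ennreal l"
        by (intro mult_left_mono I1) simp
      also have "\<dots> = ennreal ((3/2) * l powr (- (1/2) - 1))"
        using l powr_mult_base[of l "- (3/2) - 1"] by (simp add: ennreal_mult[symmetric] mult.commute)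
      also have "\<dots> = 3 * ennreal ((1/2) * l powr (- (1/2) - 1))"
        by (simp add: ennreal_mult[symmetric] flip: ennreal_numeral)
      finally show ?thesis using False l by simp
    qed
  qed
  also have "\<dots> = 3 * ennreal (v powr (- (1/2)))"
    using nn_integral_powr_to_inf[OF v(2), of "1/2"] by (simp add: nn_integral_cmult)
  also have "\<dots> = 3 * cum_powr q (- (1/2)) x" using v x by (simp add: cum_powr_def)
  finally show ?thesis .
qed

text \<open>
  The points with \<open>cum x = 0\<close> lie in all sublevel sets with positive level.
\<close>

lemma AE_cum_zero: "AE x in lborel. cum q x = 0 \<longrightarrow> q x = 0"
proof -
  have "(\<integral>\<^sup>+x. q x * indicator {x. cum q x = 0} x \<partial>lborel) \<le> ennreal e" if "e > 0" for e
  proof (rule order_trans[OF _ sublevel_cum_le[of "ennreal e"]])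
    show "(\<integral>\<^sup>+x. q x * indicator {x. cum q x = 0} x \<partial>lborel) \<le> (\<integral>\<^sup>+x. q x * indicator {x. cum q x < ennreal e} x \<partial>lborel)"
      using that by (intro nn_integral_mono mult_left_mono) (auto simp: indicator_def)
  qed
  then have "(\<integral>\<^sup>+x. q x * indicator {x. cum q x = 0} x \<partial>lborel) = 0"
    using ennreal_le_epsilon[of 0 "\<integral>\<^sup>+x. q x * indicator {x. cum q x = 0} x \<partial>lborel"] by simp
  then have "AE x in lborel. q x * indicator {x. cum q x = 0} x = 0"
    by (subst (asm) nn_integral_0_iff_AE) auto
  then show ?thesis by eventually_elim (auto simp: indicator_def)
qed

text \<open>
  Schur's test with the weight \<open>cum powr (1 / 4)\<close>: the Cauchy-Schwarz inequality puts half of the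
  weight on either factor, and after exchanging the integrals the previous two bounds apply.
\<close>

lemma hardy_cum:
  assumes h[measurable]: "h \<in> borel_measurable borel"
  shows "(\<integral>\<^sup>+r. q r * (inverse (cum q r))\<^sup>2 * (\<integral>\<^sup>+x. q x * h x * indicator {..r} x \<partial>lborel)\<^sup>2 \<partial>lborel)
    \<le> 6 * (\<integral>\<^sup>+x. q x * (h x)\<^sup>2 \<partial>lborel)"
proof -
  have point: "(inverse (cum q r))\<^sup>2 * (\<integral>\<^sup>+x. q x * h x * indicator {..r} x \<partial>lborel)\<^sup>2
      \<le> 2 * cum_powr q (- (3/2)) r * (\<integral>\<^sup>+x. q x * ((h x)\<^sup>2 * cum_powr q (1/2) x * indicator {..r} x) \<partial>lborel)" for r
  proof (cases "0 < cum q r \<and> cum q r < \<infinity>")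
    case False
    then have "cum q r = 0 \<or> cum q r = \<infinity>" by (cases "cum q r") auto
    then consider "cum q r = 0" | "cum q r = \<infinity>" by blast
    \<comment> \<open>an infinite inverse meets a vanishing integral, and the inverse of infinity is \<open>0\<close>\<close>
    then show ?thesis
    proof cases
      case 1
      have "(\<integral>\<^sup>+x. q x * indicator {..r} x \<partial>lborel) = 0" using 1 by (simp add: cum_def)
      then have "AE x in lborel. q x * indicator {..r} x = 0"
        by (subst (asm) nn_integral_0_iff_AE) auto
      then have "(\<integral>\<^sup>+x. q x * h x * indicator {..r} x \<partial>lborel) = 0"
        by (subst nn_integral_0_iff_AE) (auto elim!: eventually_mono simp: indicator_def)
      then show ?thesis by simp
    qed simp
  next
    case True
    then obtain v where v: "cum q r = ennreal v" "0 < v" by (cases "cum q r") auto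
    have cumr: "cum q x < \<infinity>" if "x \<le> r" for x using cum_mono[OF that] True by (auto intro: le_less_trans)
    have "(\<integral>\<^sup>+x. q x * h x * indicator {..r} x \<partial>lborel) =
       (\<integral>\<^sup>+x. q x * ((h x * cum_powr q (1/4) x * indicator {..r} x) * (cum_powr q (- (1/4)) x * indicator {..r} x)) \<partial>lborel)"
    proof (rule nn_integral_cong_AE)
      show "AE x in lborel. q x * h x * indicator {..r} x =
        q x * ((h x * cum_powr q (1/4) x * indicator {..r} x) * (cum_powr q (- (1/4)) x * indicator {..r} x))"
        using AE_cum_zero
      proof eventually_elim
        fix x assume z: "cum q x = 0 \<longrightarrow> q x = 0"
        show "q x * h x * indicator {..r} x = q x * ((h x * cum_powr q (1/4) x * indicator {..r} x) * (cum_powr q (- (1/4)) x * indicator {..r} x))"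
        proof (cases "x \<le> r \<and> cum q x \<noteq> 0")
          case True
          then have p: "0 < cum q x" "cum q x < \<infinity>" using cumr by (auto simp: zero_less_iff_neq_zero)
          then have "0 < enn2real (cum q x)" by (simp add: enn2real_positive_iff)
          then have "cum_powr q (1/4) x * cum_powr q (- (1/4)) x = 1" using p by (simp add: cum_powr_mult) (simp add: cum_powr_def)
          then have "h x * (cum_powr q (1/4) x * cum_powr q (- (1/4)) x) = h x" by simp
          then show ?thesis using True by (simp add: mult.assoc)
        next
          case False
          then show ?thesis using z by (auto simp: indicator_def)
        qed
      qed
    qed
    also have "\<dots> = (\<integral>\<^sup>+x. (h x * cum_powr q (1/4) x * indicator {..r} x) * (cum_powr q (- (1/4)) x * indicator {..r} x) \<partial>density lborel q)"
      by (subst nn_integral_density) auto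
    finally have "(\<integral>\<^sup>+x. q x * h x * indicator {..r} x \<partial>lborel)\<^sup>2 \<le>
      (\<integral>\<^sup>+x. (h x * cum_powr q (1/4) x * indicator {..r} x)\<^sup>2 \<partial>density lborel q) *
      (\<integral>\<^sup>+x. (cum_powr q (- (1/4)) x * indicator {..r} x)\<^sup>2 \<partial>density lborel q)"
      using Cauchy_Schwarz_nn_integral[of "\<lambda>x. h x * cum_powr q (1/4) x * indicator {..r} x" "density lborel q" "\<lambda>x. cum_powr q (- (1/4)) x * indicator {..r} x"]
      by simp
    also have "(\<integral>\<^sup>+x. (cum_powr q (- (1/4)) x * indicator {..r} x)\<^sup>2 \<partial>density lborel q) = (\<integral>\<^sup>+x. q x * (cum_powr q (- (1/2)) x * indicator {..r} x) \<partial>lborel)"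
    proof -
      have "(cum_powr q (- (1/4)) x * indicator {..r} x)\<^sup>2 = cum_powr q (- (1/2)) x * indicator {..r} x" for x
        using cum_powr_mult[of "- (1/4)" x "- (1/4)"] by (auto simp: power2_eq_square indicator_def)
      then show ?thesis by (subst nn_integral_density) auto
    qed
    also have "(\<integral>\<^sup>+x. (h x * cum_powr q (1/4) x * indicator {..r} x)\<^sup>2 \<partial>density lborel q) = (\<integral>\<^sup>+x. q x * ((h x)\<^sup>2 * cum_powr q (1/2) x * indicator {..r} x) \<partial>lborel)"
    proof -
      have "(h x * cum_powr q (1/4) x * indicator {..r} x)\<^sup>2 = (h x)\<^sup>2 * cum_powr q (1/2) x * indicator {..r} x" for x
      proof -
        have "(h x * cum_powr q (1/4) x)\<^sup>2 = (h x)\<^sup>2 * (cum_powr q (1/4) x * cum_powr q (1/4) x)" by (simp add: power2_eq_square ac_simps)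
        then show ?thesis by (auto simp: cum_powr_mult indicator_def)
      qed
      then show ?thesis by (subst nn_integral_density) auto
    qed
    finally have "(\<integral>\<^sup>+x. q x * h x * indicator {..r} x \<partial>lborel)\<^sup>2 \<le>
      (\<integral>\<^sup>+x. q x * ((h x)\<^sup>2 * cum_powr q (1/2) x * indicator {..r} x) \<partial>lborel) * (2 * cum_powr q (1/2) r)"
      by (rule order_trans) (intro mult_left_mono integral_cum_powr_below, use True in auto)
    then have "(inverse (cum q r))\<^sup>2 * (\<integral>\<^sup>+x. q x * h x * indicator {..r} x \<partial>lborel)\<^sup>2 \<le> (inverse (cum q r))\<^sup>2 *
      ((\<integral>\<^sup>+x. q x * ((h x)\<^sup>2 * cum_powr q (1/2) x * indicator {..r} x) \<partial>lborel) * (2 * cum_powr q (1/2) r))"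
      by (intro mult_left_mono) auto
    also have e: "(inverse (cum q r))\<^sup>2 = cum_powr q (- 2) r"
    proof -
      have "cum_powr q (- 2) r = ennreal (v powr (- 2))" using True v by (simp add: cum_powr_def)
      also have "v powr (- 2) = (inverse v)\<^sup>2"
        using v(2) by (simp add: powr_minus powr_numeral power_inverse)
      also have "ennreal ((inverse v)\<^sup>2) = (inverse (cum q r))\<^sup>2"
        using v by (simp add: inverse_ennreal ennreal_power)
      finally show ?thesis ..
    qed
    also have "cum_powr q (- 2) r * ((\<integral>\<^sup>+x. q x * ((h x)\<^sup>2 * cum_powr q (1/2) x * indicator {..r} x) \<partial>lborel) * (2 * cum_powr q (1/2) r)) =
        2 * (cum_powr q (- 2) r * cum_powr q (1/2) r) * (\<integral>\<^sup>+x. q x * ((h x)\<^sup>2 * cum_powr q (1/2) x * indicator {..r} x) \<partial>lborel)"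
      by (simp add: ac_simps)
    finally show ?thesis unfolding e by (simp add: cum_powr_mult)
  qed
  have "(\<integral>\<^sup>+r. q r * (inverse (cum q r))\<^sup>2 * (\<integral>\<^sup>+x. q x * h x * indicator {..r} x \<partial>lborel)\<^sup>2 \<partial>lborel)
      \<le> (\<integral>\<^sup>+r. q r * (2 * cum_powr q (- (3/2)) r * (\<integral>\<^sup>+x. q x * ((h x)\<^sup>2 * cum_powr q (1/2) x * indicator {..r} x) \<partial>lborel)) \<partial>lborel)"
    by (rule nn_integral_mono) (use mult_left_mono[OF point] in \<open>simp add: mult.assoc\<close>)
  also have "\<dots> = (\<integral>\<^sup>+r. \<integral>\<^sup>+x. (2 * q r * cum_powr q (- (3/2)) r) * (q x * ((h x)\<^sup>2 * cum_powr q (1/2) x * indicator {x. x \<le> r} x)) \<partial>lborel \<partial>lborel)"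
    by (intro nn_integral_cong, subst nn_integral_cmult) (auto simp: ac_simps indicator_def)
  also have "\<dots> = (\<integral>\<^sup>+x. \<integral>\<^sup>+r. (2 * q r * cum_powr q (- (3/2)) r) * (q x * ((h x)\<^sup>2 * cum_powr q (1/2) x * indicator {x. x \<le> r} x)) \<partial>lborel \<partial>lborel)"
    by (rule lborel_pair.Fubini') measurable
  also have "\<dots> = (\<integral>\<^sup>+x. (2 * (q x * (h x)\<^sup>2 * cum_powr q (1/2) x)) * (\<integral>\<^sup>+r. q r * (cum_powr q (- (3/2)) r * indicator {x..} r) \<partial>lborel) \<partial>lborel)"
    by (intro nn_integral_cong, subst nn_integral_cmult[symmetric])
      (auto simp: ac_simps indicator_def intro!: nn_integral_cong)
  also have "\<dots> \<le> (\<integral>\<^sup>+x. 6 * (q x * (h x)\<^sup>2) \<partial>lborel)"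
  proof (rule nn_integral_mono)
    fix x
    show "(2 * (q x * (h x)\<^sup>2 * cum_powr q (1/2) x)) * (\<integral>\<^sup>+r. q r * (cum_powr q (- (3/2)) r * indicator {x..} r) \<partial>lborel) \<le> 6 * (q x * (h x)\<^sup>2)"
    proof (cases "0 < cum q x \<and> cum q x < \<infinity>")
      case True
      then have "0 < enn2real (cum q x)" by (simp add: enn2real_positive_iff)
      then have one: "cum_powr q (1/2) x * cum_powr q (- (1/2)) x = 1" using True by (simp add: cum_powr_mult) (simp add: cum_powr_def)
      have "(2 * (q x * (h x)\<^sup>2 * cum_powr q (1/2) x)) * (\<integral>\<^sup>+r. q r * (cum_powr q (- (3/2)) r * indicator {x..} r) \<partial>lborel)
        \<le> (2 * (q x * (h x)\<^sup>2 * cum_powr q (1/2) x)) * (3 * cum_powr q (- (1/2)) x)"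
        using True by (intro mult_left_mono integral_cum_powr_above) auto
      also have "\<dots> = (2 * 3) * (q x * (h x)\<^sup>2) * (cum_powr q (1/2) x * cum_powr q (- (1/2)) x)"
        by (simp only: ac_simps)
      also have "\<dots> = 6 * (q x * (h x)\<^sup>2)" unfolding one by simp
      finally show ?thesis .
    next
      case False
      then have "cum_powr q (1/2) x = 0" by (auto simp: cum_powr_def)
      then show ?thesis by simp
    qed
  qed
  also have "\<dots> = 6 * (\<integral>\<^sup>+x. q x * (h x)\<^sup>2 \<partial>lborel)" by (rule nn_integral_cmult) measurable
  finally show ?thesis .
qed

end

lemma hardy_right:
  fixes a u :: real
  assumes [measurable]: "q \<in> borel_measurable borel" "h \<in> borel_measurable borel"
  shows "(\<integral>\<^sup>+t. indicator {a<..<u} t * (q t * (inverse (\<integral>\<^sup>+x. q x * indicator {a..t} x \<partial>lborel))\<^sup>2 *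
      (\<integral>\<^sup>+x. q x * h x * indicator {a..t} x \<partial>lborel)\<^sup>2) \<partial>lborel)
    \<le> 6 * (\<integral>\<^sup>+x. indicator {a<..<u} x * (q x * (h x)\<^sup>2) \<partial>lborel)"
proof -
  define p where "p x = q x * indicator {a<..<u} x" for x
  have [measurable]: "p \<in> borel_measurable borel" unfolding p_def by measurable
  have AEa: "AE x in lborel. x \<noteq> a" by (rule AE_lborel_singleton)
  have c: "cum p t = (\<integral>\<^sup>+x. q x * indicator {a..t} x \<partial>lborel)" if "t \<in> {a<..<u}" for t
    unfolding cum_def p_def
    by (intro nn_integral_cong_AE) (use AEa that in \<open>auto elim!: eventually_mono simp: indicator_def\<close>)
  have d: "(\<integral>\<^sup>+x. p x * h x * indicator {..t} x \<partial>lborel) = (\<integral>\<^sup>+x. q x * h x * indicator {a..t} x \<partial>lborel)" if "t \<in> {a<..<u}" for t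
    unfolding p_def
    by (intro nn_integral_cong_AE) (use AEa that in \<open>auto elim!: eventually_mono simp: indicator_def\<close>)
  have "(\<integral>\<^sup>+t. indicator {a<..<u} t * (q t * (inverse (\<integral>\<^sup>+x. q x * indicator {a..t} x \<partial>lborel))\<^sup>2 *
      (\<integral>\<^sup>+x. q x * h x * indicator {a..t} x \<partial>lborel)\<^sup>2) \<partial>lborel) =
    (\<integral>\<^sup>+t. p t * (inverse (cum p t))\<^sup>2 * (\<integral>\<^sup>+x. p x * h x * indicator {..t} x \<partial>lborel)\<^sup>2 \<partial>lborel)"
  proof (rule nn_integral_cong)
    fix t
    show "indicator {a<..<u} t * (q t * (inverse (\<integral>\<^sup>+x. q x * indicator {a..t} x \<partial>lborel))\<^sup>2 *
      (\<integral>\<^sup>+x. q x * h x * indicator {a..t} x \<partial>lborel)\<^sup>2) =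
      p t * (inverse (cum p t))\<^sup>2 * (\<integral>\<^sup>+x. p x * h x * indicator {..t} x \<partial>lborel)\<^sup>2"
    proof (cases "t \<in> {a<..<u}")
      case True
      then show ?thesis unfolding c[OF True] d[OF True] by (simp add: p_def)
    next
      case False
      then show ?thesis by (simp add: p_def)
    qed
  qed
  also have "\<dots> \<le> 6 * (\<integral>\<^sup>+x. p x * (h x)\<^sup>2 \<partial>lborel)" by (rule hardy_cum) measurable
  also have "(\<integral>\<^sup>+x. p x * (h x)\<^sup>2 \<partial>lborel) = (\<integral>\<^sup>+x. indicator {a<..<u} x * (q x * (h x)\<^sup>2) \<partial>lborel)"
    by (intro nn_integral_cong) (simp add: p_def ac_simps)
  finally show ?thesis .
qed

lemma nn_integral_reflect:
  "f \<in> borel_measurable borel \<Longrightarrow> (\<integral>\<^sup>+x. f x \<partial>lborel) = (\<integral>\<^sup>+x. f (- x :: real) \<partial>lborel)"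
  using nn_integral_real_affine[of f "-1" 0] by simp

lemma hardy_left:
  fixes a l :: real
  assumes [measurable]: "q \<in> borel_measurable borel" "h \<in> borel_measurable borel"
  shows "(\<integral>\<^sup>+t. indicator {l<..<a} t * (q t * (inverse (\<integral>\<^sup>+x. q x * indicator {t..a} x \<partial>lborel))\<^sup>2 *
      (\<integral>\<^sup>+x. q x * h x * indicator {t..a} x \<partial>lborel)\<^sup>2) \<partial>lborel)
    \<le> 6 * (\<integral>\<^sup>+x. indicator {l<..<a} x * (q x * (h x)\<^sup>2) \<partial>lborel)"
proof -
  have i: "indicator {- t..a} (- x) = (indicator {- a..t} x :: ennreal)" for t x by (auto simp: indicator_def)
  have j: "indicator {l<..<a} (- x) = (indicator {- a<..<- l} x :: ennreal)" for x by (auto simp: indicator_def)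
  have k: "indicator {t..a} x = (indicator ({x. t \<le> x} \<inter> {..a}) x :: ennreal)" for t x by (auto simp: indicator_def)
  have c: "(\<integral>\<^sup>+x. q x * indicator {- t..a} x \<partial>lborel) = (\<integral>\<^sup>+x. q (- x) * indicator {- a..t} x \<partial>lborel)" for t
    by (subst nn_integral_reflect) (auto simp: i)
  have d: "(\<integral>\<^sup>+x. q x * h x * indicator {- t..a} x \<partial>lborel) = (\<integral>\<^sup>+x. q (- x) * h (- x) * indicator {- a..t} x \<partial>lborel)" for t
    by (subst nn_integral_reflect) (auto simp: i)
  have "(\<integral>\<^sup>+t. indicator {l<..<a} t * (q t * (inverse (\<integral>\<^sup>+x. q x * indicator {t..a} x \<partial>lborel))\<^sup>2 *
      (\<integral>\<^sup>+x. q x * h x * indicator {t..a} x \<partial>lborel)\<^sup>2) \<partial>lborel) =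
    (\<integral>\<^sup>+t. indicator {- a<..<- l} t * (q (- t) * (inverse (\<integral>\<^sup>+x. q (- x) * indicator {- a..t} x \<partial>lborel))\<^sup>2 *
      (\<integral>\<^sup>+x. q (- x) * h (- x) * indicator {- a..t} x \<partial>lborel)\<^sup>2) \<partial>lborel)"
    by (subst nn_integral_reflect) (unfold k, measurable, unfold k[symmetric], simp add: c d j)
  also have "\<dots> \<le> 6 * (\<integral>\<^sup>+x. indicator {- a<..<- l} x * (q (- x) * (h (- x))\<^sup>2) \<partial>lborel)"
    by (rule hardy_right) measurable
  also have "(\<integral>\<^sup>+x. indicator {- a<..<- l} x * (q (- x) * (h (- x))\<^sup>2) \<partial>lborel) = (\<integral>\<^sup>+x. indicator {l<..<a} x * (q x * (h x)\<^sup>2) \<partial>lborel)"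
    by (subst (2) nn_integral_reflect) (auto simp: j)
  finally show ?thesis .
qed

text \<open>
  Hardy's inequality on both sides of the anchor \<open>a\<close>, with \<open>q = 1 / \<Phi>\<close> and \<open>h = \<Phi> * g\<close>. Then
  \<open>q * h = g\<close> and \<open>q * h\<^sup>2 = \<Phi> * g\<^sup>2\<close>.
\<close>

lemma hardy_anchored:
  fixes a :: real and \<Phi> :: "real \<Rightarrow> real" and g :: "real \<Rightarrow> ennreal"
  assumes a: "a \<in> {0<..<1}"
    and [measurable]: "\<Phi> \<in> borel_measurable borel" "g \<in> borel_measurable borel"
    and pos: "\<And>t. t \<noteq> a \<Longrightarrow> 0 < \<Phi> t"
  shows "(\<integral>\<^sup>+t. indicator {0<..<1} t * (inverse (ennreal (\<Phi> t)) *
      (inverse (\<integral>\<^sup>+x. inverse (ennreal (\<Phi> x)) * indicator {min a t..max a t} x \<partial>lborel))\<^sup>2 *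
      (\<integral>\<^sup>+x. g x * indicator {min a t..max a t} x \<partial>lborel)\<^sup>2) \<partial>lborel)
    \<le> 6 * (\<integral>\<^sup>+t. indicator {0<..<1} t * (ennreal (\<Phi> t) * (g t)\<^sup>2) \<partial>lborel)"
proof -
  define q where "q t = inverse (ennreal (\<Phi> t))" for t
  define h where "h t = ennreal (\<Phi> t) * g t" for t
  have [measurable]: "q \<in> borel_measurable borel" "h \<in> borel_measurable borel"
    unfolding q_def h_def by measurable
  have AEa: "AE x in lborel. x \<noteq> a" by (rule AE_lborel_singleton)
  have qh: "q x * h x = g x" "q x * (h x)\<^sup>2 = ennreal (\<Phi> x) * (g x)\<^sup>2" if "x \<noteq> a" for x
  proof -
    have one: "q x * ennreal (\<Phi> x) = 1"
      using pos[OF that] by (simp add: q_def inverse_ennreal ennreal_mult[symmetric])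
    show "q x * h x = g x" using one by (simp add: h_def mult.assoc[symmetric])
    have "q x * (h x)\<^sup>2 = (q x * ennreal (\<Phi> x)) * (ennreal (\<Phi> x) * (g x)\<^sup>2)"
      by (simp add: h_def power2_eq_square ac_simps)
    then show "q x * (h x)\<^sup>2 = ennreal (\<Phi> x) * (g x)\<^sup>2" using one by simp
  qed
  have gi: "(\<integral>\<^sup>+x. q x * h x * indicator A x \<partial>lborel) = (\<integral>\<^sup>+x. g x * indicator A x \<partial>lborel)" for A :: "real set"
    by (intro nn_integral_cong_AE) (use AEa qh in \<open>auto elim!: eventually_mono\<close>)
  let ?L = "\<lambda>t. indicator {0<..<a} t * (q t * (inverse (\<integral>\<^sup>+x. q x * indicator {t..a} x \<partial>lborel))\<^sup>2 *
      (\<integral>\<^sup>+x. q x * h x * indicator {t..a} x \<partial>lborel)\<^sup>2)"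
  let ?R = "\<lambda>t. indicator {a<..<1} t * (q t * (inverse (\<integral>\<^sup>+x. q x * indicator {a..t} x \<partial>lborel))\<^sup>2 *
      (\<integral>\<^sup>+x. q x * h x * indicator {a..t} x \<partial>lborel)\<^sup>2)"
  have k: "indicator {t..a} x = (indicator ({x. t \<le> x} \<inter> {..a}) x :: ennreal)"
    "indicator {a..t} x = (indicator ({x. x \<le> t} \<inter> {a..}) x :: ennreal)" for t x by (auto simp: indicator_def)
  have [measurable]: "?L \<in> borel_measurable borel" "?R \<in> borel_measurable borel"
    unfolding k by measurable
  have "(\<integral>\<^sup>+t. indicator {0<..<1} t * (inverse (ennreal (\<Phi> t)) *
      (inverse (\<integral>\<^sup>+x. inverse (ennreal (\<Phi> x)) * indicator {min a t..max a t} x \<partial>lborel))\<^sup>2 *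
      (\<integral>\<^sup>+x. g x * indicator {min a t..max a t} x \<partial>lborel)\<^sup>2) \<partial>lborel)
    \<le> (\<integral>\<^sup>+t. ?L t + ?R t \<partial>lborel)"
  proof (rule nn_integral_mono_AE)
    show "AE t in lborel. indicator {0<..<1} t * (inverse (ennreal (\<Phi> t)) *
      (inverse (\<integral>\<^sup>+x. inverse (ennreal (\<Phi> x)) * indicator {min a t..max a t} x \<partial>lborel))\<^sup>2 *
      (\<integral>\<^sup>+x. g x * indicator {min a t..max a t} x \<partial>lborel)\<^sup>2) \<le> ?L t + ?R t"
      using AEa
    proof eventually_elim
      fix t assume "t \<noteq> a"
      then consider "t < a" | "a < t" by linarith
      then show "indicator {0<..<1} t * (inverse (ennreal (\<Phi> t)) *
        (inverse (\<integral>\<^sup>+x. inverse (ennreal (\<Phi> x)) * indicator {min a t..max a t} x \<partial>lborel))\<^sup>2 *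
        (\<integral>\<^sup>+x. g x * indicator {min a t..max a t} x \<partial>lborel)\<^sup>2) \<le> ?L t + ?R t"
        unfolding q_def[symmetric] gi
        by cases (use a in \<open>cases "t \<in> {0<..<1}"; simp add: min_def max_def\<close>)+
    qed
  qed
  also have "\<dots> = (\<integral>\<^sup>+t. ?L t \<partial>lborel) + (\<integral>\<^sup>+t. ?R t \<partial>lborel)" by (rule nn_integral_add) measurable
  also have "\<dots> \<le> 6 * (\<integral>\<^sup>+x. indicator {0<..<a} x * (q x * (h x)\<^sup>2) \<partial>lborel) + 6 * (\<integral>\<^sup>+x. indicator {a<..<1} x * (q x * (h x)\<^sup>2) \<partial>lborel)"
    by (intro add_mono hardy_left hardy_right) measurable
  also have "\<dots> = 6 * (\<integral>\<^sup>+x. indicator {0<..<a} x * (q x * (h x)\<^sup>2) + indicator {a<..<1} x * (q x * (h x)\<^sup>2) \<partial>lborel)"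
    by (subst nn_integral_add) (auto simp: distrib_left)
  also have "(\<integral>\<^sup>+x. indicator {0<..<a} x * (q x * (h x)\<^sup>2) + indicator {a<..<1} x * (q x * (h x)\<^sup>2) \<partial>lborel) =
      (\<integral>\<^sup>+t. indicator {0<..<1} t * (ennreal (\<Phi> t) * (g t)\<^sup>2) \<partial>lborel)"
    by (intro nn_integral_cong_AE) (use AEa a qh in \<open>auto elim!: eventually_mono simp: indicator_def\<close>)
  finally show ?thesis .
qed

text \<open>
  The form in which the inequality meets the weights of the trace space: \<open>\<delta>\<close> is the increment of a
  function along a path, \<open>g\<close> bounds the derivative and \<open>\<Phi>\<close> is the weight on the path.
\<close>

lemma hardy_increment:
  fixes a :: real and \<Phi> \<delta> :: "real \<Rightarrow> real" and g :: "real \<Rightarrow> ennreal"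
  assumes a: "a \<in> {0<..<1}"
    and m: "\<Phi> \<in> borel_measurable borel" "g \<in> borel_measurable borel"
    and pos: "\<And>t. t \<noteq> a \<Longrightarrow> 0 < \<Phi> t"
    and inc: "\<And>t. ennreal \<bar>\<delta> t\<bar> \<le> (\<integral>\<^sup>+x\<in>{min a t..max a t}. g x \<partial>lborel)"
  shows "(\<integral>\<^sup>+t\<in>{0<..<1}. inverse (ennreal (\<Phi> t)) *
      (inverse (\<integral>\<^sup>+x\<in>{min a t..max a t}. inverse (ennreal (\<Phi> x)) \<partial>lborel))\<^sup>2 * ennreal (\<bar>\<delta> t\<bar>\<^sup>2) \<partial>lborel)
    \<le> 6 * (\<integral>\<^sup>+t\<in>{0<..<1}. ennreal (\<Phi> t) * (g t)\<^sup>2 \<partial>lborel)"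
proof -
  have sq: "ennreal (\<bar>\<delta> t\<bar>\<^sup>2) \<le> (\<integral>\<^sup>+x\<in>{min a t..max a t}. g x \<partial>lborel)\<^sup>2" for t
    using power_mono[OF inc[of t], of 2] by (simp only: ennreal_power abs_ge_zero zero_le)
  show ?thesis
    using order_trans[OF nn_integral_mono hardy_anchored[OF a m pos]] mult_left_mono[OF sq]
    by (simp add: mult.commute[of _ "indicator {0<..<1} _"] mult_left_mono)
qed

section \<open>Energy spaces as closures of smooth functions\<close>

text \<open>
  A completion in the sense of closures: \<open>D\<close> is the space of smooth functions whose closure is the
  energy space.
\<close>

locale energy_space = weighted_domain +
  fixes D :: "('a \<Rightarrow> real) set"
  assumes D_zero: "(\<lambda>x. 0) \<in> D"
    and D_add: "\<phi> \<in> D \<Longrightarrow> \<psi> \<in> D \<Longrightarrow> (\<lambda>x. \<phi> x + \<psi> x) \<in> D"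
    and D_scale: "\<phi> \<in> D \<Longrightarrow> (\<lambda>x. c * \<phi> x) \<in> D"
begin

definition H :: "('a \<Rightarrow> real) set" where
  "H = {u \<in> W12 U w. \<forall>\<epsilon>>0. \<exists>\<phi>\<in>D \<inter> W12 U w. W12_norm U w (\<lambda>p. u p - \<phi> p) < \<epsilon>}"

lemma H_W12: "u \<in> H \<Longrightarrow> u \<in> W12 U w" by (simp add: H_def)

lemma H_approx:
  assumes "u \<in> H" "e > 0"
  obtains \<phi> where "\<phi> \<in> D" "\<phi> \<in> W12 U w" "Q (\<lambda>p. u p - \<phi> p) < e"
proof -
  have "sqrt e > 0" using assms by simp
  then obtain \<phi> where "\<phi> \<in> D" "\<phi> \<in> W12 U w" "sqrt (Q (\<lambda>p. u p - \<phi> p)) < sqrt e"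
    using assms(1) unfolding H_def W12_norm_eq by blast
  then show thesis using that by simp
qed

lemma HI:
  assumes "u \<in> W12 U w" "\<And>e. e > 0 \<Longrightarrow> \<exists>\<phi>\<in>D \<inter> W12 U w. Q (\<lambda>p. u p - \<phi> p) < e"
  shows "u \<in> H"
  unfolding H_def W12_norm_eq
proof (intro CollectI conjI allI impI assms(1))
  fix e :: real assume e: "e > 0"
  obtain \<phi> where "\<phi> \<in> D \<inter> W12 U w" "Q (\<lambda>p. u p - \<phi> p) < e\<^sup>2" using assms(2)[of "e\<^sup>2"] e by auto
  moreover from this have "sqrt (Q (\<lambda>p. u p - \<phi> p)) < e" using e real_sqrt_less_iff[of _ "e\<^sup>2"] by simp
  ultimately show "\<exists>\<phi>\<in>D \<inter> W12 U w. sqrt (Q (\<lambda>p. u p - \<phi> p)) < e" by blast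
qed

lemma D_H: "\<phi> \<in> D \<Longrightarrow> \<phi> \<in> W12 U w \<Longrightarrow> \<phi> \<in> H"
proof (rule HI)
  fix e :: real assume "\<phi> \<in> D" "\<phi> \<in> W12 U w" "e > 0"
  moreover have "Q (\<lambda>p. 0) = 0" using Q_scale[OF W12_zero, of 0] by simp
  ultimately show "\<exists>\<psi>\<in>D \<inter> W12 U w. Q (\<lambda>p. \<phi> p - \<psi> p) < e" by (intro bexI[of _ \<phi>]) auto
qed

lemma Q_sum_lt:
  assumes "u \<in> W12 U w" "v \<in> W12 U w" "Q u < e / 4" "Q v < e / 4"
  shows "Q (\<lambda>x. u x + v x) < e"
  using Q_add_le[OF assms(1,2)] assms(3,4) by argo

lemma H_add:
  assumes "u \<in> H" "v \<in> H"
  shows "(\<lambda>p. u p + v p) \<in> H"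
proof (rule HI)
  show "(\<lambda>p. u p + v p) \<in> W12 U w" using assms by (intro W12_add H_W12)
  fix e :: real assume "e > 0"
  then have e: "e / 4 > 0" by simp
  obtain \<phi> where \<phi>: "\<phi> \<in> D" "\<phi> \<in> W12 U w" "Q (\<lambda>p. u p - \<phi> p) < e / 4" by (rule H_approx[OF assms(1) e])
  obtain \<psi> where \<psi>: "\<psi> \<in> D" "\<psi> \<in> W12 U w" "Q (\<lambda>p. v p - \<psi> p) < e / 4" by (rule H_approx[OF assms(2) e])
  have "Q (\<lambda>p. (u p - \<phi> p) + (v p - \<psi> p)) < e"
    using assms \<phi> \<psi> by (intro Q_sum_lt W12_diff) (auto intro: H_W12)
  moreover have "(\<lambda>p. (u p - \<phi> p) + (v p - \<psi> p)) = (\<lambda>p. (u p + v p) - (\<phi> p + \<psi> p))" by auto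
  ultimately show "\<exists>\<phi>\<in>D \<inter> W12 U w. Q (\<lambda>p. u p + v p - \<phi> p) < e"
    using D_add[OF \<phi>(1) \<psi>(1)] W12_add(1)[OF \<phi>(2) \<psi>(2)] by (intro bexI[of _ "\<lambda>p. \<phi> p + \<psi> p"]) auto
qed

lemma H_scale:
  assumes "u \<in> H"
  shows "(\<lambda>p. c * u p) \<in> H"
proof (rule HI)
  show "(\<lambda>p. c * u p) \<in> W12 U w" using assms by (intro W12_scale H_W12)
  fix e :: real assume "e > 0"
  have c: "c\<^sup>2 + 1 > 0" by (rule add_nonneg_pos) auto
  then have e: "e / (c\<^sup>2 + 1) > 0" using \<open>e > 0\<close> by simp
  obtain \<phi> where \<phi>: "\<phi> \<in> D" "\<phi> \<in> W12 U w" "Q (\<lambda>p. u p - \<phi> p) < e / (c\<^sup>2 + 1)" by (rule H_approx[OF assms e])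
  have "Q (\<lambda>p. c * (u p - \<phi> p)) = c\<^sup>2 * Q (\<lambda>p. u p - \<phi> p)"
    using assms \<phi> by (intro Q_scale W12_diff) (auto intro: H_W12)
  also have "\<dots> \<le> (c\<^sup>2 + 1) * Q (\<lambda>p. u p - \<phi> p)" by (intro mult_right_mono Q_nonneg) simp
  also have "\<dots> < e" using \<phi>(3) c by (simp add: pos_less_divide_eq mult.commute)
  finally have "Q (\<lambda>p. c * u p - c * \<phi> p) < e" by (simp add: right_diff_distrib)
  then show "\<exists>\<phi>\<in>D \<inter> W12 U w. Q (\<lambda>p. c * u p - \<phi> p) < e"
    using D_scale[OF \<phi>(1)] W12_scale(1)[OF \<phi>(2)] by (intro bexI[of _ "\<lambda>p. c * \<phi> p"]) auto
qed

lemma H_diff: "u \<in> H \<Longrightarrow> v \<in> H \<Longrightarrow> (\<lambda>p. u p - v p) \<in> H"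
  using H_add[of u "\<lambda>p. (-1) * v p"] H_scale[of v "-1"] by simp

lemma H_zero: "(\<lambda>p. 0) \<in> H" by (rule D_H[OF D_zero W12_zero])

lemma H_closed:
  assumes u: "\<And>n. u n \<in> H" and v: "v \<in> W12 U w" and lim: "(\<lambda>n. Q (\<lambda>x. u n x - v x)) \<longlonglongrightarrow> 0"
  shows "v \<in> H"
proof (rule HI[OF v])
  fix e :: real assume "e > 0"
  then have e: "e / 4 > 0" by simp
  then obtain n where n: "Q (\<lambda>x. u n x - v x) < e / 4"
    using LIMSEQ_D[OF lim e] Q_nonneg by (metis (no_types, lifting) abs_of_nonneg diff_zero le_refl real_norm_def)
  obtain \<phi> where \<phi>: "\<phi> \<in> D" "\<phi> \<in> W12 U w" "Q (\<lambda>p. u n p - \<phi> p) < e / 4" by (rule H_approx[OF u e])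
  have "Q (\<lambda>x. (-1) * (u n x - v x)) = Q (\<lambda>x. u n x - v x)"
    using W12_diff(1)[OF H_W12[OF u] v] by (subst Q_scale) auto
  then have "Q (\<lambda>x. v x - u n x) < e / 4" using n by simp
  then have "Q (\<lambda>p. (v p - u n p) + (u n p - \<phi> p)) < e"
    using u v \<phi> by (intro Q_sum_lt W12_diff) (auto intro: H_W12)
  then show "\<exists>\<phi>\<in>D \<inter> W12 U w. Q (\<lambda>p. v p - \<phi> p) < e"
    using \<phi> by (intro bexI[of _ \<phi>]) auto
qed

lemma semi_inner_space_H: "semi_inner_space H (\<lambda>f g x. f x + g x) (\<lambda>c f x. c * f x) B"
proof -
  interpret S: semi_inner_space "W12 U w" "\<lambda>f g x. f x + g x" "\<lambda>c f x. c * f x" B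
    by (rule semi_inner_space_W12)
  show ?thesis
    using H_zero by unfold_locales (auto intro: H_add H_scale S.B_add S.B_scl B_sym B_nonneg H_W12)
qed

definition poincare :: bool where
  "poincare \<longleftrightarrow> (\<exists>C>0. \<forall>u\<in>H. L2_norm U w u \<le> C * grad_norm U w u)"

lemma poincareD:
  assumes poincare
  obtains C where "C > 0" "\<And>u. u \<in> H \<Longrightarrow> Q u \<le> C * B u u"
proof -
  obtain C where C: "C > 0" "\<And>u. u \<in> H \<Longrightarrow> sqrt (ip u u) \<le> C * sqrt (B u u)"
    using assms by (auto simp: poincare_def L2_norm_eq grad_norm_eq)
  have "Q u \<le> (C\<^sup>2 + 1) * B u u" if "u \<in> H" for u
  proof -
    have "(sqrt (ip u u))\<^sup>2 \<le> (C * sqrt (B u u))\<^sup>2" using C(2)[OF that] by (intro power_mono) (auto simp: ip_nonneg)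
    then show ?thesis by (simp add: Q_def ip_nonneg B_nonneg power_mult_distrib algebra_simps)
  qed
  moreover have "C\<^sup>2 + 1 > 0" by (rule add_nonneg_pos) auto
  ultimately show thesis using that by blast
qed

text \<open>
  Under the Poincare inequality the energy norm controls the Sobolev norm, for which the Sobolev space
  is complete and \<open>H\<close> is closed.
\<close>

lemma H_complete:
  assumes P: poincare and u: "\<And>n. u n \<in> H"
    and Cauchy: "\<And>e. e > 0 \<Longrightarrow> \<exists>N. \<forall>m\<ge>N. \<forall>n\<ge>N. B (\<lambda>x. u m x - u n x) (\<lambda>x. u m x - u n x) < e"
  shows "\<exists>v\<in>H. (\<lambda>n. B (\<lambda>x. u n x - v x) (\<lambda>x. u n x - v x)) \<longlonglongrightarrow> 0"
proof -
  obtain C where C: "C > 0" "\<And>u. u \<in> H \<Longrightarrow> Q u \<le> C * B u u" using poincareD[OF P] by blast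
  have "\<exists>N. \<forall>m\<ge>N. \<forall>n\<ge>N. Q (\<lambda>x. u m x - u n x) < e" if "e > 0" for e
  proof -
    have "e / C > 0" using C that by simp
    then obtain N where N: "\<And>m n. m \<ge> N \<Longrightarrow> n \<ge> N \<Longrightarrow> B (\<lambda>x. u m x - u n x) (\<lambda>x. u m x - u n x) < e / C"
      using Cauchy by metis
    have "Q (\<lambda>x. u m x - u n x) < e" if "m \<ge> N" "n \<ge> N" for m n
    proof -
      have "Q (\<lambda>x. u m x - u n x) \<le> C * B (\<lambda>x. u m x - u n x) (\<lambda>x. u m x - u n x)" by (intro C H_diff u)
      also have "\<dots> < e" using N[OF that] C(1) by (simp add: pos_less_divide_eq mult.commute)
      finally show ?thesis .
    qed
    then show ?thesis by blast
  qed
  from W12_complete[OF H_W12[OF u] this] obtain v where v: "v \<in> W12 U w" "(\<lambda>n. Q (\<lambda>x. u n x - v x)) \<longlonglongrightarrow> 0"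
    by blast
  have "v \<in> H" by (rule H_closed[OF u v])
  moreover have "(\<lambda>n. B (\<lambda>x. u n x - v x) (\<lambda>x. u n x - v x)) \<longlonglongrightarrow> 0"
    by (rule Lim_null_comparison[OF _ v(2)]) (auto simp: Q_def ip_nonneg B_nonneg)
  ultimately show ?thesis by blast
qed

end

section \<open>The unit cube in coordinates\<close>

lemma open_cube: "open (cube :: (real^'n) set)"
proof -
  have e: "cube = (\<Inter>i. {x :: real^'n. 0 < x $ i} \<inter> {x. x $ i < 1})" by (auto simp: cube_def)
  have "open {x :: real^'n. 0 < x $ i}" "open {x :: real^'n. x $ i < 1}" for i
    by (auto intro!: open_Collect_less continuous_intros)
  then show ?thesis unfolding e by (intro open_INT open_Int ballI) auto
qed

lemma open_cylinder: "open (cylinder :: ((real^'n) \<times> real) set)"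
  unfolding cylinder_def by (intro open_Times open_cube) simp

lemma cube_sets[measurable, simp]: "cube \<in> sets borel" by (rule borel_open[OF open_cube])

lemma cylinder_sets[measurable, simp]: "cylinder \<in> sets borel" by (rule borel_open[OF open_cylinder])

lemma vec_lambda_sum: "(\<chi> j. f j) = (\<Sum>j\<in>UNIV. f j *\<^sub>R axis j (1::real))"
  by (simp add: vec_eq_iff axis_def if_distrib cong: if_cong)

lemma measurable_vec_lambda:
  assumes "\<And>j. (\<lambda>x. f x j) \<in> borel_measurable M"
  shows "(\<lambda>x. (\<chi> j. f x j) :: real^'n) \<in> borel_measurable M"
  unfolding vec_lambda_sum using assms by measurable

lemma measurable_vec_nth[measurable]: "(\<lambda>x. (x :: real^'n) $ j) \<in> borel_measurable borel"
  by (intro borel_measurable_continuous_onI continuous_intros)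

abbreviation unit_interval :: "real measure" where
  "unit_interval \<equiv> restrict_space lborel {0<..<1}"

interpretation unit_prod: product_sigma_finite "\<lambda>_ :: 'i. unit_interval"
  by (simp add: product_sigma_finite_def sigma_finite_measure_restrict_space sigma_finite_lborel)

interpretation lborel_prod: product_sigma_finite "\<lambda>_ :: 'i. lborel :: real measure"
  by (simp add: product_sigma_finite_def sigma_finite_lborel)

lemma prod_Basis_vec:
  fixes f :: "real^'n \<Rightarrow> 'b::comm_monoid_mult"
  shows "(\<Prod>b\<in>Basis. f b) = (\<Prod>i\<in>UNIV. f (axis i 1))"
proof -
  have B: "(Basis :: (real^'n) set) = (\<lambda>i. axis i 1) ` UNIV" by (auto simp: Basis_vec_def)
  show ?thesis unfolding B by (subst prod.reindex) (auto simp: inj_on_def axis_eq_axis)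
qed

text \<open>
  Lebesgue measure on \<open>real ^ 'n\<close> is a product over basis vectors, whereas \<open>other_coords\<close> is a product
  over indices. The two products agree on boxes.
\<close>

lemma lborel_eq_distr_PiM:
  "(lborel :: (real^'n) measure) = distr (\<Pi>\<^sub>M j\<in>UNIV. lborel) borel (\<lambda>p. \<chi> j. p j)"
proof (rule lborel_eqI)
  let ?v = "\<lambda>p. (\<chi> j. p j) :: real^'n"
  have m: "?v \<in> measurable (\<Pi>\<^sub>M j\<in>UNIV. lborel) borel" by (rule measurable_vec_lambda) measurable
  fix l u :: "real^'n"
  assume lu: "\<And>b. b \<in> Basis \<Longrightarrow> l \<bullet> b \<le> u \<bullet> b"
  have le: "l $ i \<le> u $ i" for i using lu[of "axis i 1"] by (simp add: inner_axis)
  have "?v -` box l u \<inter> space (\<Pi>\<^sub>M j\<in>UNIV. lborel) = Pi\<^sub>E UNIV (\<lambda>i. {l $ i<..<u $ i})"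
    by (auto simp: mem_box_cart space_PiM PiE_UNIV_domain Pi_iff)
  then have "emeasure (distr (\<Pi>\<^sub>M j\<in>UNIV. lborel) borel ?v) (box l u) =
      emeasure (\<Pi>\<^sub>M j\<in>UNIV. lborel) (Pi\<^sub>E UNIV (\<lambda>i. {l $ i<..<u $ i}))"
    using m by (subst emeasure_distr) auto
  also have "\<dots> = (\<Prod>i\<in>UNIV. emeasure lborel {l $ i<..<u $ i})"
    by (rule lborel_prod.emeasure_PiM) auto
  also have "\<dots> = (\<Prod>i\<in>UNIV. ennreal (u $ i - l $ i))" using le by simp
  also have "\<dots> = ennreal (\<Prod>i\<in>UNIV. u $ i - l $ i)" using le by (intro prod_ennreal) auto
  also have "(\<Prod>i\<in>UNIV. u $ i - l $ i) = (\<Prod>b\<in>Basis. (u - l) \<bullet> b)"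
    by (simp add: prod_Basis_vec inner_axis)
  finally show "emeasure (distr (\<Pi>\<^sub>M j\<in>UNIV. lborel) borel ?v) (box l u) = (\<Prod>b\<in>Basis. (u - l) \<bullet> b)" .
qed simp

text \<open>
  A rectangle with sides inside the unit interval has the same measure in the cube and in the whole
  space.
\<close>

lemma PiM_unit_interval_eq:
  "(\<Pi>\<^sub>M j\<in>(UNIV :: 'n::finite set). unit_interval) =
    distr (restrict_space lborel (cube :: (real^'n) set)) (\<Pi>\<^sub>M j\<in>UNIV. unit_interval) (\<lambda>x j. x $ j)"
proof (rule unit_prod.PiM_eqI[symmetric])
  let ?f = "\<lambda>x j. (x :: real^'n) $ j"
  have f: "?f \<in> measurable (restrict_space lborel cube) (\<Pi>\<^sub>M j\<in>UNIV. unit_interval)"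
    by (intro measurable_PiM_single' measurable_restrict_space2 measurable_restrict_space1)
      (auto simp: cube_def space_restrict_space)
  fix A :: "'n \<Rightarrow> real set" assume "\<And>i. i \<in> UNIV \<Longrightarrow> A i \<in> sets unit_interval"
  then have A: "A i \<in> sets borel" "A i \<subseteq> {0<..<1}" for i
    by (auto simp: sets_restrict_space_iff)
  have S: "Pi\<^sub>E UNIV A \<in> sets (\<Pi>\<^sub>M j\<in>UNIV. unit_interval)"
    using A by (intro sets_PiM_I_finite) (auto simp: sets_restrict_space_iff)
  let ?B = "{x :: real^'n. \<forall>i. x $ i \<in> A i}"
  have Bs: "?B \<in> sets borel"
  proof -
    have "?B = (\<Inter>i. (\<lambda>x. x $ i) -` A i \<inter> space borel)" by auto
    also have "\<dots> \<in> sets borel" using A(1) measurable_sets[OF measurable_vec_nth] by auto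
    finally show ?thesis .
  qed
  have BA: "?f -` Pi\<^sub>E UNIV A \<inter> space (restrict_space lborel cube) = ?B"
    using A(2) by (fastforce simp: space_restrict_space cube_def PiE_UNIV_domain Pi_def subset_iff)
  have "emeasure (distr (restrict_space lborel cube) (\<Pi>\<^sub>M j\<in>UNIV. unit_interval) ?f) (Pi\<^sub>E UNIV A)
      = emeasure (restrict_space lborel cube) ?B"
    using f S BA by (subst emeasure_distr) auto
  also have "\<dots> = emeasure lborel ?B"
    by (rule emeasure_restrict_space) (use A(2) in \<open>auto simp: cube_def subset_iff\<close>)
  also have "\<dots> = emeasure (\<Pi>\<^sub>M j\<in>UNIV. lborel) (Pi\<^sub>E UNIV A)"
  proof -
    have m: "(\<lambda>p. (\<chi> j. p j) :: real^'n) \<in> measurable (\<Pi>\<^sub>M j\<in>UNIV. lborel) borel"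
      by (rule measurable_vec_lambda) measurable
    have "(\<lambda>p. (\<chi> j. p j) :: real^'n) -` ?B \<inter> space (\<Pi>\<^sub>M j\<in>UNIV. lborel) = Pi\<^sub>E UNIV A"
      by (auto simp: space_PiM PiE_UNIV_domain)
    then show ?thesis using m Bs by (subst lborel_eq_distr_PiM, subst emeasure_distr) auto
  qed
  also have "\<dots> = (\<Prod>i\<in>UNIV. emeasure lborel (A i))" by (rule lborel_prod.emeasure_PiM) (use A in auto)
  also have "\<dots> = (\<Prod>i\<in>UNIV. emeasure unit_interval (A i))"
    using A by (intro prod.cong refl emeasure_restrict_space[symmetric]) auto
  finally show "emeasure (distr (restrict_space lborel cube) (\<Pi>\<^sub>M j\<in>UNIV. unit_interval) ?f) (Pi\<^sub>E UNIV A)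
      = (\<Prod>i\<in>UNIV. emeasure unit_interval (A i))" .
qed auto

lemma measurable_set_coord[measurable]:
  assumes [measurable]: "a \<in> measurable M (other_coords i)" "t \<in> borel_measurable M"
  shows "(\<lambda>x. set_coord i (a x) (t x)) \<in> borel_measurable M"
  unfolding set_coord_def
proof (rule measurable_vec_lambda)
  fix j
  show "(\<lambda>x. if j = i then t x else a x j) \<in> borel_measurable M"
  proof (cases "j = i")
    case False
    have "(\<lambda>p. p j) \<in> measurable (other_coords i) unit_interval"
      unfolding other_coords_def by (rule measurable_component_singleton) (use False in simp)
    from measurable_compose[OF assms(1) this] have "(\<lambda>x. a x j) \<in> measurable M unit_interval" .
    moreover have "(\<lambda>x. x) \<in> measurable unit_interval borel" by (simp add: measurable_restrict_space1)
    ultimately have "(\<lambda>x. a x j) \<in> borel_measurable M" by (rule measurable_compose)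
    then show ?thesis using False by simp
  qed (use assms(2) in simp)
qed

lemma sigma_finite_other_coords: "sigma_finite_measure (other_coords i)"
  unfolding other_coords_def by (rule unit_prod.sigma_finite) simp

text \<open>
  The factor with index \<open>i\<close> is split off from the product measure, after the product over all indices
  has been identified with Lebesgue measure on the cube.
\<close>

lemma nn_integral_cube_slices:
  fixes F :: "real^'n \<Rightarrow> ennreal"
  assumes F[measurable]: "F \<in> borel_measurable borel"
  shows "(\<integral>\<^sup>+z. (\<integral>\<^sup>+t\<in>{0<..<1}. F (set_coord i z t) \<partial>lborel) \<partial>other_coords i) = (\<integral>\<^sup>+x\<in>cube. F x \<partial>lborel)"
proof -
  have v: "(\<lambda>p. (\<chi> j. p j) :: real^'n) \<in> measurable (\<Pi>\<^sub>M j\<in>UNIV. unit_interval) borel"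
  proof (rule measurable_vec_lambda)
    fix j
    have "(\<lambda>x. x) \<in> measurable unit_interval borel" by (simp add: measurable_restrict_space1)
    then show "(\<lambda>p. p j) \<in> borel_measurable (\<Pi>\<^sub>M j\<in>UNIV. unit_interval)"
      by (rule measurable_compose[OF measurable_component_singleton, rotated]) simp
  qed
  have Fv: "(\<lambda>p. F (\<chi> j. p j)) \<in> borel_measurable (\<Pi>\<^sub>M j\<in>insert i (UNIV - {i}). unit_interval)"
    using measurable_compose[OF v F] by (simp add: insert_absorb)
  have f: "(\<lambda>x j. (x :: real^'n) $ j) \<in> measurable (restrict_space lborel cube) (\<Pi>\<^sub>M j\<in>UNIV. unit_interval)"
    by (intro measurable_PiM_single' measurable_restrict_space2 measurable_restrict_space1)
      (auto simp: cube_def space_restrict_space)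
  have "(\<integral>\<^sup>+z. (\<integral>\<^sup>+t\<in>{0<..<1}. F (set_coord i z t) \<partial>lborel) \<partial>other_coords i) =
    (\<integral>\<^sup>+z. (\<integral>\<^sup>+t. F (\<chi> j. (z(i := t)) j) \<partial>unit_interval) \<partial>(\<Pi>\<^sub>M j\<in>UNIV - {i}. unit_interval))"
    unfolding other_coords_def
    by (intro nn_integral_cong, subst nn_integral_restrict_space)
      (auto simp: set_coord_def fun_upd_def intro!: nn_integral_cong)
  also have "\<dots> = (\<integral>\<^sup>+p. F (\<chi> j. p j) \<partial>(\<Pi>\<^sub>M j\<in>insert i (UNIV - {i}). unit_interval))"
    by (rule unit_prod.product_nn_integral_insert[symmetric]) (use Fv in auto)
  also have "\<dots> = (\<integral>\<^sup>+p. F (\<chi> j. p j) \<partial>(\<Pi>\<^sub>M j\<in>UNIV. unit_interval))" by (simp add: insert_absorb)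
  also have "\<dots> = (\<integral>\<^sup>+x. F (\<chi> j. x $ j) \<partial>restrict_space lborel cube)"
    by (subst PiM_unit_interval_eq, subst nn_integral_distr[OF f])
      (use measurable_compose[OF v F] in \<open>simp_all\<close>)
  also have "\<dots> = (\<integral>\<^sup>+x\<in>cube. F x \<partial>lborel)"
    by (subst nn_integral_restrict_space) auto
  finally show ?thesis .
qed

lemma AE_cube_slices:
  fixes P :: "real^'n \<Rightarrow> bool"
  assumes "AE x in lborel. x \<in> cube \<longrightarrow> P x"
  shows "AE z in other_coords i. AE t in lborel. t \<in> {0<..<1} \<longrightarrow> P (set_coord i z t)"
proof -
  obtain N where N: "{x \<in> space lborel. \<not> (x \<in> cube \<longrightarrow> P x)} \<subseteq> N" "emeasure lborel N = 0" "N \<in> sets lborel"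
    using assms by (rule AE_E)
  then have [measurable]: "N \<in> sets borel" by auto
  interpret O: sigma_finite_measure "other_coords i" by (rule sigma_finite_other_coords)
  have "(\<integral>\<^sup>+x\<in>cube. indicator N x \<partial>lborel) \<le> (\<integral>\<^sup>+x. indicator N x \<partial>lborel)"
    by (intro nn_integral_mono) (auto simp: indicator_def)
  also have "\<dots> = 0" using N by simp
  finally have z: "(\<integral>\<^sup>+z. (\<integral>\<^sup>+t\<in>{0<..<1}. indicator N (set_coord i z t) \<partial>lborel) \<partial>other_coords i) = 0"
    by (subst nn_integral_cube_slices) auto
  have "AE z in other_coords i. (\<integral>\<^sup>+t\<in>{0<..<1}. indicator N (set_coord i z t) \<partial>lborel) = 0"
    using z by (subst (asm) nn_integral_0_iff_AE) measurable
  then have ae: "AE z in other_coords i. AE t in lborel. indicator N (set_coord i z t) * indicator {0<..<1} t = (0::ennreal)"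
    by (auto elim!: eventually_mono simp: nn_integral_0_iff_AE)
  have c: "set_coord i z t \<in> cube" if "t \<in> {0<..<1}" "z \<in> space (other_coords i)" for z t
    using that by (auto simp: cube_def set_coord_def other_coords_def space_PiM space_restrict_space PiE_def Pi_def)
  show ?thesis
    using ae AE_space
  proof eventually_elim
    case (elim z)
    from elim(1) show ?case
      by eventually_elim (use c elim(2) N(1) in \<open>auto simp: indicator_def split: if_splits\<close>)
  qed
qed

section \<open>Trace inequalities for smooth functions\<close>

lemma square_sum_le: "((a::real) + b)\<^sup>2 \<le> 2 * a\<^sup>2 + 2 * b\<^sup>2"
  using sum_squares_bound[of a b] by (simp add: power2_sum)

lemma nn_integral_cylinder:
  fixes F :: "(real^'n) \<times> real \<Rightarrow> ennreal"
  assumes [measurable]: "F \<in> borel_measurable borel"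
  shows "(\<integral>\<^sup>+p\<in>cylinder. F p \<partial>lborel) = (\<integral>\<^sup>+x\<in>cube. (\<integral>\<^sup>+y\<in>{0<..}. F (x, y) \<partial>lborel) \<partial>lborel)"
proof -
  have [measurable]: "F \<in> borel_measurable (lborel \<Otimes>\<^sub>M lborel)" by (simp add: lborel_prod)
  have "(\<integral>\<^sup>+p\<in>cylinder. F p \<partial>lborel) = (\<integral>\<^sup>+p. F p * indicator cylinder p \<partial>(lborel \<Otimes>\<^sub>M lborel))"
    by (simp add: lborel_prod)
  also have "\<dots> = (\<integral>\<^sup>+x. \<integral>\<^sup>+y. F (x, y) * indicator cylinder (x, y) \<partial>lborel \<partial>lborel)"
  proof (rule lborel.nn_integral_fst[symmetric])
    have "(cylinder :: ((real^'n) \<times> real) set) \<in> sets (lborel \<Otimes>\<^sub>M lborel)"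
      unfolding cylinder_def by (intro pair_measureI) auto
    then show "(\<lambda>p. F p * indicator cylinder p) \<in> borel_measurable (lborel \<Otimes>\<^sub>M lborel)" by measurable
  qed
  also have "\<dots> = (\<integral>\<^sup>+x. \<integral>\<^sup>+y. (F (x, y) * indicator {0<..} y) * indicator cube x \<partial>lborel \<partial>lborel)"
    by (intro nn_integral_cong) (auto simp: cylinder_def indicator_def)
  also have "\<dots> = (\<integral>\<^sup>+x\<in>cube. (\<integral>\<^sup>+y\<in>{0<..}. F (x, y) \<partial>lborel) \<partial>lborel)"
    by (intro nn_integral_cong nn_integral_multc) measurable
  finally show ?thesis .
qed

lemma increment_le_nn_integral:
  fixes h h' :: "real \<Rightarrow> real"
  assumes d: "\<And>r. (h has_real_derivative h' r) (at r)" and c: "continuous_on UNIV h'" and ab: "a \<le> b"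
  shows "ennreal \<bar>h b - h a\<bar> \<le> (\<integral>\<^sup>+r\<in>{a..b}. ennreal \<bar>h' r\<bar> \<partial>lborel)"
proof -
  have i: "(h' has_integral (h b - h a)) {a..b}"
    using ab d by (intro fundamental_theorem_of_calculus)
      (auto simp: has_real_derivative_iff_has_vector_derivative intro: has_vector_derivative_at_within)
  have ca: "(\<lambda>r. \<bar>h' r\<bar>) integrable_on {a..b}"
    using c by (intro integrable_continuous_interval continuous_intros) (auto intro: continuous_on_subset)
  then obtain I where I: "((\<lambda>r. \<bar>h' r\<bar>) has_integral I) {a..b}" by blast
  have "norm (integral {a..b} h') \<le> integral {a..b} (\<lambda>r. \<bar>h' r\<bar>)"
    by (rule integral_norm_bound_integral) (use i ca in auto)
  then have le: "\<bar>h b - h a\<bar> \<le> I" using i I by (simp add: integral_unique)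
  have "((\<lambda>r. if r \<in> {a..b} then \<bar>h' r\<bar> else 0) has_integral I) UNIV"
    using I by (subst has_integral_restrict_UNIV)
  moreover have [measurable]: "h' \<in> borel_measurable borel" using c by (rule borel_measurable_continuous_onI)
  ultimately have "(\<integral>\<^sup>+r. ennreal (if r \<in> {a..b} then \<bar>h' r\<bar> else 0) \<partial>lborel) = ennreal I"
    by (intro nn_integral_has_integral_lborel) auto
  also have "(\<integral>\<^sup>+r. ennreal (if r \<in> {a..b} then \<bar>h' r\<bar> else 0) \<partial>lborel) = (\<integral>\<^sup>+r\<in>{a..b}. ennreal \<bar>h' r\<bar> \<partial>lborel)"
    by (intro nn_integral_cong) (auto simp: indicator_def)
  finally show ?thesis using le by (simp add: ennreal_leI)
qed

lemma increment_along_line: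
  fixes f :: "'a::euclidean_space \<Rightarrow> real"
  assumes f: "smooth_on UNIV f" and ab: "a \<le> b"
  shows "ennreal \<bar>f (p + b *\<^sub>R v) - f (p + a *\<^sub>R v)\<bar> \<le>
    (\<integral>\<^sup>+r\<in>{a..b}. ennreal (norm v * norm (classical_gradient f (p + r *\<^sub>R v))) \<partial>lborel)"
proof -
  have d: "((\<lambda>r. f (p + r *\<^sub>R v)) has_real_derivative classical_gradient f (p + r *\<^sub>R v) \<bullet> v) (at r)" for r
  proof -
    have "((\<lambda>r. p + r *\<^sub>R v) has_derivative (\<lambda>r. r *\<^sub>R v)) (at r)" by (auto intro!: derivative_eq_intros)
    from has_derivative_compose[OF this classical_gradient_has_derivative[OF f]]
    show ?thesis unfolding has_field_derivative_def by (simp add: mult.commute[of _ "_ \<bullet> _"])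
  qed
  have c: "continuous_on UNIV (\<lambda>r. classical_gradient f (p + r *\<^sub>R v) \<bullet> v)"
    by (intro continuous_intros continuous_on_compose2[OF continuous_on_classical_gradient[OF f, of UNIV]]) auto
  have "ennreal \<bar>f (p + b *\<^sub>R v) - f (p + a *\<^sub>R v)\<bar> \<le> (\<integral>\<^sup>+r\<in>{a..b}. ennreal \<bar>classical_gradient f (p + r *\<^sub>R v) \<bullet> v\<bar> \<partial>lborel)"
    by (rule increment_le_nn_integral[OF d c ab])
  also have "\<dots> \<le> (\<integral>\<^sup>+r\<in>{a..b}. ennreal (norm v * norm (classical_gradient f (p + r *\<^sub>R v))) \<partial>lborel)"
    using Cauchy_Schwarz_ineq2[of "classical_gradient f (p + _ *\<^sub>R v)" v]
    by (intro nn_integral_mono mult_right_mono ennreal_leI) (auto simp: mult.commute)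
  finally show ?thesis .
qed

text \<open>
  The map \<open>\<tau> \<mapsto> \<bar>a - \<tau>\<bar>\<close> covers every height at most twice.
\<close>

lemma nn_integral_fold_abs:
  fixes K :: "real \<Rightarrow> ennreal"
  assumes [measurable]: "K \<in> borel_measurable borel"
  shows "(\<integral>\<^sup>+\<tau>\<in>{0<..<1}. K \<bar>a - \<tau>\<bar> \<partial>lborel) \<le> 2 * (\<integral>\<^sup>+y\<in>{0<..}. K y \<partial>lborel)"
proof -
  have "(\<integral>\<^sup>+\<tau>\<in>{0<..<1}. K \<bar>a - \<tau>\<bar> \<partial>lborel) \<le>
     (\<integral>\<^sup>+\<tau>. K (\<tau> - a) * indicator {0<..} (\<tau> - a) + K (a - \<tau>) * indicator {0<..} (a - \<tau>) \<partial>lborel)"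
  proof (rule nn_integral_mono_AE)
    show "AE \<tau> in lborel. K \<bar>a - \<tau>\<bar> * indicator {0<..<1} \<tau> \<le>
      K (\<tau> - a) * indicator {0<..} (\<tau> - a) + K (a - \<tau>) * indicator {0<..} (a - \<tau>)"
      using AE_lborel_singleton[of a]
    proof eventually_elim
      fix \<tau> assume "\<tau> \<noteq> a"
      then consider "\<tau> < a" | "a < \<tau>" by linarith
      then show "K \<bar>a - \<tau>\<bar> * indicator {0<..<1} \<tau> \<le>
        K (\<tau> - a) * indicator {0<..} (\<tau> - a) + K (a - \<tau>) * indicator {0<..} (a - \<tau>)"
        by cases (auto simp: indicator_def)
    qed
  qed
  also have "\<dots> = (\<integral>\<^sup>+\<tau>. K (\<tau> - a) * indicator {0<..} (\<tau> - a) \<partial>lborel) + (\<integral>\<^sup>+\<tau>. K (a - \<tau>) * indicator {0<..} (a - \<tau>) \<partial>lborel)"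
    by (rule nn_integral_add) measurable
  also have "(\<integral>\<^sup>+\<tau>. K (\<tau> - a) * indicator {0<..} (\<tau> - a) \<partial>lborel) = (\<integral>\<^sup>+y\<in>{0<..}. K y \<partial>lborel)"
    using nn_integral_real_affine[of "\<lambda>y. K y * indicator {0<..} y" 1 "- a"] by simp
  also have "(\<integral>\<^sup>+\<tau>. K (a - \<tau>) * indicator {0<..} (a - \<tau>) \<partial>lborel) = (\<integral>\<^sup>+y\<in>{0<..}. K y \<partial>lborel)"
    using nn_integral_real_affine[of "\<lambda>y. K y * indicator {0<..} y" "-1" a] by simp
  finally show ?thesis by (simp add: mult_2)
qed

lemma set_coord_nth: "set_coord i z t $ j = (if j = i then t else z j)"
  by (simp add: set_coord_def)

lemma set_coord_set_coord: "set_coord i (($) (set_coord i z t)) t' = set_coord i z t'"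
  by (simp add: set_coord_def vec_eq_iff)

lemma set_coord_line: "set_coord i z t = set_coord i z 0 + t *\<^sub>R axis i 1"
  by (simp add: set_coord_def vec_eq_iff axis_def)

text \<open>
  Borel data without exceptional points. They make the weights of the trace space jointly measurable
  and keep null sets out of the inequalities for smooth functions.
\<close>

locale borel_order =
  fixes s G :: "real^'n::finite \<Rightarrow> real"
  assumes s_borel[measurable]: "s \<in> borel_measurable borel"
    and G_borel[measurable]: "G \<in> borel_measurable borel"
    and s_pos: "\<And>x. 0 < s x" and s_le: "\<And>x. s x \<le> 1" and G_pos: "\<And>x. 0 < G x"
begin

abbreviation "W \<equiv> cyl_weight s G"

lemma W_eq: "W (x, y) = G x * y powr (1 - 2 * s x)" by (simp add: cyl_weight_def)

lemma W_pos: "0 < y \<Longrightarrow> 0 < W (x, y)" using G_pos by (simp add: W_eq)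

lemma W_borel[measurable]: "W \<in> borel_measurable borel"
proof -
  have e: "W = (\<lambda>p. G (fst p) * snd p powr (1 - 2 * s (fst p)))" by (auto simp: cyl_weight_def)
  have "(\<lambda>p. G (fst p) * snd p powr (1 - 2 * s (fst p))) \<in> borel_measurable (borel \<Otimes>\<^sub>M borel)"
    by measurable
  then show ?thesis unfolding e by (simp only: borel_prod)
qed

text \<open>
  The identity behind the choice of the weights: \<open>Phi\<close> is the weight of the cylinder at a height equal
  to the distance of the two coordinates.
\<close>

lemma Phi_eq_W: "Phi s G i x \<tau> = W (x, \<bar>x $ i - \<tau>\<bar>)" by (simp add: Phi_def W_eq)

lemma Phi_pos: "x $ i \<noteq> \<tau> \<Longrightarrow> 0 < Phi s G i x \<tau>" by (simp add: Phi_eq_W W_pos)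

lemma Phi_measurable[measurable]:
  assumes [measurable]: "a \<in> borel_measurable M" "t \<in> borel_measurable M"
  shows "(\<lambda>x. Phi s G i (a x) (t x)) \<in> borel_measurable M"
  unfolding Phi_def by measurable

text \<open>
  The order interval is written as a condition on all variables, which makes the dependence on them
  visibly measurable.
\<close>

lemma phi_weight_slice:
  "phi_weight s G i (set_coord i z t) \<tau> = inverse (ennreal (Phi s G i (set_coord i z t) \<tau>)) *
     (inverse (\<integral>\<^sup>+t'. inverse (ennreal (Phi s G i (set_coord i z t') \<tau>)) * (if min t \<tau> \<le> t' \<and> t' \<le> max t \<tau> then 1 else 0) \<partial>lborel))\<^sup>2"
  by (simp add: phi_weight_def set_coord_set_coord set_coord_nth indicator_def of_bool_def)

lemma phi_weight_measurable[measurable]: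
  assumes [measurable]: "a \<in> measurable M (other_coords i)" "t \<in> borel_measurable M" "\<tau> \<in> borel_measurable M"
  shows "(\<lambda>x. phi_weight s G i (set_coord i (a x) (t x)) (\<tau> x)) \<in> borel_measurable M"
  unfolding phi_weight_slice by measurable

lemma psi_weight_measurable[measurable]:
  assumes [measurable]: "a \<in> borel_measurable M" "\<tau> \<in> borel_measurable M"
  shows "(\<lambda>x. psi_weight s G i (a x) (\<tau> x)) \<in> borel_measurable M"
proof -
  have "psi_weight s G i x \<tau> = inverse (ennreal (Phi s G i x \<tau>)) *
     (inverse (\<integral>\<^sup>+t'. inverse (ennreal (Phi s G i x t')) * (if min (x $ i) \<tau> \<le> t' \<and> t' \<le> max (x $ i) \<tau> then 1 else 0) \<partial>lborel))\<^sup>2" for x \<tau>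
    by (simp add: psi_weight_def indicator_def of_bool_def)
  then show ?thesis by simp
qed

lemma w_coord_measurable[measurable]:
  assumes [measurable]: "a \<in> measurable M (other_coords i)" "t \<in> borel_measurable M" "\<tau> \<in> borel_measurable M"
  shows "(\<lambda>x. w_coord s G i (set_coord i (a x) (t x)) (\<tau> x)) \<in> borel_measurable M"
  unfolding w_coord_def by measurable

context
  fixes f :: "(real^'n) \<times> real \<Rightarrow> real"
  assumes f: "smooth_on UNIV f"
begin

abbreviation "g \<equiv> classical_gradient f"

lemma f_borel[measurable]: "f \<in> borel_measurable borel"
  using smooth_on_continuous[OF f] by (rule borel_measurable_continuous_onI)

lemma g_borel[measurable]: "g \<in> borel_measurable borel"
  using continuous_on_classical_gradient[OF f] by (rule borel_measurable_continuous_onI)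

definition fibre_energy :: "real^'n \<Rightarrow> ennreal" where
  "fibre_energy x = (\<integral>\<^sup>+y\<in>{0<..}. ennreal (W (x, y) * (norm (g (x, y)))\<^sup>2) \<partial>lborel)"

lemma fibre_energy_measurable[measurable]: "fibre_energy \<in> borel_measurable borel"
  unfolding fibre_energy_def[abs_def] by measurable

lemma nn_integral_fibre_energy:
  "(\<integral>\<^sup>+x\<in>cube. fibre_energy x \<partial>lborel) = (\<integral>\<^sup>+p\<in>cylinder. ennreal (W p * (norm (g p))\<^sup>2) \<partial>lborel)"
  unfolding fibre_energy_def by (rule nn_integral_cylinder[symmetric]) measurable

text \<open>
  The Cauchy-Schwarz inequality on the vertical segment, split as \<open>sqrt W * norm \<nabla>f\<close> times
  \<open>1 / sqrt W\<close>. The integral of \<open>1 / W\<close> over the segment is \<open>y powr (2 * s x) / (2 * s x * G x)\<close>.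
\<close>

lemma vertical_increment:
  assumes y: "0 < y"
  shows "ennreal (2 * s x * G x * (f (x, y) - f (x, 0))\<^sup>2) \<le> ennreal (y powr (2 * s x)) * fibre_energy x"
proof -
  let ?c = "2 * s x * G x"
  have c: "0 < ?c" using s_pos G_pos by simp
  have "ennreal \<bar>f (x, y) - f (x, 0)\<bar> \<le> (\<integral>\<^sup>+r\<in>{0..y}. ennreal (norm (g (x, r))) \<partial>lborel)"
    using increment_along_line[OF f, of 0 y "(x, 0)" "(0, 1)"] y by (simp add: norm_Pair)
  also have "\<dots> = (\<integral>\<^sup>+r. ennreal (sqrt (W (x, r)) * norm (g (x, r))) * indicator {0..y} r *
      (ennreal (inverse (sqrt (W (x, r)))) * indicator {0..y} r) \<partial>lborel)"
  proof (rule nn_integral_cong_AE)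
    show "AE r in lborel. ennreal (norm (g (x, r))) * indicator {0..y} r =
      ennreal (sqrt (W (x, r)) * norm (g (x, r))) * indicator {0..y} r * (ennreal (inverse (sqrt (W (x, r)))) * indicator {0..y} r)"
      using AE_lborel_singleton[of 0]
    proof eventually_elim
      fix r :: real assume "r \<noteq> 0"
      then show "ennreal (norm (g (x, r))) * indicator {0..y} r =
        ennreal (sqrt (W (x, r)) * norm (g (x, r))) * indicator {0..y} r * (ennreal (inverse (sqrt (W (x, r)))) * indicator {0..y} r)"
        using W_pos[of r x] by (cases "r \<in> {0..y}") (auto simp: ennreal_mult[symmetric])
    qed
  qed
  finally have "(ennreal \<bar>f (x, y) - f (x, 0)\<bar>)\<^sup>2 \<le> (\<integral>\<^sup>+r. ennreal (sqrt (W (x, r)) * norm (g (x, r))) * indicator {0..y} r *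
      (ennreal (inverse (sqrt (W (x, r)))) * indicator {0..y} r) \<partial>lborel)\<^sup>2"
    by (rule power_mono) simp
  also have "\<dots> \<le> (\<integral>\<^sup>+r. (ennreal (sqrt (W (x, r)) * norm (g (x, r))) * indicator {0..y} r)\<^sup>2 \<partial>lborel) *
      (\<integral>\<^sup>+r. (ennreal (inverse (sqrt (W (x, r)))) * indicator {0..y} r)\<^sup>2 \<partial>lborel)"
    by (rule Cauchy_Schwarz_nn_integral) measurable
  also have "(\<integral>\<^sup>+r. (ennreal (inverse (sqrt (W (x, r)))) * indicator {0..y} r)\<^sup>2 \<partial>lborel) = ennreal (y powr (2 * s x) / ?c)"
  proof -
    have "((\<lambda>r. r powr (2 * s x - 1)) has_integral (y powr (2 * s x - 1 + 1) / (2 * s x - 1 + 1))) {0..y}"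
      using s_pos[of x] y by (intro has_integral_powr_from_0) auto
    then have "((\<lambda>r. inverse (G x) * r powr (2 * s x - 1)) has_integral inverse (G x) * (y powr (2 * s x - 1 + 1) / (2 * s x - 1 + 1))) {0..y}"
      by (rule has_integral_mult_right)
    then have "((\<lambda>r. if r \<in> {0..y} then inverse (G x) * r powr (2 * s x - 1) else 0) has_integral (y powr (2 * s x) / ?c)) UNIV"
      by (subst has_integral_restrict_UNIV) (simp add: field_simps)
    then have "(\<integral>\<^sup>+r. ennreal (if r \<in> {0..y} then inverse (G x) * r powr (2 * s x - 1) else 0) \<partial>lborel) = ennreal (y powr (2 * s x) / ?c)"
      using G_pos[of x] by (intro nn_integral_has_integral_lborel) auto
    moreover have "(ennreal (inverse (sqrt (W (x, r)))) * indicator {0..y} r)\<^sup>2 =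
        ennreal (if r \<in> {0..y} then inverse (G x) * r powr (2 * s x - 1) else 0)" for r
    proof (cases "r \<in> {0..y}")
      case True
      then have "(inverse (sqrt (W (x, r))))\<^sup>2 = inverse (W (x, r))"
        using G_pos[of x] by (simp add: power_inverse W_eq)
      also have "\<dots> = inverse (G x) * r powr (2 * s x - 1)"
        using powr_minus[of r "1 - 2 * s x"] by (simp add: W_eq)
      finally have e: "(inverse (sqrt (W (x, r))))\<^sup>2 = inverse (G x) * r powr (2 * s x - 1)" .
      have "0 \<le> inverse (sqrt (W (x, r)))" using G_pos[of x] by (simp add: W_eq less_imp_le)
      then show ?thesis using True e by (simp add: ennreal_power)
    qed auto
    ultimately show ?thesis by simp
  qed
  also have "(\<integral>\<^sup>+r. (ennreal (sqrt (W (x, r)) * norm (g (x, r))) * indicator {0..y} r)\<^sup>2 \<partial>lborel) \<le> fibre_energy x"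
    unfolding fibre_energy_def
  proof (rule nn_integral_mono_AE)
    show "AE r in lborel. (ennreal (sqrt (W (x, r)) * norm (g (x, r))) * indicator {0..y} r)\<^sup>2 \<le>
      ennreal (W (x, r) * (norm (g (x, r)))\<^sup>2) * indicator {0<..} r"
      using AE_lborel_singleton[of 0]
    proof eventually_elim
      fix r :: real assume "r \<noteq> 0"
      then show "(ennreal (sqrt (W (x, r)) * norm (g (x, r))) * indicator {0..y} r)\<^sup>2 \<le>
        ennreal (W (x, r) * (norm (g (x, r)))\<^sup>2) * indicator {0<..} r"
        using W_pos[of r x] by (cases "r \<in> {0..y}") (auto simp: ennreal_power power_mult_distrib less_imp_le)
    qed
  qed
  finally have "ennreal ((f (x, y) - f (x, 0))\<^sup>2) \<le> fibre_energy x * ennreal (y powr (2 * s x) / ?c)"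
    by (simp add: ennreal_power mult_right_mono)
  then have "ennreal ?c * ennreal ((f (x, y) - f (x, 0))\<^sup>2) \<le> ennreal ?c * (fibre_energy x * ennreal (y powr (2 * s x) / ?c))"
    by (rule mult_left_mono) simp
  also have "\<dots> = ennreal (?c * (y powr (2 * s x) / ?c)) * fibre_energy x"
    using c by (subst ennreal_mult) (auto simp: ac_simps)
  also have "?c * (y powr (2 * s x) / ?c) = y powr (2 * s x)" using less_imp_neq[OF s_pos[of x]] less_imp_neq[OF G_pos[of x]] by simp
  finally show ?thesis using c by (simp add: ennreal_mult[symmetric] less_imp_le)
qed

text \<open>
  Comparison of the value at height \<open>0\<close> with the value at height \<open>y < 1\<close>. The factor \<open>2 * s\<close> from the
  integral of \<open>1 / w\<close> is absorbed by the weight \<open>(2 * s)\<^sup>2\<close>, which makes the bound uniform in \<open>s\<close>.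
\<close>

lemma trace_pointwise:
  assumes y: "0 < y" "y < 1"
  shows "ennreal y * ennreal (w_tilde s G x * (f (x, 0))\<^sup>2)
    \<le> 8 * ennreal (W (x, y) * (f (x, y))\<^sup>2) + 4 * (ennreal y * fibre_energy x)"
proof -
  let ?a = "f (x, 0)" and ?b = "f (x, y)"
  have s: "0 < s x" "s x \<le> 1" "0 < G x" using s_pos s_le G_pos by auto
  have s2: "(2 * s x)\<^sup>2 \<le> 4" using power_mono[of "2 * s x" 2 2] s by simp
  have "y powr 1 \<le> y powr (1 - 2 * s x)" using y s by (intro powr_mono') auto
  then have Wy: "G x * y \<le> W (x, y)" using s y by (simp add: W_eq)
  have W0: "0 < W (x, y)" by (rule W_pos[OF y(1)])
  have "y * (w_tilde s G x * ?a\<^sup>2) = (G x * y) * ((2 * s x)\<^sup>2 * ?a\<^sup>2)" by (simp add: w_tilde_def)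
  also have "\<dots> \<le> W (x, y) * ((2 * s x)\<^sup>2 * ?a\<^sup>2)" by (rule mult_right_mono[OF Wy]) simp
  also have "\<dots> \<le> W (x, y) * ((2 * s x)\<^sup>2 * (2 * ?b\<^sup>2 + 2 * (?b - ?a)\<^sup>2))"
  proof -
    have "0 \<le> (?a - 2 * ?b)\<^sup>2" by simp
    then have "?a\<^sup>2 \<le> 2 * ?b\<^sup>2 + 2 * (?b - ?a)\<^sup>2" by (simp add: power2_eq_square algebra_simps)
    then show ?thesis using W0 by (intro mult_left_mono) auto
  qed
  also have "\<dots> = 2 * ((2 * s x)\<^sup>2 * (W (x, y) * ?b\<^sup>2)) + 2 * (W (x, y) * (2 * s x)\<^sup>2 * (?b - ?a)\<^sup>2)"
    by (simp add: algebra_simps)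
  also have "\<dots> \<le> 2 * (4 * (W (x, y) * ?b\<^sup>2)) + 2 * (y powr (1 - 2 * s x) * 2 * (2 * s x * G x * (?b - ?a)\<^sup>2))"
  proof (intro add_mono mult_left_mono)
    show "(2 * s x)\<^sup>2 * (W (x, y) * ?b\<^sup>2) \<le> 4 * (W (x, y) * ?b\<^sup>2)" using s2 W0 by (intro mult_right_mono) auto
    have "W (x, y) * (2 * s x)\<^sup>2 * (?b - ?a)\<^sup>2 = y powr (1 - 2 * s x) * (2 * s x) * (2 * s x * G x * (?b - ?a)\<^sup>2)"
      by (simp add: W_eq power2_eq_square)
    also have "\<dots> \<le> y powr (1 - 2 * s x) * 2 * (2 * s x * G x * (?b - ?a)\<^sup>2)"
      using s by (intro mult_right_mono mult_left_mono) auto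
    finally show "W (x, y) * (2 * s x)\<^sup>2 * (?b - ?a)\<^sup>2 \<le> y powr (1 - 2 * s x) * 2 * (2 * s x * G x * (?b - ?a)\<^sup>2)" .
  qed auto
  finally have "ennreal (y * (w_tilde s G x * ?a\<^sup>2)) \<le>
      ennreal (8 * (W (x, y) * ?b\<^sup>2) + (4 * y powr (1 - 2 * s x)) * (2 * s x * G x * (?b - ?a)\<^sup>2))"
    by (intro ennreal_leI) simp
  also have "\<dots> = 8 * ennreal (W (x, y) * ?b\<^sup>2) + ennreal (4 * y powr (1 - 2 * s x)) * ennreal (2 * s x * G x * (?b - ?a)\<^sup>2)"
  proof -
    have "ennreal (8 * (W (x, y) * ?b\<^sup>2)) = 8 * ennreal (W (x, y) * ?b\<^sup>2)"
      using W0 by (subst ennreal_mult) auto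
    moreover have "ennreal ((4 * y powr (1 - 2 * s x)) * (2 * s x * G x * (?b - ?a)\<^sup>2)) =
      ennreal (4 * y powr (1 - 2 * s x)) * ennreal (2 * s x * G x * (?b - ?a)\<^sup>2)"
      using s by (intro ennreal_mult) auto
    ultimately show ?thesis using s W0 by (subst ennreal_plus) auto
  qed
  also have "\<dots> \<le> 8 * ennreal (W (x, y) * ?b\<^sup>2) + ennreal (4 * y powr (1 - 2 * s x)) * (ennreal (y powr (2 * s x)) * fibre_energy x)"
    by (intro add_left_mono mult_left_mono vertical_increment y) simp
  also have "ennreal (4 * y powr (1 - 2 * s x)) * (ennreal (y powr (2 * s x)) * fibre_energy x) = 4 * (ennreal y * fibre_energy x)"
  proof -
    have "y powr (1 - 2 * s x) * y powr (2 * s x) = y" using y by (simp add: powr_add[symmetric])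
    then have "ennreal (4 * y powr (1 - 2 * s x)) * ennreal (y powr (2 * s x)) = 4 * ennreal y"
      using y by (simp add: ennreal_mult[symmetric] mult.assoc) (simp add: ennreal_mult)
    then show ?thesis by (simp add: mult.assoc[symmetric])
  qed
  also have "ennreal (y * (w_tilde s G x * ?a\<^sup>2)) = ennreal y * ennreal (w_tilde s G x * ?a\<^sup>2)"
    using y s by (intro ennreal_mult) (auto simp: w_tilde_def)
  finally show ?thesis .
qed

lemma nn_integral_id_unit: "(\<integral>\<^sup>+y\<in>{0<..<1}. ennreal y \<partial>lborel) = ennreal (1 / 2)"
proof -
  have "((\<lambda>y. y) has_integral (1 powr (1 + 1) / (1 + 1))) {0..1::real}"
    by (rule has_integral_eq[OF _ has_integral_powr_from_0]) auto
  then have "((\<lambda>y. if y \<in> {0..1} then y else 0) has_integral (1 / 2 :: real)) UNIV"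
    by (subst has_integral_restrict_UNIV) simp
  then have "(\<integral>\<^sup>+y. ennreal (if y \<in> {0..1::real} then y else 0) \<partial>lborel) = ennreal (1 / 2)"
    by (intro nn_integral_has_integral_lborel) auto
  moreover have "(\<integral>\<^sup>+y. ennreal (if y \<in> {0..1::real} then y else 0) \<partial>lborel) = (\<integral>\<^sup>+y\<in>{0<..<1}. ennreal y \<partial>lborel)"
    by (intro nn_integral_cong_AE)
      (use AE_lborel_singleton[of 1] in \<open>auto elim!: eventually_mono simp: indicator_def\<close>)
  ultimately show ?thesis by simp
qed

text \<open>
  The pointwise comparison is integrated over the heights between \<open>0\<close> and \<open>1\<close>.
\<close>

lemma trace_L2_bound:
  "(\<integral>\<^sup>+x\<in>cube. ennreal (w_tilde s G x * (f (x, 0))\<^sup>2) \<partial>lborel) \<le>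
    16 * (\<integral>\<^sup>+p\<in>cylinder. ennreal (W p * (f p)\<^sup>2) \<partial>lborel) + 4 * (\<integral>\<^sup>+p\<in>cylinder. ennreal (W p * (norm (g p))\<^sup>2) \<partial>lborel)"
proof -
  define M where "M x = (\<integral>\<^sup>+y\<in>{0<..}. ennreal (W (x, y) * (f (x, y))\<^sup>2) \<partial>lborel)" for x
  have [measurable]: "M \<in> borel_measurable borel" unfolding M_def[abs_def] by measurable
  have "ennreal (w_tilde s G x * (f (x, 0))\<^sup>2) \<le> 16 * M x + 4 * fibre_energy x" for x
  proof -
    define half where "half = ennreal (1 / 2)"
    have u: "(\<integral>\<^sup>+y\<in>{0<..<1}. ennreal y \<partial>lborel) = half" by (simp only: half_def nn_integral_id_unit)
    have "2 * half = ennreal (2 * (1 / 2))" unfolding half_def by (subst ennreal_mult) auto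
    then have h: "2 * half = 1" by simp
    have "half * ennreal (w_tilde s G x * (f (x, 0))\<^sup>2) = (\<integral>\<^sup>+y. (ennreal y * indicator {0<..<1} y) * ennreal (w_tilde s G x * (f (x, 0))\<^sup>2) \<partial>lborel)"
      using u by (subst nn_integral_multc) auto
    also have "\<dots> \<le> (\<integral>\<^sup>+y. 8 * (ennreal (W (x, y) * (f (x, y))\<^sup>2) * indicator {0<..} y) + 4 * ((ennreal y * indicator {0<..<1} y) * fibre_energy x) \<partial>lborel)"
    proof (rule nn_integral_mono)
      fix y :: real
      show "(ennreal y * indicator {0<..<1} y) * ennreal (w_tilde s G x * (f (x, 0))\<^sup>2) \<le>
        8 * (ennreal (W (x, y) * (f (x, y))\<^sup>2) * indicator {0<..} y) + 4 * ((ennreal y * indicator {0<..<1} y) * fibre_energy x)"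
        using trace_pointwise[of y x] by (cases "y \<in> {0<..<1}") auto
    qed
    also have "\<dots> = 8 * M x + 4 * (half * fibre_energy x)"
      using u unfolding M_def
      by (subst nn_integral_add) (auto simp: nn_integral_cmult nn_integral_multc)
    finally have "2 * (half * ennreal (w_tilde s G x * (f (x, 0))\<^sup>2)) \<le> 2 * (8 * M x + 4 * (half * fibre_energy x))"
      by (rule mult_left_mono) simp
    moreover have "2 * (half * a) = a" for a by (simp only: mult.assoc[symmetric] h mult_1_left)
    moreover have "2 * (8 * M x + 4 * (half * fibre_energy x)) = 16 * M x + 4 * (2 * (half * fibre_energy x))"
      by (simp add: distrib_left mult.assoc[symmetric])
    ultimately show ?thesis by (simp only:)
  qed
  then have "(\<integral>\<^sup>+x\<in>cube. ennreal (w_tilde s G x * (f (x, 0))\<^sup>2) \<partial>lborel) \<le> (\<integral>\<^sup>+x. 16 * (M x * indicator cube x) + 4 * (fibre_energy x * indicator cube x) \<partial>lborel)"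
    by (intro nn_integral_mono) (auto simp: indicator_def)
  also have "\<dots> = 16 * (\<integral>\<^sup>+x\<in>cube. M x \<partial>lborel) + 4 * (\<integral>\<^sup>+x\<in>cube. fibre_energy x \<partial>lborel)"
    by (subst nn_integral_add) (auto simp: nn_integral_cmult)
  also have "(\<integral>\<^sup>+x\<in>cube. M x \<partial>lborel) = (\<integral>\<^sup>+p\<in>cylinder. ennreal (W p * (f p)\<^sup>2) \<partial>lborel)"
    unfolding M_def by (rule nn_integral_cylinder[symmetric]) measurable
  finally show ?thesis by (simp add: nn_integral_fibre_energy)
qed

text \<open>
  The weight \<open>psi_weight\<close> belongs to the vertical segment from \<open>(x, 0)\<close> to \<open>(x, \<bar>x $ i - \<tau>\<bar>)\<close>,
  parametrised by \<open>\<tau>\<close>; along it \<open>Phi\<close> is the weight of the cylinder.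
\<close>

lemma vertical_hardy:
  assumes x: "x $ i \<in> {0<..<1}"
  shows "(\<integral>\<^sup>+\<tau>\<in>{0<..<1}. psi_weight s G i x \<tau> * ennreal (\<bar>f (x, 0) - f (x, \<bar>x $ i - \<tau>\<bar>)\<bar>\<^sup>2) \<partial>lborel) \<le> 12 * fibre_energy x"
proof -
  let ?a = "x $ i" and ?\<Phi> = "\<lambda>\<tau>. Phi s G i x \<tau>" and ?h = "\<lambda>\<tau>. ennreal (norm (g (x, \<bar>x $ i - \<tau>\<bar>)))"
  have inc: "ennreal \<bar>f (x, 0) - f (x, \<bar>?a - \<tau>\<bar>)\<bar> \<le> (\<integral>\<^sup>+r\<in>{min ?a \<tau>..max ?a \<tau>}. ?h r \<partial>lborel)" for \<tau>
  proof (cases "?a \<le> \<tau>")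
    case True
    have "ennreal \<bar>f (x, 0) - f (x, \<bar>?a - \<tau>\<bar>)\<bar> \<le> (\<integral>\<^sup>+r\<in>{?a..\<tau>}. ennreal (norm (g (x, r - ?a))) \<partial>lborel)"
      using increment_along_line[OF f True, of "(x, - ?a)" "(0, 1)"] True by (simp add: norm_Pair abs_minus_commute)
    also have "\<dots> = (\<integral>\<^sup>+r\<in>{min ?a \<tau>..max ?a \<tau>}. ?h r \<partial>lborel)"
      using True by (intro nn_integral_cong) (auto simp: indicator_def)
    finally show ?thesis .
  next
    case False
    then have le: "\<tau> \<le> ?a" by simp
    have "ennreal \<bar>f (x, 0) - f (x, \<bar>?a - \<tau>\<bar>)\<bar> \<le> (\<integral>\<^sup>+r\<in>{\<tau>..?a}. ennreal (norm (g (x, ?a - r))) \<partial>lborel)"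
      using increment_along_line[OF f le, of "(x, ?a)" "(0, -1)"] le by (simp add: norm_Pair)
    also have "\<dots> = (\<integral>\<^sup>+r\<in>{min ?a \<tau>..max ?a \<tau>}. ?h r \<partial>lborel)"
      using le by (intro nn_integral_cong) (auto simp: indicator_def)
    finally show ?thesis .
  qed
  have "(\<integral>\<^sup>+\<tau>\<in>{0<..<1}. psi_weight s G i x \<tau> * ennreal (\<bar>f (x, 0) - f (x, \<bar>?a - \<tau>\<bar>)\<bar>\<^sup>2) \<partial>lborel) \<le>
      6 * (\<integral>\<^sup>+t\<in>{0<..<1}. ennreal (?\<Phi> t) * (?h t)\<^sup>2 \<partial>lborel)"
    unfolding psi_weight_def by (rule hardy_increment[OF x _ _ _ inc]) (auto simp: Phi_pos)
  also have "(\<integral>\<^sup>+t\<in>{0<..<1}. ennreal (?\<Phi> t) * (?h t)\<^sup>2 \<partial>lborel) =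
      (\<integral>\<^sup>+t\<in>{0<..<1}. ennreal (W (x, \<bar>?a - t\<bar>) * (norm (g (x, \<bar>?a - t\<bar>)))\<^sup>2) \<partial>lborel)"
    by (intro nn_integral_cong) (simp add: Phi_eq_W ennreal_power ennreal_mult'')
  also have "\<dots> \<le> 2 * fibre_energy x"
    unfolding fibre_energy_def by (rule nn_integral_fold_abs) measurable
  finally show ?thesis by (simp add: mult_left_mono mult.assoc[symmetric])
qed

text \<open>
  The weight \<open>phi_weight\<close> belongs to the diagonal segment from the base point with \<open>i\<close>-th coordinate
  \<open>\<tau>\<close> to the endpoint of the vertical segment; its direction has length \<open>sqrt 2\<close>.
\<close>

lemma diagonal_hardy:
  assumes \<tau>: "\<tau> \<in> {0<..<1}"
  shows "(\<integral>\<^sup>+t\<in>{0<..<1}. phi_weight s G i (set_coord i z t) \<tau> *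
      ennreal (\<bar>f (set_coord i z t, \<bar>t - \<tau>\<bar>) - f (set_coord i z \<tau>, 0)\<bar>\<^sup>2) \<partial>lborel)
    \<le> 12 * (\<integral>\<^sup>+t\<in>{0<..<1}. ennreal (W (set_coord i z t, \<bar>t - \<tau>\<bar>) * (norm (g (set_coord i z t, \<bar>t - \<tau>\<bar>)))\<^sup>2) \<partial>lborel)"
proof -
  let ?p = "\<lambda>t. (set_coord i z t, \<bar>t - \<tau>\<bar>)"
  let ?\<Phi> = "\<lambda>t. Phi s G i (set_coord i z t) \<tau>" and ?h = "\<lambda>t. ennreal (sqrt 2 * norm (g (?p t)))"
  have [measurable]: "(\<lambda>t. set_coord i z t) \<in> borel_measurable borel"
  proof -
    have "(\<lambda>t. set_coord i z t) = (\<lambda>t. set_coord i z 0 + t *\<^sub>R axis i 1)" by (rule ext) (rule set_coord_line)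
    then show ?thesis by (rule ssubst) measurable
  qed
  have inc: "ennreal \<bar>f (?p t) - f (set_coord i z \<tau>, 0)\<bar> \<le> (\<integral>\<^sup>+r\<in>{min \<tau> t..max \<tau> t}. ?h r \<partial>lborel)" for t
  proof (cases "\<tau> \<le> t")
    case True
    have e: "(set_coord i z 0, - \<tau>) + r *\<^sub>R (axis i 1, 1) = (set_coord i z r, r - \<tau>)" for r
      by (simp add: set_coord_line[of i z r])
    have "ennreal \<bar>f (?p t) - f (set_coord i z \<tau>, 0)\<bar> \<le> (\<integral>\<^sup>+r\<in>{\<tau>..t}. ennreal (sqrt 2 * norm (g (set_coord i z r, r - \<tau>))) \<partial>lborel)"
      using increment_along_line[OF f True, of "(set_coord i z 0, - \<tau>)" "(axis i 1, 1)"] True unfolding e by (simp add: norm_Pair)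
    also have "\<dots> = (\<integral>\<^sup>+r\<in>{min \<tau> t..max \<tau> t}. ?h r \<partial>lborel)"
      using True by (intro nn_integral_cong) (auto simp: indicator_def)
    finally show ?thesis .
  next
    case False
    then have le: "t \<le> \<tau>" by simp
    have e: "(set_coord i z 0, \<tau>) + r *\<^sub>R (axis i 1, - 1) = (set_coord i z r, \<tau> - r)" for r
      by (simp add: set_coord_line[of i z r])
    have "ennreal \<bar>f (?p t) - f (set_coord i z \<tau>, 0)\<bar> \<le> (\<integral>\<^sup>+r\<in>{t..\<tau>}. ennreal (sqrt 2 * norm (g (set_coord i z r, \<tau> - r))) \<partial>lborel)"
      using increment_along_line[OF f le, of "(set_coord i z 0, \<tau>)" "(axis i 1, - 1)"] le unfolding e
      by (simp add: norm_Pair abs_minus_commute)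
    also have "\<dots> = (\<integral>\<^sup>+r\<in>{min \<tau> t..max \<tau> t}. ?h r \<partial>lborel)"
      using le by (intro nn_integral_cong) (auto simp: indicator_def)
    finally show ?thesis .
  qed
  have w: "phi_weight s G i (set_coord i z t) \<tau> = inverse (ennreal (?\<Phi> t)) *
      (inverse (\<integral>\<^sup>+r\<in>{min \<tau> t..max \<tau> t}. inverse (ennreal (?\<Phi> r)) \<partial>lborel))\<^sup>2" for t
    by (simp add: phi_weight_def set_coord_set_coord set_coord_nth min.commute max.commute)
  have "(\<integral>\<^sup>+t\<in>{0<..<1}. phi_weight s G i (set_coord i z t) \<tau> * ennreal (\<bar>f (?p t) - f (set_coord i z \<tau>, 0)\<bar>\<^sup>2) \<partial>lborel) \<le>
      6 * (\<integral>\<^sup>+t\<in>{0<..<1}. ennreal (?\<Phi> t) * (?h t)\<^sup>2 \<partial>lborel)"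
    unfolding w by (rule hardy_increment[OF \<tau> _ _ _ inc]) (auto simp: Phi_pos set_coord_nth)
  also have "(\<integral>\<^sup>+t\<in>{0<..<1}. ennreal (?\<Phi> t) * (?h t)\<^sup>2 \<partial>lborel) =
      (\<integral>\<^sup>+t. 2 * (ennreal (W (?p t) * (norm (g (?p t)))\<^sup>2) * indicator {0<..<1} t) \<partial>lborel)"
  proof (rule nn_integral_cong)
    fix t
    have "(?h t)\<^sup>2 = 2 * ennreal ((norm (g (?p t)))\<^sup>2)"
      by (simp add: ennreal_power power_mult_distrib ennreal_mult)
    then show "ennreal (?\<Phi> t) * (?h t)\<^sup>2 * indicator {0<..<1} t = 2 * (ennreal (W (?p t) * (norm (g (?p t)))\<^sup>2) * indicator {0<..<1} t)"
      by (simp add: Phi_eq_W set_coord_nth ennreal_mult'' ac_simps)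
  qed
  also have "\<dots> = 2 * (\<integral>\<^sup>+t\<in>{0<..<1}. ennreal (W (?p t) * (norm (g (?p t)))\<^sup>2) \<partial>lborel)"
    by (rule nn_integral_cmult) measurable
  finally show ?thesis by (simp add: mult.assoc[symmetric])
qed

text \<open>
  The increment is split at the corner of the path, at height \<open>\<bar>t - \<tau>\<bar>\<close> over the first base point. In the vertical part \<open>t\<close> is the anchor
  of Hardy's inequality, in the diagonal part it is \<open>\<tau>\<close>, so there the integrals are exchanged before and
  after.
\<close>

lemma trace_slice_bound:
  assumes z: "z \<in> space (other_coords i)"
  shows "(\<integral>\<^sup>+t\<in>{0<..<1}. (\<integral>\<^sup>+\<tau>\<in>{0<..<1}. w_coord s G i (set_coord i z t) \<tau> *
      ennreal (\<bar>f (set_coord i z t, 0) - f (set_coord i z \<tau>, 0)\<bar>\<^sup>2) \<partial>lborel) \<partial>lborel)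
    \<le> 72 * (\<integral>\<^sup>+t\<in>{0<..<1}. fibre_energy (set_coord i z t) \<partial>lborel)"
proof -
  let ?x = "set_coord i z" and ?I = "indicator {0<..<1} :: real \<Rightarrow> ennreal"
  have [measurable]: "(\<lambda>_. z) \<in> measurable M (other_coords i)" for M :: "'x measure" using z by (rule measurable_const)
  have [measurable]: "(\<lambda>_. z) \<in> measurable M (other_coords i)" for M :: "real measure" using z by (rule measurable_const)
  have [measurable]: "(\<lambda>_. z) \<in> measurable M (other_coords i)" for M :: "(real \<times> real) measure" using z by (rule measurable_const)
  \<comment> \<open>vertical part, diagonal part, and the energy density at the corner of the path\<close>
  let ?V = "\<lambda>t \<tau>. psi_weight s G i (?x t) \<tau> * ennreal (\<bar>f (?x t, 0) - f (?x t, \<bar>t - \<tau>\<bar>)\<bar>\<^sup>2)"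
  let ?D = "\<lambda>t \<tau>. phi_weight s G i (?x t) \<tau> * ennreal (\<bar>f (?x t, \<bar>t - \<tau>\<bar>) - f (?x \<tau>, 0)\<bar>\<^sup>2)"
  let ?K = "\<lambda>t \<tau>. ennreal (W (?x t, \<bar>t - \<tau>\<bar>) * (norm (g (?x t, \<bar>t - \<tau>\<bar>)))\<^sup>2)"
  have split: "w_coord s G i (?x t) \<tau> * ennreal (\<bar>f (?x t, 0) - f (?x \<tau>, 0)\<bar>\<^sup>2) \<le> 2 * ?V t \<tau> + 2 * ?D t \<tau>" for t \<tau>
  proof -
    let ?a = "f (?x t, 0) - f (?x t, \<bar>t - \<tau>\<bar>)" and ?b = "f (?x t, \<bar>t - \<tau>\<bar>) - f (?x \<tau>, 0)"
    have "(?a + ?b)\<^sup>2 \<le> 2 * ?a\<^sup>2 + 2 * ?b\<^sup>2" by (rule square_sum_le)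
    then have "ennreal (\<bar>f (?x t, 0) - f (?x \<tau>, 0)\<bar>\<^sup>2) \<le> ennreal (2 * \<bar>?a\<bar>\<^sup>2 + 2 * \<bar>?b\<bar>\<^sup>2)"
      by (intro ennreal_leI) simp
    also have "\<dots> = 2 * ennreal (\<bar>?a\<bar>\<^sup>2) + 2 * ennreal (\<bar>?b\<bar>\<^sup>2)"
      by (subst ennreal_plus) (auto simp: ennreal_mult simp del: power2_abs)
    finally have "w_coord s G i (?x t) \<tau> * ennreal (\<bar>f (?x t, 0) - f (?x \<tau>, 0)\<bar>\<^sup>2) \<le>
      w_coord s G i (?x t) \<tau> * (2 * ennreal (\<bar>?a\<bar>\<^sup>2) + 2 * ennreal (\<bar>?b\<bar>\<^sup>2))" by (rule mult_left_mono) simp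
    also have "\<dots> = 2 * (w_coord s G i (?x t) \<tau> * ennreal (\<bar>?a\<bar>\<^sup>2)) + 2 * (w_coord s G i (?x t) \<tau> * ennreal (\<bar>?b\<bar>\<^sup>2))"
      by (simp only: distrib_left ac_simps)
    also have "\<dots> \<le> 2 * ?V t \<tau> + 2 * ?D t \<tau>"
      by (intro add_mono mult_left_mono mult_right_mono) (auto simp: w_coord_def)
    finally show ?thesis .
  qed
  have V: "(\<integral>\<^sup>+\<tau>. ?V t \<tau> * ?I \<tau> \<partial>lborel) * ?I t \<le> 12 * (fibre_energy (?x t) * ?I t)" for t
    using vertical_hardy[of "?x t" i] by (cases "t \<in> {0<..<1}") (auto simp: set_coord_nth)
  have "(\<integral>\<^sup>+t. (\<integral>\<^sup>+\<tau>. ?D t \<tau> * ?I \<tau> \<partial>lborel) * ?I t \<partial>lborel) = (\<integral>\<^sup>+t. \<integral>\<^sup>+\<tau>. ?D t \<tau> * ?I \<tau> * ?I t \<partial>lborel \<partial>lborel)"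
    by (intro nn_integral_cong nn_integral_multc[symmetric]) measurable
  also have "\<dots> = (\<integral>\<^sup>+\<tau>. \<integral>\<^sup>+t. ?D t \<tau> * ?I \<tau> * ?I t \<partial>lborel \<partial>lborel)"
    by (rule lborel_pair.Fubini'[symmetric]) measurable
  also have "\<dots> = (\<integral>\<^sup>+\<tau>. (\<integral>\<^sup>+t. ?D t \<tau> * ?I t \<partial>lborel) * ?I \<tau> \<partial>lborel)"
    by (subst nn_integral_multc[symmetric]) (auto intro!: nn_integral_cong simp: ac_simps)
  also have "\<dots> \<le> (\<integral>\<^sup>+\<tau>. 12 * ((\<integral>\<^sup>+t. ?K t \<tau> * ?I t \<partial>lborel) * ?I \<tau>) \<partial>lborel)"
  proof (rule nn_integral_mono)
    fix \<tau>
    show "(\<integral>\<^sup>+t. ?D t \<tau> * ?I t \<partial>lborel) * ?I \<tau> \<le> 12 * ((\<integral>\<^sup>+t. ?K t \<tau> * ?I t \<partial>lborel) * ?I \<tau>)"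
      using diagonal_hardy[of \<tau> i z] by (cases "\<tau> \<in> {0<..<1}") auto
  qed
  also have "\<dots> = 12 * (\<integral>\<^sup>+\<tau>. \<integral>\<^sup>+t. ?K t \<tau> * ?I t * ?I \<tau> \<partial>lborel \<partial>lborel)"
    by (subst nn_integral_cmult[symmetric]) (auto intro!: nn_integral_cong simp: nn_integral_multc)
  also have "(\<integral>\<^sup>+\<tau>. \<integral>\<^sup>+t. ?K t \<tau> * ?I t * ?I \<tau> \<partial>lborel \<partial>lborel) = (\<integral>\<^sup>+t. \<integral>\<^sup>+\<tau>. ?K t \<tau> * ?I t * ?I \<tau> \<partial>lborel \<partial>lborel)"
    by (rule lborel_pair.Fubini') measurable
  also have "\<dots> \<le> (\<integral>\<^sup>+t. 2 * (fibre_energy (?x t) * ?I t) \<partial>lborel)"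
  proof (rule nn_integral_mono)
    fix t
    have "(\<integral>\<^sup>+\<tau>. ?K t \<tau> * ?I t * ?I \<tau> \<partial>lborel) = (\<integral>\<^sup>+\<tau>. ?K t \<tau> * ?I \<tau> \<partial>lborel) * ?I t"
      by (subst nn_integral_multc[symmetric]) (auto intro!: nn_integral_cong simp: ac_simps)
    also have "\<dots> \<le> (2 * fibre_energy (?x t)) * ?I t"
      unfolding fibre_energy_def by (intro mult_right_mono nn_integral_fold_abs[of "\<lambda>y. ennreal (W (?x t, y) * (norm (g (?x t, y)))\<^sup>2)"]) auto
    finally show "(\<integral>\<^sup>+\<tau>. ?K t \<tau> * ?I t * ?I \<tau> \<partial>lborel) \<le> 2 * (fibre_energy (?x t) * ?I t)" by (simp add: mult.assoc)
  qed
  also have "\<dots> = 2 * (\<integral>\<^sup>+t. fibre_energy (?x t) * ?I t \<partial>lborel)" by (rule nn_integral_cmult) measurable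
  finally have D: "(\<integral>\<^sup>+t. (\<integral>\<^sup>+\<tau>. ?D t \<tau> * ?I \<tau> \<partial>lborel) * ?I t \<partial>lborel) \<le> 24 * (\<integral>\<^sup>+t. fibre_energy (?x t) * ?I t \<partial>lborel)"
    by (simp add: mult_left_mono mult.assoc[symmetric])
  have "(\<integral>\<^sup>+t\<in>{0<..<1}. (\<integral>\<^sup>+\<tau>\<in>{0<..<1}. w_coord s G i (?x t) \<tau> * ennreal (\<bar>f (?x t, 0) - f (?x \<tau>, 0)\<bar>\<^sup>2) \<partial>lborel) \<partial>lborel)
    \<le> (\<integral>\<^sup>+t. 2 * ((\<integral>\<^sup>+\<tau>. ?V t \<tau> * ?I \<tau> \<partial>lborel) * ?I t) + 2 * ((\<integral>\<^sup>+\<tau>. ?D t \<tau> * ?I \<tau> \<partial>lborel) * ?I t) \<partial>lborel)"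
  proof (rule nn_integral_mono)
    fix t
    have "(\<integral>\<^sup>+\<tau>\<in>{0<..<1}. w_coord s G i (?x t) \<tau> * ennreal (\<bar>f (?x t, 0) - f (?x \<tau>, 0)\<bar>\<^sup>2) \<partial>lborel)
      \<le> (\<integral>\<^sup>+\<tau>. 2 * (?V t \<tau> * ?I \<tau>) + 2 * (?D t \<tau> * ?I \<tau>) \<partial>lborel)"
      using split by (intro nn_integral_mono) (auto simp: indicator_def)
    also have "\<dots> = 2 * (\<integral>\<^sup>+\<tau>. ?V t \<tau> * ?I \<tau> \<partial>lborel) + 2 * (\<integral>\<^sup>+\<tau>. ?D t \<tau> * ?I \<tau> \<partial>lborel)"
      by (subst nn_integral_add) (auto simp: nn_integral_cmult)
    finally show "(\<integral>\<^sup>+\<tau>\<in>{0<..<1}. w_coord s G i (?x t) \<tau> * ennreal (\<bar>f (?x t, 0) - f (?x \<tau>, 0)\<bar>\<^sup>2) \<partial>lborel) * ?I t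
      \<le> 2 * ((\<integral>\<^sup>+\<tau>. ?V t \<tau> * ?I \<tau> \<partial>lborel) * ?I t) + 2 * ((\<integral>\<^sup>+\<tau>. ?D t \<tau> * ?I \<tau> \<partial>lborel) * ?I t)"
      by (cases "t \<in> {0<..<1}") auto
  qed
  also have "\<dots> \<le> (\<integral>\<^sup>+t. 24 * (fibre_energy (?x t) * ?I t) + 2 * ((\<integral>\<^sup>+\<tau>. ?D t \<tau> * ?I \<tau> \<partial>lborel) * ?I t) \<partial>lborel)"
  proof (intro nn_integral_mono add_right_mono)
    fix t
    show "2 * ((\<integral>\<^sup>+\<tau>. ?V t \<tau> * ?I \<tau> \<partial>lborel) * ?I t) \<le> 24 * (fibre_energy (?x t) * ?I t)"
      using mult_left_mono[OF V[of t], of 2] by (simp add: mult.assoc[symmetric])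
  qed
  also have "\<dots> = 24 * (\<integral>\<^sup>+t. fibre_energy (?x t) * ?I t \<partial>lborel) + 2 * (\<integral>\<^sup>+t. (\<integral>\<^sup>+\<tau>. ?D t \<tau> * ?I \<tau> \<partial>lborel) * ?I t \<partial>lborel)"
    by (subst nn_integral_add) (auto simp: nn_integral_cmult)
  also have "\<dots> \<le> 24 * (\<integral>\<^sup>+t. fibre_energy (?x t) * ?I t \<partial>lborel) + 2 * (24 * (\<integral>\<^sup>+t. fibre_energy (?x t) * ?I t \<partial>lborel))"
    by (intro add_left_mono mult_left_mono D) simp
  also have "\<dots> = 72 * (\<integral>\<^sup>+t. fibre_energy (?x t) * ?I t \<partial>lborel)"
    by (simp add: mult.assoc[symmetric] distrib_right[symmetric])
  finally show ?thesis .
qed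

lemma trace_A_form_bound:
  "A_form s G i (\<lambda>x. f (x, 0)) \<le> 72 * (\<integral>\<^sup>+p\<in>cylinder. ennreal (W p * (norm (g p))\<^sup>2) \<partial>lborel)"
proof -
  have "A_form s G i (\<lambda>x. f (x, 0)) \<le> (\<integral>\<^sup>+z. 72 * (\<integral>\<^sup>+t\<in>{0<..<1}. fibre_energy (set_coord i z t) \<partial>lborel) \<partial>other_coords i)"
    unfolding A_form_def by (intro nn_integral_mono trace_slice_bound)
  also have "\<dots> = 72 * (\<integral>\<^sup>+z. (\<integral>\<^sup>+t\<in>{0<..<1}. fibre_energy (set_coord i z t) \<partial>lborel) \<partial>other_coords i)"
    by (rule nn_integral_cmult) measurable
  also have "\<dots> = 72 * (\<integral>\<^sup>+p\<in>cylinder. ennreal (W p * (norm (g p))\<^sup>2) \<partial>lborel)"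
    by (subst nn_integral_cube_slices) (auto simp: nn_integral_fibre_energy)
  finally show ?thesis .
qed

end

end

section \<open>Borel representatives and lines in the cube\<close>

lemma borel_representative:
  fixes f :: "'a::euclidean_space \<Rightarrow> real"
  assumes f: "f \<in> borel_measurable (lebesgue_on S)" and S: "S \<in> sets lebesgue"
  obtains f' where "f' \<in> borel_measurable borel" "AE x in lborel. x \<in> S \<longrightarrow> f x = f' x"
proof -
  have "(\<lambda>x. if x \<in> S then f x else 0) \<in> borel_measurable lebesgue"
    using f S by (simp add: borel_measurable_if)
  then obtain f' where "f' \<in> borel_measurable lborel" "AE x in lborel. (if x \<in> S then f x else 0) = f' x"
    using completion_ex_borel_measurable_real by blast
  then show thesis by (intro that[of f']) (auto elim!: eventually_mono)
qed

text \<open>Lebesgue measure is complete.\<close>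

lemma measurable_lebesgue_on_AE:
  fixes F :: "'a::euclidean_space \<Rightarrow> real"
  assumes F'[measurable]: "F' \<in> borel_measurable borel" and S[measurable]: "S \<in> sets borel"
    and eq: "AE x in lborel. x \<in> S \<longrightarrow> F x = F' x"
  shows "F \<in> borel_measurable (lebesgue_on S)"
proof -
  have m: "(\<lambda>x. indicator S x *\<^sub>R F' x) \<in> borel_measurable borel" by measurable
  have ae: "AE x in lebesgue. indicator S x *\<^sub>R F' x = indicator S x *\<^sub>R F x"
    using AE_completion[OF eq] by eventually_elim (auto simp: indicator_def)
  have "(\<lambda>x. indicator S x *\<^sub>R F x) \<in> borel_measurable lebesgue"
  proof (rule measurableI)
    fix B :: "real set" assume B: "B \<in> sets borel"
    show "(\<lambda>x. indicator S x *\<^sub>R F x) -` B \<inter> space lebesgue \<in> sets lebesgue"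
    proof (rule completion.in_sets_AE)
      show "(\<lambda>x. indicator S x *\<^sub>R F' x) -` B \<inter> space lebesgue \<in> sets lebesgue"
        using measurable_sets[OF m B] by (simp add: sets_completionI_sets)
      show "AE x in lebesgue. (x \<in> (\<lambda>x. indicator S x *\<^sub>R F' x) -` B \<inter> space lebesgue) =
          (x \<in> (\<lambda>x. indicator S x *\<^sub>R F x) -` B \<inter> space lebesgue)"
        using ae by eventually_elim auto
    qed simp
  qed simp
  then show ?thesis using S by (subst borel_measurable_restrict_space_iff) auto
qed

lemma AE_lebesgue_on_iff:
  fixes S :: "'a::euclidean_space set"
  assumes "S \<in> sets lebesgue"
  shows "(AE x in lebesgue_on S. P x) \<longleftrightarrow> (AE x in lborel. x \<in> S \<longrightarrow> P x)"
  using assms by (simp add: AE_restrict_space_iff AE_completion_iff)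

lemma nn_integral_lebesgue_on:
  fixes S :: "'a::euclidean_space set"
  assumes [measurable]: "F \<in> borel_measurable borel" and [measurable]: "S \<in> sets borel"
  shows "(\<integral>\<^sup>+x. F x \<partial>lebesgue_on S) = (\<integral>\<^sup>+x\<in>S. F x \<partial>lborel)"
proof -
  have "(\<integral>\<^sup>+x. F x \<partial>lebesgue_on S) = (\<integral>\<^sup>+x. F x * indicator S x \<partial>lebesgue)"
    by (rule nn_integral_restrict_space) simp
  also have "\<dots> = (\<integral>\<^sup>+x\<in>S. F x \<partial>lborel)" by (rule nn_integral_completion)
  finally show ?thesis .
qed

text \<open>
  By Fubini's theorem a null set of the cube meets almost every line in a null set of the line. On such a
  line the weights agree for almost every \<open>t\<close> and all \<open>\<tau>\<close>.
\<close>

lemma A_form_cong_AE: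
  assumes sG: "AE x in lborel. x \<in> cube \<longrightarrow> s x = s' x \<and> G x = G' x"
    and v: "AE x in lborel. x \<in> cube \<longrightarrow> v x = v' x"
  shows "A_form s G i v = A_form s' G' i v'"
  unfolding A_form_def
proof (rule nn_integral_cong_AE, goal_cases)
  case 1
  show ?case
    using AE_cube_slices[OF sG, of i] AE_cube_slices[OF v, of i]
  proof eventually_elim
    case z: (elim z)
    let ?x = "set_coord i z"
    have P: "AE t in lborel. t \<in> {0<..<1} \<longrightarrow> (\<forall>\<tau>. Phi s G i (?x t) \<tau> = Phi s' G' i (?x t) \<tau>)"
      using z(1) by eventually_elim (simp add: Phi_def)
    have wc: "w_coord s G i (?x t) \<tau> = w_coord s' G' i (?x t) \<tau>"
      if t: "t \<in> {0<..<1}" "\<tau> \<in> {0<..<1}" and Pt: "\<And>\<tau>. Phi s G i (?x t) \<tau> = Phi s' G' i (?x t) \<tau>" for t \<tau>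
    proof -
      have sub: "{min t \<tau>..max t \<tau>} \<subseteq> {0<..<1}" using t by (auto simp: min_def max_def split: if_splits)
      have "(\<integral>\<^sup>+t'\<in>{min t \<tau>..max t \<tau>}. inverse (ennreal (Phi s G i (?x t') \<tau>)) \<partial>lborel) =
        (\<integral>\<^sup>+t'\<in>{min t \<tau>..max t \<tau>}. inverse (ennreal (Phi s' G' i (?x t') \<tau>)) \<partial>lborel)"
      proof (rule nn_integral_cong_AE, goal_cases)
        case 1
        show ?case using P by eventually_elim (use sub in \<open>auto simp: indicator_def\<close>)
      qed
      then show ?thesis
        using Pt by (simp add: w_coord_def phi_weight_def psi_weight_def set_coord_set_coord set_coord_nth)
    qed
    show ?case
    proof (rule nn_integral_cong_AE, goal_cases)
      case 1
      show ?case
        using P z(2)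
      proof eventually_elim
        case t: (elim t)
        show ?case
        proof (cases "t \<in> {0<..<1}")
          case True
          have "AE \<tau> in lborel. w_coord s G i (?x t) \<tau> * ennreal (\<bar>v (?x t) - v (?x \<tau>)\<bar>\<^sup>2) * indicator {0<..<1} \<tau> =
              w_coord s' G' i (?x t) \<tau> * ennreal (\<bar>v' (?x t) - v' (?x \<tau>)\<bar>\<^sup>2) * indicator {0<..<1} \<tau>"
            using z(2)
          proof eventually_elim
            case \<tau>: (elim \<tau>)
            show ?case
              using wc[of t \<tau>] t \<tau> True by (cases "\<tau> \<in> {0<..<1}") auto
          qed
          from nn_integral_cong_AE[OF this] show ?thesis by simp
        qed simp
      qed
    qed
  qed
qed

lemma A_form_zero: "A_form s G i (\<lambda>_. 0) = 0"
  by (simp add: A_form_def)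

context borel_order
begin

text \<open>
  The integrand of \<open>A_form\<close> and its inner integral, as functions of the coordinates on a line.
\<close>

definition slice_density :: "(real^'n \<Rightarrow> real) \<Rightarrow> 'n \<Rightarrow> ('n \<Rightarrow> real) \<Rightarrow> real \<Rightarrow> real \<Rightarrow> ennreal" where
  "slice_density v i z t \<tau> = w_coord s G i (set_coord i z t) \<tau> *
     ennreal (\<bar>v (set_coord i z t) - v (set_coord i z \<tau>)\<bar>\<^sup>2) * indicator {0<..<1} \<tau>"

definition slice_integral :: "(real^'n \<Rightarrow> real) \<Rightarrow> 'n \<Rightarrow> ('n \<Rightarrow> real) \<Rightarrow> real \<Rightarrow> ennreal" where
  "slice_integral v i z t = (\<integral>\<^sup>+\<tau>. slice_density v i z t \<tau> \<partial>lborel) * indicator {0<..<1} t"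

lemma A_form_eq_slices: "A_form s G i v = (\<integral>\<^sup>+z. (\<integral>\<^sup>+t. slice_integral v i z t \<partial>lborel) \<partial>other_coords i)"
  by (simp add: A_form_def slice_integral_def slice_density_def)

lemma slice_density_measurable:
  assumes v: "v \<in> borel_measurable borel" and a: "a \<in> measurable M (other_coords i)"
    and t: "t \<in> borel_measurable M" and \<tau>: "\<tau> \<in> borel_measurable M"
  shows "(\<lambda>x. slice_density v i (a x) (t x) (\<tau> x)) \<in> borel_measurable M"
proof -
  have [measurable]: "(\<lambda>x. v (set_coord i (a x) (t x))) \<in> borel_measurable M" "(\<lambda>x. v (set_coord i (a x) (\<tau> x))) \<in> borel_measurable M"
    using measurable_compose[OF measurable_set_coord[OF a t] v] measurable_compose[OF measurable_set_coord[OF a \<tau>] v] by auto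
  note [measurable] = w_coord_measurable[OF a t \<tau>] \<tau>
  show ?thesis unfolding slice_density_def by measurable
qed

lemma slice_integral_measurable:
  assumes v: "v \<in> borel_measurable borel" and a: "a \<in> measurable M (other_coords i)"
    and t: "t \<in> borel_measurable M"
  shows "(\<lambda>x. slice_integral v i (a x) (t x)) \<in> borel_measurable M"
proof -
  have "(\<lambda>p. slice_density v i (a (fst p)) (t (fst p)) (snd p)) \<in> borel_measurable (M \<Otimes>\<^sub>M lborel)"
    by (intro slice_density_measurable v measurable_compose[OF measurable_fst a] measurable_compose[OF measurable_fst t]) simp
  then have "(\<lambda>x. \<integral>\<^sup>+\<tau>. slice_density v i (a x) (t x) \<tau> \<partial>lborel) \<in> borel_measurable M"
    by (intro lborel.borel_measurable_nn_integral) (simp add: split_beta')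
  then show ?thesis unfolding slice_integral_def using t by measurable
qed

text \<open>
  Fatou's lemma is applied to each of the three nested integrals. Convergence almost everywhere on the
  cube gives convergence at almost all points of almost every line.
\<close>

lemma A_form_Fatou:
  fixes b :: "nat \<Rightarrow> real^'n \<Rightarrow> real"
  assumes b: "\<And>k. b k \<in> borel_measurable borel"
    and lim: "AE x in lborel. x \<in> cube \<longrightarrow> (\<lambda>k. b k x) \<longlonglongrightarrow> v x"
  shows "A_form s G i v \<le> liminf (\<lambda>k. A_form s G i (b k))"
proof -
  let ?x = "set_coord i"
  have mult_liminf: "c * liminf a \<le> liminf (\<lambda>k. c * a k)" for c :: ennreal and a
    unfolding liminf_SUP_INF SUP_mult_left_ennreal
    by (intro SUP_mono) (auto intro!: exI INF_greatest mult_left_mono INF_lower)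
  have density: "slice_density v i z t \<tau> \<le> liminf (\<lambda>k. slice_density (b k) i z t \<tau>)"
    if t: "(\<lambda>k. b k (?x z t)) \<longlonglongrightarrow> v (?x z t)" and \<tau>: "\<tau> \<in> {0<..<1} \<longrightarrow> (\<lambda>k. b k (?x z \<tau>)) \<longlonglongrightarrow> v (?x z \<tau>)" for z t \<tau>
  proof (cases "\<tau> \<in> {0<..<1}")
    case True
    have conv: "(\<lambda>k. ennreal (\<bar>b k (?x z t) - b k (?x z \<tau>)\<bar>\<^sup>2)) \<longlonglongrightarrow> ennreal (\<bar>v (?x z t) - v (?x z \<tau>)\<bar>\<^sup>2)"
      using t \<tau> True by (intro tendsto_ennrealI tendsto_intros) auto
    have "slice_density v i z t \<tau> = w_coord s G i (?x z t) \<tau> * liminf (\<lambda>k. ennreal (\<bar>b k (?x z t) - b k (?x z \<tau>)\<bar>\<^sup>2))"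
      using True lim_imp_Liminf[OF trivial_limit_sequentially conv] by (simp add: slice_density_def)
    also have "\<dots> \<le> liminf (\<lambda>k. slice_density (b k) i z t \<tau>)"
      using mult_liminf True by (simp add: slice_density_def)
    finally show ?thesis .
  qed (simp add: slice_density_def)
  have "A_form s G i v \<le> (\<integral>\<^sup>+z. liminf (\<lambda>k. \<integral>\<^sup>+t. slice_integral (b k) i z t \<partial>lborel) \<partial>other_coords i)"
    unfolding A_form_eq_slices
  proof (rule nn_integral_mono_AE)
    show "AE z in other_coords i. (\<integral>\<^sup>+t. slice_integral v i z t \<partial>lborel) \<le> liminf (\<lambda>k. \<integral>\<^sup>+t. slice_integral (b k) i z t \<partial>lborel)"
      using AE_cube_slices[OF lim, of i] AE_space
    proof eventually_elim
      case (elim z)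
      have zc: "(\<lambda>_. z) \<in> measurable lborel (other_coords i)" using elim(2) by (rule measurable_const)
      have "(\<integral>\<^sup>+t. slice_integral v i z t \<partial>lborel) \<le> (\<integral>\<^sup>+t. liminf (\<lambda>k. slice_integral (b k) i z t) \<partial>lborel)"
      proof (rule nn_integral_mono_AE)
        show "AE t in lborel. slice_integral v i z t \<le> liminf (\<lambda>k. slice_integral (b k) i z t)"
          using elim(1)
        proof eventually_elim
          fix t assume t: "t \<in> {0<..<1} \<longrightarrow> (\<lambda>k. b k (?x z t)) \<longlonglongrightarrow> v (?x z t)"
          show "slice_integral v i z t \<le> liminf (\<lambda>k. slice_integral (b k) i z t)"
          proof (cases "t \<in> {0<..<1}")
            case True
            have "(\<integral>\<^sup>+\<tau>. slice_density v i z t \<tau> \<partial>lborel) \<le> (\<integral>\<^sup>+\<tau>. liminf (\<lambda>k. slice_density (b k) i z t \<tau>) \<partial>lborel)"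
              by (rule nn_integral_mono_AE) (use elim(1) density t True in \<open>auto elim!: eventually_mono\<close>)
            also have "\<dots> \<le> liminf (\<lambda>k. \<integral>\<^sup>+\<tau>. slice_density (b k) i z t \<tau> \<partial>lborel)"
              by (rule nn_integral_liminf) (rule slice_density_measurable[OF b zc], simp_all)
            finally show ?thesis using True by (simp add: slice_integral_def)
          qed (simp add: slice_integral_def)
        qed
      qed
      also have "\<dots> \<le> liminf (\<lambda>k. \<integral>\<^sup>+t. slice_integral (b k) i z t \<partial>lborel)"
        by (rule nn_integral_liminf) (rule slice_integral_measurable[OF b zc], simp)
      finally show ?case .
    qed
  qed
  also have "\<dots> \<le> liminf (\<lambda>k. A_form s G i (b k))"
    unfolding A_form_eq_slices
  proof (rule nn_integral_liminf)
    fix k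
    have "(\<lambda>p. slice_integral (b k) i (fst p) (snd p)) \<in> borel_measurable (other_coords i \<Otimes>\<^sub>M lborel)"
      by (rule slice_integral_measurable[OF b]) simp_all
    then show "(\<lambda>z. \<integral>\<^sup>+t. slice_integral (b k) i z t \<partial>lborel) \<in> borel_measurable (other_coords i)"
      by (intro lborel.borel_measurable_nn_integral) (simp add: split_beta')
  qed
  finally show ?thesis .
qed

end

section \<open>The weighted cylinder\<close>

text \<open>
  The base of the cylinder lies in its closure, where a smooth extension has the same values.
\<close>

lemma Cc_cylinderE:
  assumes "\<phi> \<in> Cc_cylinder"
  obtains f where "smooth_on UNIV f" "\<And>p. p \<in> cylinder \<Longrightarrow> \<phi> p = f p" "\<And>x. x \<in> cube \<Longrightarrow> \<phi> (x, 0) = f (x, 0)"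
proof -
  obtain f where f: "smooth_on UNIV f" "\<And>p. p \<in> closure cylinder \<Longrightarrow> \<phi> p = f p"
    using assms unfolding Cc_cylinder_def by blast
  have "\<phi> (x, 0) = f (x, 0)" if "x \<in> cube" for x
  proof (rule f(2))
    have "(0::real) \<in> closure {0<..}" by simp
    then show "(x, 0) \<in> closure cylinder"
      using that closure_subset[of cube] by (auto simp: cylinder_def closure_Times)
  qed
  then show thesis using that f closure_subset by blast
qed

lemma Cc_cylinder_zero: "(\<lambda>p. 0) \<in> Cc_cylinder"
  unfolding Cc_cylinder_def
  by (auto simp: smooth_on_def Ck_on_const intro!: exI[of _ "\<lambda>p. 0"] exI[of _ "{}"])

lemma Cc_cylinder_add:
  assumes "\<phi> \<in> Cc_cylinder" "\<psi> \<in> Cc_cylinder"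
  shows "(\<lambda>p. \<phi> p + \<psi> p) \<in> Cc_cylinder"
proof -
  obtain f K where f: "smooth_on UNIV f" "\<forall>p\<in>closure cylinder. \<phi> p = f p"
    "compact K" "K \<subseteq> cylinder_base" "\<forall>p\<in>closure cylinder - K. \<phi> p = 0"
    using assms(1) unfolding Cc_cylinder_def by blast
  obtain g L where g: "smooth_on UNIV g" "\<forall>p\<in>closure cylinder. \<psi> p = g p"
    "compact L" "L \<subseteq> cylinder_base" "\<forall>p\<in>closure cylinder - L. \<psi> p = 0"
    using assms(2) unfolding Cc_cylinder_def by blast
  show ?thesis
    unfolding Cc_cylinder_def
    using smooth_on_add[OF f(1) g(1)] f g
    by (intro CollectI conjI exI[of _ "\<lambda>p. f p + g p"] exI[of _ "K \<union> L"]) auto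
qed

lemma Cc_cylinder_scale:
  assumes "\<phi> \<in> Cc_cylinder"
  shows "(\<lambda>p. c * \<phi> p) \<in> Cc_cylinder"
proof -
  obtain f K where f: "smooth_on UNIV f" "\<forall>p\<in>closure cylinder. \<phi> p = f p"
    "compact K" "K \<subseteq> cylinder_base" "\<forall>p\<in>closure cylinder - K. \<phi> p = 0"
    using assms unfolding Cc_cylinder_def by blast
  show ?thesis
    unfolding Cc_cylinder_def
    using smooth_on_cmult[OF f(1), of c] f
    by (intro CollectI conjI exI[of _ "\<lambda>p. c * f p"] exI[of _ K]) auto
qed

text \<open>
  The data of the problem together with Borel data that agree with them almost everywhere.
\<close>

locale trace_setting = R: borel_order s' G' for s' G' :: "real^'n::finite \<Rightarrow> real" +
  fixes s G :: "real^'n \<Rightarrow> real"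
  assumes sG: "AE x in lborel. x \<in> cube \<longrightarrow> s x = s' x \<and> G x = G' x"
    and G_inverse: "locally_integrable cube (\<lambda>x. inverse (G x))"
    and poinc: "poincare_inequality (cyl_weight s G)"
begin

abbreviation "w \<equiv> cyl_weight s G"
abbreviation "w' \<equiv> cyl_weight s' G'"

lemma w_eq: "AE p in lborel. p \<in> cylinder \<longrightarrow> w p = w' p"
proof -
  obtain N where N: "{x \<in> space lborel. \<not> (x \<in> cube \<longrightarrow> s x = s' x \<and> G x = G' x)} \<subseteq> N"
    "emeasure lborel N = 0" "N \<in> sets lborel"
    using sG by (rule AE_E)
  have "emeasure (lborel \<Otimes>\<^sub>M lborel) (N \<times> (UNIV :: real set)) = emeasure lborel N * emeasure lborel (UNIV :: real set)"
    using N by (intro lborel.emeasure_pair_measure_Times) auto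
  then have "N \<times> UNIV \<in> null_sets (lborel :: ((real^'n) \<times> real) measure)"
    using N by (intro null_setsI) (auto simp: lborel_prod intro!: borel_Times)
  then have "AE p in lborel. p \<notin> N \<times> (UNIV :: real set)" by (rule AE_not_in)
  then show ?thesis
    by eventually_elim (use N(1) in \<open>auto simp: cylinder_def cyl_weight_def\<close>)
qed

text \<open>
  On a compact subset of the cylinder the heights are bounded and bounded away from \<open>0\<close>, so the power of
  the height is bounded there, and local integrability of \<open>1 / G\<close> is inherited.
\<close>

lemma inverse_w'_locally_integrable: "locally_integrable cylinder (\<lambda>p. inverse (w' p))"
  unfolding locally_integrable_def
proof (intro allI impI)
  fix K :: "((real^'n) \<times> real) set" assume K: "compact K \<and> K \<subseteq> cylinder"
  have K1: "compact (fst ` K)" "fst ` K \<subseteq> cube"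
    using K by (auto simp: cylinder_def intro!: compact_continuous_image continuous_intros)
  have K2: "compact (snd ` K)" "snd ` K \<subseteq> {0<..}"
    using K by (auto simp: cylinder_def intro!: compact_continuous_image continuous_intros)
  obtain b where b: "\<And>y. y \<in> snd ` K \<Longrightarrow> norm y \<le> b" using compact_imp_bounded[OF K2(1)] unfolding bounded_iff by blast
  obtain a where a: "0 < a" "\<And>y. y \<in> snd ` K \<Longrightarrow> a \<le> y"
  proof (cases "K = {}")
    case False
    then obtain a where "a \<in> snd ` K" "\<forall>y\<in>snd ` K. a \<le> y"
      using compact_attains_inf[OF K2(1)] by auto
    then show thesis using K2(2) by (intro that[of a]) auto
  qed (use that[of 1] in auto)
  \<comment> \<open>the exponent \<open>2 * s' x - 1\<close> lies between \<open>-1\<close> and \<open>1\<close>\<close>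
  define C where "C = max (inverse a) (max b 1)"
  have C: "1 \<le> C" by (simp add: C_def)
  have pow: "y powr (2 * s' x - 1) \<le> C" if "y \<in> snd ` K" for x y
  proof -
    have y: "a \<le> y" "0 < y" "y \<le> b" using a b[OF that] that K2(2) by auto
    have s: "0 < s' x" "s' x \<le> 1" using R.s_pos R.s_le by auto
    show ?thesis
    proof (cases "1 \<le> y")
      case True
      have "y powr (2 * s' x - 1) \<le> y powr 1" using True s by (intro powr_mono) auto
      then show ?thesis using y by (simp add: C_def)
    next
      case False
      have "y powr (2 * s' x - 1) \<le> y powr (-1)" using False y s by (intro powr_mono') auto
      also have "\<dots> = inverse y" using y by (simp add: powr_minus)
      also have "\<dots> \<le> inverse a" using y a by (intro le_imp_inverse_le) auto
      finally show ?thesis by (simp add: C_def)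
    qed
  qed
  have G'i: "(\<integral>\<^sup>+x\<in>fst ` K. ennreal (inverse (G' x)) \<partial>lborel) < \<infinity>"
  proof -
    have Ks: "fst ` K \<in> sets borel" using K1 by (simp add: compact_imp_closed borel_closed)
    have "integrable lebesgue (\<lambda>x. indicator (fst ` K) x *\<^sub>R inverse (G x))"
      using G_inverse K1 by (auto simp: locally_integrable_def set_integrable_def)
    then have "(\<integral>\<^sup>+x. ennreal (norm (indicator (fst ` K) x *\<^sub>R inverse (G x))) \<partial>lebesgue) < \<infinity>"
      by (simp only: integrable_iff_bounded)
    also have "(\<integral>\<^sup>+x. ennreal (norm (indicator (fst ` K) x *\<^sub>R inverse (G x))) \<partial>lebesgue)
        = (\<integral>\<^sup>+x. ennreal (inverse (G' x)) * indicator (fst ` K) x \<partial>lebesgue)"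
    proof (rule nn_integral_cong_AE)
      have "AE x in lebesgue. x \<in> cube \<longrightarrow> s x = s' x \<and> G x = G' x" using sG by (rule AE_completion)
      then show "AE x in lebesgue. ennreal (norm (indicator (fst ` K) x *\<^sub>R inverse (G x))) = ennreal (inverse (G' x)) * indicator (fst ` K) x"
        by eventually_elim (use K1(2) R.G_pos in \<open>auto simp: indicator_def less_imp_le\<close>)
    qed
    also have "\<dots> = (\<integral>\<^sup>+x\<in>fst ` K. ennreal (inverse (G' x)) \<partial>lborel)"
      by (rule nn_integral_completion)
    finally show ?thesis .
  qed
  have Km: "K \<in> sets borel" using K by (simp add: compact_imp_closed borel_closed)
  have m: "(\<lambda>p. indicator K p *\<^sub>R inverse (w' p)) \<in> borel_measurable borel" using Km by measurable
  have "(\<integral>\<^sup>+p. ennreal (norm (indicator K p *\<^sub>R inverse (w' p))) \<partial>lborel) \<le>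
      (\<integral>\<^sup>+p\<in>cylinder. ennreal (inverse (G' (fst p))) * indicator (fst ` K) (fst p) * (ennreal C * indicator {0..b} (snd p)) \<partial>lborel)"
  proof (rule nn_integral_mono)
    fix p :: "(real^'n) \<times> real"
    show "ennreal (norm (indicator K p *\<^sub>R inverse (w' p))) \<le> ennreal (inverse (G' (fst p))) * indicator (fst ` K) (fst p) * (ennreal C * indicator {0..b} (snd p)) * indicator cylinder p"
    proof (cases "p \<in> K")
      case True
      obtain x y where p: "p = (x, y)" by fastforce
      have x: "x \<in> fst ` K" "y \<in> snd ` K" using True p by force+
      have y: "0 < y" "y \<le> b" using b[OF x(2)] K2(2) x(2) by auto
      have pc: "p \<in> cylinder" using K True by auto
      have "inverse (w' p) = inverse (G' x) * y powr (2 * s' x - 1)"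
        using powr_minus[of y "1 - 2 * s' x"] by (simp add: p R.W_eq)
      also have "\<dots> \<le> inverse (G' x) * C" using pow[OF x(2)] R.G_pos[of x] by (intro mult_left_mono) auto
      finally have "ennreal (inverse (w' p)) \<le> ennreal (inverse (G' x)) * ennreal C"
        using C by (subst ennreal_mult[symmetric]) (auto intro: ennreal_leI R.G_pos less_imp_le)
      moreover have "0 \<le> inverse (w' p)" using R.W_pos[of y x] y by (simp add: p less_imp_le)
      ultimately show ?thesis using True x y pc p by simp
    qed simp
  qed
  also have "\<dots> = (\<integral>\<^sup>+x\<in>cube. (\<integral>\<^sup>+y\<in>{0<..}. ennreal (inverse (G' x)) * indicator (fst ` K) x * (ennreal C * indicator {0..b} y) \<partial>lborel) \<partial>lborel)"
  proof (subst nn_integral_cylinder)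
    have [measurable]: "fst ` K \<in> sets borel" using K1 by (simp add: compact_imp_closed borel_closed)
    have "(\<lambda>p. ennreal (inverse (G' (fst p))) * indicator (fst ` K) (fst p) * (ennreal C * indicator {0..b} (snd p))) \<in> borel_measurable (borel \<Otimes>\<^sub>M borel)"
      by measurable
    then show "(\<lambda>p. ennreal (inverse (G' (fst p))) * indicator (fst ` K) (fst p) * (ennreal C * indicator {0..b} (snd p))) \<in> borel_measurable borel"
      by (simp only: borel_prod)
  qed simp
  also have "\<dots> \<le> (\<integral>\<^sup>+x. (ennreal (inverse (G' x)) * indicator (fst ` K) x) * (ennreal C * ennreal (max b 0)) \<partial>lborel)"
  proof (rule nn_integral_mono)
    fix x
    have "(\<integral>\<^sup>+y\<in>{0<..}. ennreal (inverse (G' x)) * indicator (fst ` K) x * (ennreal C * indicator {0..b} y) \<partial>lborel)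
      \<le> (\<integral>\<^sup>+y. (ennreal (inverse (G' x)) * indicator (fst ` K) x * ennreal C) * indicator {0..b} y \<partial>lborel)"
      by (intro nn_integral_mono) (auto simp: indicator_def)
    also have "\<dots> = (ennreal (inverse (G' x)) * indicator (fst ` K) x * ennreal C) * emeasure lborel {0..b}"
      by (rule nn_integral_cmult_indicator) simp
    also have "emeasure lborel {0..b} = ennreal (max b 0)" by (cases "0 \<le> b") auto
    finally show "(\<integral>\<^sup>+y\<in>{0<..}. ennreal (inverse (G' x)) * indicator (fst ` K) x * (ennreal C * indicator {0..b} y) \<partial>lborel) * indicator cube x
      \<le> (ennreal (inverse (G' x)) * indicator (fst ` K) x) * (ennreal C * ennreal (max b 0))"
      by (cases "x \<in> cube") (simp_all add: mult.assoc)
  qed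
  also have "\<dots> = (\<integral>\<^sup>+x\<in>fst ` K. ennreal (inverse (G' x)) \<partial>lborel) * (ennreal C * ennreal (max b 0))"
    using K1 by (intro nn_integral_multc) (auto simp: compact_imp_closed borel_closed)
  also have "\<dots> < \<infinity>" using G'i by (simp add: ennreal_mult_less_top)
  finally have "integrable lborel (\<lambda>p. indicator K p *\<^sub>R inverse (w' p))"
    using m by (simp add: integrable_iff_bounded)
  then show "(\<lambda>p. inverse (w' p)) absolutely_integrable_on K"
    unfolding set_integrable_def using m by (simp add: integrable_completion)
qed

lemma AE_lebesgue_on_cylinder: "(AE p in lebesgue_on cylinder. P p) \<longleftrightarrow> (AE p in lborel. p \<in> cylinder \<longrightarrow> P p)"
  by (rule AE_lebesgue_on_iff) (simp add: lebesgue_measurable_open open_cylinder)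

lemma AE_lebesgue_on_cube: "(AE p in lebesgue_on cube. P p) \<longleftrightarrow> (AE p in lborel. p \<in> cube \<longrightarrow> P p)"
  by (rule AE_lebesgue_on_iff) (simp add: lebesgue_measurable_open open_cube)

end

lemma locally_integrable_cong_AE:
  assumes eq: "AE x in lborel. x \<in> U \<longrightarrow> f x = f' x" and f': "locally_integrable U f'"
    and f: "f \<in> borel_measurable (lebesgue_on U)" and U: "U \<in> sets lebesgue"
  shows "locally_integrable U (f :: 'a::euclidean_space \<Rightarrow> real)"
  unfolding locally_integrable_def set_integrable_def
proof (intro allI impI)
  fix K assume K: "compact K \<and> K \<subseteq> U"
  have Ks: "K \<in> sets lebesgue" using K by (simp add: compact_imp_closed borel_closed)
  show "integrable lebesgue (\<lambda>x. indicator K x *\<^sub>R f x)"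
  proof (rule integrable_cong_AE_imp)
    show "integrable lebesgue (\<lambda>x. indicator K x *\<^sub>R f' x)"
      using f' K by (auto simp: locally_integrable_def set_integrable_def)
    have "(\<lambda>x. indicator U x *\<^sub>R f x) \<in> borel_measurable lebesgue"
      using f U by (subst (asm) borel_measurable_restrict_space_iff) auto
    then have "(\<lambda>x. indicator K x *\<^sub>R (indicator U x *\<^sub>R f x)) \<in> borel_measurable lebesgue"
      by (rule borel_measurable_scaleR[OF borel_measurable_indicator[OF Ks]])
    moreover have "(\<lambda>x. indicator K x *\<^sub>R (indicator U x *\<^sub>R f x)) = (\<lambda>x. indicator K x *\<^sub>R f x)"
      using K by (fastforce simp: indicator_def)
    ultimately show "(\<lambda>x. indicator K x *\<^sub>R f x) \<in> borel_measurable lebesgue" by simp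
    show "AE x in lebesgue. indicator K x *\<^sub>R f' x = indicator K x *\<^sub>R f x"
      using AE_completion[OF eq] by eventually_elim (use K in \<open>auto simp: indicator_def\<close>)
  qed
qed

context trace_setting
begin

lemma w_measurable: "w \<in> borel_measurable (lebesgue_on cylinder)"
  by (rule measurable_lebesgue_on_AE[OF R.W_borel cylinder_sets w_eq])

sublocale E: energy_space "cylinder :: ((real^'n) \<times> real) set" w Cc_cylinder
proof
  show "open (cylinder :: ((real^'n) \<times> real) set)" by (rule open_cylinder)
  show "is_weight cylinder w"
    unfolding is_weight_def AE_lebesgue_on_cylinder
    using w_eq w_measurable by (auto elim!: eventually_mono simp: cylinder_def R.W_pos)
  have "AE p in lborel. p \<in> cylinder \<longrightarrow> inverse (w p) = inverse (w' p)"
    using w_eq by eventually_elim auto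
  then show "locally_integrable cylinder (\<lambda>p. inverse (w p))"
    by (rule locally_integrable_cong_AE[OF _ inverse_w'_locally_integrable])
      (use w_measurable in \<open>auto simp: lebesgue_measurable_open open_cylinder\<close>)
qed (auto intro: Cc_cylinder_zero Cc_cylinder_add Cc_cylinder_scale)

lemma H0L_eq: "H0L w = E.H" by (simp add: H0L_def E.H_def)

lemma poincare_E: "E.poincare"
  using poinc by (simp add: E.poincare_def poincare_inequality_def H0L_eq)

abbreviation grad_sq :: "((real^'n) \<times> real \<Rightarrow> real) \<Rightarrow> real" where "grad_sq u \<equiv> E.B u u"

lemma grad_sq_add_le:
  assumes "u \<in> W12 cylinder w" "v \<in> W12 cylinder w"
  shows "grad_sq (\<lambda>x. u x + v x) \<le> 2 * grad_sq u + 2 * grad_sq v"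
proof -
  have "grad_sq (\<lambda>x. u x + v x) = E.ip (\<lambda>x. E.wg u x + E.wg v x) (\<lambda>x. E.wg u x + E.wg v x)"
    using assms by (intro E.B_cong E.W12_add) (auto intro!: E.wg_measurable borel_measurable_add)
  then show ?thesis using E.ip_add_square_le[of "E.wg u" "E.wg v"] assms by (simp add: E.W12D E.B_def)
qed

lemma grad_sq_scale: "u \<in> W12 cylinder w \<Longrightarrow> grad_sq (\<lambda>x. c * u x) = c\<^sup>2 * grad_sq u"
  using semi_inner_space.B_simps[OF E.semi_inner_space_W12] by (simp add: power2_eq_square)

lemma grad_sq_diff_commute:
  assumes "u \<in> W12 cylinder w" "v \<in> W12 cylinder w"
  shows "grad_sq (\<lambda>x. u x - v x) = grad_sq (\<lambda>x. v x - u x)"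
proof -
  have e: "(\<lambda>x. (-1) * (u x - v x)) = (\<lambda>x. v x - u x)" by auto
  show ?thesis using grad_sq_scale[OF E.W12_diff(1)[OF assms], of "-1"] unfolding e by simp
qed

lemma grad_sq_diff_le:
  assumes "u \<in> W12 cylinder w" "\<phi> \<in> W12 cylinder w" "\<psi> \<in> W12 cylinder w"
  shows "grad_sq (\<lambda>x. \<phi> x - \<psi> x) \<le> 2 * grad_sq (\<lambda>x. u x - \<phi> x) + 2 * grad_sq (\<lambda>x. u x - \<psi> x)"
proof -
  have e: "(\<lambda>x. (\<phi> x - u x) + (u x - \<psi> x)) = (\<lambda>x. \<phi> x - \<psi> x)" by auto
  have "grad_sq (\<lambda>x. \<phi> x - \<psi> x) \<le> 2 * grad_sq (\<lambda>x. \<phi> x - u x) + 2 * grad_sq (\<lambda>x. u x - \<psi> x)"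
    using grad_sq_add_le[OF E.W12_diff(1)[OF assms(2,1)] E.W12_diff(1)[OF assms(1,3)]] unfolding e .
  also have "grad_sq (\<lambda>x. \<phi> x - u x) = grad_sq (\<lambda>x. u x - \<phi> x)" by (rule grad_sq_diff_commute[OF assms(2,1)])
  finally show ?thesis .
qed

lemma grad_sq_approx_le:
  assumes "u \<in> W12 cylinder w" "\<phi> \<in> W12 cylinder w"
  shows "grad_sq \<phi> \<le> 2 * grad_sq u + 2 * grad_sq (\<lambda>x. u x - \<phi> x)"
proof -
  have e: "(\<lambda>x. u x + (\<phi> x - u x)) = \<phi>" by auto
  have "grad_sq \<phi> \<le> 2 * grad_sq u + 2 * grad_sq (\<lambda>x. \<phi> x - u x)"
    using grad_sq_add_le[OF assms(1) E.W12_diff(1)[OF assms(2,1)]] unfolding e .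
  also have "grad_sq (\<lambda>x. \<phi> x - u x) = grad_sq (\<lambda>x. u x - \<phi> x)" by (rule grad_sq_diff_commute[OF assms(2,1)])
  finally show ?thesis .
qed

section \<open>The trace operator\<close>

text \<open>
  Cutting off outside the cube makes the base values Borel measurable: smooth functions on the cylinder
  are restricted only on its closure.
\<close>

definition base :: "((real^'n) \<times> real \<Rightarrow> real) \<Rightarrow> real^'n \<Rightarrow> real" where
  "base \<phi> x = (if x \<in> cube then \<phi> (x, 0) else 0)"

definition cube_sq :: "(real^'n \<Rightarrow> real) \<Rightarrow> ennreal" where
  "cube_sq v = (\<integral>\<^sup>+x\<in>cube. ennreal (w_tilde s' G' x * (v x)\<^sup>2) \<partial>lborel)"

abbreviation "smooth_dom \<equiv> Cc_cylinder \<inter> W12 cylinder w"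

lemma smooth_dom_H: "\<phi> \<in> smooth_dom \<Longrightarrow> \<phi> \<in> E.H" by (auto intro: E.D_H)

lemma smooth_dom_diff: "\<phi> \<in> smooth_dom \<Longrightarrow> \<psi> \<in> smooth_dom \<Longrightarrow> (\<lambda>p. \<phi> p - \<psi> p) \<in> smooth_dom"
  using Cc_cylinder_add[of \<phi> "\<lambda>p. (-1) * \<psi> p"] Cc_cylinder_scale[of \<psi> "-1"] E.W12_diff(1)[of \<phi> \<psi>] by auto

lemma smooth_dom_add: "\<phi> \<in> smooth_dom \<Longrightarrow> \<psi> \<in> smooth_dom \<Longrightarrow> (\<lambda>p. \<phi> p + \<psi> p) \<in> smooth_dom"
  by (auto intro: Cc_cylinder_add E.W12_add)

lemma smooth_dom_scale: "\<phi> \<in> smooth_dom \<Longrightarrow> (\<lambda>p. c * \<phi> p) \<in> smooth_dom"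
  by (auto intro: Cc_cylinder_scale E.W12_scale)

lemma base_diff: "base (\<lambda>p. \<phi> p - \<psi> p) = (\<lambda>x. base \<phi> x - base \<psi> x)"
  by (auto simp: base_def)

lemma base_add: "base (\<lambda>p. \<phi> p + \<psi> p) = (\<lambda>x. base \<phi> x + base \<psi> x)"
  by (auto simp: base_def)

lemma base_scale: "base (\<lambda>p. c * \<phi> p) = (\<lambda>x. c * base \<phi> x)"
  by (auto simp: base_def)

text \<open>
  Norms of the classical and of the selected weak gradient agree, and the Borel data may be used.
\<close>

lemma base_smooth:
  assumes "\<phi> \<in> smooth_dom"
  obtains f where "smooth_on UNIV f" "\<And>x. x \<in> cube \<Longrightarrow> base \<phi> x = f (x, 0)"
    "ennreal (grad_sq \<phi>) = (\<integral>\<^sup>+p\<in>cylinder. ennreal (w' p * (norm (classical_gradient f p))\<^sup>2) \<partial>lborel)"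
    "ennreal (E.ip \<phi> \<phi>) = (\<integral>\<^sup>+p\<in>cylinder. ennreal (w' p * (f p)\<^sup>2) \<partial>lborel)"
proof -
  have W: "\<phi> \<in> W12 cylinder w" and C: "\<phi> \<in> Cc_cylinder" using assms by auto
  obtain f where f: "smooth_on UNIV f" "\<And>p. p \<in> cylinder \<Longrightarrow> \<phi> p = f p" "\<And>x. x \<in> cube \<Longrightarrow> \<phi> (x, 0) = f (x, 0)"
    using C by (rule Cc_cylinderE) blast
  have [measurable]: "f \<in> borel_measurable borel" "classical_gradient f \<in> borel_measurable borel"
    using smooth_on_continuous[OF f(1)] continuous_on_classical_gradient[OF f(1)]
    by (auto intro: borel_measurable_continuous_onI)
  have "is_weak_gradient cylinder \<phi> (classical_gradient f)"
    by (rule is_weak_gradient_cong[OF classical_gradient_is_weak_gradient[OF open_cylinder f(1)]]) (simp add: f(2))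
  then have "AE p in lebesgue_on cylinder. E.wg \<phi> p = classical_gradient f p"
    using E.weak_gradient_AE_eq by blast
  moreover have "AE p in lebesgue_on cylinder. w p = w' p" by (simp add: AE_lebesgue_on_cylinder w_eq)
  ultimately have "AE p in lebesgue_on cylinder. ennreal (w p * (norm (E.wg \<phi> p))\<^sup>2) = ennreal (w' p * (norm (classical_gradient f p))\<^sup>2)"
    by eventually_elim simp
  then have "E.sq (E.wg \<phi>) = (\<integral>\<^sup>+p. ennreal (w' p * (norm (classical_gradient f p))\<^sup>2) \<partial>lebesgue_on cylinder)"
    unfolding E.sq_def by (rule nn_integral_cong_AE)
  also have "\<dots> = (\<integral>\<^sup>+p\<in>cylinder. ennreal (w' p * (norm (classical_gradient f p))\<^sup>2) \<partial>lborel)"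
    by (rule nn_integral_lebesgue_on) measurable
  finally have 1: "ennreal (grad_sq \<phi>) = (\<integral>\<^sup>+p\<in>cylinder. ennreal (w' p * (norm (classical_gradient f p))\<^sup>2) \<partial>lborel)"
    using E.sq_eq_ip[OF E.W12D(3)[OF W]] by (simp add: E.B_def)
  have "AE p in lebesgue_on cylinder. ennreal (w p * (norm (\<phi> p))\<^sup>2) = ennreal (w' p * (f p)\<^sup>2)"
    unfolding AE_lebesgue_on_cylinder using w_eq by eventually_elim (auto simp: f(2))
  then have "E.sq \<phi> = (\<integral>\<^sup>+p. ennreal (w' p * (f p)\<^sup>2) \<partial>lebesgue_on cylinder)"
    unfolding E.sq_def by (rule nn_integral_cong_AE)
  also have "\<dots> = (\<integral>\<^sup>+p\<in>cylinder. ennreal (w' p * (f p)\<^sup>2) \<partial>lborel)"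
    by (rule nn_integral_lebesgue_on) measurable
  finally have 2: "ennreal (E.ip \<phi> \<phi>) = (\<integral>\<^sup>+p\<in>cylinder. ennreal (w' p * (f p)\<^sup>2) \<partial>lborel)"
    using E.sq_eq_ip[OF E.W12D(1)[OF W]] by simp
  show thesis
    by (rule that[OF f(1) _ 1 2]) (simp add: base_def f(3))
qed

lemma base_borel[measurable]:
  assumes "\<phi> \<in> smooth_dom"
  shows "base \<phi> \<in> borel_measurable borel"
proof -
  obtain f where f: "smooth_on UNIV f" "\<And>x. x \<in> cube \<Longrightarrow> base \<phi> x = f (x, 0)"
    "ennreal (grad_sq \<phi>) = (\<integral>\<^sup>+p\<in>cylinder. ennreal (w' p * (norm (classical_gradient f p))\<^sup>2) \<partial>lborel)"
    by (rule base_smooth[OF assms]) blast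
  have "continuous_on UNIV (\<lambda>x. f (x, 0))"
    by (intro continuous_on_compose2[OF smooth_on_continuous[OF f(1), of UNIV]] continuous_intros) auto
  then have [measurable]: "(\<lambda>x. f (x, 0)) \<in> borel_measurable borel" by (rule borel_measurable_continuous_onI)
  have "base \<phi> = (\<lambda>x. indicator cube x * f (x, 0))" using f(2) by (auto simp: indicator_def base_def fun_eq_iff)
  then show ?thesis by simp
qed

lemma cube_sq_base_le_Q: "\<phi> \<in> smooth_dom \<Longrightarrow> cube_sq (base \<phi>) \<le> ennreal (16 * E.Q \<phi>)"
proof -
  assume "\<phi> \<in> smooth_dom"
  then obtain f where f: "smooth_on UNIV f" "\<And>x. x \<in> cube \<Longrightarrow> base \<phi> x = f (x, 0)"
    "ennreal (grad_sq \<phi>) = (\<integral>\<^sup>+p\<in>cylinder. ennreal (w' p * (norm (classical_gradient f p))\<^sup>2) \<partial>lborel)"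
    "ennreal (E.ip \<phi> \<phi>) = (\<integral>\<^sup>+p\<in>cylinder. ennreal (w' p * (f p)\<^sup>2) \<partial>lborel)"
    by (rule base_smooth) blast
  have "cube_sq (base \<phi>) = (\<integral>\<^sup>+x\<in>cube. ennreal (w_tilde s' G' x * (f (x, 0))\<^sup>2) \<partial>lborel)"
    unfolding cube_sq_def by (intro nn_integral_cong) (auto simp: indicator_def f(2))
  also have "\<dots> \<le> 16 * ennreal (E.ip \<phi> \<phi>) + 4 * ennreal (grad_sq \<phi>)"
    unfolding f(3,4) by (rule R.trace_L2_bound[OF f(1)])
  also have "\<dots> = ennreal (16 * E.ip \<phi> \<phi> + 4 * grad_sq \<phi>)"
    by (simp add: ennreal_plus ennreal_mult E.ip_nonneg E.B_nonneg)
  also have "\<dots> \<le> ennreal (16 * E.Q \<phi>)"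
    by (intro ennreal_leI) (simp add: E.Q_def E.B_nonneg)
  finally show ?thesis .
qed

lemma A_form_base_le: "\<phi> \<in> smooth_dom \<Longrightarrow> A_form s' G' i (base \<phi>) \<le> ennreal (72 * grad_sq \<phi>)"
proof -
  assume "\<phi> \<in> smooth_dom"
  then obtain f where f: "smooth_on UNIV f" "\<And>x. x \<in> cube \<Longrightarrow> base \<phi> x = f (x, 0)"
    "ennreal (grad_sq \<phi>) = (\<integral>\<^sup>+p\<in>cylinder. ennreal (w' p * (norm (classical_gradient f p))\<^sup>2) \<partial>lborel)"
    by (rule base_smooth) blast
  have "A_form s' G' i (base \<phi>) = A_form s' G' i (\<lambda>x. f (x, 0))"
    by (rule A_form_cong_AE) (auto simp: f(2))
  also have "\<dots> \<le> 72 * ennreal (grad_sq \<phi>)" unfolding f(3) by (rule R.trace_A_form_bound[OF f(1)])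
  also have "\<dots> = ennreal (72 * grad_sq \<phi>)" by (simp add: ennreal_mult E.B_nonneg)
  finally show ?thesis .
qed

lemma cube_sq_base_le_grad_sq:
  obtains K where "K > 0" "\<And>\<phi>. \<phi> \<in> smooth_dom \<Longrightarrow> cube_sq (base \<phi>) \<le> ennreal (K * grad_sq \<phi>)"
proof -
  obtain C where C: "C > 0" "\<And>u. u \<in> E.H \<Longrightarrow> E.Q u \<le> C * grad_sq u"
    using E.poincareD[OF poincare_E] by blast
  have "cube_sq (base \<phi>) \<le> ennreal ((16 * C) * grad_sq \<phi>)" if "\<phi> \<in> smooth_dom" for \<phi>
  proof -
    have "cube_sq (base \<phi>) \<le> ennreal (16 * E.Q \<phi>)" by (rule cube_sq_base_le_Q[OF that])
    also have "\<dots> \<le> ennreal ((16 * C) * grad_sq \<phi>)" using C(2)[OF smooth_dom_H[OF that]] by (intro ennreal_leI) simp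
    finally show ?thesis .
  qed
  then show thesis using C(1) by (intro that[of "16 * C"]) auto
qed

lemma w_tilde_borel[measurable]: "w_tilde s' G' \<in> borel_measurable borel"
  unfolding w_tilde_def[abs_def] by measurable

lemma w_tilde_pos: "0 < w_tilde s' G' x"
  using R.s_pos[of x] R.G_pos[of x] by (simp add: w_tilde_def)

lemma cube_sq_add_le:
  assumes [measurable]: "a \<in> borel_measurable borel" "b \<in> borel_measurable borel"
  shows "cube_sq (\<lambda>x. a x + b x) \<le> 2 * cube_sq a + 2 * cube_sq b"
proof -
  have "cube_sq (\<lambda>x. a x + b x) \<le> (\<integral>\<^sup>+x. 2 * (ennreal (w_tilde s' G' x * (a x)\<^sup>2) * indicator cube x) + 2 * (ennreal (w_tilde s' G' x * (b x)\<^sup>2) * indicator cube x) \<partial>lborel)"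
    unfolding cube_sq_def
  proof (rule nn_integral_mono)
    fix x
    have "w_tilde s' G' x * (a x + b x)\<^sup>2 \<le> w_tilde s' G' x * (2 * (a x)\<^sup>2 + 2 * (b x)\<^sup>2)"
      using w_tilde_pos[of x] by (intro mult_left_mono square_sum_le) auto
    then have "ennreal (w_tilde s' G' x * (a x + b x)\<^sup>2) \<le> ennreal (2 * (w_tilde s' G' x * (a x)\<^sup>2) + 2 * (w_tilde s' G' x * (b x)\<^sup>2))"
      by (intro ennreal_leI) (simp add: algebra_simps)
    also have "\<dots> = 2 * ennreal (w_tilde s' G' x * (a x)\<^sup>2) + 2 * ennreal (w_tilde s' G' x * (b x)\<^sup>2)"
      using w_tilde_pos[of x] by (simp add: ennreal_plus ennreal_mult)
    finally show "ennreal (w_tilde s' G' x * (a x + b x)\<^sup>2) * indicator cube x \<le>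
      2 * (ennreal (w_tilde s' G' x * (a x)\<^sup>2) * indicator cube x) + 2 * (ennreal (w_tilde s' G' x * (b x)\<^sup>2) * indicator cube x)"
      by (auto simp: indicator_def)
  qed
  also have "\<dots> = 2 * cube_sq a + 2 * cube_sq b"
    unfolding cube_sq_def by (subst nn_integral_add) (auto simp: nn_integral_cmult)
  finally show ?thesis .
qed

lemma cube_sq_scale:
  assumes [measurable]: "a \<in> borel_measurable borel"
  shows "cube_sq (\<lambda>x. c * a x) = ennreal (c\<^sup>2) * cube_sq a"
proof -
  have "cube_sq (\<lambda>x. c * a x) = (\<integral>\<^sup>+x. ennreal (c\<^sup>2) * (ennreal (w_tilde s' G' x * (a x)\<^sup>2) * indicator cube x) \<partial>lborel)"
    unfolding cube_sq_def
  proof (rule nn_integral_cong)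
    fix x
    have "w_tilde s' G' x * (c * a x)\<^sup>2 = c\<^sup>2 * (w_tilde s' G' x * (a x)\<^sup>2)" by (simp add: power_mult_distrib)
    then show "ennreal (w_tilde s' G' x * (c * a x)\<^sup>2) * indicator cube x = ennreal (c\<^sup>2) * (ennreal (w_tilde s' G' x * (a x)\<^sup>2) * indicator cube x)"
      by (simp only: ennreal_mult'[OF zero_le_power2] mult.assoc)
  qed
  then show ?thesis unfolding cube_sq_def by (subst (asm) nn_integral_cmult) auto
qed

lemma cube_sq_diff_commute: "cube_sq (\<lambda>x. a x - b x) = cube_sq (\<lambda>x. b x - a x)"
  by (simp add: cube_sq_def power2_commute)

lemma cube_sq_zero_iff:
  assumes [measurable]: "a \<in> borel_measurable borel"
  shows "cube_sq a = 0 \<longleftrightarrow> (AE x in lborel. x \<in> cube \<longrightarrow> a x = 0)"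
proof -
  have "cube_sq a = 0 \<longleftrightarrow> (AE x in lborel. ennreal (w_tilde s' G' x * (a x)\<^sup>2) * indicator cube x = 0)"
    unfolding cube_sq_def by (rule nn_integral_0_iff_AE) measurable
  also have "\<dots> \<longleftrightarrow> (AE x in lborel. x \<in> cube \<longrightarrow> a x = 0)"
  proof (rule AE_cong)
    fix x
    show "(ennreal (w_tilde s' G' x * (a x)\<^sup>2) * indicator cube x = 0) = (x \<in> cube \<longrightarrow> a x = 0)"
      using w_tilde_pos[of x] by (cases "x \<in> cube") (auto simp: ennreal_eq_0_iff mult_le_0_iff)
  qed
  finally show ?thesis .
qed

text \<open>
  A relation, since a trace is determined only up to null sets. The pair \<open>(u, v)\<close> lies in the closure of
  the graph of \<open>base\<close> on smooth functions, so linear identities and bounds pass from \<open>base\<close> to traces.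
\<close>

definition has_trace :: "((real^'n) \<times> real \<Rightarrow> real) \<Rightarrow> (real^'n \<Rightarrow> real) \<Rightarrow> bool" where
  "has_trace u v \<longleftrightarrow> v \<in> borel_measurable borel \<and>
     (\<forall>e>0. \<exists>\<phi>\<in>smooth_dom. grad_sq (\<lambda>p. u p - \<phi> p) < e \<and> cube_sq (\<lambda>x. v x - base \<phi> x) < ennreal e)"

lemma has_traceD:
  assumes "has_trace u v" "e > 0"
  obtains \<phi> where "\<phi> \<in> smooth_dom" "grad_sq (\<lambda>p. u p - \<phi> p) < e" "cube_sq (\<lambda>x. v x - base \<phi> x) < ennreal e"
  using assms unfolding has_trace_def by blast

lemma has_trace_base:
  assumes "\<phi> \<in> smooth_dom"
  shows "has_trace \<phi> (base \<phi>)"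
  unfolding has_trace_def
proof (intro conjI allI impI bexI[of _ \<phi>])
  fix e :: real assume "0 < e"
  then show "grad_sq (\<lambda>p. \<phi> p - \<phi> p) < e" using grad_sq_scale[OF E.W12_zero, of 0] by simp
  show "cube_sq (\<lambda>x. base \<phi> x - base \<phi> x) < ennreal e" using \<open>0 < e\<close> by (simp add: cube_sq_def)
qed (use assms in \<open>auto intro: base_borel\<close>)

text \<open>
  Base values of smooth functions approximating \<open>u\<close> are a Cauchy sequence by the trace inequality. Both
  properties of the limit are obtained along the sequence.
\<close>

lemma has_trace_exists:
  assumes u: "u \<in> E.H"
  shows "\<exists>v. has_trace u v \<and> (\<forall>i. A_form s' G' i v \<le> ennreal (144 * grad_sq u))"
proof -
  have uW: "u \<in> W12 cylinder w" using u by (rule E.H_W12)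
  obtain K where K: "K > 0" "\<And>\<phi>. \<phi> \<in> smooth_dom \<Longrightarrow> cube_sq (base \<phi>) \<le> ennreal (K * grad_sq \<phi>)"
    by (rule cube_sq_base_le_grad_sq) blast
  have "\<exists>\<phi>. \<phi> \<in> smooth_dom \<and> grad_sq (\<lambda>p. u p - \<phi> p) < 1 / real (Suc n)" for n
  proof -
    obtain \<phi> where "\<phi> \<in> Cc_cylinder" "\<phi> \<in> W12 cylinder w" "E.Q (\<lambda>p. u p - \<phi> p) < 1 / real (Suc n)"
      by (rule E.H_approx[OF u, of "1 / real (Suc n)"]) auto
    moreover have "grad_sq (\<lambda>p. u p - \<phi> p) \<le> E.Q (\<lambda>p. u p - \<phi> p)" by (simp add: E.Q_def E.ip_nonneg)
    ultimately show ?thesis by (intro exI[of _ \<phi>]) auto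
  qed
  then obtain \<phi> where \<phi>: "\<And>n. \<phi> n \<in> smooth_dom" "\<And>n. grad_sq (\<lambda>p. u p - \<phi> n p) < 1 / real (Suc n)" by metis
  have \<phi>W: "\<phi> n \<in> W12 cylinder w" for n using \<phi>(1)[of n] by auto
  define b where "b n = base (\<phi> n)" for n
  have bm[measurable]: "b n \<in> borel_measurable borel" for n unfolding b_def by (rule base_borel[OF \<phi>(1)])
  have small: "\<exists>N. \<forall>n\<ge>N. grad_sq (\<lambda>p. u p - \<phi> n p) < e" if "e > 0" for e
  proof -
    obtain N where N: "inverse (real (Suc N)) < e" using reals_Archimedean[OF \<open>e > 0\<close>] by blast
    have "grad_sq (\<lambda>p. u p - \<phi> n p) < e" if "n \<ge> N" for n
    proof -
      have "1 / real (Suc n) \<le> inverse (real (Suc N))" using that by (simp add: divide_inverse le_imp_inverse_le)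
      then show ?thesis using \<phi>(2)[of n] N by linarith
    qed
    then show ?thesis by blast
  qed
  let ?d = "\<lambda>x. ennreal (w_tilde s' G' x) * indicator cube x"
  let ?M = "density lborel ?d"
  have dens: "(\<integral>\<^sup>+x. ennreal ((norm (a x - c x))\<^sup>2) \<partial>?M) = cube_sq (\<lambda>x. a x - c x)"
    if [measurable]: "a \<in> borel_measurable borel" "c \<in> borel_measurable borel" for a c
    unfolding cube_sq_def
    by (subst nn_integral_density)
      (auto intro!: nn_integral_cong simp: indicator_def ennreal_mult'' mult.commute)
  have Cauchy: "\<exists>N. \<forall>m\<ge>N. \<forall>n\<ge>N. (\<integral>\<^sup>+x. ennreal ((norm (b m x - b n x))\<^sup>2) \<partial>?M) \<le> ennreal e" if "e > 0" for e
  proof -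
    have "e / (4 * K) > 0" using K that by simp
    from small[OF this] obtain N where N: "\<And>n. n \<ge> N \<Longrightarrow> grad_sq (\<lambda>p. u p - \<phi> n p) < e / (4 * K)" by blast
    have "(\<integral>\<^sup>+x. ennreal ((norm (b m x - b n x))\<^sup>2) \<partial>?M) \<le> ennreal e" if "m \<ge> N" "n \<ge> N" for m n
    proof -
      have "(\<integral>\<^sup>+x. ennreal ((norm (b m x - b n x))\<^sup>2) \<partial>?M) = cube_sq (base (\<lambda>p. \<phi> m p - \<phi> n p))"
        unfolding dens[OF bm bm] by (simp add: base_diff b_def)
      also have "\<dots> \<le> ennreal (K * grad_sq (\<lambda>p. \<phi> m p - \<phi> n p))" by (rule K(2)[OF smooth_dom_diff[OF \<phi>(1) \<phi>(1)]])
      also have "\<dots> \<le> ennreal e"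
      proof (rule ennreal_leI)
        have "grad_sq (\<lambda>p. \<phi> m p - \<phi> n p) \<le> 2 * (e / (4 * K)) + 2 * (e / (4 * K))"
          using grad_sq_diff_le[OF uW \<phi>W \<phi>W, of m n] N[OF that(1)] N[OF that(2)] by linarith
        then have "K * grad_sq (\<lambda>p. \<phi> m p - \<phi> n p) \<le> K * (2 * (e / (4 * K)) + 2 * (e / (4 * K)))"
          using K(1) by (intro mult_left_mono) auto
        then show "K * grad_sq (\<lambda>p. \<phi> m p - \<phi> n p) \<le> e" using K(1) by (simp add: field_simps)
      qed
      finally show ?thesis .
    qed
    then show ?thesis by blast
  qed
  have bM: "b n \<in> borel_measurable ?M" for n using bm by simp
  obtain v r where v: "v \<in> borel_measurable ?M" "strict_mono (r :: nat \<Rightarrow> nat)"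
    "AE x in ?M. (\<lambda>k. b (r k) x) \<longlonglongrightarrow> v x"
    "\<And>e. e > 0 \<Longrightarrow> \<exists>N. \<forall>n\<ge>N. (\<integral>\<^sup>+x. ennreal ((norm (b n x - v x))\<^sup>2) \<partial>?M) \<le> ennreal e"
    by (rule L2_Cauchy_limit[OF bM Cauchy]) blast+
  from v(1) have vm[measurable]: "v \<in> borel_measurable borel" by simp
  have "has_trace u v"
    unfolding has_trace_def
  proof (intro conjI allI impI vm)
    fix e :: real assume e: "0 < e"
    obtain N where N: "\<And>n. n \<ge> N \<Longrightarrow> grad_sq (\<lambda>p. u p - \<phi> n p) < e" using small[OF e] by blast
    have "e / 2 > 0" using e by simp
    from v(4)[OF this] obtain N' where N': "\<And>n. n \<ge> N' \<Longrightarrow> cube_sq (\<lambda>x. b n x - v x) \<le> ennreal (e / 2)"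
      unfolding dens[OF bm vm] by blast
    define n where "n = max N N'"
    have "cube_sq (\<lambda>x. v x - b n x) \<le> ennreal (e / 2)"
      using N'[of n] cube_sq_diff_commute[of v "b n"] by (simp add: n_def)
    also have "\<dots> < ennreal e" using e by (simp add: ennreal_less_iff)
    finally show "\<exists>\<phi>\<in>smooth_dom. grad_sq (\<lambda>p. u p - \<phi> p) < e \<and> cube_sq (\<lambda>x. v x - base \<phi> x) < ennreal e"
      using N[of n] \<phi>(1)[of n] by (intro bexI[of _ "\<phi> n"]) (auto simp: n_def b_def)
  qed
  moreover have "A_form s' G' i v \<le> ennreal (144 * grad_sq u)" for i
  proof -
    have "AE x in lborel. 0 < ?d x \<longrightarrow> (\<lambda>k. b (r k) x) \<longlonglongrightarrow> v x"
      using v(3) by (subst (asm) AE_density) auto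
    then have "AE x in lborel. x \<in> cube \<longrightarrow> (\<lambda>k. b (r k) x) \<longlonglongrightarrow> v x"
      by eventually_elim (use w_tilde_pos in \<open>auto simp: indicator_def\<close>)
    then have "A_form s' G' i v \<le> liminf (\<lambda>k. A_form s' G' i (b (r k)))"
      by (intro R.A_form_Fatou) auto
    also have "\<dots> \<le> ennreal (144 * grad_sq u)"
    proof (rule ennreal_le_epsilon)
      fix e :: real assume "0 < e"
      then have "e / 144 > 0" by simp
      from small[OF this] obtain N where N: "\<And>n. n \<ge> N \<Longrightarrow> grad_sq (\<lambda>p. u p - \<phi> n p) < e / 144" by blast
      have "A_form s' G' i (b (r k)) \<le> ennreal (144 * grad_sq u) + ennreal e" if k: "k \<ge> N" for k
      proof -
        have "r k \<ge> N" using seq_suble[OF v(2), of k] k by simp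
        have "A_form s' G' i (b (r k)) \<le> ennreal (72 * grad_sq (\<phi> (r k)))"
          unfolding b_def by (rule A_form_base_le[OF \<phi>(1)])
        also have "\<dots> \<le> ennreal (144 * grad_sq u + e)"
          using grad_sq_approx_le[OF uW \<phi>W, of "r k"] N[OF \<open>r k \<ge> N\<close>] by (intro ennreal_leI) linarith
        also have "\<dots> = ennreal (144 * grad_sq u) + ennreal e"
          using \<open>0 < e\<close> by (intro ennreal_plus) (auto simp: E.B_nonneg)
        finally show ?thesis .
      qed
      then show "liminf (\<lambda>k. A_form s' G' i (b (r k))) \<le> ennreal (144 * grad_sq u) + ennreal e"
        by (intro Liminf_le) (auto intro!: eventually_sequentiallyI[of N])
    qed
    finally show ?thesis .
  qed
  ultimately show ?thesis by blast
qed

text \<open>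
  Two smooth functions close to \<open>u\<close> are close to each other in energy, hence have close base values.
\<close>

lemma has_trace_unique:
  assumes u: "u \<in> E.H" and v: "has_trace u v" "has_trace u v1"
  shows "AE x in lborel. x \<in> cube \<longrightarrow> v x = v1 x"
proof -
  have uW: "u \<in> W12 cylinder w" using u by (rule E.H_W12)
  have [measurable]: "v \<in> borel_measurable borel" "v1 \<in> borel_measurable borel" using v by (auto simp: has_trace_def)
  obtain K where K: "K > 0" "\<And>\<phi>. \<phi> \<in> smooth_dom \<Longrightarrow> cube_sq (base \<phi>) \<le> ennreal (K * grad_sq \<phi>)"
    by (rule cube_sq_base_le_grad_sq) blast
  have "cube_sq (\<lambda>x. v x - v1 x) \<le> 0 + ennreal e" if e: "0 < e" for e
  proof -
    \<comment> \<open>twice the error of \<open>v\<close>, four times that of \<open>v1\<close>, and \<open>4 * K\<close> times the energy \<open>4 * d\<close> between them\<close>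
    define d where "d = e / (6 + 16 * K)"
    have "(6 + 16 * K) * d = e" using K(1) by (simp add: d_def)
    moreover have "2 * d + 2 * (2 * (K * (4 * d)) + 2 * d) = (6 + 16 * K) * d" by (simp add: algebra_simps)
    moreover have "0 < d" using e K(1) by (simp add: d_def)
    ultimately have d: "0 < d" "2 * d + 2 * (2 * (K * (4 * d)) + 2 * d) = e" by simp_all
    have two: "2 * ennreal x = ennreal (2 * x)" for x using ennreal_mult'[of 2 x] by simp
    obtain \<phi> where \<phi>: "\<phi> \<in> smooth_dom" "grad_sq (\<lambda>p. u p - \<phi> p) < d" "cube_sq (\<lambda>x. v x - base \<phi> x) < ennreal d"
      by (rule has_traceD[OF v(1) d(1)])
    obtain \<psi> where \<psi>: "\<psi> \<in> smooth_dom" "grad_sq (\<lambda>p. u p - \<psi> p) < d" "cube_sq (\<lambda>x. v1 x - base \<psi> x) < ennreal d"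
      by (rule has_traceD[OF v(2) d(1)])
    have [measurable]: "base \<phi> \<in> borel_measurable borel" "base \<psi> \<in> borel_measurable borel"
      using \<phi>(1) \<psi>(1) by (auto intro!: base_borel)
    have "cube_sq (\<lambda>x. v x - v1 x) = cube_sq (\<lambda>x. (v x - base \<phi> x) + ((base \<phi> x - base \<psi> x) + (base \<psi> x - v1 x)))" by simp
    also have "\<dots> \<le> 2 * cube_sq (\<lambda>x. v x - base \<phi> x) + 2 * cube_sq (\<lambda>x. (base \<phi> x - base \<psi> x) + (base \<psi> x - v1 x))"
      by (rule cube_sq_add_le) measurable
    also have "\<dots> \<le> 2 * cube_sq (\<lambda>x. v x - base \<phi> x) + 2 * (2 * cube_sq (\<lambda>x. base \<phi> x - base \<psi> x) + 2 * cube_sq (\<lambda>x. base \<psi> x - v1 x))"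
      by (intro add_left_mono mult_left_mono cube_sq_add_le) auto
    also have "\<dots> \<le> 2 * ennreal d + 2 * (2 * ennreal (K * (4 * d)) + 2 * ennreal d)"
    proof (intro add_mono mult_left_mono)
      show "cube_sq (\<lambda>x. v x - base \<phi> x) \<le> ennreal d" using \<phi>(3) by simp
      show "cube_sq (\<lambda>x. base \<psi> x - v1 x) \<le> ennreal d" using \<psi>(3) cube_sq_diff_commute[of "base \<psi>" v1] by simp
      have "cube_sq (\<lambda>x. base \<phi> x - base \<psi> x) \<le> ennreal (K * grad_sq (\<lambda>p. \<phi> p - \<psi> p))"
        using K(2)[OF smooth_dom_diff[OF \<phi>(1) \<psi>(1)]] by (simp add: base_diff)
      also have "\<dots> \<le> ennreal (K * (4 * d))"
        using grad_sq_diff_le[OF uW, of \<phi> \<psi>] \<phi> \<psi> K(1) by (intro ennreal_leI mult_left_mono) auto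
      finally show "cube_sq (\<lambda>x. base \<phi> x - base \<psi> x) \<le> ennreal (K * (4 * d))" .
    qed auto
    also have "\<dots> = ennreal (2 * d + 2 * (2 * (K * (4 * d)) + 2 * d))"
      using d(1) K(1) by (simp add: two ennreal_plus[symmetric] del: ennreal_plus)
    finally show ?thesis unfolding d(2) by simp
  qed
  then have "cube_sq (\<lambda>x. v x - v1 x) \<le> 0" by (rule ennreal_le_epsilon)
  then have "cube_sq (\<lambda>x. v x - v1 x) = 0" by simp
  then have "AE x in lborel. x \<in> cube \<longrightarrow> v x - v1 x = 0" by (subst (asm) cube_sq_zero_iff) auto
  then show ?thesis by eventually_elim auto
qed

lemma has_trace_add:
  assumes u: "u \<in> E.H" "u1 \<in> E.H" and v: "has_trace u v" "has_trace u1 v1"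
  shows "has_trace (\<lambda>p. u p + u1 p) (\<lambda>x. v x + v1 x)"
  unfolding has_trace_def
proof (intro conjI allI impI)
  have [measurable]: "v \<in> borel_measurable borel" "v1 \<in> borel_measurable borel" using v by (auto simp: has_trace_def)
  show "(\<lambda>x. v x + v1 x) \<in> borel_measurable borel" by measurable
  fix e :: real assume "0 < e"
  then have e: "e / 4 > 0" by simp
  obtain \<phi> where \<phi>: "\<phi> \<in> smooth_dom" "grad_sq (\<lambda>p. u p - \<phi> p) < e / 4" "cube_sq (\<lambda>x. v x - base \<phi> x) < ennreal (e / 4)"
    by (rule has_traceD[OF v(1) e])
  obtain \<psi> where \<psi>: "\<psi> \<in> smooth_dom" "grad_sq (\<lambda>p. u1 p - \<psi> p) < e / 4" "cube_sq (\<lambda>x. v1 x - base \<psi> x) < ennreal (e / 4)"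
    by (rule has_traceD[OF v(2) e])
  have [measurable]: "base \<phi> \<in> borel_measurable borel" "base \<psi> \<in> borel_measurable borel"
    using \<phi>(1) \<psi>(1) by (auto intro!: base_borel)
  have "grad_sq (\<lambda>p. (u p - \<phi> p) + (u1 p - \<psi> p)) \<le> 2 * grad_sq (\<lambda>p. u p - \<phi> p) + 2 * grad_sq (\<lambda>p. u1 p - \<psi> p)"
    using u \<phi>(1) \<psi>(1) by (intro grad_sq_add_le E.W12_diff) (auto intro: E.H_W12)
  also have "\<dots> < e" using \<phi>(2) \<psi>(2) by linarith
  finally have 1: "grad_sq (\<lambda>p. u p + u1 p - (\<phi> p + \<psi> p)) < e" by (simp add: algebra_simps)
  have "cube_sq (\<lambda>x. (v x - base \<phi> x) + (v1 x - base \<psi> x)) \<le> 2 * cube_sq (\<lambda>x. v x - base \<phi> x) + 2 * cube_sq (\<lambda>x. v1 x - base \<psi> x)"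
    by (rule cube_sq_add_le) measurable
  also have "\<dots> < 2 * ennreal (e / 4) + 2 * ennreal (e / 4)"
    using \<phi>(3) \<psi>(3) by (intro add_strict_mono ennreal_mult_strict_left_mono) auto
  also have "2 * ennreal (e / 4) = ennreal (e / 2)"
    using e ennreal_mult[of 2 "e / 4"] by simp
  also have "ennreal (e / 2) + ennreal (e / 2) = ennreal e"
    using e by (subst ennreal_plus[symmetric]) auto
  finally have "cube_sq (\<lambda>x. (v x - base \<phi> x) + (v1 x - base \<psi> x)) < ennreal e" .
  then have 2: "cube_sq (\<lambda>x. v x + v1 x - base (\<lambda>p. \<phi> p + \<psi> p) x) < ennreal e" by (simp add: base_add algebra_simps)
  show "\<exists>\<phi>\<in>smooth_dom. grad_sq (\<lambda>p. u p + u1 p - \<phi> p) < e \<and> cube_sq (\<lambda>x. v x + v1 x - base \<phi> x) < ennreal e"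
    by (intro bexI[of _ "\<lambda>p. \<phi> p + \<psi> p"] conjI 1 2 smooth_dom_add[OF \<phi>(1) \<psi>(1)])
qed

lemma has_trace_scale:
  assumes u: "u \<in> E.H" and v: "has_trace u v"
  shows "has_trace (\<lambda>p. c * u p) (\<lambda>x. c * v x)"
  unfolding has_trace_def
proof (intro conjI allI impI)
  have [measurable]: "v \<in> borel_measurable borel" using v by (auto simp: has_trace_def)
  show "(\<lambda>x. c * v x) \<in> borel_measurable borel" by measurable
  fix e :: real assume "0 < e"
  have c: "c\<^sup>2 + 1 > 0" by (rule add_nonneg_pos) auto
  define d where "d = e / (c\<^sup>2 + 1)"
  have d: "d > 0" "(c\<^sup>2 + 1) * d = e" using \<open>0 < e\<close> c by (auto simp: d_def)
  obtain \<phi> where \<phi>: "\<phi> \<in> smooth_dom" "grad_sq (\<lambda>p. u p - \<phi> p) < d" "cube_sq (\<lambda>x. v x - base \<phi> x) < ennreal d"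
    by (rule has_traceD[OF v d(1)])
  have [measurable]: "base \<phi> \<in> borel_measurable borel" using \<phi>(1) by (rule base_borel)
  have c2: "c\<^sup>2 * d < e" using d by (simp add: algebra_simps)
  have "grad_sq (\<lambda>p. c * (u p - \<phi> p)) = c\<^sup>2 * grad_sq (\<lambda>p. u p - \<phi> p)"
    using u \<phi>(1) by (intro grad_sq_scale E.W12_diff) (auto intro: E.H_W12)
  also have "\<dots> \<le> c\<^sup>2 * d" using \<phi>(2) by (intro mult_left_mono) auto
  finally have 1: "grad_sq (\<lambda>p. c * u p - c * \<phi> p) < e" using c2 by (simp add: right_diff_distrib)
  have "cube_sq (\<lambda>x. c * (v x - base \<phi> x)) = ennreal (c\<^sup>2) * cube_sq (\<lambda>x. v x - base \<phi> x)" by (rule cube_sq_scale) measurable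
  also have "\<dots> \<le> ennreal (c\<^sup>2) * ennreal d" using \<phi>(3) by (intro mult_left_mono) auto
  also have "\<dots> < ennreal e" using c2 d(1) by (simp add: ennreal_mult[symmetric] ennreal_less_iff)
  finally have 2: "cube_sq (\<lambda>x. c * v x - base (\<lambda>p. c * \<phi> p) x) < ennreal e" by (simp add: base_scale right_diff_distrib)
  show "\<exists>\<phi>\<in>smooth_dom. grad_sq (\<lambda>p. c * u p - \<phi> p) < e \<and> cube_sq (\<lambda>x. c * v x - base \<phi> x) < ennreal e"
    by (intro bexI[of _ "\<lambda>p. c * \<phi> p"] conjI 1 2 smooth_dom_scale[OF \<phi>(1)])
qed

lemma cube_sq_has_trace_le:
  assumes K: "K > 0" "\<And>\<phi>. \<phi> \<in> smooth_dom \<Longrightarrow> cube_sq (base \<phi>) \<le> ennreal (K * grad_sq \<phi>)"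
    and u: "u \<in> E.H" and v: "has_trace u v"
  shows "cube_sq v \<le> ennreal (4 * K * grad_sq u)"
proof (rule ennreal_le_epsilon)
  have [measurable]: "v \<in> borel_measurable borel" using v by (auto simp: has_trace_def)
  fix e :: real assume e: "0 < e"
  \<comment> \<open>twice the error of the trace and \<open>2 * K\<close> times twice the error in energy\<close>
  define d where "d = e / (2 + 4 * K)"
  have "(2 + 4 * K) * d = e" using K(1) by (simp add: d_def)
  moreover have "2 * d + 4 * K * d = (2 + 4 * K) * d" by (simp add: algebra_simps)
  moreover have "0 < d" using e K(1) by (simp add: d_def)
  ultimately have d: "0 < d" "2 * d + 4 * K * d = e" by simp_all
  obtain \<phi> where \<phi>: "\<phi> \<in> smooth_dom" "grad_sq (\<lambda>p. u p - \<phi> p) < d" "cube_sq (\<lambda>x. v x - base \<phi> x) < ennreal d"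
    by (rule has_traceD[OF v d(1)])
  have [measurable]: "base \<phi> \<in> borel_measurable borel" using \<phi>(1) by (rule base_borel)
  have "cube_sq v = cube_sq (\<lambda>x. (v x - base \<phi> x) + base \<phi> x)" by simp
  also have "\<dots> \<le> 2 * cube_sq (\<lambda>x. v x - base \<phi> x) + 2 * cube_sq (base \<phi>)" by (rule cube_sq_add_le) measurable
  also have "\<dots> \<le> 2 * ennreal d + 2 * ennreal (K * (2 * grad_sq u + 2 * d))"
  proof (intro add_mono mult_left_mono)
    have "grad_sq \<phi> \<le> 2 * grad_sq u + 2 * d"
      using grad_sq_approx_le[OF E.H_W12[OF u], of \<phi>] \<phi> by auto
    then show "cube_sq (base \<phi>) \<le> ennreal (K * (2 * grad_sq u + 2 * d))"
      using K(1) by (intro order_trans[OF K(2)[OF \<phi>(1)]] ennreal_leI mult_left_mono) auto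
  qed (use \<phi>(3) in auto)
  also have "\<dots> = ennreal (2 * d + 2 * (K * (2 * grad_sq u + 2 * d)))"
    using d(1) K(1) by (subst ennreal_plus) (auto simp: ennreal_mult E.B_nonneg simp del: ennreal_plus)
  also have "2 * d + 2 * (K * (2 * grad_sq u + 2 * d)) = 4 * K * grad_sq u + e" using d(2) by (simp add: algebra_simps)
  also have "ennreal (4 * K * grad_sq u + e) = ennreal (4 * K * grad_sq u) + ennreal e"
    using K(1) e by (intro ennreal_plus) (auto simp: E.B_nonneg)
  finally show "cube_sq v \<le> ennreal (4 * K * grad_sq u) + ennreal e" .
qed

lemma A_form_eq: "A_form s G i v = A_form s' G' i v"
  by (rule A_form_cong_AE[OF sG]) simp

lemma L2_cube_facts:
  assumes v[measurable]: "v \<in> borel_measurable borel" and fin: "cube_sq v < \<infinity>"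
  shows "v \<in> L2 cube (w_tilde s G)" "(L2_norm cube (w_tilde s G) v)\<^sup>2 = enn2real (cube_sq v)"
proof -
  let ?F = "\<lambda>x. \<bar>v x\<bar>\<^sup>2 * w_tilde s G x" and ?F' = "\<lambda>x. w_tilde s' G' x * (v x)\<^sup>2"
  have eq: "AE x in lborel. x \<in> cube \<longrightarrow> ?F x = ?F' x"
    using sG by eventually_elim (auto simp: w_tilde_def)
  have m: "?F \<in> borel_measurable (lebesgue_on cube)"
    by (rule measurable_lebesgue_on_AE[OF _ _ eq]) measurable
  have nn: "AE x in lebesgue_on cube. 0 \<le> ?F x"
    unfolding AE_lebesgue_on_cube using eq by eventually_elim (auto simp: w_tilde_pos less_imp_le)
  have "(\<integral>\<^sup>+x. ennreal (?F x) \<partial>lebesgue_on cube) = (\<integral>\<^sup>+x. ennreal (?F' x) \<partial>lebesgue_on cube)"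
    by (rule nn_integral_cong_AE) (use eq in \<open>auto simp: AE_lebesgue_on_cube mult.commute elim!: eventually_mono\<close>)
  also have "\<dots> = cube_sq v" unfolding cube_sq_def by (rule nn_integral_lebesgue_on) measurable
  finally have e: "(\<integral>\<^sup>+x. ennreal (?F x) \<partial>lebesgue_on cube) = cube_sq v" .
  have i: "integrable (lebesgue_on cube) ?F"
    by (rule integrableI_nonneg[OF m nn]) (use e fin in simp)
  have "v \<in> borel_measurable (lebesgue_on cube)"
    by (intro measurable_restrict_space1 measurable_completion) simp
  with i show "v \<in> L2 cube (w_tilde s G)" unfolding L2_def by blast
  have "(LINT x|lebesgue_on cube. ?F x) = enn2real (cube_sq v)"
    using integral_eq_nn_integral[OF m nn] e by simp
  moreover have "0 \<le> (LINT x|lebesgue_on cube. ?F x)" using nn by (rule integral_nonneg_AE)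
  ultimately show "(L2_norm cube (w_tilde s G) v)\<^sup>2 = enn2real (cube_sq v)"
    by (simp add: L2_norm_def)
qed

text \<open>
  Selecting a trace for every function gives an operator that is linear up to null sets, since traces
  are unique and sums and multiples of traces are traces.
\<close>

theorem trace_operator_exists: "\<exists>T. is_trace_operator s G T"
proof -
  obtain K where K: "K > 0" "\<And>\<phi>. \<phi> \<in> smooth_dom \<Longrightarrow> cube_sq (base \<phi>) \<le> ennreal (K * grad_sq \<phi>)"
    by (rule cube_sq_base_le_grad_sq) blast
  define T where "T u = (SOME v. has_trace u v \<and> (\<forall>i. A_form s' G' i v \<le> ennreal (144 * grad_sq u)))" for u
  have T: "has_trace u (T u)" "\<And>i. A_form s' G' i (T u) \<le> ennreal (144 * grad_sq u)" if "u \<in> E.H" for u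
    using someI_ex[OF has_trace_exists[OF that]] unfolding T_def by blast+
  have m: "T u \<in> borel_measurable borel" if "u \<in> E.H" for u using T(1)[OF that] by (simp add: has_trace_def)
  have N: "cube_sq (T u) \<le> ennreal (4 * K * grad_sq u)" if "u \<in> E.H" for u by (rule cube_sq_has_trace_le[OF K that T(1)[OF that]])
  have fin: "cube_sq (T u) < \<infinity>" if "u \<in> E.H" for u using N[OF that] by (auto intro: le_less_trans)
  note L = L2_cube_facts[OF m fin]
  have A: "A_form s G i (T u) \<le> ennreal (144 * grad_sq u)" if "u \<in> E.H" for u i
    unfolding A_form_eq by (rule T(2)[OF that])
  let ?C = "sqrt (4 * K + real CARD('n) * 144)"
  have "Ws2_norm s G (T u) \<le> ?C * grad_norm cylinder w u" if u: "u \<in> E.H" for u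
  proof -
    have "enn2real (A_form s G i (T u)) \<le> 144 * grad_sq u" for i
      using enn2real_mono[OF A[OF u, of i]] by (simp add: E.B_nonneg)
    then have "(\<Sum>i\<in>UNIV. enn2real (A_form s G i (T u))) \<le> (\<Sum>i\<in>(UNIV::'n set). 144 * grad_sq u)" by (rule sum_mono)
    moreover have "(L2_norm cube (w_tilde s G) (T u))\<^sup>2 \<le> 4 * K * grad_sq u"
      using enn2real_mono[OF N[OF u]] K(1) by (simp add: L[OF u u] E.B_nonneg)
    ultimately have "(L2_norm cube (w_tilde s G) (T u))\<^sup>2 + (\<Sum>i\<in>UNIV. enn2real (A_form s G i (T u))) \<le> (4 * K + real CARD('n) * 144) * grad_sq u"
      by (simp add: algebra_simps)
    then have "Ws2_norm s G (T u) \<le> sqrt ((4 * K + real CARD('n) * 144) * grad_sq u)"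
      unfolding Ws2_norm_def by (rule real_sqrt_le_mono)
    then show ?thesis by (simp add: real_sqrt_mult E.grad_norm_eq)
  qed
  then have bound: "\<exists>C. \<forall>u\<in>E.H. Ws2_norm s G (T u) \<le> C * grad_norm cylinder w u" by blast
  have "is_trace_operator s G T"
    unfolding is_trace_operator_def H0L_eq Let_def
  proof (intro conjI ballI allI bound)
    fix u assume u: "u \<in> E.H"
    show "T u \<in> Ws2 s G" unfolding Ws2_def using L(1)[OF u u] le_less_trans[OF A[OF u]] by auto
    fix c :: real
    show "AE x in lebesgue_on cube. T (\<lambda>p. c * u p) x = c * T u x"
      unfolding AE_lebesgue_on_cube
      by (rule has_trace_unique[OF E.H_scale[OF u] T(1)[OF E.H_scale[OF u]] has_trace_scale[OF u T(1)[OF u]]])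
  next
    fix u u1 assume u: "u \<in> E.H" "u1 \<in> E.H"
    show "AE x in lebesgue_on cube. T (\<lambda>p. u p + u1 p) x = T u x + T u1 x"
      unfolding AE_lebesgue_on_cube
      by (rule has_trace_unique[OF E.H_add[OF u] T(1)[OF E.H_add[OF u]] has_trace_add[OF u T(1)[OF u(1)] T(1)[OF u(2)]]])
  next
    fix u assume "u \<in> E.H \<inter> Cc_cylinder"
    then have u: "u \<in> E.H" "u \<in> smooth_dom" by (auto intro: E.H_W12)
    have "AE x in lborel. x \<in> cube \<longrightarrow> T u x = base u x"
      by (rule has_trace_unique[OF u(1) T(1)[OF u(1)] has_trace_base[OF u(2)]])
    then show "AE x in lebesgue_on cube. T u x = u (x, 0)"
      unfolding AE_lebesgue_on_cube by (rule eventually_mono) (auto simp: base_def)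
  qed
  then show ?thesis by blast
qed

end

section \<open>The trace kernel\<close>

context trace_setting
begin

abbreviation T :: "((real^'n) \<times> real \<Rightarrow> real) \<Rightarrow> real^'n \<Rightarrow> real" where "T \<equiv> trace_op s G"

lemma trace_op: "is_trace_operator s G T"
  unfolding trace_op_def by (rule someI_ex[OF trace_operator_exists])

lemma T_Ws2: "u \<in> E.H \<Longrightarrow> T u \<in> Ws2 s G"
  using trace_op by (simp add: is_trace_operator_def H0L_eq Let_def)

lemma T_add: "u \<in> E.H \<Longrightarrow> v \<in> E.H \<Longrightarrow> AE x in lborel. x \<in> cube \<longrightarrow> T (\<lambda>p. u p + v p) x = T u x + T v x"
  using trace_op by (simp add: is_trace_operator_def H0L_eq AE_lebesgue_on_cube Let_def)

lemma T_scale: "u \<in> E.H \<Longrightarrow> AE x in lborel. x \<in> cube \<longrightarrow> T (\<lambda>p. c * u p) x = c * T u x"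
  using trace_op by (simp add: is_trace_operator_def H0L_eq AE_lebesgue_on_cube Let_def)

lemma T_bound:
  obtains C where "0 \<le> C" "\<And>u. u \<in> E.H \<Longrightarrow> Ws2_norm s G (T u) \<le> C * sqrt (grad_sq u)"
proof -
  obtain C where C: "\<forall>u\<in>E.H. Ws2_norm s G (T u) \<le> C * sqrt (grad_sq u)"
    using trace_op unfolding is_trace_operator_def H0L_eq Let_def E.grad_norm_eq by blast
  have "Ws2_norm s G (T u) \<le> \<bar>C\<bar> * sqrt (grad_sq u)" if "u \<in> E.H" for u
    using C that mult_right_mono[OF abs_ge_self[of C], of "sqrt (grad_sq u)"] E.B_nonneg[of u] by force
  then show thesis by (intro that[of "\<bar>C\<bar>"]) auto
qed

lemma w_tilde_measurable: "w_tilde s G \<in> borel_measurable (lebesgue_on cube)"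
proof (rule measurable_lebesgue_on_AE)
  show "AE x in lborel. x \<in> cube \<longrightarrow> w_tilde s G x = w_tilde s' G' x"
    using sG by eventually_elim (simp add: w_tilde_def)
qed auto

lemma w_tilde_pos_AE: "AE x in lborel. x \<in> cube \<longrightarrow> 0 < w_tilde s G x"
  using sG
proof eventually_elim
  fix x assume "x \<in> cube \<longrightarrow> s x = s' x \<and> G x = G' x"
  then show "x \<in> cube \<longrightarrow> 0 < w_tilde s G x" using w_tilde_pos[of x] by (simp add: w_tilde_def)
qed

lemma Ws2_measurable: "v \<in> Ws2 s G \<Longrightarrow> v \<in> borel_measurable (lebesgue_on cube)"
  by (simp add: Ws2_def L2_def)

lemma Ws2_norm_cong:
  assumes "v \<in> Ws2 s G" "v' \<in> Ws2 s G" "AE x in lborel. x \<in> cube \<longrightarrow> v x = v' x"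
  shows "Ws2_norm s G v = Ws2_norm s G v'"
proof -
  have "(LINT x|lebesgue_on cube. \<bar>v x\<bar>\<^sup>2 * w_tilde s G x) = (LINT x|lebesgue_on cube. \<bar>v' x\<bar>\<^sup>2 * w_tilde s G x)"
  proof (rule integral_cong_AE)
    note [measurable] = Ws2_measurable[OF assms(1)] Ws2_measurable[OF assms(2)] w_tilde_measurable
    show "(\<lambda>x. \<bar>v x\<bar>\<^sup>2 * w_tilde s G x) \<in> borel_measurable (lebesgue_on cube)" by measurable
    show "(\<lambda>x. \<bar>v' x\<bar>\<^sup>2 * w_tilde s G x) \<in> borel_measurable (lebesgue_on cube)" by measurable
    show "AE x in lebesgue_on cube. \<bar>v x\<bar>\<^sup>2 * w_tilde s G x = \<bar>v' x\<bar>\<^sup>2 * w_tilde s G x"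
      unfolding AE_lebesgue_on_cube using assms(3) by eventually_elim simp
  qed
  moreover have "A_form s G i v = A_form s G i v'" for i by (rule A_form_cong_AE[OF _ assms(3)]) simp
  ultimately show ?thesis by (simp add: Ws2_norm_def L2_norm_def)
qed

text \<open>
  A function that vanishes almost everywhere belongs to the trace space and has norm \<open>0\<close>. Hence bounded
  functionals do not depend on representatives.
\<close>

lemma null_Ws2:
  assumes d: "d \<in> borel_measurable (lebesgue_on cube)" and z: "AE x in lborel. x \<in> cube \<longrightarrow> d x = 0"
  shows "d \<in> Ws2 s G" "Ws2_norm s G d = 0"
proof -
  have A: "A_form s G i d = 0" for i
  proof -
    have "A_form s G i d = A_form s G i (\<lambda>_. 0)" by (rule A_form_cong_AE[OF _ z]) simp
    then show ?thesis by (simp add: A_form_zero)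
  qed
  have ae: "AE x in lebesgue_on cube. \<bar>d x\<bar>\<^sup>2 * w_tilde s G x = 0"
    unfolding AE_lebesgue_on_cube using z by eventually_elim simp
  have m: "(\<lambda>x. \<bar>d x\<bar>\<^sup>2 * w_tilde s G x) \<in> borel_measurable (lebesgue_on cube)"
    using d w_tilde_measurable by measurable
  have "integrable (lebesgue_on cube) (\<lambda>x. \<bar>d x\<bar>\<^sup>2 * w_tilde s G x)"
    by (rule integrable_cong_AE_imp[of _ "\<lambda>_. 0"]) (use m ae in \<open>auto elim!: eventually_mono\<close>)
  then have "d \<in> L2 cube (w_tilde s G)" using d unfolding L2_def by blast
  then show "d \<in> Ws2 s G" unfolding Ws2_def using A by simp
  have "(LINT x|lebesgue_on cube. \<bar>d x\<bar>\<^sup>2 * w_tilde s G x) = 0" using ae by (rule integral_eq_zero_AE)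
  then show "Ws2_norm s G d = 0" by (simp add: Ws2_norm_def L2_norm_def A)
qed

text \<open>
  The weight \<open>w_tilde\<close> is positive almost everywhere because \<open>s\<close> vanishes only on a null set.
\<close>

lemma Ws2_norm_zero:
  assumes v: "v \<in> Ws2 s G" and z: "Ws2_norm s G v \<le> 0"
  shows "AE x in lborel. x \<in> cube \<longrightarrow> v x = 0"
proof -
  let ?F = "\<lambda>x. \<bar>v x\<bar>\<^sup>2 * w_tilde s G x"
  have nn: "AE x in lebesgue_on cube. 0 \<le> ?F x"
    unfolding AE_lebesgue_on_cube using w_tilde_pos_AE by eventually_elim (simp add: less_imp_le)
  have i: "integrable (lebesgue_on cube) ?F" using v by (simp add: Ws2_def L2_def)
  have "(L2_norm cube (w_tilde s G) v)\<^sup>2 + (\<Sum>i\<in>UNIV. enn2real (A_form s G i v)) \<le> 0"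
    using z by (simp add: Ws2_norm_def)
  moreover have "0 \<le> (\<Sum>i\<in>UNIV. enn2real (A_form s G i v))" by (intro sum_nonneg) simp
  ultimately have "(L2_norm cube (w_tilde s G) v)\<^sup>2 \<le> 0" by linarith
  then have "(LINT x|lebesgue_on cube. ?F x) = 0" by (simp add: L2_norm_def)
  then have "AE x in lebesgue_on cube. ?F x = 0"
    using integral_nonneg_eq_0_iff_AE[OF i nn] by simp
  then show ?thesis
    unfolding AE_lebesgue_on_cube using w_tilde_pos_AE by eventually_elim auto
qed

abbreviation "W0 \<equiv> W0_kernel s G"

lemma W0_iff: "u \<in> W0 \<longleftrightarrow> u \<in> E.H \<and> (AE x in lborel. x \<in> cube \<longrightarrow> T u x = 0)"
  by (simp add: W0_kernel_def H0L_eq AE_lebesgue_on_cube)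

lemma W0_H: "u \<in> W0 \<Longrightarrow> u \<in> E.H" by (simp add: W0_iff)

lemma W0_add:
  assumes "u \<in> W0" "v \<in> W0"
  shows "(\<lambda>p. u p + v p) \<in> W0"
proof -
  have "AE x in lborel. x \<in> cube \<longrightarrow> T (\<lambda>p. u p + v p) x = 0"
    using T_add[of u v] assms unfolding W0_iff by (auto elim!: eventually_elim2 eventually_rev_mp)
  then show ?thesis using assms by (simp add: W0_iff E.H_add)
qed

lemma W0_scale:
  assumes "u \<in> W0"
  shows "(\<lambda>p. c * u p) \<in> W0"
proof -
  have "AE x in lborel. x \<in> cube \<longrightarrow> T (\<lambda>p. c * u p) x = 0"
    using T_scale[of u c] assms unfolding W0_iff by (auto elim!: eventually_elim2 eventually_rev_mp)
  then show ?thesis using assms by (simp add: W0_iff E.H_scale)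
qed

lemma W0_zero: "(\<lambda>p. 0) \<in> W0"
  using T_scale[OF E.H_zero, of 0] by (simp add: W0_iff E.H_zero)

lemma W0_if_grad_sq_zero:
  assumes u: "u \<in> E.H" and z: "grad_sq u = 0"
  shows "u \<in> W0"
proof -
  obtain C where "\<And>u. u \<in> E.H \<Longrightarrow> Ws2_norm s G (T u) \<le> C * sqrt (grad_sq u)" by (rule T_bound) blast
  from this[OF u] have "Ws2_norm s G (T u) \<le> 0" using z by simp
  from Ws2_norm_zero[OF T_Ws2[OF u] this] show ?thesis using u by (simp add: W0_iff)
qed

text \<open>
  The trace of the limit \<open>v\<close> is the trace of \<open>v - u n\<close>, whose norm tends to \<open>0\<close>.
\<close>

lemma W0_closed:
  assumes u: "\<And>n. u n \<in> W0" and v: "v \<in> E.H" and lim: "(\<lambda>n. grad_sq (\<lambda>p. u n p - v p)) \<longlonglongrightarrow> 0"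
  shows "v \<in> W0"
proof -
  obtain C where C: "\<And>u. u \<in> E.H \<Longrightarrow> Ws2_norm s G (T u) \<le> C * sqrt (grad_sq u)" by (rule T_bound) blast
  have "Ws2_norm s G (T v) \<le> C * sqrt (grad_sq (\<lambda>p. u n p - v p))" for n
  proof -
    have un: "u n \<in> E.H" by (rule W0_H[OF u])
    have d: "(\<lambda>p. v p - u n p) \<in> E.H" by (rule E.H_diff[OF v un])
    have "AE x in lborel. x \<in> cube \<longrightarrow> T (\<lambda>p. (v p - u n p) + u n p) x = T (\<lambda>p. v p - u n p) x + T (u n) x"
      by (rule T_add[OF d un])
    moreover have "AE x in lborel. x \<in> cube \<longrightarrow> T (u n) x = 0" using u[of n] by (simp add: W0_iff)
    ultimately have "AE x in lborel. x \<in> cube \<longrightarrow> T v x = T (\<lambda>p. v p - u n p) x"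
      by eventually_elim simp
    then have "Ws2_norm s G (T v) = Ws2_norm s G (T (\<lambda>p. v p - u n p))"
      by (rule Ws2_norm_cong[OF T_Ws2[OF v] T_Ws2[OF d]])
    also have "\<dots> \<le> C * sqrt (grad_sq (\<lambda>p. v p - u n p))" by (rule C[OF d])
    also have "grad_sq (\<lambda>p. v p - u n p) = grad_sq (\<lambda>p. u n p - v p)"
      by (rule grad_sq_diff_commute[OF E.H_W12[OF v] E.H_W12[OF un]])
    finally show ?thesis .
  qed
  moreover have "(\<lambda>n. C * sqrt (grad_sq (\<lambda>p. u n p - v p))) \<longlonglongrightarrow> C * sqrt 0"
    by (intro tendsto_intros lim)
  ultimately have "Ws2_norm s G (T v) \<le> C * sqrt 0" by (intro LIMSEQ_le_const[of _ "C * sqrt 0"]) auto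
  then have "Ws2_norm s G (T v) \<le> 0" by simp
  from Ws2_norm_zero[OF T_Ws2[OF v] this] show ?thesis using v by (simp add: W0_iff)
qed

section \<open>Orthogonality to the trace kernel and the quotient space\<close>

abbreviation grad_ip :: "((real^'n) \<times> real \<Rightarrow> real) \<Rightarrow> ((real^'n) \<times> real \<Rightarrow> real) \<Rightarrow> real" where "grad_ip \<equiv> E.B"

interpretation IH: semi_inner_space E.H "\<lambda>f g x. f x + g x" "\<lambda>c f x. c * f x" grad_ip
  by (rule E.semi_inner_space_H)

interpretation IW: semi_inner_space W0 "\<lambda>f g x. f x + g x" "\<lambda>c f x. c * f x" grad_ip
  using W0_zero by unfold_locales
    (auto intro: W0_add W0_scale W0_H IH.B_add IH.B_scl E.B_sym E.B_nonneg)

lemma B_diff_left: "u \<in> E.H \<Longrightarrow> v \<in> E.H \<Longrightarrow> k \<in> E.H \<Longrightarrow> grad_ip (\<lambda>p. u p - v p) k = grad_ip u k - grad_ip v k"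
  using IH.B_add[of u "\<lambda>p. (-1) * v p" k] IH.B_scl[of v k "-1"] E.H_scale[of v "-1"] by simp

lemma dst_H: "IH.dst u v = grad_sq (\<lambda>p. u p - v p)" by (simp add: IH.dst_def)

lemma dst_W: "IW.dst u v = grad_sq (\<lambda>p. u p - v p)" by (simp add: IW.dst_def)

lemma riesz_H:
  assumes "\<And>u v. u \<in> E.H \<Longrightarrow> v \<in> E.H \<Longrightarrow> F (\<lambda>p. u p + v p) = F u + F v"
    "\<And>u c. u \<in> E.H \<Longrightarrow> F (\<lambda>p. c * u p) = c * F u" "\<And>u. u \<in> E.H \<Longrightarrow> \<bar>F u\<bar> \<le> C * sqrt (grad_sq u)"
  shows "\<exists>u\<in>E.H. \<forall>k\<in>E.H. grad_ip u k = F k"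
proof (rule IH.riesz[OF _ assms])
  fix u assume u: "\<And>n::nat. u n \<in> E.H" and C: "\<And>e. e > 0 \<Longrightarrow> \<exists>N. \<forall>m\<ge>N. \<forall>n\<ge>N. IH.dst (u m) (u n) < e"
  show "\<exists>v\<in>E.H. (\<lambda>n. IH.dst (u n) v) \<longlonglongrightarrow> 0"
    unfolding dst_H by (rule E.H_complete[OF poincare_E u C[unfolded dst_H]])
qed

lemma riesz_W0:
  assumes "\<And>u v. u \<in> W0 \<Longrightarrow> v \<in> W0 \<Longrightarrow> F (\<lambda>p. u p + v p) = F u + F v"
    "\<And>u c. u \<in> W0 \<Longrightarrow> F (\<lambda>p. c * u p) = c * F u" "\<And>u. u \<in> W0 \<Longrightarrow> \<bar>F u\<bar> \<le> C * sqrt (grad_sq u)"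
  shows "\<exists>u\<in>W0. \<forall>k\<in>W0. grad_ip u k = F k"
proof (rule IW.riesz[OF _ assms])
  fix u assume u: "\<And>n::nat. u n \<in> W0" and C: "\<And>e. e > 0 \<Longrightarrow> \<exists>N. \<forall>m\<ge>N. \<forall>n\<ge>N. IW.dst (u m) (u n) < e"
  obtain v where v: "v \<in> E.H" "(\<lambda>n. grad_sq (\<lambda>x. u n x - v x)) \<longlonglongrightarrow> 0"
    using E.H_complete[OF poincare_E W0_H[OF u] C[unfolded dst_W]] by blast
  have "v \<in> W0" by (rule W0_closed[OF u v])
  with v show "\<exists>v\<in>W0. (\<lambda>n. IW.dst (u n) v) \<longlonglongrightarrow> 0" unfolding dst_W by blast
qed

definition perp :: "((real^'n) \<times> real \<Rightarrow> real) \<Rightarrow> bool" where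
  "perp u \<longleftrightarrow> u \<in> E.H \<and> (\<forall>k\<in>W0. grad_ip u k = 0)"

lemma B_abs_le: "u \<in> E.H \<Longrightarrow> v \<in> E.H \<Longrightarrow> \<bar>grad_ip u v\<bar> \<le> sqrt (grad_sq u) * sqrt (grad_sq v)"
  using IH.Cauchy_Schwarz[of u v] by (simp add: real_sqrt_mult[symmetric] real_le_rsqrt)

text \<open>
  The orthogonal projection of \<open>u0\<close> onto the trace kernel represents the functional \<open>grad_ip u0\<close> there;
  subtracting it gives \<open>u\<close>.
\<close>

lemma perp_exists:
  assumes u0: "u0 \<in> E.H"
  obtains u where "perp u" "(\<lambda>p. u0 p - u p) \<in> W0"
proof -
  have "\<exists>q\<in>W0. \<forall>k\<in>W0. grad_ip q k = grad_ip u0 k"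
    by (rule riesz_W0[where C="sqrt (grad_sq u0)"])
      (use u0 in \<open>auto intro: IH.B_add' IH.B_scl' W0_H B_abs_le\<close>)
  then obtain q where q: "q \<in> W0" "\<And>k. k \<in> W0 \<Longrightarrow> grad_ip q k = grad_ip u0 k" by blast
  have "perp (\<lambda>p. u0 p - q p)"
    unfolding perp_def using u0 q by (auto simp: B_diff_left W0_H intro: E.H_diff W0_H)
  moreover have "(\<lambda>p. u0 p - (u0 p - q p)) \<in> W0" using q(1) by simp
  ultimately show thesis by (rule that)
qed

lemma TR_eq: "TR s G u = {u'. u \<in> E.H \<and> u' \<in> E.H \<and> (\<lambda>p. u p - u' p) \<in> W0}"
  by (auto simp: TR_def W0_rel_def H0L_eq)

lemma W0_diff_commute: "(\<lambda>p. u p - v p) \<in> W0 \<Longrightarrow> (\<lambda>p. v p - u p) \<in> W0"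
  using W0_scale[of "\<lambda>p. u p - v p" "-1"] by simp

lemma W0_diff_trans: "(\<lambda>p. u p - v p) \<in> W0 \<Longrightarrow> (\<lambda>p. v p - k p) \<in> W0 \<Longrightarrow> (\<lambda>p. u p - k p) \<in> W0"
  using W0_add[of "\<lambda>p. u p - v p" "\<lambda>p. v p - k p"] by simp

lemma TR_self: "u \<in> E.H \<Longrightarrow> u \<in> TR s G u"
  using W0_zero by (simp add: TR_eq)

lemma TR_eq_iff: "u \<in> E.H \<Longrightarrow> v \<in> E.H \<Longrightarrow> TR s G u = TR s G v \<longleftrightarrow> (\<lambda>p. u p - v p) \<in> W0"
proof
  assume u: "u \<in> E.H" "v \<in> E.H" and e: "TR s G u = TR s G v"
  then have "v \<in> TR s G u" using TR_self by simp
  then show "(\<lambda>p. u p - v p) \<in> W0" by (simp add: TR_eq)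
next
  assume u: "u \<in> E.H" "v \<in> E.H" and d: "(\<lambda>p. u p - v p) \<in> W0"
  have "(\<lambda>p. u p - k p) \<in> W0 \<longleftrightarrow> (\<lambda>p. v p - k p) \<in> W0" for k
    using W0_diff_trans[OF d, of k] W0_diff_trans[OF W0_diff_commute[OF d], of k] by blast
  then show "TR s G u = TR s G v" using u by (simp add: TR_eq)
qed

lemma Y_space_eq: "Y_space s G = TR s G ` E.H"
  by (auto simp: Y_space_def quotient_def TR_def H0L_eq)

lemma TR_Y: "u \<in> E.H \<Longrightarrow> TR s G u \<in> Y_space s G" by (simp add: Y_space_eq)

lemma TR_member: "u \<in> E.H \<Longrightarrow> k \<in> TR s G u \<Longrightarrow> k \<in> E.H \<and> TR s G k = TR s G u"
proof -
  assume u: "u \<in> E.H" and k: "k \<in> TR s G u"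
  then have "k \<in> E.H" "(\<lambda>p. u p - k p) \<in> W0" by (auto simp: TR_eq)
  then show ?thesis using TR_eq_iff[OF u, of k] by blast
qed

lemma TR_some: "u \<in> E.H \<Longrightarrow> (SOME k. k \<in> TR s G u) \<in> E.H \<and> TR s G (SOME k. k \<in> TR s G u) = TR s G u"
  using TR_member[of u "SOME k. k \<in> TR s G u"] someI[of "\<lambda>k. k \<in> TR s G u", OF TR_self] by blast

lemma Y_space_perp:
  assumes "v \<in> Y_space s G"
  obtains u where "perp u" "v = TR s G u"
proof -
  obtain u0 where u0: "u0 \<in> E.H" "v = TR s G u0" using assms by (auto simp: Y_space_eq)
  obtain u where u: "perp u" "(\<lambda>p. u0 p - u p) \<in> W0" by (rule perp_exists[OF u0(1)])
  then have "TR s G u0 = TR s G u" using TR_eq_iff[OF u0(1)] by (simp add: perp_def)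
  with u u0 show thesis by (intro that[of u]) auto
qed

lemma energy_eq: "energy s G u = 1 / 2 * grad_sq u"
  by (simp add: energy_def E.B_def E.ip_def dot_square_norm)

text \<open>
  Minimal energy extensions are unique up to functions of energy zero, so the minimiser chosen in
  \<open>S_min\<close> has the same inner products as the representative that is orthogonal to the trace kernel.
\<close>

lemma S_min_perp:
  assumes u: "perp u"
  shows "S_min s G (TR s G u) \<in> E.H" "k \<in> E.H \<Longrightarrow> grad_ip (S_min s G (TR s G u)) k = grad_ip u k"
proof -
  let ?P = "\<lambda>y. y \<in> H0L (cyl_weight s G) \<and> TR s G y = TR s G u"
  have uH: "u \<in> E.H" and orth: "\<And>k. k \<in> W0 \<Longrightarrow> grad_ip u k = 0" using u by (auto simp: perp_def)
  have pyth: "grad_sq y = grad_sq u + grad_sq (\<lambda>p. y p - u p)" if y: "?P y" for y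
  proof -
    have yH: "y \<in> E.H" using y by (simp add: H0L_eq)
    have d: "(\<lambda>p. y p - u p) \<in> W0" using y TR_eq_iff[OF yH uH] by simp
    have "grad_sq (\<lambda>p. u p + 1 * (y p - u p)) = grad_sq u + 2 * grad_ip u (\<lambda>p. y p - u p) * 1 + grad_sq (\<lambda>p. y p - u p) * 1\<^sup>2"
      by (rule IH.B_expand[OF uH W0_H[OF d]])
    then show ?thesis by (simp add: orth[OF d])
  qed
  have "is_arg_min (energy s G) ?P u"
    unfolding is_arg_min_def energy_eq
  proof (intro conjI notI)
    show "u \<in> H0L (cyl_weight s G)" using uH by (simp add: H0L_eq)
    assume "\<exists>y. ?P y \<and> 1 / 2 * grad_sq y < 1 / 2 * grad_sq u"
    then obtain y where "?P y" "1 / 2 * grad_sq y < 1 / 2 * grad_sq u" by blast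
    then show False using pyth[of y] E.B_nonneg[of "\<lambda>p. y p - u p"] by linarith
  qed simp
  then have min: "is_arg_min (energy s G) ?P (S_min s G (TR s G u))"
    unfolding S_min_def arg_min_def by (rule someI[where P="is_arg_min (energy s G) ?P"])
  let ?S = "S_min s G (TR s G u)"
  have S: "?P ?S" and le: "grad_sq ?S \<le> grad_sq u"
    using min uH unfolding is_arg_min_def energy_eq by (auto simp: H0L_eq not_less)
  show SH: "?S \<in> E.H" using S by (simp add: H0L_eq)
  have z: "grad_sq (\<lambda>p. ?S p - u p) = 0"
    using pyth[OF S] le E.B_nonneg[of "\<lambda>p. ?S p - u p"] by linarith
  assume k: "k \<in> E.H"
  have "\<bar>grad_ip (\<lambda>p. ?S p - u p) k\<bar> \<le> sqrt (grad_sq (\<lambda>p. ?S p - u p)) * sqrt (grad_sq k)"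
    by (rule B_abs_le[OF E.H_diff[OF SH uH] k])
  then have "grad_ip (\<lambda>p. ?S p - u p) k = 0" using z by simp
  then show "grad_ip ?S k = grad_ip u k" using B_diff_left[OF SH uH k] by simp
qed

text \<open>
  The functional \<open>TR \<psi> \<mapsto> grad_ip u \<psi>\<close> is well defined as \<open>u\<close> is orthogonal to the trace kernel, and bounded for
  the quotient norm because the Cauchy-Schwarz inequality holds for every representative of the class.
\<close>

lemma frac_laplacian_perp:
  assumes u: "perp u"
  shows "frac_laplacian s G (TR s G u) \<in> extensional (Y_space s G)"
    "\<psi> \<in> E.H \<Longrightarrow> frac_laplacian s G (TR s G u) (TR s G \<psi>) = grad_ip u \<psi>"
proof -
  have uH: "u \<in> E.H" and orth: "\<And>k. k \<in> W0 \<Longrightarrow> grad_ip u k = 0" using u by (auto simp: perp_def)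
  define L0 where "L0 = restrict (\<lambda>y. grad_ip u (SOME k. k \<in> y)) (Y_space s G)"
  have L0: "L0 (TR s G \<psi>) = grad_ip u \<psi>" if \<psi>: "\<psi> \<in> E.H" for \<psi>
  proof -
    let ?k = "SOME k. k \<in> TR s G \<psi>"
    have k: "?k \<in> E.H" "(\<lambda>p. ?k p - \<psi> p) \<in> W0" using TR_some[OF \<psi>] TR_eq_iff[OF _ \<psi>] by auto
    have "grad_ip (\<lambda>p. ?k p - \<psi> p) u = grad_ip ?k u - grad_ip \<psi> u" by (rule B_diff_left[OF k(1) \<psi> uH])
    then have "grad_ip u ?k = grad_ip u \<psi>" using orth[OF k(2)] by (simp add: E.B_sym[of _ u])
    then show ?thesis using TR_Y[OF \<psi>] by (simp add: L0_def)
  qed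
  have bound: "\<bar>L0 v\<bar> \<le> sqrt (grad_sq u) * Y_norm s G v" if v: "v \<in> Y_space s G" for v
  proof -
    obtain \<psi> where \<psi>: "\<psi> \<in> E.H" "v = TR s G \<psi>" using v by (auto simp: Y_space_eq)
    have le: "\<bar>L0 v\<bar> \<le> sqrt (grad_sq u) * sqrt (grad_sq k)" if "k \<in> v" for k
    proof -
      have k: "k \<in> E.H" "v = TR s G k" using TR_member[OF \<psi>(1)] that \<psi>(2) by auto
      show ?thesis unfolding k(2) L0[OF k(1)] by (rule B_abs_le[OF uH k(1)])
    qed
    show ?thesis
    proof (cases "grad_sq u = 0")
      case True
      then show ?thesis using le[of \<psi>] TR_self[OF \<psi>(1)] \<psi>(2) by simp
    next
      case False
      then have pos: "0 < sqrt (grad_sq u)" using E.B_nonneg[of u] by simp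
      have "\<bar>L0 v\<bar> / sqrt (grad_sq u) \<le> (INF k\<in>v. grad_norm cylinder (cyl_weight s G) k)"
      proof (rule cINF_greatest)
        show "v \<noteq> {}" using TR_self[OF \<psi>(1)] \<psi>(2) by blast
        fix k assume "k \<in> v"
        from le[OF this] show "\<bar>L0 v\<bar> / sqrt (grad_sq u) \<le> grad_norm cylinder (cyl_weight s G) k"
          unfolding E.grad_norm_eq using pos by (simp add: pos_divide_le_eq mult.commute)
      qed
      then show ?thesis unfolding Y_norm_def using pos by (simp add: pos_divide_le_eq mult.commute)
    qed
  qed
  have L0_dual: "L0 \<in> Y_dual s G"
    unfolding Y_dual_def H0L_eq Let_def
  proof (intro CollectI conjI ballI allI)
    show "L0 \<in> extensional (Y_space s G)" by (simp add: L0_def)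
    show "\<exists>C. \<forall>v\<in>Y_space s G. \<bar>L0 v\<bar> \<le> C * Y_norm s G v" using bound by blast
  qed (use uH in \<open>auto simp: L0 E.H_add E.H_scale IH.B_add' IH.B_scl'\<close>)
  have eq: "(LINT p|lebesgue_on cylinder. cyl_weight s G p * (weak_gradient cylinder (S_min s G (TR s G u)) p \<bullet> weak_gradient cylinder \<psi> p)) = grad_ip u \<psi>"
    if "\<psi> \<in> E.H" for \<psi>
    using S_min_perp(2)[OF u that] by (simp add: E.B_def E.ip_def)
  have "frac_laplacian s G (TR s G u) = L0"
    unfolding frac_laplacian_def
  proof (rule the_equality)
    show "L0 \<in> Y_dual s G \<and> (\<forall>\<psi>\<in>H0L (cyl_weight s G). L0 (TR s G \<psi>) =
        (LINT p|lebesgue_on cylinder. cyl_weight s G p * (weak_gradient cylinder (S_min s G (TR s G u)) p \<bullet> weak_gradient cylinder \<psi> p)))"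
      using L0_dual by (simp add: H0L_eq eq L0)
    fix L assume L: "L \<in> Y_dual s G \<and> (\<forall>\<psi>\<in>H0L (cyl_weight s G). L (TR s G \<psi>) =
        (LINT p|lebesgue_on cylinder. cyl_weight s G p * (weak_gradient cylinder (S_min s G (TR s G u)) p \<bullet> weak_gradient cylinder \<psi> p)))"
    show "L = L0"
    proof (rule extensionalityI)
      show "L \<in> extensional (Y_space s G)" using L by (simp add: Y_dual_def)
      show "L0 \<in> extensional (Y_space s G)" by (simp add: L0_def)
      fix y assume "y \<in> Y_space s G"
      then obtain \<psi> where "\<psi> \<in> E.H" "y = TR s G \<psi>" by (auto simp: Y_space_eq)
      then show "L y = L0 y" using L by (simp add: H0L_eq eq L0)
    qed
  qed
  then show "frac_laplacian s G (TR s G u) \<in> extensional (Y_space s G)"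
    "\<psi> \<in> E.H \<Longrightarrow> frac_laplacian s G (TR s G u) (TR s G \<psi>) = grad_ip u \<psi>"
    using L0 by (auto simp: L0_def)
qed

section \<open>The equation for functionals on the trace space\<close>

context
  fixes h :: "(real^'n \<Rightarrow> real) \<Rightarrow> real"
  assumes h: "h \<in> Ws2_dual s G"
begin

lemma h_add: "v \<in> Ws2 s G \<Longrightarrow> v' \<in> Ws2 s G \<Longrightarrow> h (\<lambda>x. v x + v' x) = h v + h v'"
  and h_scale: "v \<in> Ws2 s G \<Longrightarrow> h (\<lambda>x. c * v x) = c * h v"
  and h_bound: "\<exists>C. \<forall>v\<in>Ws2 s G. \<bar>h v\<bar> \<le> C * Ws2_norm s G v"
  using h by (auto simp: Ws2_dual_def)

text \<open>The difference is null in the trace space, and \<open>h\<close> is bounded.\<close>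

lemma h_cong:
  assumes v: "v \<in> Ws2 s G" and k: "k \<in> borel_measurable (lebesgue_on cube)"
    and eq: "AE x in lborel. x \<in> cube \<longrightarrow> k x = v x"
  shows "h k = h v"
proof -
  let ?d = "\<lambda>x. k x - v x"
  have d: "?d \<in> borel_measurable (lebesgue_on cube)" using k Ws2_measurable[OF v] by measurable
  have z: "AE x in lborel. x \<in> cube \<longrightarrow> ?d x = 0" using eq by eventually_elim simp
  obtain C where C: "\<forall>v\<in>Ws2 s G. \<bar>h v\<bar> \<le> C * Ws2_norm s G v" using h_bound by blast
  have "h ?d = 0" using C null_Ws2[OF d z] by fastforce
  then show ?thesis using h_add[OF v null_Ws2(1)[OF d z]] by simp
qed

lemma hT_add:
  assumes "u \<in> E.H" "v \<in> E.H"
  shows "h (T (\<lambda>p. u p + v p)) = h (T u) + h (T v)"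
proof -
  have "(\<lambda>x. T u x + T v x) \<in> borel_measurable (lebesgue_on cube)"
    using Ws2_measurable[OF T_Ws2[OF assms(1)]] Ws2_measurable[OF T_Ws2[OF assms(2)]] by measurable
  moreover have "AE x in lborel. x \<in> cube \<longrightarrow> T u x + T v x = T (\<lambda>p. u p + v p) x"
    using T_add[OF assms] by eventually_elim simp
  ultimately have "h (\<lambda>x. T u x + T v x) = h (T (\<lambda>p. u p + v p))"
    by (intro h_cong T_Ws2 E.H_add assms)
  then show ?thesis using h_add[OF T_Ws2[OF assms(1)] T_Ws2[OF assms(2)]] by simp
qed

lemma hT_scale:
  assumes "u \<in> E.H"
  shows "h (T (\<lambda>p. c * u p)) = c * h (T u)"
proof -
  have "(\<lambda>x. c * T u x) \<in> borel_measurable (lebesgue_on cube)"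
    using Ws2_measurable[OF T_Ws2[OF assms]] by measurable
  moreover have "AE x in lborel. x \<in> cube \<longrightarrow> c * T u x = T (\<lambda>p. c * u p) x"
    using T_scale[OF assms, of c] by eventually_elim simp
  ultimately have "h (\<lambda>x. c * T u x) = h (T (\<lambda>p. c * u p))"
    by (intro h_cong T_Ws2 E.H_scale assms)
  then show ?thesis using h_scale[OF T_Ws2[OF assms]] by simp
qed

lemma hT_W0:
  assumes "k \<in> W0"
  shows "h (T k) = 0"
proof -
  have "AE x in lborel. x \<in> cube \<longrightarrow> (0::real) = T k x"
    using assms unfolding W0_iff by (auto elim!: eventually_mono)
  then have "h (\<lambda>x. 0) = h (T k)" by (intro h_cong T_Ws2 W0_H assms) auto
  moreover have "h (\<lambda>x. 0) = 0" using h_scale[OF T_Ws2[OF W0_H[OF assms]], of 0] by simp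
  ultimately show ?thesis by simp
qed

lemma hT_cong:
  assumes "u \<in> E.H" "v \<in> E.H" "TR s G u = TR s G v"
  shows "h (T u) = h (T v)"
proof -
  have d: "(\<lambda>p. u p - v p) \<in> W0" using assms TR_eq_iff by simp
  have "h (T (\<lambda>p. (u p - v p) + v p)) = h (T (\<lambda>p. u p - v p)) + h (T v)"
    by (rule hT_add[OF W0_H[OF d] assms(2)])
  then show ?thesis using hT_W0[OF d] by simp
qed

lemma Y_incl_adjoint_TR:
  assumes "\<psi> \<in> E.H"
  shows "Y_incl_adjoint s G h (TR s G \<psi>) = h (T \<psi>)"
  unfolding Y_incl_adjoint_def Y_incl_def
  using TR_Y[OF assms] TR_some[OF assms] hT_cong[OF _ assms] by simp

text \<open>
  The representing function is orthogonal to the trace kernel since \<open>h (T k)\<close> vanishes for \<open>k\<close> in it.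
\<close>

lemma hT_representer:
  obtains u where "perp u" "\<And>k. k \<in> E.H \<Longrightarrow> grad_ip u k = h (T k)"
proof -
  obtain C where C: "0 \<le> C" "\<And>u. u \<in> E.H \<Longrightarrow> Ws2_norm s G (T u) \<le> C * sqrt (grad_sq u)" by (rule T_bound) blast
  obtain D where D: "\<forall>v\<in>Ws2 s G. \<bar>h v\<bar> \<le> D * Ws2_norm s G v" using h_bound by blast
  have "\<bar>h (T u)\<bar> \<le> (\<bar>D\<bar> * C) * sqrt (grad_sq u)" if u: "u \<in> E.H" for u
  proof -
    have n: "0 \<le> Ws2_norm s G (T u)" by (simp add: Ws2_norm_def sum_nonneg)
    have "\<bar>h (T u)\<bar> \<le> D * Ws2_norm s G (T u)" using D T_Ws2[OF u] by blast
    also have "\<dots> \<le> \<bar>D\<bar> * Ws2_norm s G (T u)" using n by (intro mult_right_mono) auto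
    also have "\<dots> \<le> \<bar>D\<bar> * (C * sqrt (grad_sq u))" using C(2)[OF u] by (intro mult_left_mono) auto
    finally show ?thesis by simp
  qed
  then have "\<exists>u\<in>E.H. \<forall>k\<in>E.H. grad_ip u k = h (T k)"
    by (intro riesz_H[where C="\<bar>D\<bar> * C"] hT_add hT_scale)
  then obtain u where u: "u \<in> E.H" "\<And>k. k \<in> E.H \<Longrightarrow> grad_ip u k = h (T k)" by blast
  moreover have "perp u" unfolding perp_def using u hT_W0 W0_H by simp
  ultimately show thesis using that by blast
qed

lemma frac_laplacian_solution: "\<exists>!v. v \<in> Y_space s G \<and> frac_laplacian s G v = Y_incl_adjoint s G h"
proof -
  obtain u where u: "perp u" "\<And>k. k \<in> E.H \<Longrightarrow> grad_ip u k = h (T k)" by (rule hT_representer) blast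
  have uH: "u \<in> E.H" using u by (simp add: perp_def)
  have ext: "Y_incl_adjoint s G h \<in> extensional (Y_space s G)" by (simp add: Y_incl_adjoint_def)
  show ?thesis
  proof (rule ex1I[of _ "TR s G u"], intro conjI)
    show "TR s G u \<in> Y_space s G" by (rule TR_Y[OF uH])
    show "frac_laplacian s G (TR s G u) = Y_incl_adjoint s G h"
    proof (rule extensionalityI[OF frac_laplacian_perp(1)[OF u(1)] ext])
      fix y assume "y \<in> Y_space s G"
      then obtain \<psi> where "\<psi> \<in> E.H" "y = TR s G \<psi>" by (auto simp: Y_space_eq)
      then show "frac_laplacian s G (TR s G u) y = Y_incl_adjoint s G h y"
        using frac_laplacian_perp(2)[OF u(1)] Y_incl_adjoint_TR u(2) by simp
    qed
    fix v assume v: "v \<in> Y_space s G \<and> frac_laplacian s G v = Y_incl_adjoint s G h"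
    then obtain u1 where u1: "perp u1" "v = TR s G u1" using Y_space_perp by blast
    have u1H: "u1 \<in> E.H" using u1 by (simp add: perp_def)
    have d: "(\<lambda>p. u1 p - u p) \<in> E.H" by (rule E.H_diff[OF u1H uH])
    have "grad_ip u1 \<psi> = grad_ip u \<psi>" if \<psi>: "\<psi> \<in> E.H" for \<psi>
    proof -
      have "grad_ip u1 \<psi> = frac_laplacian s G v (TR s G \<psi>)"
        unfolding u1(2) by (rule frac_laplacian_perp(2)[OF u1(1) \<psi>, symmetric])
      also have "\<dots> = h (T \<psi>)" using v Y_incl_adjoint_TR[OF \<psi>] by simp
      finally show ?thesis by (simp add: u(2)[OF \<psi>])
    qed
    then have "grad_sq (\<lambda>p. u1 p - u p) = 0" using B_diff_left[OF u1H uH d] d by simp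
    from W0_if_grad_sq_zero[OF d this] show "v = TR s G u" using TR_eq_iff[OF u1H uH] u1(2) by simp
  qed
qed

end

lemma Y_incl_Ws2: "v \<in> Y_space s G \<Longrightarrow> Y_incl s G v \<in> Ws2 s G"
  unfolding Y_incl_def Y_space_eq using TR_some T_Ws2 by auto

end

text \<open>
  Almost everywhere the values of \<open>s\<close> lie in \<open>{0<..1}\<close> and those of \<open>G\<close> are positive; at the remaining points
  a Borel representative is reset to \<open>1\<close>.
\<close>

lemma borel_order_exists:
  fixes s G :: "real^'n::finite \<Rightarrow> real"
  assumes s: "s \<in> borel_measurable (lebesgue_on cube)" "AE x in lebesgue_on cube. 0 \<le> s x \<and> s x \<le> 1"
    "emeasure lebesgue {x \<in> cube. s x = 0} = 0" and G: "is_weight cube G"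
  obtains s' G' where "borel_order s' G'" "AE x in lborel. x \<in> cube \<longrightarrow> s x = s' x \<and> G x = G' x"
proof -
  have c: "(cube :: (real^'n) set) \<in> sets lebesgue" by (rule lebesgue_measurable_open[OF open_cube])
  obtain s1 where s1: "s1 \<in> borel_measurable borel" "AE x in lborel. x \<in> cube \<longrightarrow> s x = s1 x"
    by (rule borel_representative[OF s(1) c])
  obtain G1 where G1: "G1 \<in> borel_measurable borel" "AE x in lborel. x \<in> cube \<longrightarrow> G x = G1 x"
    using G by (elim borel_representative[OF _ c, rotated]) (simp add: is_weight_def)
  have "{x \<in> cube. s x = 0} \<in> sets lebesgue"
  proof -
    have "{x \<in> space (lebesgue_on cube). s x = 0} \<in> sets (lebesgue_on cube)" using s(1) by measurable
    then show ?thesis using c by (simp add: sets_restrict_space_iff)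
  qed
  then have "{x \<in> cube. s x = 0} \<in> null_sets lebesgue" using s(3) by (intro null_setsI)
  then have "AE x in lebesgue. x \<notin> {x \<in> cube. s x = 0}" by (rule AE_not_in)
  then have nz: "AE x in lborel. x \<notin> {x \<in> cube. s x = 0}" by (simp add: AE_completion_iff)
  have r: "AE x in lborel. x \<in> cube \<longrightarrow> 0 \<le> s x \<and> s x \<le> 1" using s(2) unfolding AE_lebesgue_on_iff[OF c] .
  have Gp: "AE x in lborel. x \<in> cube \<longrightarrow> 0 < G x" using G by (simp add: is_weight_def AE_lebesgue_on_iff[OF c])
  show thesis
  proof (rule that)
    show "borel_order (\<lambda>x. if 0 < s1 x \<and> s1 x \<le> 1 then s1 x else 1) (\<lambda>x. if 0 < G1 x then G1 x else 1)"
      by unfold_locales (use s1(1) G1(1) in auto)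
    show "AE x in lborel. x \<in> cube \<longrightarrow> s x = (if 0 < s1 x \<and> s1 x \<le> 1 then s1 x else 1) \<and> G x = (if 0 < G1 x then G1 x else 1)"
      using s1(2) G1(2) nz r Gp by eventually_elim auto
  qed
qed

theorem theorem7p5:
  fixes s G :: "real^'n::finite \<Rightarrow> real"
    and h :: "(real^'n \<Rightarrow> real) \<Rightarrow> real"
  assumes s_measurable: "s \<in> borel_measurable (lebesgue_on cube)"
    and s_range: "AE x in lebesgue_on cube. 0 \<le> s x \<and> s x \<le> 1"
    and s_nonzero: "emeasure lebesgue {x \<in> cube. s x = 0} = 0"
    and G_weight: "is_weight cube G"
    and G_inverse: "locally_integrable cube (\<lambda>x. inverse (G x))"
    and G_const: "\<And>\<sigma>. 0 < \<sigma> \<Longrightarrow> \<sigma> < 1 \<Longrightarrow> (\<forall>x\<in>cube. s x = \<sigma>) \<Longrightarrow>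
        (\<forall>x\<in>cube. G x = 2 powr (2 * \<sigma> - 1) * Gamma \<sigma> / Gamma (1 - \<sigma>))"
    and slices: "\<And>i. AE z in other_coords i. AE \<zeta> in lebesgue_on {0<..<1}.
        (\<integral>\<^sup>+t\<in>{0<..<1}. inverse (ennreal (Phi s G i (set_coord i z t) \<zeta>)) \<partial>lborel) < \<infinity>"
    and poincare: "poincare_inequality (cyl_weight s G)"
    and h_dual: "h \<in> Ws2_dual s G"
  shows "(\<exists>!v. v \<in> Y_space s G \<and> frac_laplacian s G v = Y_incl_adjoint s G h) \<and>
         (\<forall>v\<in>Y_space s G. Y_incl s G v \<in> Ws2 s G)"
proof -
  obtain s' G' where "borel_order s' G'" "AE x in lborel. x \<in> cube \<longrightarrow> s x = s' x \<and> G x = G' x"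
    by (rule borel_order_exists[OF s_measurable s_range s_nonzero G_weight])
  then interpret trace_setting s' G' s G
    using G_inverse poincare by (simp add: trace_setting_def trace_setting_axioms_def)
  show ?thesis
    using frac_laplacian_solution[OF h_dual] Y_incl_Ws2 by blast
qed

end
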